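(* For $\alpha\in\mathbb{Q}\cap(0,1)$ with continued fraction expansion $\alpha=[0;b_1,\dots,b_r]$, $b_r>1$, let $r(\alpha):=r$ and $\Sigma(\alpha):=\sum_{\ell=1}^r b_\ell$. Then $$\log\mathcal{J}_{4_1,0}(e(\alpha))\sim\frac{\mathrm{Vol}(4_1)}{2\pi}\,\Sigma(\alpha)\qquad\text{as } \Sigma(\alpha)/r(\alpha)\to\infty,$$ i.e. for every $\varepsilon>0$ there is $A$ such that $\big|\log\mathcal{J}_{4_1,0}(e(\alpha))/(\tfrac{\mathrm{Vol}(4_1)}{2\pi}\Sigma(\alpha))-1\big|<\varepsilon$ whenever $\Sigma(\alpha)>A\, r(\alpha)$. In particular, for almost all roots of unity $q$ of order $n\leq N$, $$\log\mathcal{J}_{4_1,0}(q)\sim\frac{12}{\pi^2}\,\frac{\mathrm{Vol}(4_1)}{2\pi}\log n\log\log n$$ as $N\to\infty$; that is, for every $\varepsilon>0$, the proportion of roots of unity $q$ of order $n\leq N$ for which $\big|\log\mathcal{J}_{4_1,0}(q)-\frac{12}{\pi^2}\frac{\mathrm{Vol}(4_1)}{2\pi}\log n\log\log n\big|>\varepsilon\log n\log\log n$ tends to $0$ as $N\to\infty$.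
   Context: $e(x):=e^{2\pi i x}$. For $q\in\mathbb{C}$ and integer $r\geq0$, $(q)_r:=\prod_{i=1}^r(1-q^i)$. For a root of unity $q$, $\mathcal{J}_{4_1,0}(q):=\sum_{r=0}^\infty |(q)_r|^2$ (a finite sum). $\mathrm{Vol}(4_1)$ is the hyperbolic volume of the figure-eight knot complement. *)

theory Defs
  imports "HOL-Analysis.Analysis" "HOL-Algebra.Generated_Groups"
begin

definition ee :: "real \<Rightarrow> complex" where
  "ee x = exp (2 * of_real pi * \<i> * of_real x)"

definition qfac :: "complex \<Rightarrow> nat \<Rightarrow> complex" where
  "qfac q r = (\<Prod>i=1..r. 1 - q ^ i)"

text \<open>Used only at roots of unity, where all but finitely many terms vanish.\<close>

definition J41 :: "complex \<Rightarrow> real" where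
  "J41 q = (\<Sum>r. (cmod (qfac q r))\<^sup>2)"

lemma J41_finite_sum:
  assumes "0 < n" "q ^ n = 1"
  shows "J41 q = (\<Sum>r<n. (cmod (qfac q r))\<^sup>2)"
proof -
  have "qfac q r = 0" if "r \<ge> n" for r
    using assms that unfolding qfac_def by (intro prod_zero) (auto intro!: bexI[of _ n])
  then show ?thesis
    unfolding J41_def by (intro suminf_finite) auto
qed

definition unity_order :: "complex \<Rightarrow> nat" where
  "unity_order q = (LEAST n. 0 < n \<and> q ^ n = 1)"

definition unity_roots_upto :: "nat \<Rightarrow> complex set" where
  "unity_roots_upto N = {q. (\<exists>n>0. q ^ n = 1) \<and> unity_order q \<le> N}"

text \<open>\<open>cf_value [b\<^sub>1, \<dots>, b\<^sub>r]\<close> is \<open>[0; b\<^sub>1, \<dots>, b\<^sub>r]\<close>.\<close>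

fun cf_value :: "nat list \<Rightarrow> real" where
  "cf_value [] = 0"
| "cf_value (b # bs) = 1 / (real b + cf_value bs)"

definition cf_normal :: "nat list \<Rightarrow> bool" where
  "cf_normal bs \<longleftrightarrow> bs \<noteq> [] \<and> (\<forall>b\<in>set bs. b \<ge> 1) \<and> last bs > 1"

definition cf_of :: "real \<Rightarrow> nat list" where
  "cf_of \<alpha> = (THE bs. cf_normal bs \<and> cf_value bs = \<alpha>)"

definition cf_len :: "real \<Rightarrow> nat" where
  "cf_len \<alpha> = length (cf_of \<alpha>)"

definition cf_sum :: "real \<Rightarrow> nat" where
  "cf_sum \<alpha> = sum_list (cf_of \<alpha>)"

lemma cf_value_bounds: "cf_normal bs \<Longrightarrow> 0 < cf_value bs \<and> cf_value bs < 1"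
proof (induction bs)
  case Nil
  then show ?case by (simp add: cf_normal_def)
next
  case (Cons b bs)
  show ?case
  proof (cases bs)
    case Nil
    then show ?thesis using Cons.prems by (simp add: cf_normal_def)
  next
    case (Cons c cs)
    then have "cf_normal bs" "b \<ge> 1"
      using Cons.prems by (auto simp: cf_normal_def)
    with Cons.IH have "0 < cf_value bs" by simp
    with \<open>b \<ge> 1\<close> show ?thesis by (simp add: divide_simps)
  qed
qed

lemma cf_tail:
  assumes "cf_normal (b # bs)"
  shows "bs = [] \<and> b > 1 \<or> cf_normal bs \<and> b \<ge> 1"
  using assms by (cases bs) (auto simp: cf_normal_def)

lemma cf_unique:
  "cf_normal bs \<Longrightarrow> cf_normal cs \<Longrightarrow> cf_value bs = cf_value cs \<Longrightarrow> bs = cs"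
proof (induction bs arbitrary: cs)
  case Nil
  then show ?case by (simp add: cf_normal_def)
next
  case (Cons b bs)
  obtain c ds where cs: "cs = c # ds"
    using Cons.prems by (cases cs) (auto simp: cf_normal_def)
  have b: "0 \<le> cf_value bs \<and> cf_value bs < 1" and c: "0 \<le> cf_value ds \<and> cf_value ds < 1"
    using cf_tail Cons.prems cs cf_value_bounds by fastforce+
  have pos: "real b \<ge> 1" "real c \<ge> 1"
    using Cons.prems cs by (auto simp: cf_normal_def)
  have eq: "real b + cf_value bs = real c + cf_value ds"
    using Cons.prems(3) cs b c pos by (simp add: divide_simps split: if_splits)
  then have bc: "b = c" using b c by linarith
  with eq have eq': "cf_value bs = cf_value ds" by simp
  have "bs = ds"
  proof (cases "bs = []")
    case True
    then show ?thesis using eq' cf_tail[of c ds] cf_value_bounds[of ds] Cons.prems cs by auto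
  next
    case False
    then have n: "cf_normal bs" using cf_tail Cons.prems by blast
    then have "ds \<noteq> []" using eq' cf_value_bounds[of bs] by auto
    then have "cf_normal ds" using cf_tail[of c ds] Cons.prems cs by auto
    with n eq' Cons.IH show ?thesis by blast
  qed
  with bc cs show ?case by simp
qed

lemma cf_exists: "0 < p \<Longrightarrow> p < n \<Longrightarrow> \<exists>bs. cf_normal bs \<and> cf_value bs = real p / real n"
proof (induction p arbitrary: n rule: less_induct)
  case (less p)
  have q: "n div p \<ge> 1" using less.prems by (simp add: Suc_le_eq div_greater_zero_iff)
  have n: "real n = real p * real (n div p) + real (n mod p)"
    by (metis mult_div_mod_eq of_nat_add of_nat_mult)
  show ?case
  proof (cases "n mod p = 0")
    case True
    have "n div p \<noteq> 1" using True less.prems by (metis mult_div_mod_eq add.right_neutral mult.right_neutral less_irrefl)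
    with q have "cf_normal [n div p]" by (simp add: cf_normal_def)
    moreover have "cf_value [n div p] = real p / real n"
      using n True less.prems by (simp add: divide_simps)
    ultimately show ?thesis by blast
  next
    case False
    then obtain bs where bs: "cf_normal bs" "cf_value bs = real (n mod p) / real p"
      using less.IH[of "n mod p" p] less.prems by auto
    have "cf_normal (n div p # bs)" using bs q by (auto simp: cf_normal_def)
    moreover have "real (n div p) + cf_value bs = real n / real p"
      using bs n less.prems by (simp add: field_simps)
    then have "cf_value (n div p # bs) = real p / real n" by simp
    ultimately show ?thesis by blast
  qed
qed

lemma cf_of_unique_existence:
  assumes "\<alpha> \<in> \<rat>" "0 < \<alpha>" "\<alpha> < 1"
  shows "\<exists>!bs. cf_normal bs \<and> cf_value bs = \<alpha>"
proof -
  obtain m n where mn: "n \<noteq> 0" "\<bar>\<alpha>\<bar> = real m / real n"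
    using Rats_abs_nat_div_natE[OF assms(1)] by metis
  then have \<alpha>: "\<alpha> = real m / real n" using assms by simp
  have "0 < m" using \<alpha> assms by (intro gr0I) auto
  moreover have "m < n"
  proof -
    have "real m / real n < 1" using \<alpha> assms by simp
    then show ?thesis using mn by (subst (asm) divide_less_eq_1_pos) auto
  qed
  ultimately show ?thesis using \<alpha> cf_exists cf_unique by metis
qed

definition hyp3 :: "(complex \<times> real) set" where
  "hyp3 = {(z, t). 0 < t}"

definition hyp3_measure :: "(complex \<times> real) measure" where
  "hyp3_measure = density lborel (\<lambda>(z, t). if 0 < t then ennreal (1 / t ^ 3) else 0)"

definition SL2C :: "(complex^2^2) monoid" where
  "SL2C = \<lparr>carrier = {A. det A = 1}, mult = (**), one = mat 1\<rparr>"

lemma group_SL2C: "group SL2C"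
proof (rule groupI)
  fix A assume A: "A \<in> carrier SL2C"
  then have "invertible A" by (simp add: SL2C_def invertible_det_nz)
  then obtain B where B: "B ** A = mat 1" by (auto simp: invertible_def)
  then have "det B * det A = 1" by (metis det_mul det_I)
  then show "\<exists>B\<in>carrier SL2C. B \<otimes>\<^bsub>SL2C\<^esub> A = \<one>\<^bsub>SL2C\<^esub>"
    using A B by (auto simp: SL2C_def)
qed (auto simp: SL2C_def det_mul matrix_mul_assoc)

text \<open>The Poincare extension of a Moebius transformation to upper half-space.\<close>

definition hyp3_act :: "complex^2^2 \<Rightarrow> complex \<times> real \<Rightarrow> complex \<times> real" where
  "hyp3_act A = (\<lambda>(z, t).
     let a = A$1$1; b = A$1$2; c = A$2$1; d = A$2$2;
         k = (cmod (c * z + d))\<^sup>2 + (cmod c)\<^sup>2 * t\<^sup>2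
     in (((a * z + b) * cnj (c * z + d) + a * cnj c * of_real (t\<^sup>2)) / of_real k, t / k))"

text \<open>The kernel of the action of \<open>SL\<^sub>2(\<complex>)\<close> is \<open>{1, -1}\<close>.\<close>

definition fundamental_domain :: "(complex^2^2) set \<Rightarrow> (complex \<times> real) set \<Rightarrow> bool" where
  "fundamental_domain \<Gamma> F \<longleftrightarrow>
     F \<in> sets borel \<and> F \<subseteq> hyp3 \<and>
     (AE p in hyp3_measure. \<exists>A\<in>\<Gamma>. p \<in> hyp3_act A ` F) \<and>
     (\<forall>A\<in>\<Gamma>. A \<noteq> mat 1 \<and> A \<noteq> - mat 1 \<longrightarrow>
        (AE p in hyp3_measure. p \<notin> F \<inter> hyp3_act A ` F))"

text \<open>The volume of the quotient of hyperbolic space by a discrete group \<open>\<Gamma>\<close>: all fundamental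
  domains of a countable \<open>\<Gamma>\<close> have the same measure.\<close>

definition hyp3_covolume :: "(complex^2^2) set \<Rightarrow> real" where
  "hyp3_covolume \<Gamma> =
     (THE v. \<exists>F. fundamental_domain \<Gamma> F \<and> v = measure hyp3_measure F)"

text \<open>The complete hyperbolic structure on the complement of \<open>4\<^sub>1\<close> is the quotient of hyperbolic
  space by the image of the discrete faithful representation of the knot group
  \<open>\<langle>x, y | w x = y w\<rangle>\<close>, \<open>w = x\<^sup>-\<^sup>1 y x y\<^sup>-\<^sup>1\<close>, where \<open>x\<close> and \<open>y\<close> are meridians
  (R. Riley, A quadratic parabolic group, 1975); its hyperbolic volume is the covolume of that
  image, which by Mostow rigidity depends only on the knot complement.\<close>

definition fig8_x :: "complex^2^2" where
  "fig8_x = vector [vector [1, 1], vector [0, 1]]"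

definition fig8_y :: "complex^2^2" where
  "fig8_y = vector [vector [1, 0], vector [- cis (2 * pi / 3), 1]]"

lemma fig8_in_SL2C: "fig8_x \<in> carrier SL2C" "fig8_y \<in> carrier SL2C"
  by (simp_all add: SL2C_def fig8_x_def fig8_y_def det_2 vector_2)

lemma fig8_inverses:
  "inv\<^bsub>SL2C\<^esub> fig8_x = vector [vector [1, -1], vector [0, 1]]"
  "inv\<^bsub>SL2C\<^esub> fig8_y = vector [vector [1, 0], vector [cis (2 * pi / 3), 1]]"
  by (rule group.inv_equality[OF group_SL2C];
      simp add: SL2C_def fig8_x_def fig8_y_def det_2 vector_2 matrix_matrix_mult_def
        mat_def vec_eq_iff forall_2 sum_2)+

lemma fig8_relation:
  defines "w \<equiv> inv\<^bsub>SL2C\<^esub> fig8_x \<otimes>\<^bsub>SL2C\<^esub> fig8_y \<otimes>\<^bsub>SL2C\<^esub> fig8_x \<otimes>\<^bsub>SL2C\<^esub> inv\<^bsub>SL2C\<^esub> fig8_y"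
  shows "w \<otimes>\<^bsub>SL2C\<^esub> fig8_x = fig8_y \<otimes>\<^bsub>SL2C\<^esub> w"
proof -
  define u :: complex where "u = cis (2 * pi / 3)"
  have re: "Re u = - 1 / 2" and im: "Im u * Im u = 3 / 4"
    by (simp_all add: u_def cos_120 sin_120)
  then have u2: "u * u = - 1 - u"
    by (simp add: complex_eq_iff)
  show ?thesis
    unfolding w_def fig8_inverses
    unfolding fig8_x_def fig8_y_def u_def[symmetric]
    apply (simp add: SL2C_def vector_2 matrix_matrix_mult_def vec_eq_iff forall_2 sum_2)
    apply (intro conjI; (use u2 in algebra)?)
    done
qed

definition fig8_group :: "(complex^2^2) set" where
  "fig8_group = generate SL2C {fig8_x, fig8_y}"

definition Vol41 :: real where
  "Vol41 = hyp3_covolume fig8_group"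

end

theory Submission
  imports Defs "HOL-Number_Theory.Totient" "HOL-Real_Asymp.Real_Asymp"
begin

text \<open>At \<open>q = e(\<alpha>)\<close> the sum \<open>J41 q\<close> consists of the squares of the Sudler products
  \<open>P\<^sub>N = \<Prod>\<^sub>k\<^sub>\<le>\<^sub>N 2 |sin (\<pi> k \<alpha>)|\<close>, so its logarithm is twice that of the largest product up to
  \<open>O(ln n)\<close>. A reciprocity step relates the products of \<open>\<alpha>\<close> to those of the next continued fraction
  remainder; a partial quotient \<open>b\<close> contributes a Riemann sum of \<open>ln (2 sin (\<pi> x))\<close> with spacing
  \<open>1 / b\<close>, which is maximal when it ends at \<open>x = 5 / 6\<close>. The integral over \<open>[0, 1/2]\<close> vanishes, so the
  contribution is \<open>kap b + o(b) + O(1)\<close> with \<open>kap\<close> the integral over \<open>[1/2, 5/6]\<close>.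

  For almost all fractions with denominator at most \<open>N\<close>, the sum of the partial quotients truncated
  at about \<open>ln N\<close> times a slowly growing factor concentrates around \<open>12/\<pi>\<^sup>2 ln n ln ln n\<close>, by counting
  coprime pairs for the first and second moment; larger partial quotients are negligible.

  Finally \<open>Vol41 = 4 \<pi> kap\<close>: a fundamental domain of the group, which is a subgroup of
  \<open>SL\<^sub>2(\<int>[\<omega>])\<close>, consists of the points above four cells of the hexagonal lattice and outside the
  unit spheres around lattice points, and its volume is an integral of \<open>ln (2 cos x)\<close>.\<close>

section \<open>Sudler products\<close>

text \<open>The reciprocity step rests on the double sine function with periods 1 and
  \<open>a\<close>. Its two shift equations produce the factors of the products at \<open>a\<close>
  and at \<open>1 / a\<close>, so following the orbit of the rotation by \<open>a\<close> expresses
  the quotient of the two products by two of its values. Only finite truncations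
  \<open>dsl K a\<close> occur. They are convex on half of their interval of symmetry, which gives
  bounds uniform in \<open>K\<close>, and their constants come from a closed orbit and from full
  products, not from asymptotic expansions. The point 5 / 6 is where \<open>2 sin (\<pi> x)\<close>
  falls below 1.

  The moments are taken over all pairs \<open>a < n \<le> N\<close>, coprime or not, because the
  remainders behind a fixed prefix then run through all lattice points of a triangle. Coprime pairs
  have positive density, so an exceptional set of size \<open>o(N^2)\<close> stays negligible among
  them.

  For the group, the difficulty is to know exactly which translations it contains, since this
  decides the number of cells. Words in the generators produce enough translations; congruences
  modulo 4 that hold for all matrices of the group exclude the others.\<close>

definition sn :: "real \<Rightarrow> real" where
  "sn x = 2 * \<bar>sin (pi * x)\<bar>"

lemma sn_nonneg [simp]: "0 \<le> sn x"
  by (simp add: sn_def)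

lemma sn_minus [simp]: "sn (- x) = sn x"
  by (simp add: sn_def)

lemma sn_add_int [simp]: "sn (x + of_int k) = sn x"
proof -
  have "sin (pi * (x + of_int k)) = sin (pi * x) * cos (pi * of_int k)"
    by (simp add: distrib_left sin_add sin_zero_iff_int2)
  moreover have "\<bar>cos (pi * of_int k)\<bar> = 1"
  proof -
    have "sin (pi * of_int k) = 0" by (auto simp: sin_zero_iff_int2)
    then have "(cos (pi * of_int k))\<^sup>2 = 1" using sin_cos_squared_add[of "pi * of_int k"] by simp
    then show ?thesis by (simp add: power2_eq_1_iff abs_if)
  qed
  ultimately show ?thesis by (simp add: sn_def abs_mult)
qed

lemma sn_cong_int:
  assumes "x - y \<in> \<int>"
  shows "sn x = sn y"
proof -
  obtain k where "x = y + of_int k" using assms by (metis Ints_cases add.commute diff_add_cancel)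
  then show ?thesis by simp
qed

lemma sn_pos_iff: "0 < sn x \<longleftrightarrow> x \<notin> \<int>"
proof -
  have "sin (pi * x) = 0 \<longleftrightarrow> x \<in> \<int>"
    by (auto simp: sin_zero_iff_int2 Ints_def)
  then show ?thesis by (simp add: sn_def)
qed

lemma norm_cis_diff: "cmod (cis a - cis b) = 2 * \<bar>sin ((a - b) / 2)\<bar>"
proof -
  have "(cmod (cis a - cis b))\<^sup>2 = (cos a - cos b)\<^sup>2 + (sin a - sin b)\<^sup>2"
    by (simp add: cmod_power2)
  also have "\<dots> = 2 - 2 * cos (a - b)"
    using sin_cos_squared_add[of a] sin_cos_squared_add[of b]
    by (simp add: cos_diff power2_eq_square algebra_simps)
  also have "\<dots> = (2 * \<bar>sin ((a - b) / 2)\<bar>)\<^sup>2"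
  proof -
    have "2 * ((a - b) / 2) = a - b" by simp
    from cos_double_sin[of "(a - b) / 2", unfolded this]
    have "cos (a - b) = 1 - 2 * (sin ((a - b) / 2))\<^sup>2" .
    then show ?thesis by (simp add: power_mult_distrib)
  qed
  finally show ?thesis by (rule power2_eq_imp_eq) auto
qed

lemma cmod_one_minus_ee: "cmod (1 - ee x ^ j) = sn (real j * x)"
proof -
  have "ee x ^ j = cis (2 * pi * (real j * x))"
    by (simp add: ee_def cis_conv_exp exp_of_nat_mult[symmetric] mult_ac)
  moreover have "1 = cis 0" by simp
  ultimately have "cmod (1 - ee x ^ j) = 2 * \<bar>sin ((0 - 2 * pi * (real j * x)) / 2)\<bar>"
    using norm_cis_diff by metis
  then show ?thesis by (simp add: sn_def mult_ac)
qed

text \<open>Both sides are monic of degree n in z, so their difference has degree below n; but it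
  vanishes at the n roots of unity.\<close>

lemma prod_roots_unity:
  assumes "n > 0"
  shows "(\<Prod>k<n. z - cis (2 * pi * real k / real n)) = z ^ n - 1"
proof -
  let ?r = "\<lambda>k. cis (2 * pi * real k / real n)"
  let ?q = "\<Prod>k<n. [:- ?r k, 1:]"
  define p :: "complex poly" where "p = monom 1 n - 1 - ?q"
  have dq: "degree ?q = n"
    by (subst degree_prod_eq_sum_degree) auto
  have lq: "lead_coeff ?q = 1"
    by (simp add: lead_coeff_prod)
  have "degree p \<le> n"
    unfolding p_def using dq by (intro degree_diff_le) (auto simp: degree_monom_le)
  moreover have "coeff p n = 0"
    using lq dq assms by (simp add: p_def)
  ultimately have dp: "degree p < n" if "p \<noteq> 0"
    using that by (metis le_neq_implies_less leading_coeff_0_iff)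
  have roots: "{z. z ^ n = 1} \<subseteq> {z. poly p z = 0}"
  proof safe
    fix z :: complex assume z: "z ^ n = 1"
    then obtain k where "k < n" "z = ?r k"
      using Complex.bij_betw_roots_unity[OF assms] unfolding bij_betw_def by blast
    then have "poly ?q z = 0"
      by (auto simp: poly_prod intro!: bexI[of _ k])
    then show "poly p z = 0" using z by (simp add: p_def poly_monom)
  qed
  have "p = 0"
  proof (rule ccontr)
    assume "p \<noteq> 0"
    then have "card {z. poly p z = 0} \<le> degree p" "finite {z. poly p z = 0}"
      by (auto intro: card_poly_roots_bound poly_roots_finite)
    with card_mono[OF this(2) roots] card_roots_unity_eq[OF assms] dp[OF \<open>p \<noteq> 0\<close>]
    show False by simp
  qed
  then have "poly ?q z = poly (monom 1 n - 1) z" by (simp add: p_def)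
  then show ?thesis by (simp add: poly_prod poly_monom)
qed

text \<open>The multiplication formula of the sine: take absolute values in the factorisation of
  \<open>z ^ n - 1\<close> at a point of the unit circle.\<close>

lemma prod_sn_add:
  assumes "n > 0"
  shows "(\<Prod>j<n. sn (x + real j / real n)) = sn (real n * x)"
proof -
  have "(\<Prod>j<n. sn (x + real j / real n)) = (\<Prod>j<n. cmod (cis (- 2 * pi * x) - cis (2 * pi * real j / real n)))"
  proof (intro prod.cong refl)
    fix j
    have "(- 2 * pi * x - 2 * pi * real j / real n) / 2 = - (pi * (x + real j / real n))"
      by (simp add: field_simps)
    then show "sn (x + real j / real n) = cmod (cis (- 2 * pi * x) - cis (2 * pi * real j / real n))"
      unfolding norm_cis_diff sn_def by (simp only: sin_minus abs_minus)
  qed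
  also have "\<dots> = cmod (cis (- 2 * pi * x) ^ n - cis 0)"
    by (simp add: prod_norm prod_roots_unity[OF assms])
  also have "\<dots> = sn (real n * x)"
  proof -
    have "cis (- 2 * pi * x) ^ n = cis (real n * (- 2 * pi * x))" by (rule Complex.DeMoivre)
    moreover have "(real n * (- 2 * pi * x) - 0) / 2 = - (pi * (real n * x))" by simp
    ultimately show ?thesis by (simp only: norm_cis_diff sn_def sin_minus abs_minus)
  qed
  finally show ?thesis .
qed

lemma bij_betw_mult_mod:
  fixes n p :: nat
  assumes "n > 0" "coprime p n"
  shows "bij_betw (\<lambda>j. j * p mod n) {..<n} {..<n}"
proof -
  have "inj_on (\<lambda>j. j * p mod n) {..<n}"
  proof (rule inj_onI)
    fix i j assume "i \<in> {..<n}" "j \<in> {..<n}" "i * p mod n = j * p mod n"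
    then have "[i * p = j * p] (mod n)" by (simp add: cong_def)
    then have "[i = j] (mod n)" using assms cong_mult_rcancel_nat by blast
    then show "i = j" using \<open>i \<in> _\<close> \<open>j \<in> _\<close> by (simp add: cong_def)
  qed
  moreover have "(\<lambda>j. j * p mod n) ` {..<n} \<subseteq> {..<n}" using assms by auto
  ultimately show ?thesis
    by (metis bij_betw_def endo_inj_surj finite_lessThan)
qed

lemma sn_add_mod: "n > 0 \<Longrightarrow> sn (x + real (m mod n) / real n) = sn (x + real m / real n)"
proof (rule sn_cong_int)
  assume "n > 0"
  have "real m = real (m div n) * real n + real (m mod n)"
    by (metis div_mult_mod_eq of_nat_add of_nat_mult)
  then have "x + real (m mod n) / real n - (x + real m / real n) = - of_nat (m div n)"
    using \<open>n > 0\<close> by (simp add: field_simps)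
  then show "x + real (m mod n) / real n - (x + real m / real n) \<in> \<int>" by simp
qed

lemma prod_sn_add_coprime:
  fixes n p :: nat
  assumes "n > 0" "coprime p n"
  shows "(\<Prod>j<n. sn (x + real j * (real p / real n))) = sn (real n * x)"
proof -
  have "(\<Prod>j<n. sn (x + real j * (real p / real n))) = (\<Prod>j<n. sn (x + real (j * p mod n) / real n))"
    using assms by (intro prod.cong refl) (simp add: sn_add_mod)
  also have "\<dots> = (\<Prod>j<n. sn (x + real j / real n))"
    by (rule prod.reindex_bij_betw[OF bij_betw_mult_mod[OF assms]])
  finally show ?thesis using prod_sn_add[OF assms(1)] by simp
qed

text \<open>The factor \<open>j = 0\<close> of the multiplication formula vanishes at
  \<open>x = 0\<close>. Dividing by it and letting x tend to 0 from the right leaves the limit n of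
  \<open>sn (n x) / sn x\<close>.\<close>

lemma prod_sn:
  assumes "n > 0"
  shows "(\<Prod>j=1..<n. sn (real j / real n)) = real n"
proof -
  let ?f = "\<lambda>x. \<Prod>j=1..<n. sn (x + real j / real n)"
  have cont: "(?f \<longlongrightarrow> ?f 0) (at_right 0)"
    unfolding sn_def by (intro tendsto_intros)
  have "eventually (\<lambda>x. ?f x = sn (real n * x) / sn x) (at_right 0)"
  proof -
    have "eventually (\<lambda>x::real. x \<in> {0<..<1}) (at_right 0)"
      by (rule eventually_at_right_real) simp
    then show ?thesis
    proof eventually_elim
      case (elim x)
      then have "sn x > 0" by (auto simp: sn_pos_iff elim!: Ints_cases)
      have "{..<n} = insert 0 {1..<n}" using assms by auto
      then have "sn (real n * x) = sn x * ?f x"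
        using prod_sn_add[OF assms, of x] by simp
      then show ?case using \<open>sn x > 0\<close> by simp
    qed
  qed
  then have "((\<lambda>x. sn (real n * x) / sn x) \<longlongrightarrow> ?f 0) (at_right 0)"
    using cont tendsto_cong by fastforce
  moreover have "((\<lambda>x. sn (real n * x) / sn x) \<longlongrightarrow> real n) (at_right 0)"
    unfolding sn_def using assms by real_asymp
  ultimately have "?f 0 = real n"
    using tendsto_unique trivial_limit_at_right_real by blast
  then show ?thesis by simp
qed

definition sudler :: "nat \<Rightarrow> real \<Rightarrow> real" where
  "sudler N x = (\<Prod>j=1..N. sn (real j * x))"

lemma sudler_cong_int:
  assumes "x - y \<in> \<int>"
  shows "sudler N x = sudler N y"
  unfolding sudler_def
proof (intro prod.cong refl sn_cong_int)
  fix j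
  have "real j * x - real j * y = of_nat j * (x - y)" by (simp add: algebra_simps)
  then show "real j * x - real j * y \<in> \<int>" using assms Ints_mult Ints_of_nat by metis
qed

lemma sudler_minus: "sudler N (- x) = sudler N x"
  by (simp add: sudler_def)

lemma rational_multiple_not_int:
  assumes "coprime p n" "0 < j" "j < n"
  shows "real j * (real p / real n) \<notin> \<int>"
proof
  assume "real j * (real p / real n) \<in> \<int>"
  then obtain k where "real j * (real p / real n) = of_int k" by (auto elim: Ints_cases)
  then have "real j * real p = of_int k * real n" using assms by (simp add: field_simps)
  then have "int (j * p) = k * int n"
    by (metis of_int_eq_iff of_int_mult of_int_of_nat_eq of_nat_mult)
  then have "n dvd j * p" by (metis dvd_triv_right int_dvd_int_iff)
  then have "n dvd j" using assms by (simp add: coprime_commute coprime_dvd_mult_left_iff)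
  then show False using assms by (simp add: nat_dvd_not_less)
qed

lemma sudler_pos:
  assumes "coprime p n" "N < n"
  shows "0 < sudler N (real p / real n)"
  unfolding sudler_def
  using assms rational_multiple_not_int[OF assms(1)]
  by (intro prod_pos) (auto simp: sn_pos_iff)

text \<open>Multiplication by p permutes the nonzero residues modulo n, so the value is the one for
  \<open>p = 1\<close>. These exact values later fix the boundary value in the reciprocity
  law.\<close>

lemma sudler_full:
  assumes "coprime p n" "n > 0"
  shows "sudler (n - 1) (real p / real n) = real n"
proof (cases "n = 1")
  case True
  then show ?thesis by (simp add: sudler_def)
next
  case False
  have bij: "bij_betw (\<lambda>j. j * p mod n) {1..<n} {1..<n}"
  proof -
    have "bij_betw (\<lambda>j. j * p mod n) ({..<n} - {0}) ({..<n} - {0 * p mod n})"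
      using bij_betw_mult_mod[of n p] assms by (intro bij_betw_DiffI) (auto simp: bij_betw_def)
    moreover have "{..<n} - {0} = {1..<n}" by auto
    ultimately show ?thesis by simp
  qed
  have "sudler (n - 1) (real p / real n) = (\<Prod>j=1..<n. sn (0 + real (j * p mod n) / real n))"
    unfolding sudler_def using assms
    by (intro prod.cong) (auto simp only: sn_add_mod, auto)
  also have "\<dots> = (\<Prod>j=1..<n. sn (0 + real j / real n))"
    by (rule prod.reindex_bij_betw[OF bij])
  finally show ?thesis using prod_sn assms by simp
qed

lemma J41_eq_sum_sudler:
  assumes "n > 0"
  shows "J41 (ee (real p / real n)) = (\<Sum>N<n. (sudler N (real p / real n))\<^sup>2)"
proof -
  have "ee (real p / real n) ^ n = 1"
  proof -
    have "ee (real p / real n) ^ n = exp (of_nat n * (2 * of_real pi * \<i> * of_real (real p / real n)))"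
      unfolding ee_def by (simp only: exp_of_nat_mult)
    also have "of_nat n * (2 * of_real pi * \<i> * of_real (real p / real n)) = of_nat p * (2 * of_real pi * \<i>)"
      using assms by simp
    also have "exp \<dots> = exp (2 * of_real pi * \<i>) ^ p" by (simp only: exp_of_nat_mult)
    finally show ?thesis by simp
  qed
  moreover have "cmod (qfac (ee x) N) = sudler N x" for x N
    by (simp add: qfac_def prod_norm[symmetric] cmod_one_minus_ee sudler_def)
  ultimately show ?thesis using J41_finite_sum[OF assms] by simp
qed

section \<open>Truncated double sine functions and their shift equations\<close>

text \<open>Euler's product for the sine, regrouped into the factors
  \<open>(x + n) (1 - x + n)\<close> and divided by its value at \<open>x = 1 / 2\<close>, where the
  sine is 1; the division cancels the growing factorials.\<close>

lemma tendsto_sum_ln_sin: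
  assumes x: "0 < x" "x < 1"
  shows "(\<lambda>K. \<Sum>n<K. ln (x + real n) + ln (1 - x + real n) - 2 * ln (1 / 2 + real n))
           \<longlonglongrightarrow> ln (sin (pi * x))"
proof -
  define R where "R K x = (\<Prod>n<K. (x + real n) * (1 - x + real n))" for K and x :: real
  define W where "W K x = pi * x * (\<Prod>k=1..K. 1 - x\<^sup>2 / (real k)\<^sup>2)" for K and x :: real
  \<comment> \<open>\<open>R\<close> pairs \<open>x + n\<close> with \<open>1 - x + n\<close>,
    whereas \<open>W\<close> pairs \<open>k - x\<close> with \<open>k + x\<close>. The shifted
    pairing leaves one unmatched factor, \<open>K + 1 - x\<close>.\<close>
  have R_eq: "R (Suc K) x * pi = (fact K)\<^sup>2 * (real K + 1 - x) * W K x" for K and x :: real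
  proof (induction K)
    case 0
    then show ?case by (simp add: R_def W_def)
  next
    case (Suc K)
    have "R (Suc (Suc K)) x * pi = (R (Suc K) x * pi) * ((x + real (Suc K)) * (1 - x + real (Suc K)))"
      by (simp add: R_def)
    also have "\<dots> = (fact K)\<^sup>2 * W K x * (((real K + 1 - x) * (real K + 1 + x)) * (real K + 2 - x))"
      unfolding Suc by (simp add: algebra_simps)
    also have "(real K + 1 - x) * (real K + 1 + x) = (real (Suc K))\<^sup>2 * (1 - x\<^sup>2 / (real (Suc K))\<^sup>2)"
    proof -
      have "r\<^sup>2 * (1 - x\<^sup>2 / r\<^sup>2) = (r - x) * (r + x)" if "r \<noteq> 0" for r :: real
        using that by (simp add: field_simps power2_eq_square)
      from this[of "real (Suc K)"] show ?thesis by (simp add: add_ac)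
    qed
    also have "(fact K)\<^sup>2 * W K x * ((real (Suc K))\<^sup>2 * (1 - x\<^sup>2 / (real (Suc K))\<^sup>2) * (real K + 2 - x))
       = (fact (Suc K))\<^sup>2 * (real (Suc K) + 1 - x) * W (Suc K) x"
      unfolding W_def by (simp add: power_mult_distrib mult_ac add_ac)
    finally show ?case .
  qed
  have W: "(\<lambda>K. W K x) \<longlonglongrightarrow> sin (pi * x)" for x
    unfolding W_def using sin_product_formula_real[of x] by simp
  have "(\<lambda>K. ((real K + 1 - x) / (real K + 1 / 2)) * (W K x / W K (1/2))) \<longlonglongrightarrow> 1 * (sin (pi * x) / sin (pi * (1 / 2)))"
    by (intro tendsto_mult tendsto_divide W) (real_asymp, simp)
  moreover have "R (Suc K) x / R (Suc K) (1 / 2) = ((real K + 1 - x) / (real K + 1 / 2)) * (W K x / W K (1/2))" for K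
  proof -
    have "R (Suc K) x / R (Suc K) (1 / 2) = (R (Suc K) x * pi) / (R (Suc K) (1 / 2) * pi)" by simp
    also have "\<dots> = ((real K + 1 - x) * W K x) / ((real K + 1 / 2) * W K (1/2))"
      unfolding R_eq by simp
    finally show ?thesis by simp
  qed
  ultimately have "(\<lambda>K. R (Suc K) x / R (Suc K) (1 / 2)) \<longlonglongrightarrow> sin (pi * x)"
    by simp
  then have "(\<lambda>K. R K x / R K (1 / 2)) \<longlonglongrightarrow> sin (pi * x)"
    by (rule LIMSEQ_imp_Suc)
  moreover have "sin (pi * x) > 0" using x by (intro sin_gt_zero) auto
  ultimately have "(\<lambda>K. ln (R K x / R K (1 / 2))) \<longlonglongrightarrow> ln (sin (pi * x))"
    by (intro tendsto_ln) auto
  moreover have "ln (R K x / R K (1 / 2)) = (\<Sum>n<K. ln (x + real n) + ln (1 - x + real n) - 2 * ln (1 / 2 + real n))" for K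
  proof (induction K)
    case 0
    then show ?case by (simp add: R_def)
  next
    case (Suc K)
    have pos: "R K x > 0" "R K (1 / 2) > 0" "x + real K > 0" "1 - x + real K > 0"
      using x unfolding R_def by (auto intro!: prod_pos mult_pos_pos)
    have "R (Suc K) x / R (Suc K) (1 / 2) =
        (R K x / R K (1 / 2)) * ((x + real K) * (1 - x + real K) / (1 / 2 + real K)\<^sup>2)"
      by (simp add: R_def power2_eq_square)
    moreover have "ln ((R K x / R K (1 / 2)) * ((x + real K) * (1 - x + real K) / (1 / 2 + real K)\<^sup>2)) =
       ln (R K x / R K (1 / 2)) + (ln (x + real K) + ln (1 - x + real K) - 2 * ln (1 / 2 + real K))"
      using pos by (simp add: ln_mult ln_div ln_realpow)
    ultimately show ?case using Suc by simp
  qed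
  ultimately show ?thesis by simp
qed

text \<open>By \<open>(1 / 2 + s)^2 - (x + s) (1 - x + s) = (x - 1 / 2)^2 \<le> 1 / 4\<close>, each
  of the K terms is at most \<open>1 / (4 (K a)^2)\<close>, so the sum is
  \<open>O(1 / K)\<close>.\<close>

lemma tendsto_sum_ln_tail:
  assumes a: "0 < a" and x: "0 < x" "x < 1"
  shows "(\<lambda>K. \<Sum>n<K. 2 * ln (1 / 2 + real K * a + real n) - ln (x + real K * a + real n)
           - ln (1 - x + real K * a + real n)) \<longlonglongrightarrow> 0"
proof -
  have term_bound: "0 \<le> 2 * ln (1 / 2 + s) - ln (x + s) - ln (1 - x + s) \<and>
      2 * ln (1 / 2 + s) - ln (x + s) - ln (1 - x + s) \<le> 1 / (4 * t\<^sup>2)" if "0 < t" "t \<le> s" for s t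
  proof -
    let ?p = "(x + s) * (1 - x + s)"
    have pos: "x + s > 0" "1 - x + s > 0" "1 / 2 + s > 0" using that x by auto
    have pe: "(1 / 2 + s)\<^sup>2 - ?p = (x - 1 / 2)\<^sup>2" by (simp add: power2_eq_square algebra_simps)
    have "\<bar>x - 1 / 2\<bar> \<le> 1 / 2" using x by arith
    then have "(x - 1 / 2)\<^sup>2 \<le> (1 / 2)\<^sup>2" by (rule power2_le_iff_abs_le[THEN iffD2, rotated]) simp
    then have q: "(x - 1 / 2)\<^sup>2 \<le> 1 / 4" by (simp add: power2_eq_square)
    have "t\<^sup>2 \<le> s\<^sup>2" using that by (intro power_mono) auto
    moreover have "s\<^sup>2 \<le> ?p" using that x by (simp add: power2_eq_square algebra_simps)
      (smt (verit) mult_left_le_one_le mult_nonneg_nonneg mult_less_cancel_left2)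
    ultimately have tp: "t\<^sup>2 \<le> ?p" by linarith
    have pp: "?p > 0" using pos by simp
    have eq: "2 * ln (1 / 2 + s) - ln (x + s) - ln (1 - x + s) = ln ((1 / 2 + s)\<^sup>2 / ?p)"
      using pos by (simp add: ln_div ln_mult ln_realpow)
    have rat: "(1 / 2 + s)\<^sup>2 / ?p = 1 + (x - 1 / 2)\<^sup>2 / ?p"
      using pe pp by (simp add: field_simps)
    have "(x - 1 / 2)\<^sup>2 / ?p \<le> (1 / 4) / t\<^sup>2"
      using q tp that by (intro frac_le) auto
    moreover have "0 \<le> (x - 1 / 2)\<^sup>2 / ?p" using pp by simp
    ultimately show ?thesis unfolding eq rat
      using ln_add_one_self_le_self[of "(x - 1 / 2)\<^sup>2 / ?p"] by auto
  qed
  have bound: "0 \<le> (\<Sum>n<K. 2 * ln (1 / 2 + real K * a + real n) - ln (x + real K * a + real n)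
           - ln (1 - x + real K * a + real n)) \<and> (\<Sum>n<K. 2 * ln (1 / 2 + real K * a + real n) - ln (x + real K * a + real n)
           - ln (1 - x + real K * a + real n)) \<le> (1 / (4 * a\<^sup>2)) / real K" if "K > 0" for K
  proof
    have tb: "0 \<le> 2 * ln (1 / 2 + real K * a + real n) - ln (x + real K * a + real n) - ln (1 - x + real K * a + real n) \<and>
      2 * ln (1 / 2 + real K * a + real n) - ln (x + real K * a + real n) - ln (1 - x + real K * a + real n) \<le> 1 / (4 * (real K * a)\<^sup>2)" for n
      using term_bound[of "real K * a" "real K * a + real n"] that a by (simp add: add_ac)
    then show "0 \<le> (\<Sum>n<K. 2 * ln (1 / 2 + real K * a + real n) - ln (x + real K * a + real n)
           - ln (1 - x + real K * a + real n))" by (intro sum_nonneg) auto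
    have "(\<Sum>n<K. 2 * ln (1 / 2 + real K * a + real n) - ln (x + real K * a + real n)
           - ln (1 - x + real K * a + real n)) \<le> (\<Sum>n<K. 1 / (4 * (real K * a)\<^sup>2))"
      using tb by (intro sum_mono) auto
    also have "\<dots> = (1 / (4 * a\<^sup>2)) / real K" using that a by (simp add: field_simps power2_eq_square)
    finally show "(\<Sum>n<K. 2 * ln (1 / 2 + real K * a + real n) - ln (x + real K * a + real n)
           - ln (1 - x + real K * a + real n)) \<le> (1 / (4 * a\<^sup>2)) / real K" .
  qed
  show ?thesis
  proof (rule tendsto_sandwich[where f = "\<lambda>_. 0" and h = "\<lambda>K. (1 / (4 * a\<^sup>2)) / real K"])
    show "(\<lambda>K. (1 / (4 * a\<^sup>2)) / real K) \<longlonglongrightarrow> 0" by (rule lim_const_over_n)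
  qed (use bound in \<open>auto intro!: eventually_sequentiallyI[of 1]\<close>)
qed

text \<open>The coefficient of the linear correction in \<open>dsl\<close>, chosen so that the shift
  by a produces \<open>ln (2 sin (\<pi> x))\<close> with no constant left over.\<close>

definition dsl_slope :: "nat \<Rightarrow> real \<Rightarrow> real" where
  "dsl_slope K a = (ln 2 + (\<Sum>n<K. 2 * ln (1 / 2 + real K * a + real n) - 2 * ln (1 / 2 + real n))) / a"

text \<open>A K by K truncation of the logarithm of the double sine function with periods 1 and a,
  up to the sign convention: the quotient of two double gamma products at x and
  \<open>1 + a - x\<close>. The linear term stands for the regularising factors of the infinite
  product and vanishes at the centre \<open>(1 + a) / 2\<close>.\<close>

definition dsl :: "nat \<Rightarrow> real \<Rightarrow> real \<Rightarrow> real" where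
  "dsl K a x = (\<Sum>m<K. \<Sum>n<K. ln (1 + a - x + real m * a + real n) - ln (x + real m * a + real n))
     + dsl_slope K a * (x - (1 + a) / 2)"

text \<open>The constant in the shift by 1. The other shift equation has already fixed the slope, so
  the limit \<open>ln 2\<close> of this constant is a fact to be proved;
  \<open>tendsto_dsl_const\<close> does so for rational a.\<close>

definition dsl_const :: "nat \<Rightarrow> real \<Rightarrow> real" where
  "dsl_const K a = dsl_slope K a + (\<Sum>m<K. 2 * ln (1 / 2 + real m) - 2 * ln (1 / 2 + real K / a + real m))"

lemma dsl_reflect: "dsl K a (1 + a - x) = - dsl K a x"
proof -
  have "dsl_slope K a * (1 + a - x - (1 + a) / 2) = - (dsl_slope K a * (x - (1 + a) / 2))"
    by (simp add: algebra_simps)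
  moreover have "(\<Sum>m<K. \<Sum>n<K. ln (1 + a - (1 + a - x) + real m * a + real n) - ln (1 + a - x + real m * a + real n))
     = - (\<Sum>m<K. \<Sum>n<K. ln (1 + a - x + real m * a + real n) - ln (x + real m * a + real n))"
    by (simp add: sum_negf[symmetric])
  ultimately show ?thesis unfolding dsl_def by simp
qed

text \<open>The sum over m telescopes. The terms with \<open>m = 0\<close> form the sum that tends
  to the logarithm of the sine, those with \<open>m = K\<close> an error that tends to 0.\<close>

lemma dsl_shift_a:
  assumes a: "0 < a"
  shows "dsl K a (x + a) - dsl K a x = ln 2
     + (\<Sum>n<K. ln (x + real n) + ln (1 - x + real n) - 2 * ln (1 / 2 + real n))
     + (\<Sum>n<K. 2 * ln (1 / 2 + real K * a + real n) - ln (x + real K * a + real n)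
           - ln (1 - x + real K * a + real n))"
proof -
  define f where "f n m = ln (1 - x + real m * a + real n) + ln (x + real m * a + real n)" for n m :: nat
  have "dsl K a (x + a) - dsl K a x = (\<Sum>m<K. \<Sum>n<K. f n m - f n (Suc m)) + dsl_slope K a * a"
    unfolding dsl_def f_def
    by (simp add: sum_subtractf[symmetric] algebra_simps sum.distrib)
  also have "(\<Sum>m<K. \<Sum>n<K. f n m - f n (Suc m)) = (\<Sum>n<K. \<Sum>m<K. f n m - f n (Suc m))"
    by (rule sum.swap)
  also have "\<dots> = (\<Sum>n<K. f n 0 - f n K)"
    by (simp add: sum_lessThan_telescope')
  also have "dsl_slope K a * a = ln 2 + (\<Sum>n<K. 2 * ln (1 / 2 + real K * a + real n) - 2 * ln (1 / 2 + real n))"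
    using a by (simp add: dsl_slope_def)
  finally show ?thesis
    by (simp add: f_def sum.distrib sum_subtractf algebra_simps)
qed

text \<open>Here the sum over n telescopes. Dividing all arguments by a turns the boundary terms
  into those for \<open>sin (\<pi> x / a)\<close>; the \<open>ln a\<close> cancel because positive
  and negative logarithms are equal in number.\<close>

lemma dsl_shift_1:
  assumes a: "0 < a" and x: "0 < x" "x < a"
  shows "dsl K a (x + 1) - dsl K a x = dsl_const K a
     + (\<Sum>n<K. ln (x / a + real n) + ln (1 - x / a + real n) - 2 * ln (1 / 2 + real n))
     + (\<Sum>n<K. 2 * ln (1 / 2 + real K * (1 / a) + real n) - ln (x / a + real K * (1 / a) + real n)
           - ln (1 - x / a + real K * (1 / a) + real n))"
proof -
  define f where "f m n = ln (a - x + real m * a + real n) + ln (x + real m * a + real n)" for n m :: nat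
  have "dsl K a (x + 1) - dsl K a x = (\<Sum>m<K. \<Sum>n<K. f m n - f m (Suc n)) + dsl_slope K a"
    unfolding dsl_def f_def
    by (simp add: sum_subtractf[symmetric] algebra_simps sum.distrib)
  also have "(\<Sum>m<K. \<Sum>n<K. f m n - f m (Suc n)) = (\<Sum>m<K. f m 0 - f m K)"
    by (simp add: sum_lessThan_telescope')
  finally have eq: "dsl K a (x + 1) - dsl K a x = (\<Sum>m<K. f m 0 - f m K) + dsl_slope K a" .
  have ln_a: "ln (u / a) = ln u - ln a" if "u > 0" for u using that a by (simp add: ln_div)
  have xa: "0 < x / a" "x / a < 1" using a x by auto
  have "f m 0 - f m K = (ln (x / a + real m) + ln (1 - x / a + real m) - 2 * ln (1 / 2 + real m))
     + (2 * ln (1 / 2 + real K * (1 / a) + real m) - ln (x / a + real K * (1 / a) + real m)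
           - ln (1 - x / a + real K * (1 / a) + real m))
     + (2 * ln (1 / 2 + real m) - 2 * ln (1 / 2 + real K / a + real m))" for m
  proof -
    have p: "x + real m * a > 0" "a - x + real m * a > 0" "x + real m * a + real K > 0" "a - x + real m * a + real K > 0"
      using a x by (auto intro!: add_pos_nonneg)
    have e: "x / a + real m = (x + real m * a) / a" "1 - x / a + real m = (a - x + real m * a) / a"
      "x / a + real K * (1 / a) + real m = (x + real m * a + real K) / a"
      "1 - x / a + real K * (1 / a) + real m = (a - x + real m * a + real K) / a"
      using a by (auto simp: field_simps)
    show ?thesis unfolding e f_def using p by (simp add: ln_a)
  qed
  then have "(\<Sum>m<K. f m 0 - f m K) = (\<Sum>m<K. (ln (x / a + real m) + ln (1 - x / a + real m) - 2 * ln (1 / 2 + real m))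
     + (2 * ln (1 / 2 + real K * (1 / a) + real m) - ln (x / a + real K * (1 / a) + real m)
           - ln (1 - x / a + real K * (1 / a) + real m))
     + (2 * ln (1 / 2 + real m) - 2 * ln (1 / 2 + real K / a + real m)))"
    by (intro sum.cong refl)
  then show ?thesis unfolding eq dsl_const_def by (simp only: sum.distrib)
qed

lemma tendsto_dsl_shift_a:
  assumes "0 < a" "0 < x" "x < 1"
  shows "(\<lambda>K. dsl K a (x + a) - dsl K a x) \<longlonglongrightarrow> ln (sn x)"
proof -
  have "sin (pi * x) > 0" using assms by (intro sin_gt_zero) auto
  then have "ln (sn x) = ln 2 + ln (sin (pi * x)) + 0" by (simp add: sn_def ln_mult)
  then show ?thesis unfolding dsl_shift_a[OF assms(1)]
    by (simp only:) (intro tendsto_add tendsto_const tendsto_sum_ln_sin tendsto_sum_ln_tail assms)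
qed

lemma tendsto_dsl_shift_1:
  assumes "0 < a" "0 < x" "x < a"
  shows "(\<lambda>K. dsl K a (x + 1) - dsl K a x - (dsl_const K a - ln 2)) \<longlonglongrightarrow> ln (sn (x / a))"
proof -
  have xa: "0 < x / a" "x / a < 1" using assms by auto
  then have "sin (pi * (x / a)) > 0" by (intro sin_gt_zero mult_pos_pos) (simp_all del: times_divide_eq_right)
  then have "ln (sn (x / a)) = ln 2 + ln (sin (pi * (x / a))) + 0" by (simp add: sn_def ln_mult)
  moreover have "(\<lambda>K. ln 2 + (\<Sum>n<K. ln (x / a + real n) + ln (1 - x / a + real n) - 2 * ln (1 / 2 + real n))
     + (\<Sum>n<K. 2 * ln (1 / 2 + real K * (1 / a) + real n) - ln (x / a + real K * (1 / a) + real n)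
           - ln (1 - x / a + real K * (1 / a) + real n))) \<longlonglongrightarrow> ln 2 + ln (sin (pi * (x / a))) + 0"
    using xa assms by (intro tendsto_add tendsto_const tendsto_sum_ln_sin tendsto_sum_ln_tail) auto
  moreover have "dsl K a (x + 1) - dsl K a x - (dsl_const K a - ln 2) =
      ln 2 + (\<Sum>n<K. ln (x / a + real n) + ln (1 - x / a + real n) - 2 * ln (1 / 2 + real n))
     + (\<Sum>n<K. 2 * ln (1 / 2 + real K * (1 / a) + real n) - ln (x / a + real K * (1 / a) + real n)
           - ln (1 - x / a + real K * (1 / a) + real n))" for K
    using dsl_shift_1[OF assms, of K] by linarith
  ultimately show ?thesis by (simp only:)
qed

text \<open>A term has second derivative \<open>1 / (x + s)^2 - 1 / (1 + a + s - x)^2\<close>,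
  nonnegative left of the centre, and adding a linear function preserves convexity. This turns the
  values at \<open>a / 2\<close>, at a and at the centre into bounds that are uniform in K.\<close>

lemma convex_on_dsl:
  assumes a: "0 < a"
  shows "convex_on {0<..(1 + a) / 2} (dsl K a)"
proof -
  have conv_sum: "convex_on S (\<lambda>x. \<Sum>i\<in>I. f i x)"
    if "finite I" "convex S" "\<And>i. i \<in> I \<Longrightarrow> convex_on S (f i)" for I :: "nat set" and S :: "real set" and f
    using that by (induction I rule: finite_induct) (auto intro!: convex_on_add simp: convex_on_const)
  have term_conv': "convex_on {0<..(1 + a) / 2} (\<lambda>x. ln (1 + a + s - x) - ln (x + s))" if s: "0 \<le> s" for s
  proof (rule f''_ge0_imp_convex)
    fix x assume x: "x \<in> {0<..(1 + a) / 2}"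
    then have p: "0 < x + s" "x + s \<le> 1 + a + s - x" "0 < 1 + a + s - x"
      using s a by (auto simp: field_simps)
    show "((\<lambda>x. ln (1 + a + s - x) - ln (x + s)) has_real_derivative
      - inverse (1 + a + s - x) - inverse (x + s)) (at x)"
      using p by (auto intro!: derivative_eq_intros simp: divide_inverse)
    show "((\<lambda>x. - inverse (1 + a + s - x) - inverse (x + s)) has_real_derivative
      (inverse (x + s))\<^sup>2 - (inverse (1 + a + s - x))\<^sup>2) (at x)"
      using p by (auto intro!: derivative_eq_intros simp: power2_eq_square)
    have "inverse (1 + a + s - x) \<le> inverse (x + s)"
      using p by (intro le_imp_inverse_le) auto
    then show "0 \<le> (inverse (x + s))\<^sup>2 - (inverse (1 + a + s - x))\<^sup>2"
      using p by (simp add: power_mono)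
  qed simp
  have term_conv: "convex_on {0<..(1 + a) / 2} (\<lambda>x. ln (1 + a - x + real m * a + real n) - ln (x + real m * a + real n))"
    for m n :: nat
    using term_conv'[of "real m * a + real n"] a by (simp add: algebra_simps)
  have lin: "convex_on {0<..(1 + a) / 2} (\<lambda>x. dsl_slope K a * (x - (1 + a) / 2))"
    by (rule f''_ge0_imp_convex[where f' = "\<lambda>_. dsl_slope K a" and f'' = "\<lambda>_. 0"])
       (auto intro!: derivative_eq_intros)
  have "convex_on {0<..(1 + a) / 2} (\<lambda>x. (\<Sum>m<K. \<Sum>n<K. ln (1 + a - x + real m * a + real n) - ln (x + real m * a + real n))
     + dsl_slope K a * (x - (1 + a) / 2))"
    by (intro convex_on_add conv_sum lin term_conv) auto
  then show ?thesis by (simp add: dsl_def[abs_def])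
qed

section \<open>Reciprocity between the products at a and at 1 / a\<close>

lemma frac_step:
  fixes y a :: real
  assumes "0 < a" "a < 1" "y + a \<notin> \<int>" "0 \<le> y"
  shows "frac y + a < 1 \<and> frac (y + a) = frac y + a \<and> nat \<lfloor>y + a\<rfloor> = nat \<lfloor>y\<rfloor>
       \<or> 1 < frac y + a \<and> frac (y + a) = frac y + a - 1 \<and> nat \<lfloor>y + a\<rfloor> = Suc (nat \<lfloor>y\<rfloor>)"
proof -
  have y: "y = of_int \<lfloor>y\<rfloor> + frac y" by (simp add: frac_def)
  have f: "0 \<le> frac y" "frac y < 1" by (simp_all add: frac_lt_1)
  have "frac y + a \<noteq> 1"
  proof
    assume "frac y + a = 1"
    then have "y + a = of_int (\<lfloor>y\<rfloor> + 1)" using y by simp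
    then show False using assms(3) Ints_of_int by metis
  qed
  then consider "frac y + a < 1" | "1 < frac y + a" by linarith
  then show ?thesis
  proof cases
    case 1
    then have "\<lfloor>y + a\<rfloor> = \<lfloor>y\<rfloor>" using y f assms by (intro floor_unique) linarith+
    then show ?thesis using 1 by (simp add: frac_def)
  next
    case 2
    then have "\<lfloor>y + a\<rfloor> = \<lfloor>y\<rfloor> + 1" using y f assms by (intro floor_unique) (simp, linarith)+
    moreover have "0 \<le> \<lfloor>y\<rfloor>" using assms by simp
    ultimately show ?thesis using 2 by (auto simp: frac_def nat_add_distrib)
  qed
qed

text \<open>Each step of the rotation by \<open>a\<close> is one application of the \<open>a\<close>-shift equation, preceded by the
  \<open>1\<close>-shift equation backwards whenever the orbit wraps around.\<close>

lemma tendsto_dsl_walk: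
  assumes a: "0 < a" "a < 1" and x: "0 \<le> x" "x < 1"
    and nint: "\<And>j. 1 \<le> j \<Longrightarrow> j \<le> N \<Longrightarrow> x + real j * a \<notin> \<int>"
  shows "(\<lambda>K. dsl K a (frac (x + real N * a) + a) - dsl K a (x + a)
           + real (nat \<lfloor>x + real N * a\<rfloor>) * (dsl_const K a - ln 2))
    \<longlonglongrightarrow> (\<Sum>j=1..N. ln (sn (x + real j * a))) - (\<Sum>m=1..nat \<lfloor>x + real N * a\<rfloor>. ln (sn ((x - real m) / a)))"
  using nint
proof (induction N)
  case 0
  have "frac x = x" "nat \<lfloor>x\<rfloor> = 0" using x by (auto simp: frac_eq floor_eq_iff)
  then show ?case by simp
next
  case (Suc N)
  define y where "y = x + real N * a"
  define z where "z = frac y + a"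
  have ya: "x + real (Suc N) * a = y + a" by (simp add: y_def algebra_simps)
  have y0: "0 \<le> y" using x a by (simp add: y_def)
  have IH: "(\<lambda>K. dsl K a z - dsl K a (x + a) + real (nat \<lfloor>y\<rfloor>) * (dsl_const K a - ln 2))
    \<longlonglongrightarrow> (\<Sum>j=1..N. ln (sn (x + real j * a))) - (\<Sum>m=1..nat \<lfloor>y\<rfloor>. ln (sn ((x - real m) / a)))"
    unfolding y_def z_def using Suc by simp
  have yn: "y + a \<notin> \<int>" using Suc.prems[of "Suc N"] ya by simp
  have yfl: "y = real (nat \<lfloor>y\<rfloor>) + frac y" using y0 by (simp add: frac_def)
  have sz: "sn z = sn (x + real (Suc N) * a)"
    unfolding ya by (rule sn_cong_int) (simp add: z_def frac_def)
  have sumS: "(\<Sum>j=1..Suc N. ln (sn (x + real j * a))) = (\<Sum>j=1..N. ln (sn (x + real j * a))) + ln (sn z)"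
    using sz by simp
  have zpos: "0 < z" using a by (simp add: z_def add_nonneg_pos)
  from frac_step[OF a yn y0] show ?case
  proof (elim disjE conjE, goal_cases)
    case 1
    have "(\<lambda>K. (dsl K a (z + a) - dsl K a z) + (dsl K a z - dsl K a (x + a) + real (nat \<lfloor>y\<rfloor>) * (dsl_const K a - ln 2)))
      \<longlonglongrightarrow> ln (sn z) + ((\<Sum>j=1..N. ln (sn (x + real j * a))) - (\<Sum>m=1..nat \<lfloor>y\<rfloor>. ln (sn ((x - real m) / a))))"
      using 1 zpos a by (intro tendsto_add IH tendsto_dsl_shift_a) (auto simp: z_def)
    then show ?case using 1 sz unfolding ya by (simp add: z_def y_def algebra_simps)
  next
    case 2
    let ?M = "nat \<lfloor>y\<rfloor>"
    have z: "0 < z - 1" "z - 1 < a" "z - 1 < 1" using 2 a frac_lt_1[of y] by (auto simp: z_def)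
    have s2: "sn ((z - 1) / a) = sn ((x - real (Suc ?M)) / a)"
    proof (rule sn_cong_int)
      have "z - 1 = x + real (Suc N) * a - real (Suc ?M)"
        using yfl ya unfolding z_def by simp
      then have "(z - 1) - (x - real (Suc ?M)) = real (Suc N) * a" by simp
      then have "(z - 1) / a - (x - real (Suc ?M)) / a = of_nat (Suc N)"
        using a by (simp only: diff_divide_distrib[symmetric]) simp
      then show "(z - 1) / a - (x - real (Suc ?M)) / a \<in> \<int>" by (simp only: Ints_of_nat)
    qed
    have s3: "sn (z - 1) = sn z" using sn_cong_int[of "z - 1" z] by simp
    have "(\<lambda>K. (dsl K a (z - 1 + a) - dsl K a (z - 1)) - (dsl K a (z - 1 + 1) - dsl K a (z - 1) - (dsl_const K a - ln 2))
        + (dsl K a z - dsl K a (x + a) + real ?M * (dsl_const K a - ln 2)))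
      \<longlonglongrightarrow> ln (sn (z - 1)) - ln (sn ((z - 1) / a)) +
        ((\<Sum>j=1..N. ln (sn (x + real j * a))) - (\<Sum>m=1..?M. ln (sn ((x - real m) / a))))"
      using z a by (intro tendsto_add tendsto_diff IH tendsto_dsl_shift_a tendsto_dsl_shift_1) auto
    moreover have e: "frac (y + a) + a = z - 1 + a" "nat \<lfloor>y + a\<rfloor> = Suc ?M" using 2 by (auto simp: z_def)
    moreover have "(\<Sum>m=1..Suc ?M. ln (sn ((x - real m) / a))) = (\<Sum>m=1..?M. ln (sn ((x - real m) / a))) + ln (sn ((z - 1) / a))"
      by (simp add: s2)
    ultimately show ?case unfolding ya e s3 sumS by (simp add: algebra_simps)
  qed
qed

text \<open>A closed orbit decides the constant. After n steps and p wraps the rotation by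
  \<open>p / n\<close> is back at its start, so the two values of \<open>dsl\<close> cancel, while
  both products equal \<open>sn (1 / 2)\<close> by the multiplication formula. Hence
  \<open>p (dsl_const K a - ln 2)\<close> tends to 0.\<close>

lemma tendsto_dsl_const:
  fixes p n :: nat
  assumes pn: "coprime p n" "0 < p" "p < n"
  defines "a \<equiv> real p / real n"
  shows "(\<lambda>K. dsl_const K a) \<longlonglongrightarrow> ln 2"
proof -
  have a: "0 < a" "a < 1" using pn by (auto simp: a_def)
  \<comment> \<open>Half of the spacing \<open>1 / n\<close>: the orbit then avoids the integers,
    and \<open>n x = 1 / 2\<close> makes both products explicit.\<close>
  define x where "x = 1 / (2 * real n)"
  have x: "0 \<le> x" "x < 1" using pn by (auto simp: x_def divide_less_eq)
  have nx: "real n * x = 1 / 2" using pn by (simp add: x_def)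
  have nint: "x + real j * a \<notin> \<int>" for j
  proof
    assume "x + real j * a \<in> \<int>"
    then obtain k where "x + real j * a = of_int k" by (auto elim: Ints_cases)
    then have "1 + 2 * real j * real p = 2 * real n * of_int k"
      using pn unfolding x_def a_def by (simp add: field_simps)
    then have "1 + 2 * int j * int p = 2 * int n * k"
      by (metis (mono_tags) of_int_eq_iff of_int_add of_int_mult of_int_of_nat_eq of_int_1 of_int_numeral)
    then have "even (1 + 2 * int j * int p)" by simp
    then show False by simp
  qed
  have na: "real n * a = real p" using pn by (simp add: a_def)
  have "frac (x + real n * a) = x" "nat \<lfloor>x + real n * a\<rfloor> = p"
    using x by (auto simp: na frac_def floor_eq_iff)
      (simp_all add: floor_eq_iff nat_add_distrib)
  with tendsto_dsl_walk[OF a x nint, of n]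
  have lim: "(\<lambda>K. real p * (dsl_const K a - ln 2))
    \<longlonglongrightarrow> (\<Sum>j=1..n. ln (sn (x + real j * a))) - (\<Sum>m=1..p. ln (sn ((x - real m) / a)))" by simp
  \<comment> \<open>The orbit products run over \<open>1..k\<close>, the multiplication formula over
    indices below k; by periodicity the end terms agree.\<close>
  have shift: "(\<Prod>j=1..k. f j) = (\<Prod>j<k. f j)" if "f k = f 0" for f :: "nat \<Rightarrow> real" and k
  proof -
    have "(\<Prod>j=1..k. f j) * f 0 = (\<Prod>j\<le>k. f j)"
      by (simp add: atMost_atLeast0 prod.atLeast_Suc_atMost)
    also have "\<dots> = (\<Prod>j<k. f j) * f k" by (simp add: lessThan_Suc_atMost[symmetric])
    finally show ?thesis
    proof (cases "f 0 = 0 \<and> k > 0")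
      case True
      then have "(\<Prod>j=1..k. f j) = 0" using that by (intro prod_zero bexI[of _ k]) auto
      moreover have "(\<Prod>j<k. f j) = 0" using True by (intro prod_zero bexI[of _ 0]) auto
      ultimately show ?thesis by (simp only:)
    qed (use that in auto)
  qed
  have pos1: "sn (x + real j * a) > 0" for j using nint by (simp add: sn_pos_iff)
  have "(\<Sum>j=1..n. ln (sn (x + real j * a))) = ln (\<Prod>j=1..n. sn (x + real j * a))"
    by (rule ln_prod[symmetric]) (use pos1 in \<open>metis finite_atLeastAtMost less_irrefl\<close>)+
  also have "(\<Prod>j=1..n. sn (x + real j * a)) = (\<Prod>j<n. sn (x + real j * a))"
    using sn_cong_int[of "x + real n * a" x] na by (intro shift) simp
  also have "\<dots> = sn (1 / 2)"
    unfolding a_def using prod_sn_add_coprime[of n p x] pn nx by simp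
  finally have s1: "(\<Sum>j=1..n. ln (sn (x + real j * a))) = ln (sn (1 / 2))" .
  have eqm: "(x - real m) / a = - (- (x / a) + real m * (real n / real p))" for m
    using a pn by (simp add: a_def field_simps)
  have e2: "real p * (x / a) = real n * x" using pn by (simp add: a_def)
  have pos2: "sn ((x - real m) / a) > 0" for m
  proof -
    have "(x - real m) / a \<notin> \<int>"
    proof
      assume "(x - real m) / a \<in> \<int>"
      then obtain k where "(x - real m) / a = of_int k" by (auto elim: Ints_cases)
      then have "x - real m = of_int k * a" using a by (simp add: divide_eq_eq)
      then have "2 * (real n * x) - 2 * real n * real m = 2 * of_int k * (real n * a)"
        by (metis mult.assoc mult.left_commute right_diff_distrib)
      then have "1 = 2 * real n * real m + 2 * real p * of_int k"
        unfolding nx na by (simp add: algebra_simps)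
      then have "1 = 2 * int n * int m + 2 * int p * k"
        by (metis (mono_tags) of_int_eq_iff of_int_add of_int_mult of_int_of_nat_eq of_int_1 of_int_numeral)
      then have "even (1 :: int)" by (metis dvd_add dvd_mult2 dvd_triv_left)
      then show False by simp
    qed
    then show ?thesis by (simp add: sn_pos_iff)
  qed
  have "(\<Sum>m=1..p. ln (sn ((x - real m) / a))) = ln (\<Prod>m=1..p. sn ((x - real m) / a))"
    by (rule ln_prod[symmetric]) (use pos2 in \<open>metis finite_atLeastAtMost less_irrefl\<close>)+
  also have "(\<Prod>m=1..p. sn ((x - real m) / a)) = (\<Prod>m<p. sn ((x - real m) / a))"
  proof (rule shift, rule sn_cong_int)
    have "(x - real p) / a - (x - real 0) / a = - of_nat n" using pn by (simp add: a_def field_simps)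
    then show "(x - real p) / a - (x - real 0) / a \<in> \<int>" by simp
  qed
  also have "\<dots> = (\<Prod>m<p. sn (- (x / a) + real m * (real n / real p)))"
    unfolding eqm sn_minus ..
  also have "\<dots> = sn (1 / 2)"
  proof -
    have "real p * - (x / a) = - (1 / 2)" unfolding mult_minus_right e2 nx ..
    then show ?thesis
      using prod_sn_add_coprime[of p n "- (x / a)"] pn by (simp only: sn_minus coprime_commute)
  qed
  finally have s2: "(\<Sum>m=1..p. ln (sn ((x - real m) / a))) = ln (sn (1 / 2))" .
  from lim have "(\<lambda>K. real p * (dsl_const K a - ln 2) / real p + ln 2) \<longlonglongrightarrow> 0 / real p + ln 2"
    unfolding s1 s2 using pn by (intro tendsto_intros) auto
  then show ?thesis using pn by simp
qed

text \<open>From above, the chord from a to the centre, where \<open>dsl\<close> vanishes, gives the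
  bound \<open>|dsl K a a|\<close>. From below, the chord from \<open>a / 2\<close> to the point
  passes above the value at a, which limits the descent after a. A point right of the centre is
  reflected.\<close>

lemma dsl_abs_bound:
  assumes a: "0 < a" "a \<le> 1 / 2" and z: "a \<le> z" "z < 2 * a"
  shows "\<bar>dsl K a z\<bar> \<le> \<bar>dsl K a a\<bar> + 2 * \<bar>dsl K a a - dsl K a (a / 2)\<bar>"
proof -
  define c where "c = (1 + a) / 2"
  let ?f = "dsl K a"
  have c0: "?f c = 0"
    using dsl_reflect[of K a c] by (simp add: c_def field_simps)
  have ac: "a < c" using a by (simp add: c_def)
  have conv: "convex_on {u..v} ?f" if "0 < u" "v \<le> c" for u v
    using convex_on_dsl[OF a(1), of K] that by (rule_tac convex_on_subset) (auto simp: c_def)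
  have main: "\<bar>?f v\<bar> \<le> \<bar>?f a\<bar> + 2 * \<bar>?f a - ?f (a / 2)\<bar>" if v: "a \<le> v" "v \<le> 2 * a" "v \<le> c" for v
  proof -
    have "?f v \<le> (?f c - ?f a) / (c - a) * (v - a) + ?f a"
      using convex_onD_Icc'[OF conv[of a c], of v] v a ac by simp
    also have "\<dots> = ?f a * (1 - (v - a) / (c - a))" using c0 ac by (simp add: field_simps)
    also have "\<dots> \<le> \<bar>?f a\<bar> * 1"
    proof (rule order.trans[OF mult_right_mono[OF abs_ge_self] mult_left_mono])
      show "0 \<le> 1 - (v - a) / (c - a)" using v ac by (simp add: field_simps)
      show "1 - (v - a) / (c - a) \<le> 1" using v ac by simp
    qed simp
    finally have upper: "?f v \<le> \<bar>?f a\<bar>" by simp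
    have "?f a \<le> (?f (a / 2) - ?f v) / (v - a / 2) * (v - a) + ?f v"
      using convex_onD_Icc''[OF conv[of "a / 2" v], of a] v a by simp
    then have "?f a * (v - a / 2) \<le> ((?f (a / 2) - ?f v) / (v - a / 2) * (v - a) + ?f v) * (v - a / 2)"
      using v a by (intro mult_right_mono) auto
    also have "\<dots> = ?f (a / 2) * (v - a) + ?f v * (a / 2)"
      using v a by (simp add: field_simps)
    finally have "?f v * (a / 2) \<ge> ?f a * (a / 2) + (?f a - ?f (a / 2)) * (v - a)"
      by (simp add: algebra_simps)
    moreover have "(?f a - ?f (a / 2)) * (v - a) \<ge> - (\<bar>?f a - ?f (a / 2)\<bar> * a)"
    proof -
      have "\<bar>(?f a - ?f (a / 2)) * (v - a)\<bar> \<le> \<bar>?f a - ?f (a / 2)\<bar> * a"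
        unfolding abs_mult using v by (intro mult_left_mono) auto
      then show ?thesis by linarith
    qed
    ultimately have "?f v * (a / 2) \<ge> (?f a - 2 * \<bar>?f a - ?f (a / 2)\<bar>) * (a / 2)"
      by (simp add: algebra_simps)
    then have "?f v \<ge> ?f a - 2 * \<bar>?f a - ?f (a / 2)\<bar>" using a by (simp add: mult_le_cancel_right)
    moreover have "\<bar>x\<bar> \<le> \<bar>y\<bar> + 2 * D" if "y - 2 * D \<le> x" "x \<le> \<bar>y\<bar>" "0 \<le> D" for x y D :: real
      using that by arith
    ultimately show ?thesis using upper by simp
  qed
  show ?thesis
  proof (cases "z \<le> c")
    case True
    then show ?thesis using main[of z] z by simp
  next
    case False
    then have "a \<le> 1 + a - z" "1 + a - z \<le> c" "1 + a - z \<le> 2 * a"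
      using z a by (auto simp: c_def field_simps)
    from main[OF this(1,3,2)] show ?thesis by (simp add: dsl_reflect)
  qed
qed

text \<open>The orbit starts at 0, so the logarithm of the quotient is the limit of a difference of
  \<open>dsl\<close> at \<open>frac (N a) + a\<close> and at a. The hypothesis on
  \<open>frac\<close> says that the orbit has just wrapped; it places the first point in
  \<open>[a, 2 a)\<close>, where convexity controls \<open>dsl\<close>.\<close>

lemma sudler_reciprocity:
  fixes p n N :: nat
  assumes pn: "coprime p n" "0 < p" "2 * p \<le> n" and N: "N < n"
  defines "a \<equiv> real p / real n"
  assumes fr: "frac (real N * a) < a"
  shows "\<bar>ln (sudler N a) - ln (sudler (nat \<lfloor>real N * a\<rfloor>) (1 / a))\<bar> \<le> 2 * ln (1 / a)"
proof -
  have a: "0 < a" "a < 1" "a \<le> 1 / 2" using pn by (auto simp: a_def field_simps)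
  have pn': "p < n" using pn by simp
  note C = tendsto_dsl_const[OF pn(1,2) pn', folded a_def]
  have C0: "(\<lambda>K. real k * (dsl_const K a - ln 2)) \<longlonglongrightarrow> 0" for k
    using tendsto_mult[OF tendsto_const tendsto_diff[OF C tendsto_const[of "ln 2"]], of "real k"] by simp
  have ai: "1 / a = real n / real p" by (simp add: a_def)
  have walk: "(\<lambda>K. dsl K a (frac (real k * a) + a) - dsl K a a)
    \<longlonglongrightarrow> ln (sudler k a) - ln (sudler (nat \<lfloor>real k * a\<rfloor>) (1 / a))" if "k < n" for k
  proof -
    let ?m = "nat \<lfloor>real k * a\<rfloor>"
    have nint: "0 + real j * a \<notin> \<int>" if "1 \<le> j" "j \<le> k" for j
      using rational_multiple_not_int[OF pn(1), of j] that \<open>k < n\<close> by (simp add: a_def)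
    have "real k * a < real p"
      using \<open>k < n\<close> pn pn' by (simp add: a_def field_simps)
    then have "\<lfloor>real k * a\<rfloor> < int p" by (simp add: floor_less_iff)
    then have mp: "?m < p" using pn(2) by simp
    have "(\<Sum>j=1..k. ln (sn (0 + real j * a))) = ln (sudler k a)"
    proof -
      have "sn (real j * a) \<noteq> 0" if "1 \<le> j" "j \<le> k" for j
        using nint[OF that] sn_pos_iff[of "real j * a"] by auto
      then show ?thesis unfolding sudler_def by (subst ln_prod) auto
    qed
    moreover have "(\<Sum>m=1..?m. ln (sn ((0 - real m) / a))) = ln (sudler ?m (1 / a))"
    proof -
      have "sn (real m * (1 / a)) \<noteq> 0" if "1 \<le> m" "m \<le> ?m" for m
        using rational_multiple_not_int[of n p m] pn that mp sn_pos_iff[of "real m * (1 / a)"]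
        unfolding ai by (auto simp: coprime_commute)
      moreover have "(0 - real m) / a = - (real m * (1 / a))" for m by simp
      ultimately show ?thesis unfolding sudler_def by (simp only: sn_minus) (subst ln_prod, auto)
    qed
    ultimately have "(\<lambda>K. (dsl K a (frac (0 + real k * a) + a) - dsl K a (0 + a)
           + real (nat \<lfloor>0 + real k * a\<rfloor>) * (dsl_const K a - ln 2)) - real ?m * (dsl_const K a - ln 2))
      \<longlonglongrightarrow> (ln (sudler k a) - ln (sudler ?m (1 / a))) - 0"
      using tendsto_diff[OF tendsto_dsl_walk[OF a(1,2), of 0 k, OF _ _ nint] C0[of ?m]] by simp
    then show ?thesis by simp
  qed
  \<comment> \<open>At position \<open>n - 1\<close> the argument \<open>frac + a\<close> is 1 and
    both products are full, with values n and p. Reflection exchanges 1 and a, so one equation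
    determines the limit.\<close>
  have fa: "(\<lambda>K. dsl K a a) \<longlonglongrightarrow> ln a / 2"
  proof -
    have e: "real (n - 1) * a = real (p - 1) + (1 - a)"
      using pn pn' by (simp add: a_def of_nat_diff field_simps)
    have fl: "\<lfloor>real (n - 1) * a\<rfloor> = int (p - 1)"
      unfolding e using a by (intro floor_unique) auto
    then have f1: "frac (real (n - 1) * a) + a = 1" unfolding frac_def using e by simp
    have "sudler (p - 1) (1 / a) = real p"
      unfolding ai using sudler_full[of n p] pn by (simp add: coprime_commute)
    moreover have "sudler (n - 1) a = real n" unfolding a_def using sudler_full[of p n] pn pn' by simp
    ultimately have "(\<lambda>K. dsl K a 1 - dsl K a a) \<longlonglongrightarrow> ln (real n) - ln (real p)"
    proof -
      have fn: "nat \<lfloor>real (n - 1) * a\<rfloor> = p - 1" using fl by simp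
      assume "sudler (p - 1) (1 / a) = real p" "sudler (n - 1) a = real n"
      then show ?thesis using walk[of "n - 1", unfolded f1 fn] pn pn' by simp
    qed
    moreover have "dsl K a 1 = - dsl K a a" for K using dsl_reflect[of K a a] by simp
    moreover have "ln (real n) - ln (real p) = - ln a" using pn pn' by (simp add: a_def ln_div)
    ultimately have "(\<lambda>K. - 2 * dsl K a a) \<longlonglongrightarrow> - ln a" by simp
    from tendsto_divide[OF this tendsto_const[of "- 2"]] show ?thesis by simp
  qed
  \<comment> \<open>From \<open>a / 2\<close> the shift by 1 leads to its own mirror image
    \<open>1 + a / 2\<close>.\<close>
  have fa2: "(\<lambda>K. dsl K a (a / 2)) \<longlonglongrightarrow> - ln 2 / 2"
  proof -
    have "dsl K a (a / 2 + 1) = - dsl K a (a / 2)" for K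
      using dsl_reflect[of K a "a / 2"] by (simp add: algebra_simps)
    moreover have "ln (sn (a / 2 / a)) = ln 2" using a by (simp add: sn_def)
    ultimately have "(\<lambda>K. - 2 * dsl K a (a / 2) - (dsl_const K a - ln 2)) \<longlonglongrightarrow> ln 2"
      using tendsto_dsl_shift_1[OF a(1), of "a / 2"] a by simp
    from tendsto_add[OF this C0[of 1]] have "(\<lambda>K. - 2 * dsl K a (a / 2)) \<longlonglongrightarrow> ln 2" by simp
    from tendsto_divide[OF this tendsto_const[of "- 2"]] show ?thesis by simp
  qed
  define z where "z = frac (real N * a) + a"
  have z: "a \<le> z" "z < 2 * a" using fr by (auto simp: z_def)
  have "\<bar>ln (sudler N a) - ln (sudler (nat \<lfloor>real N * a\<rfloor>) (1 / a))\<bar>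
      \<le> \<bar>ln a / 2\<bar> + 2 * \<bar>ln a / 2 - - ln 2 / 2\<bar> + \<bar>ln a / 2\<bar>"
  proof (rule LIMSEQ_le)
    show "(\<lambda>K. \<bar>dsl K a z - dsl K a a\<bar>) \<longlonglongrightarrow> \<bar>ln (sudler N a) - ln (sudler (nat \<lfloor>real N * a\<rfloor>) (1 / a))\<bar>"
      unfolding z_def by (intro tendsto_rabs walk N)
    show "(\<lambda>K. \<bar>dsl K a a\<bar> + 2 * \<bar>dsl K a a - dsl K a (a / 2)\<bar> + \<bar>dsl K a a\<bar>)
      \<longlonglongrightarrow> \<bar>ln a / 2\<bar> + 2 * \<bar>ln a / 2 - - ln 2 / 2\<bar> + \<bar>ln a / 2\<bar>"
      by (intro tendsto_intros fa fa2)
    show "\<exists>k. \<forall>K\<ge>k. \<bar>dsl K a z - dsl K a a\<bar> \<le> \<bar>dsl K a a\<bar> + 2 * \<bar>dsl K a a - dsl K a (a / 2)\<bar> + \<bar>dsl K a a\<bar>"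
      using order.trans[OF abs_triangle_ineq4 add_right_mono[OF dsl_abs_bound[OF a(1,3) z]]] by blast
  qed
  \<comment> \<open>Since \<open>2 a \<le> 1\<close>, both \<open>ln a\<close> and
    \<open>ln (2 a)\<close> are nonpositive, so every absolute value opens with a known
    sign.\<close>
  also have "\<dots> \<le> 2 * ln (1 / a)"
  proof -
    have l: "ln (2 * a) \<le> 0" "ln a \<le> 0" using a by auto
    have e: "ln (2 * a) = ln 2 + ln a" "ln (1 / a) = - ln a" using a by (simp_all add: ln_mult ln_div)
    have key: "\<bar>u / 2\<bar> + 2 * \<bar>u / 2 - - w / 2\<bar> + \<bar>u / 2\<bar> \<le> 2 * - u" if "w + u \<le> 0" "u \<le> 0" "0 < w" for u w :: real
    proof -
      have "\<bar>u / 2\<bar> = - u / 2" "\<bar>u / 2 - - w / 2\<bar> = - (w + u) / 2"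
        using that by (simp_all add: abs_if)
      then show ?thesis using that by simp
    qed
    have "ln (2::real) > 0" by simp
    from key[OF l(1)[unfolded e(1)] l(2) this] show ?thesis unfolding e(2) .
  qed
  finally show ?thesis .
qed

section \<open>Sums of ln (2 sin (\<pi> x)) over arithmetic progressions\<close>

definition hh :: "real \<Rightarrow> real" where
  "hh x = ln (2 * sin (pi * x))"

lemma ln_sn_eq: "0 < x \<Longrightarrow> x < 1 \<Longrightarrow> ln (sn x) = hh x"
  using sin_gt_zero[of "pi * x"] by (simp add: sn_def hh_def)

text \<open>For a negative argument \<open>ln\<close> takes the value at the absolute value, and
  \<open>ln 0 = 0\<close>; the bound therefore holds also where the sine is not positive.\<close>

lemma hh_le: "hh x \<le> ln 2"
proof (cases "2 * sin (pi * x) > 0")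
  case True
  then show ?thesis by (simp add: hh_def)
next
  case False
  have "sin (pi * x) \<ge> - 1" by simp
  show ?thesis
  proof (cases "sin (pi * x) = 0")
    case False
    with \<open>\<not> 2 * sin (pi * x) > 0\<close> have "ln (2 * sin (pi * x)) = ln (2 * \<bar>sin (pi * x)\<bar>)"
      by (simp add: ln_real_def)
    then show ?thesis using False by (simp add: hh_def)
  qed (simp add: hh_def)
qed

lemma hh_mono:
  assumes "0 < x" "x \<le> y" "y \<le> 1 / 2"
  shows "hh x \<le> hh y"
proof -
  have "0 < sin (pi * x)" using assms by (intro sin_gt_zero) auto
  moreover have "sin (pi * x) \<le> sin (pi * y)"
  proof (rule sin_monotone_2pi_le)
    have "0 \<le> pi * x" using assms by simp
    then show "- (pi / 2) \<le> pi * x" using pi_gt_zero by linarith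
  qed (use assms in auto)
  ultimately show ?thesis by (simp add: hh_def)
qed

lemma hh_antimono:
  assumes "1 / 2 \<le> x" "x \<le> y" "y < 1"
  shows "hh y \<le> hh x"
proof -
  have "sin (pi * (1 - x)) = sin (pi * x)" "sin (pi * (1 - y)) = sin (pi * y)"
    by (simp_all add: right_diff_distrib)
  then show ?thesis using hh_mono[of "1 - y" "1 - x"] assms by (simp add: hh_def)
qed

lemma hh_56: "hh (5 / 6) = 0"
proof -
  have "pi * (5 / 6) = pi - pi / 6" by simp
  then have "sin (pi * (5 / 6)) = sin (pi / 6)" by (metis sin_pi_minus)
  then show ?thesis by (simp add: hh_def sin_30)
qed

lemma jordan_inequality:
  assumes "0 \<le> x" "x \<le> pi / 2"
  shows "(2 / pi) * x \<le> sin x"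
proof -
  have "convex_on {0..pi / 2} (\<lambda>x. - sin x)"
    by (rule f''_ge0_imp_convex[where f' = "\<lambda>x. - cos x" and f'' = sin])
       (auto intro!: derivative_eq_intros sin_ge_zero)
  from convex_onD_Icc'[OF this, of x] assms show ?thesis by simp
qed

definition kap :: real where
  "kap = integral {1 / 2..5 / 6} hh"

lemma hh_continuous: "0 < u \<Longrightarrow> v < 1 \<Longrightarrow> continuous_on {u..v} hh"
proof -
  assume u: "0 < u" and v: "v < 1"
  have "2 * sin (pi * x) \<noteq> 0" if "x \<in> {u..v}" for x
  proof -
    have "0 < x" "x < 1" using that u v by auto
    then have "0 < sin (pi * x)" by (intro sin_gt_zero) auto
    then show ?thesis by simp
  qed
  then show ?thesis unfolding hh_def by (intro continuous_intros) auto
qed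

lemma hh_integrable: "0 < u \<Longrightarrow> v < 1 \<Longrightarrow> hh integrable_on {u..v}"
  by (intro integrable_continuous_real hh_continuous)

text \<open>The product of all \<open>sn (j / m)\<close> is m, and \<open>j \<mapsto> m - j\<close>
  exchanges the two halves. The left half thus carries half of \<open>ln m\<close>, up to the middle
  term \<open>hh (1 / 2) = ln 2\<close> that is present for even m.\<close>

lemma sum_hh_bounds:
  assumes "m > 0"
  shows "0 \<le> (\<Sum>j | 1 \<le> j \<and> 2 * j \<le> m. hh (real j / real m))"
    "(\<Sum>j | 1 \<le> j \<and> 2 * j \<le> m. hh (real j / real m)) \<le> ln (real m) + 1"
proof -
  let ?L = "{j. 1 \<le> j \<and> 2 * j \<le> m}" and ?E = "{j. 1 \<le> j \<and> 2 * j < m}" and ?U = "{j. m \<le> 2 * j \<and> j < m}"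
  let ?f = "\<lambda>j. hh (real j / real m)"
  have fin: "finite ?L" "finite ?E" "finite ?U"
    by (rule finite_subset[of _ "{..m}"], force, simp)+
  have "ln (real m) = ln (\<Prod>j=1..<m. sn (real j / real m))" using prod_sn[OF assms] by simp
  also have "\<dots> = (\<Sum>j=1..<m. ln (sn (real j / real m)))"
  proof (rule ln_prod)
    fix j assume "j \<in> {1..<m}"
    then have "\<not> real j / real m \<in> \<int>" using rational_multiple_not_int[of 1 m j] by simp
    then have "0 < sn (real j / real m)" by (simp only: sn_pos_iff not_False_eq_True)
    then show "sn (real j / real m) \<noteq> 0" by simp
  qed simp
  also have "\<dots> = (\<Sum>j=1..<m. ?f j)"
    by (intro sum.cong refl ln_sn_eq) auto
  also have "{1..<m} = ?E \<union> ?U" using assms by auto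
  also have "(\<Sum>j\<in>?E \<union> ?U. ?f j) = sum ?f ?E + sum ?f ?U" using fin by (intro sum.union_disjoint) auto
  also have "sum ?f ?U = sum ?f ?L"
  proof (rule sum.reindex_bij_witness[where i = "\<lambda>j. m - j" and j = "\<lambda>j. m - j"])
    fix j assume j: "j \<in> ?U"
    then have "real (m - j) / real m = 1 - real j / real m" using assms by (simp add: of_nat_diff field_simps)
    moreover have "sin (pi * (1 - x)) = sin (pi * x)" for x by (simp add: right_diff_distrib)
    ultimately show "hh (real (m - j) / real m) = hh (real j / real m)" by (simp add: hh_def)
  next
    fix j assume "j \<in> ?U"
    then show "m - j \<in> ?L" "m - (m - j) = j" by auto
  next
    fix j assume "j \<in> ?L"
    then show "m - j \<in> ?U" "m - (m - j) = j" by auto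
  qed
  finally have eq: "ln (real m) = sum ?f ?E + sum ?f ?L" .
  have half: "hh (1 / 2) = ln 2" by (simp add: hh_def)
  have ln2: "0 < ln (2::real)" "ln (2::real) \<le> 1" using ln_2_less_1 by auto
  have "sum ?f ?L = sum ?f ?E + (if even m then ln 2 else 0)"
  proof (cases "even m")
    case True
    then obtain k where k: "m = 2 * k" by blast
    then have "?L = insert k ?E" using assms by auto
    moreover have "?f k = ln 2" using k assms half by simp
    ultimately show ?thesis using True fin k by simp
  next
    case False
    then have "?L = ?E" by (auto simp: le_less)
    then show ?thesis using False by simp
  qed
  then obtain \<delta> where \<delta>: "sum ?f ?L = sum ?f ?E + \<delta>" "0 \<le> \<delta>" "\<delta> \<le> 1" using ln2 by (auto split: if_splits)
  have "ln (real m) \<ge> 0" using assms by simp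
  then show "0 \<le> sum ?f ?L" "sum ?f ?L \<le> ln (real m) + 1" using eq \<delta> by linarith+
qed

lemma ln_2_le_1: "ln (2::real) \<le> 1"
  using ln_2_less_1 by simp

lemma sum_le_card_ln2: "finite A \<Longrightarrow> (\<Sum>i\<in>A. hh (f i)) \<le> real (card A)"
  using sum_bounded_above[of A "\<lambda>i. hh (f i)" 1] hh_le ln_2_le_1 by (auto intro: order.trans)

text \<open>The points of the progression below \<open>1 / 2\<close> contribute only \<open>O(1 + ln (1 / a))\<close>, because the
  corresponding integral vanishes; they are compared with the points \<open>j / m\<close>, \<open>m\<close> close to \<open>1 / a\<close>.\<close>

lemma sum_hh_left_half:
  assumes a: "0 < a" "a \<le> 1 / 2" and t: "0 \<le> t" "t < a"
  shows "\<bar>\<Sum>i | 1 \<le> i \<and> t + real i * a \<le> 1 / 2. hh (t + real i * a)\<bar> \<le> 2 * ln (1 / a) + 6"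
proof -
  let ?A = "{i. 1 \<le> i \<and> t + real i * a \<le> 1 / 2}"
  define b where "b = 1 / a"
  have b: "2 \<le> b" and ab: "a * b = 1" using a by (auto simp: b_def field_simps)
  have fA: "finite ?A"
  proof (rule finite_subset[of _ "{..nat \<lceil>b\<rceil>}"])
    show "?A \<subseteq> {..nat \<lceil>b\<rceil>}"
    proof
      fix i assume "i \<in> ?A"
      then have i: "t + real i * a \<le> 1 / 2" by simp
      then have "real i * a \<le> 1" using t by simp
      then have "real i * a * b \<le> 1 * b" using b by (intro mult_right_mono) auto
      then have "real i \<le> b" using ab by (simp add: mult.assoc)
      then have "i \<le> nat \<lceil>b\<rceil>" by linarith
      then show "i \<in> {..nat \<lceil>b\<rceil>}" by simp
    qed
  qed simp
  have lnb: "ln (1 / a) = ln b" "0 \<le> ln b" using b by (auto simp: b_def)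
  have inA: "i \<in> ?A" if "1 \<le> i" "real i + 1 \<le> b / 2" for i
  proof -
    have "(real i + 1) * a \<le> (b / 2) * a" using that a by (intro mult_right_mono) auto
    then show ?thesis using ab t that by (simp add: algebra_simps)
  qed
  have Ab: "real i \<le> b / 2" if "i \<in> ?A" for i
  proof -
    have "real i * a \<le> 1 / 2" using that t by simp
    then have "real i * a * b \<le> 1 / 2 * b" using b by (intro mult_right_mono) auto
    then show ?thesis using ab by (simp add: mult.assoc)
  qed
  have lower: "- 3 \<le> (\<Sum>i\<in>?A. hh (t + real i * a))"
  proof -
    \<comment> \<open>Rounding up puts \<open>j / m\<close> left of \<open>t + j a\<close>, so the
      comparison sum is smaller term by term. At most three points of \<open>?L\<close> lie outside
      \<open>?A\<close>, each contributing at most 1.\<close>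
    define m where "m = nat \<lceil>b\<rceil>"
    have m: "b \<le> real m" "real m < b + 1" "m > 0" using b unfolding m_def by linarith+
    let ?L = "{j. 1 \<le> j \<and> 2 * j \<le> m}"
    have fL: "finite ?L" by (rule finite_subset[of _ "{..m}"]) auto
    have AL: "?A \<subseteq> ?L"
    proof
      fix i assume i: "i \<in> ?A"
      from Ab[OF i] m have "real (2 * i) \<le> real m" by simp
      then show "i \<in> ?L" using i by (simp only: of_nat_le_iff) simp
    qed
    have "card (?L - ?A) \<le> card {i. b / 2 - 1 < real i \<and> real i \<le> b / 2 + 1 / 2}"
    proof (rule card_mono)
      show "finite {i. b / 2 - 1 < real i \<and> real i \<le> b / 2 + 1 / 2}"
        by (rule finite_subset[of _ "{..m}"]) (use m b in auto)
      show "?L - ?A \<subseteq> {i. b / 2 - 1 < real i \<and> real i \<le> b / 2 + 1 / 2}"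
      proof
        fix i assume "i \<in> ?L - ?A"
        then have i: "1 \<le> i" "2 * i \<le> m" "i \<notin> ?A" by auto
        then have "\<not> real i + 1 \<le> b / 2" using inA[of i] by blast
        moreover from \<open>2 * i \<le> m\<close> have "real (2 * i) \<le> real m" by (simp only: of_nat_le_iff)
        ultimately show "i \<in> {i. b / 2 - 1 < real i \<and> real i \<le> b / 2 + 1 / 2}" using m by simp
      qed
    qed
    also have "\<dots> \<le> card {nat \<lfloor>b / 2 - 1\<rfloor>..nat \<lfloor>b / 2 - 1\<rfloor> + 2}"
    proof (rule card_mono)
      show "{i. b / 2 - 1 < real i \<and> real i \<le> b / 2 + 1 / 2} \<subseteq> {nat \<lfloor>b / 2 - 1\<rfloor>..nat \<lfloor>b / 2 - 1\<rfloor> + 2}"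
      proof
        fix i :: nat assume "i \<in> {i. b / 2 - 1 < real i \<and> real i \<le> b / 2 + 1 / 2}"
        then have i: "b / 2 - 1 < real i" "real i \<le> b / 2 + 1 / 2" by auto
        have fl: "\<lfloor>b / 2 - 1\<rfloor> \<ge> 0" using b by simp
        have "\<lfloor>b / 2 - 1\<rfloor> \<le> int i" using i by linarith
        moreover have "int i < \<lfloor>b / 2 - 1\<rfloor> + 3" using i by linarith
        ultimately show "i \<in> {nat \<lfloor>b / 2 - 1\<rfloor>..nat \<lfloor>b / 2 - 1\<rfloor> + 2}" using fl by auto
      qed
    qed simp
    finally have c3: "card (?L - ?A) \<le> 3" by simp
    have "0 \<le> (\<Sum>j\<in>?L. hh (real j / real m))" using sum_hh_bounds(1)[of m] m by simp
    also have "\<dots> = (\<Sum>j\<in>?A. hh (real j / real m)) + (\<Sum>j\<in>?L - ?A. hh (real j / real m))"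
      using sum.subset_diff[OF AL fL, of "\<lambda>j. hh (real j / real m)"] by simp
    also have "(\<Sum>j\<in>?L - ?A. hh (real j / real m)) \<le> real (card (?L - ?A))"
      using fL by (intro sum_le_card_ln2) auto
    also have "\<dots> \<le> 3" using c3 by simp
    also have "(\<Sum>j\<in>?A. hh (real j / real m)) \<le> (\<Sum>i\<in>?A. hh (t + real i * a))"
    proof (rule sum_mono, rule hh_mono)
      fix i assume i: "i \<in> ?A"
      show "0 < real i / real m" using i m by simp
      have "real i * (a * b) \<le> real i * (a * real m)" using m a by (intro mult_left_mono) auto
      then have "real i / real m \<le> real i * a" using m ab by (simp add: field_simps)
      then show "real i / real m \<le> t + real i * a" using t by simp
      show "t + real i * a \<le> 1 / 2" using i by simp
    qed
    finally show ?thesis by simp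
  qed
  have upper: "(\<Sum>i\<in>?A. hh (t + real i * a)) \<le> 2 * ln b + 6"
  proof -
    \<comment> \<open>Rounding down and shifting the index by one puts \<open>t + i a\<close> left
      of \<open>(i + 1) / m\<close>. The shift skips the point \<open>1 / m\<close>, where the
      Jordan inequality bounds \<open>- hh\<close> by \<open>ln m\<close>.\<close>
    define m where "m = nat \<lfloor>b\<rfloor>"
    have m: "real m \<le> b" "b < real m + 1" "2 \<le> m" using b unfolding m_def by linarith+
    let ?L = "{j. 1 \<le> j \<and> 2 * j \<le> m}" and ?B = "{i. 1 \<le> i \<and> 2 * (i + 1) \<le> m}"
    have fL: "finite ?L" by (rule finite_subset[of _ "{..m}"]) auto
    have fB: "finite ?B" by (rule finite_subset[of _ "{..m}"]) auto
    have BA: "?B \<subseteq> ?A"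
    proof
      fix i assume "i \<in> ?B"
      then have "real (2 * (i + 1)) \<le> real m" "1 \<le> i" by (simp_all only: of_nat_le_iff) auto
      then show "i \<in> ?A" using m by (intro inA) auto
    qed
    have "?A - ?B \<subseteq> {nat \<lfloor>b / 2 - 3 / 2\<rfloor>..nat \<lfloor>b / 2 - 3 / 2\<rfloor> + 2}"
    proof
      fix i assume i: "i \<in> ?A - ?B"
      then have "i \<ge> 1" "real i \<le> b / 2" using Ab by auto
      have "m < 2 * (i + 1)" using i by auto
      then have "m + 1 \<le> 2 * (i + 1)" by simp
      then have "real (m + 1) \<le> real (2 * (i + 1))" by (simp only: of_nat_le_iff)
      then have "b / 2 - 1 < real i" using m by simp
      then show "i \<in> {nat \<lfloor>b / 2 - 3 / 2\<rfloor>..nat \<lfloor>b / 2 - 3 / 2\<rfloor> + 2}"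
        using \<open>real i \<le> b / 2\<close> \<open>i \<ge> 1\<close> by (auto simp: nat_le_iff) linarith+
    qed
    then have "card (?A - ?B) \<le> card {nat \<lfloor>b / 2 - 3 / 2\<rfloor>..nat \<lfloor>b / 2 - 3 / 2\<rfloor> + 2}"
      by (intro card_mono) auto
    then have c3: "card (?A - ?B) \<le> 3" by simp
    have s1: "(\<Sum>i\<in>?A. hh (t + real i * a)) = (\<Sum>i\<in>?B. hh (t + real i * a)) + (\<Sum>i\<in>?A - ?B. hh (t + real i * a))"
      using sum.subset_diff[OF BA fA, of "\<lambda>i. hh (t + real i * a)"] by simp
    have "(\<Sum>i\<in>?A - ?B. hh (t + real i * a)) \<le> real (card (?A - ?B))"
      using fA by (intro sum_le_card_ln2) auto
    then have s2: "(\<Sum>i\<in>?A - ?B. hh (t + real i * a)) \<le> 3" using c3 by simp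
    have s3: "(\<Sum>i\<in>?B. hh (t + real i * a)) \<le> (\<Sum>i\<in>?B. hh (real (i + 1) / real m))"
    proof (rule sum_mono, rule hh_mono)
      fix i assume i: "i \<in> ?B"
      have i1: "real (2 * (i + 1)) \<le> real m" using i by (simp only: of_nat_le_iff) auto
      show "0 < t + real i * a" using i t a by (intro add_nonneg_pos) auto
      have "real m * a \<le> b * a" using m a by (intro mult_right_mono) auto
      then have "a \<le> 1 / real m" using m ab by (simp add: field_simps)
      then have "(real i + 1) * a \<le> (real i + 1) * (1 / real m)" by (intro mult_left_mono) auto
      then show "t + real i * a \<le> real (i + 1) / real m" using t by (simp add: algebra_simps)
      show "real (i + 1) / real m \<le> 1 / 2" using i1 m by (simp add: field_simps)
    qed
    have s4: "(\<Sum>i\<in>?B. hh (real (i + 1) / real m)) = (\<Sum>j\<in>?L - {1}. hh (real j / real m))"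
      by (rule sum.reindex_bij_witness[of _ "\<lambda>j. j - 1" "\<lambda>i. i + 1"]) auto
    have s5: "(\<Sum>j\<in>?L - {1}. hh (real j / real m)) = (\<Sum>j\<in>?L. hh (real j / real m)) - hh (1 / real m)"
      using fL m by (subst sum_diff1) auto
    have s6: "(\<Sum>j\<in>?L. hh (real j / real m)) \<le> ln (real m) + 1" using sum_hh_bounds(2)[of m] m by simp
    have s7: "- hh (1 / real m) \<le> ln (real m)"
    proof -
      have "pi * (1 / real m) \<le> pi * (1 / 2)"
        using m by (intro mult_left_mono) (auto simp: field_simps)
      then have "(2 / pi) * (pi * (1 / real m)) \<le> sin (pi * (1 / real m))"
        using m by (intro jordan_inequality) auto
      then have "4 / real m \<le> 2 * sin (pi * (1 / real m))" by simp
      moreover have "0 < 4 / real m" using m by simp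
      ultimately have "ln (4 / real m) \<le> hh (1 / real m)" unfolding hh_def
        by (intro ln_mono) auto
      moreover have "ln (4 / real m) = ln 4 - ln (real m)" using m by (simp add: ln_div)
      moreover have "ln (4::real) \<ge> 0" by simp
      ultimately show ?thesis by linarith
    qed
    have "(\<Sum>i\<in>?A. hh (t + real i * a)) \<le> 2 * ln (real m) + 4"
      using s1 s2 s3 s4 s5 s6 s7 by linarith
    also have "ln (real m) \<le> ln b" using m by simp
    finally show ?thesis by simp
  qed
  show ?thesis unfolding lnb using lower upper lnb by (intro abs_leI) linarith+
qed

lemma kap_pos: "0 < kap"
proof -
  have "ln (5 / 4 :: real) / 6 \<le> integral {1 / 2..2 / 3::real} (\<lambda>_. ln (5 / 4))" by simp
  also have "\<dots> \<le> integral {1 / 2..2 / 3} hh"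
  proof (rule integral_le)
    show "hh integrable_on {1 / 2..2 / 3}" by (rule hh_integrable) auto
    fix x :: real assume x: "x \<in> {1 / 2..2 / 3}"
    have "pi * (2 / 3) = pi - pi / 3" by simp
    then have s: "sin (pi * (2 / 3)) = sqrt 3 / 2" by (metis sin_pi_minus sin_60)
    have "(5 / 4 :: real)\<^sup>2 \<le> 3" by (simp add: power2_eq_square)
    then have "5 / 4 \<le> sqrt 3" by (rule real_le_rsqrt)
    then have "ln (5 / 4) \<le> hh (2 / 3)" unfolding hh_def s by simp
    also have "\<dots> \<le> hh x" using x by (intro hh_antimono) auto
    finally show "ln (5 / 4) \<le> hh x" .
  qed (rule integrable_const_ivl)
  finally have 1: "0 < integral {1 / 2..2 / 3} hh"
    by (rule less_le_trans[rotated]) simp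
  have "0 \<le> integral {2 / 3..5 / 6} hh"
  proof (rule integral_nonneg)
    show "hh integrable_on {2 / 3..5 / 6}" by (rule hh_integrable) auto
    fix x :: real assume x: "x \<in> {2 / 3..5 / 6}"
    then show "0 \<le> hh x" using hh_antimono[of x "5 / 6"] hh_56 by auto
  qed
  moreover have "kap = integral {1 / 2..2 / 3} hh + integral {2 / 3..5 / 6} hh"
    unfolding kap_def by (rule Henstock_Kurzweil_Integration.integral_combine[symmetric]) (auto intro!: hh_integrable)
  ultimately show ?thesis using 1 by simp
qed

lemma integral_hh_le: "1 / 2 \<le> u \<Longrightarrow> u \<le> v \<Longrightarrow> v < 1 \<Longrightarrow> integral {u..v} hh \<le> (v - u) * hh u"
  and integral_hh_ge: "1 / 2 \<le> u \<Longrightarrow> u \<le> v \<Longrightarrow> v < 1 \<Longrightarrow> (v - u) * hh v \<le> integral {u..v} hh"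
proof -
  assume uv: "1 / 2 \<le> u" "u \<le> v" "v < 1"
  have i: "hh integrable_on {u..v}" using uv by (intro hh_integrable) auto
  have "integral {u..v} hh \<le> integral {u..v} (\<lambda>_. hh u)"
    using uv by (intro integral_le i hh_antimono) auto
  then show "integral {u..v} hh \<le> (v - u) * hh u" using uv by simp
  have "integral {u..v} (\<lambda>_. hh v) \<le> integral {u..v} hh"
    using uv by (intro integral_le i hh_antimono) auto
  then show "(v - u) * hh v \<le> integral {u..v} hh" using uv by simp
qed

lemma hh_split: "1 / 2 \<le> u \<Longrightarrow> u \<le> v \<Longrightarrow> v \<le> w \<Longrightarrow> w < 1 \<Longrightarrow>
    integral {u..w} hh = integral {u..v} hh + integral {v..w} hh"
  by (rule Henstock_Kurzweil_Integration.integral_combine[symmetric]) (auto intro!: hh_integrable)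

text \<open>Up to 5 / 6 the function is nonnegative and decreasing, so the sum stays below the
  integral. Every later term is nonpositive.\<close>

lemma sum_hh_right_half_upper:
  assumes a: "0 < a" and x: "1 / 2 \<le> x" "x + real k * a < 1"
  shows "(\<Sum>i=1..k. hh (x + real i * a)) \<le> kap / a"
  using x(2)
proof -
  have main: "(\<Sum>i=1..k. hh (x + real i * a)) * a \<le> integral {x..x + real k * a} hh" if "x + real k * a \<le> 5 / 6" for k
    using that
  proof (induction k)
    case (Suc k)
    have le: "x + real k * a \<le> x + real (Suc k) * a" using a by (simp add: algebra_simps)
    have x1: "1 / 2 \<le> x + real k * a" using x(1) a by (simp add: add_increasing2)
    have "hh (x + real (Suc k) * a) * a \<le> integral {x + real k * a..x + real (Suc k) * a} hh"
      using integral_hh_ge[of "x + real k * a" "x + real (Suc k) * a"] x1 a Suc.prems le by (simp add: algebra_simps)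
    moreover have "integral {x..x + real (Suc k) * a} hh = integral {x..x + real k * a} hh + integral {x + real k * a..x + real (Suc k) * a} hh"
      using x(1) a Suc.prems le by (intro hh_split) auto
    moreover have "(\<Sum>i=1..k. hh (x + real i * a)) * a \<le> integral {x..x + real k * a} hh"
      using Suc le by simp
    ultimately show ?case by (simp add: algebra_simps)
  qed simp
  have int_le: "integral {x..v} hh \<le> kap" if "x \<le> v" "v \<le> 5 / 6" for v
  proof -
    have "kap = integral {1 / 2..x} hh + (integral {x..v} hh + integral {v..5 / 6} hh)"
      unfolding kap_def using hh_split[of "1 / 2" x "5 / 6"] hh_split[of x v "5 / 6"] that x(1) by linarith
    moreover have "0 \<le> integral {1 / 2..x} hh"
    proof -
      have "0 \<le> hh x" using hh_antimono[of x "5 / 6"] hh_56 x(1) that by auto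
      then have "0 \<le> (x - 1 / 2) * hh x" using x(1) by (intro mult_nonneg_nonneg) auto
      also have "\<dots> \<le> integral {1 / 2..x} hh" using x(1) that by (intro integral_hh_ge) auto
      finally show ?thesis .
    qed
    moreover have "0 \<le> integral {v..5 / 6} hh"
      using integral_hh_ge[of v "5 / 6"] hh_56 x that by auto
    ultimately show ?thesis by linarith
  qed
  have "(\<Sum>i=1..k. hh (x + real i * a)) * a \<le> kap" if "x + real k * a < 1"
    using that
  proof (induction k)
    case 0
    then show ?case using kap_pos by simp
  next
    case (Suc k)
    have le: "x + real k * a \<le> x + real (Suc k) * a" using a by (simp add: algebra_simps)
    show ?case
    proof (cases "x + real (Suc k) * a \<le> 5 / 6")
      case True
      have "x \<le> x + real (Suc k) * a" using a by simp
      then show ?thesis using main[OF True] int_le[of "x + real (Suc k) * a"] True by linarith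
    next
      case False
      then have "hh (x + real (Suc k) * a) \<le> 0"
        using hh_antimono[of "5 / 6" "x + real (Suc k) * a"] hh_56 Suc.prems by auto
      then have "hh (x + real (Suc k) * a) * a \<le> 0" using a by (simp add: mult_nonpos_nonneg)
      then show ?thesis using Suc le by (simp add: distrib_right)
    qed
  qed
  from this[OF x(2)] show ?thesis using a by (simp add: pos_le_divide_eq)
qed

text \<open>Left endpoints of a decreasing function overestimate the integral. The only loss is the
  gap between 1 / 2 and the first point, of width at most a, where
  \<open>hh \<le> 1\<close>.\<close>

lemma sum_hh_right_half_lower:
  assumes a: "0 < a" and x: "1 / 2 \<le> x" "x \<le> 1 / 2 + a"
    and k: "x + real k * a \<le> 5 / 6" "5 / 6 < x + real (Suc k) * a"
  shows "kap / a - 1 \<le> (\<Sum>i=0..k. hh (x + real i * a))"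
proof -
  have main: "integral {x..x + real j * a} hh \<le> (\<Sum>i<j. hh (x + real i * a)) * a" if "j \<le> k" for j
    using that
  proof (induction j)
    case (Suc j)
    have le: "x + real j * a \<le> x + real (Suc j) * a" using a by (simp add: algebra_simps)
    have "real (Suc j) * a \<le> real k * a" using a Suc.prems by (intro mult_right_mono) auto
    then have l2: "x + real (Suc j) * a < 1" using k by linarith
    have x1: "1 / 2 \<le> x + real j * a" using x(1) a by (simp add: add_increasing2)
    have "integral {x + real j * a..x + real (Suc j) * a} hh \<le> hh (x + real j * a) * a"
      using integral_hh_le[of "x + real j * a" "x + real (Suc j) * a"] x1 a l2 le by (simp add: algebra_simps)
    moreover have "integral {x..x + real (Suc j) * a} hh = integral {x..x + real j * a} hh + integral {x + real j * a..x + real (Suc j) * a} hh"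
      using x(1) a l2 le by (intro hh_split) auto
    ultimately show ?case using Suc by (simp add: algebra_simps)
  qed simp
  let ?y = "x + real k * a"
  have xy: "x \<le> ?y" using a by simp
  have hy: "0 \<le> hh ?y" using hh_antimono[of ?y "5 / 6"] hh_56 k x xy by auto
  have "kap = integral {1 / 2..x} hh + (integral {x..?y} hh + integral {?y..5 / 6} hh)"
    unfolding kap_def using hh_split[of "1 / 2" x "5 / 6"] hh_split[of x ?y "5 / 6"] k x xy by linarith
  also have "integral {1 / 2..x} hh \<le> a"
  proof -
    have x1: "x < 1" using k(1) xy by linarith
    have "integral {1 / 2..x} hh \<le> (x - 1 / 2) * hh (1 / 2)" using x x1 by (intro integral_hh_le) auto
    also have "\<dots> \<le> (x - 1 / 2) * 1" using x ln_2_le_1 by (intro mult_left_mono) (auto simp: hh_def)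
    finally show ?thesis using x by simp
  qed
  also have "integral {x..?y} hh \<le> (\<Sum>i<k. hh (x + real i * a)) * a" by (rule main) simp
  also have "integral {?y..5 / 6} hh \<le> hh ?y * a"
  proof -
    have y1: "1 / 2 \<le> ?y" using x xy by linarith
    have "integral {?y..5 / 6} hh \<le> (5 / 6 - ?y) * hh ?y" using y1 k by (intro integral_hh_le) auto
    also have "\<dots> \<le> a * hh ?y" using k hy by (intro mult_right_mono) (auto simp: algebra_simps)
    finally show ?thesis by (simp add: mult.commute)
  qed
  finally have "kap \<le> a + (\<Sum>i=0..k. hh (x + real i * a)) * a"
    by (simp add: atLeast0AtMost lessThan_Suc_atMost[symmetric] algebra_simps)
  then show ?thesis using a by (simp add: field_simps)
qed

lemma sum_hh_split:
  assumes a: "0 < a" "a \<le> 1 / 2" and t: "0 \<le> t" "t < a" "t + real k * a < 1"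
    and k: "1 / 2 < t + real (Suc k) * a"
  obtains k0 where "k0 \<le> k" "t + real k0 * a \<le> 1 / 2" "1 / 2 < t + real (Suc k0) * a"
    "(\<Sum>i=1..k. hh (t + real i * a)) =
       (\<Sum>i | 1 \<le> i \<and> t + real i * a \<le> 1 / 2. hh (t + real i * a)) + (\<Sum>i=Suc k0..k. hh (t + real i * a))"
proof -
  define k0 where "k0 = (GREATEST i. t + real i * a \<le> 1 / 2)"
  have bnd: "i \<le> k" if "t + real i * a \<le> 1 / 2" for i
  proof (rule ccontr)
    assume "\<not> i \<le> k"
    then have "real (Suc k) * a \<le> real i * a" using a by (intro mult_right_mono) auto
    then show False using that k by linarith
  qed
  have t0: "t + real 0 * a \<le> 1 / 2" using a t by simp
  have P: "t + real k0 * a \<le> 1 / 2"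
    unfolding k0_def by (rule GreatestI_nat[where P = "\<lambda>i. t + real i * a \<le> 1 / 2" and k = 0 and b = k, OF t0 bnd])
  have G: "i \<le> k0" if "t + real i * a \<le> 1 / 2" for i
    unfolding k0_def by (rule Greatest_le_nat[where P = "\<lambda>i. t + real i * a \<le> 1 / 2" and b = k, OF that bnd])
  have N: "1 / 2 < t + real (Suc k0) * a" using G[of "Suc k0"] by force
  have set_eq: "{i. 1 \<le> i \<and> t + real i * a \<le> 1 / 2} = {1..k0}"
  proof (intro equalityI subsetI)
    fix i assume "i \<in> {1..k0}"
    then have "real i * a \<le> real k0 * a" "1 \<le> i" using a by (auto intro!: mult_right_mono)
    then show "i \<in> {i. 1 \<le> i \<and> t + real i * a \<le> 1 / 2}" using P by auto
  qed (use G in auto)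
  have "{1..k} = {1..k0} \<union> {Suc k0..k}" using bnd[OF P] by auto
  then have "(\<Sum>i=1..k. hh (t + real i * a)) = (\<Sum>i=1..k0. hh (t + real i * a)) + (\<Sum>i=Suc k0..k. hh (t + real i * a))"
    by (simp only:) (rule sum.union_disjoint, auto)
  with P N bnd[OF P] show ?thesis unfolding set_eq[symmetric] by (intro that)
qed

lemma sum_hh_shift: "(\<Sum>i=Suc k0..k. hh (t + real i * a)) = (\<Sum>i=0..<k - k0. hh (t + real (Suc k0) * a + real i * a))"
  by (rule sum.reindex_bij_witness[of _ "\<lambda>i. i + Suc k0" "\<lambda>i. i - Suc k0"]) (auto simp: of_nat_diff algebra_simps)

text \<open>If the progression stops before passing 1 / 2, its terms increase. Either the last one
  is nonnegative, and completing the left half adds only nonnegative terms, or all of them are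
  nonpositive.\<close>

lemma sum_hh_upper:
  assumes a: "0 < a" "a \<le> 1 / 2" and t: "0 \<le> t" "t < a" "t + real k * a < 1"
  shows "(\<Sum>i=1..k. hh (t + real i * a)) \<le> kap / a + 2 * ln (1 / a) + 7"
proof (cases "1 / 2 < t + real (Suc k) * a")
  case True
  from sum_hh_split[OF a t True] obtain k0 where k0: "k0 \<le> k" "t + real k0 * a \<le> 1 / 2" "1 / 2 < t + real (Suc k0) * a"
    "(\<Sum>i=1..k. hh (t + real i * a)) =
       (\<Sum>i | 1 \<le> i \<and> t + real i * a \<le> 1 / 2. hh (t + real i * a)) + (\<Sum>i=Suc k0..k. hh (t + real i * a))" .
  have "(\<Sum>i=Suc k0..k. hh (t + real i * a)) \<le> kap / a + 1"
  proof (cases "k = k0")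
    case True
    then show ?thesis using kap_pos a by simp
  next
    case False
    define x where "x = t + real (Suc k0) * a"
    define l where "l = k - k0 - 1"
    have "k - k0 = Suc l" using False k0 by (simp add: l_def)
    then have "(\<Sum>i=Suc k0..k. hh (t + real i * a)) = (\<Sum>i=0..<Suc l. hh (x + real i * a))"
      by (simp add: sum_hh_shift x_def)
    also have "{0..<Suc l} = insert 0 {1..l}" by auto
    also have "(\<Sum>i\<in>insert 0 {1..l}. hh (x + real i * a)) = hh x + (\<Sum>i=1..l. hh (x + real i * a))" by simp
    also have "hh x \<le> 1" using hh_le[of x] ln_2_le_1 by simp
    also have "x + real l * a = t + real k * a"
    proof -
      have "real (Suc k0) + real l = real k" using False k0 by (simp add: l_def)
      then show ?thesis unfolding x_def by (metis add.assoc distrib_right)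
    qed
    then have "(\<Sum>i=1..l. hh (x + real i * a)) \<le> kap / a"
      using k0 t by (intro sum_hh_right_half_upper a) (auto simp: x_def)
    finally show ?thesis by simp
  qed
  then show ?thesis using sum_hh_left_half[OF a t(1,2)] k0(4) by linarith
next
  case False
  let ?A = "{i. 1 \<le> i \<and> t + real i * a \<le> 1 / 2}"
  have sub: "{1..k} \<subseteq> ?A"
  proof
    fix i assume i: "i \<in> {1..k}"
    then have "real i * a \<le> real (Suc k) * a" using a by (intro mult_right_mono) auto
    then show "i \<in> ?A" using False i by auto
  qed
  have fA: "finite ?A"
  proof (rule finite_subset[of _ "{..nat \<lceil>1 / a\<rceil>}"])
    show "?A \<subseteq> {..nat \<lceil>1 / a\<rceil>}"
    proof
      fix i assume "i \<in> ?A"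
      then have "real i * a \<le> 1" using t by simp
      then have "real i \<le> 1 / a" using a by (simp add: pos_le_divide_eq)
      then show "i \<in> {..nat \<lceil>1 / a\<rceil>}" by (simp add: le_nat_iff) linarith
    qed
  qed simp
  have L: "0 \<le> kap / a" "0 \<le> ln (1 / a)" using kap_pos a by simp_all
  have mono: "hh (t + real i * a) \<le> hh (t + real j * a)" if "1 \<le> i" "i \<le> j" "j \<in> ?A" for i j
  proof (rule hh_mono)
    show "0 < t + real i * a" using t a that by (intro add_nonneg_pos) auto
    show "t + real i * a \<le> t + real j * a" using a that by (simp add: mult_right_mono)
  qed (use that in auto)
  show ?thesis
  proof (cases "hh (t + real k * a) \<ge> 0 \<and> k \<ge> 1")
    case True
    have "(\<Sum>i=1..k. hh (t + real i * a)) \<le> (\<Sum>i\<in>?A. hh (t + real i * a))"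
    proof (rule sum_mono2[OF fA sub])
      fix j assume j: "j \<in> ?A - {1..k}"
      then have "k \<le> j" by auto
      then show "0 \<le> hh (t + real j * a)" using mono[of k j] True j by auto
    qed
    then show ?thesis using sum_hh_left_half[OF a t(1,2)] L by linarith
  next
    case neg: False
    have "(\<Sum>i=1..k. hh (t + real i * a)) \<le> 0"
    proof (rule sum_nonpos)
      fix i assume i: "i \<in> {1..k}"
      then have "k \<in> {1..k}" by simp
      then have "k \<ge> 1" "k \<in> ?A" using sub by (simp, blast)
      then show "hh (t + real i * a) \<le> 0" using mono[of i k] i neg by auto
    qed
    then show ?thesis using L by linarith
  qed
qed

text \<open>The progression is stopped at its last point not beyond 5 / 6, after which
  \<open>hh\<close> is negative.\<close>

lemma sum_hh_lower:
  assumes a: "0 < a" "a \<le> 1 / 2" and t: "0 \<le> t" "t < a"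
  obtains k where "t + real k * a < 1" "kap / a - 2 * ln (1 / a) - 7 \<le> (\<Sum>i=1..k. hh (t + real i * a))"
proof -
  define k where "k = nat \<lfloor>(5 / 6 - t) / a\<rfloor>"
  have q: "0 \<le> (5 / 6 - t) / a" using a t by (intro divide_nonneg_pos) auto
  have "real k \<le> (5 / 6 - t) / a" "(5 / 6 - t) / a < real k + 1"
    unfolding k_def using q by linarith+
  then have "real k * a \<le> 5 / 6 - t" "5 / 6 - t < (real k + 1) * a"
    using a by (simp_all add: pos_le_divide_eq pos_divide_less_eq)
  then have k: "t + real k * a \<le> 5 / 6" "5 / 6 < t + real (Suc k) * a" by (simp_all add: add_ac)
  from sum_hh_split[OF a t, of k] k obtain k0 where k0: "k0 \<le> k" "t + real k0 * a \<le> 1 / 2" "1 / 2 < t + real (Suc k0) * a"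
    "(\<Sum>i=1..k. hh (t + real i * a)) =
       (\<Sum>i | 1 \<le> i \<and> t + real i * a \<le> 1 / 2. hh (t + real i * a)) + (\<Sum>i=Suc k0..k. hh (t + real i * a))"
    by auto
  have "kap / a - 1 \<le> (\<Sum>i=Suc k0..k. hh (t + real i * a))"
  proof (cases "k = k0")
    case True
    \<comment> \<open>No point falls between 1 / 2 and 5 / 6, so the step is at least 1 / 3; as
      \<open>kap \<le> 1 / 3\<close>, the lower bound is then nonpositive and the empty sum
      satisfies it.\<close>
    have "kap \<le> integral {1 / 2..5 / 6::real} (\<lambda>_. 1)"
      unfolding kap_def using hh_le ln_2_le_1
      by (intro integral_le hh_integrable integrable_const_ivl) (auto intro: order.trans)
    then have "kap \<le> 1 / 3" by simp
    moreover have "1 / 3 \<le> a" using k(2) k0(2) True by (simp add: algebra_simps)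
    ultimately have "kap / a \<le> 1" using a by simp
    then show ?thesis using True by simp
  next
    case False
    define x where "x = t + real (Suc k0) * a"
    define l where "l = k - k0 - 1"
    have "k - k0 = Suc l" using False k0 by (simp add: l_def)
    then have e: "(\<Sum>i=Suc k0..k. hh (t + real i * a)) = (\<Sum>i=0..l. hh (x + real i * a))"
      by (simp add: sum_hh_shift x_def atLeastLessThanSuc_atLeastAtMost)
    have xl: "x + real l * a = t + real k * a"
    proof -
      have "real (Suc k0) + real l = real k" using False k0 by (simp add: l_def)
      then show ?thesis unfolding x_def by (metis add.assoc distrib_right)
    qed
    moreover have "x + real (Suc l) * a = t + real (Suc k) * a" using xl by (simp add: algebra_simps)
    moreover have "x \<le> 1 / 2 + a" using k0(2) by (simp add: x_def algebra_simps)
    ultimately show ?thesis unfolding e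
      using k0 k by (intro sum_hh_right_half_lower a) (auto simp: x_def)
  qed
  moreover have "t + real k * a < 1" using k by simp
  ultimately show ?thesis using that[of k] sum_hh_left_half[OF a t(1,2)] k0(4) by linarith
qed

text \<open>One step of the continued fraction algorithm, from \<open>p / n\<close> to the fractional part of \<open>n / p\<close>.\<close>

lemma sudler_step:
  fixes p n :: nat
  assumes pn: "coprime p n" "0 < p" "2 * p \<le> n"
  defines "a \<equiv> real p / real n"
  shows sudler_step_upper: "N < n \<Longrightarrow> \<exists>M<p. ln (sudler N a) \<le> ln (sudler M (1 / a)) + kap / a + 4 * ln (1 / a) + 7"
    and sudler_step_lower: "M < p \<Longrightarrow> \<exists>N<n. ln (sudler M (1 / a)) + kap / a - 4 * ln (1 / a) - 7 \<le> ln (sudler N a)"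
proof -
  have a: "0 < a" "a < 1" "a \<le> 1 / 2" using pn by (auto simp: a_def field_simps)
  have split: "sudler (N + k) a = sudler N a * (\<Prod>i=1..k. sn (frac (real N * a) + real i * a))" for N k
  proof -
    have "{1..N + k} = {1..N} \<union> {N + 1..N + k}" by auto
    then have "sudler (N + k) a = sudler N a * (\<Prod>j=N + 1..N + k. sn (real j * a))"
      unfolding sudler_def by (simp only:) (rule prod.union_disjoint, auto)
    also have "(\<Prod>j=N + 1..N + k. sn (real j * a)) = (\<Prod>i=1..k. sn (real (i + N) * a))"
      by (rule prod.reindex_bij_witness[of _ "\<lambda>i. i + N" "\<lambda>j. j - N"]) auto
    also have "\<dots> = (\<Prod>i=1..k. sn (frac (real N * a) + real i * a))"
      by (intro prod.cong refl sn_cong_int) (simp add: frac_def algebra_simps)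
    finally show ?thesis .
  qed
  have bracket: "ln (sudler (N + k) a) = ln (sudler N a) + (\<Sum>i=1..k. hh (frac (real N * a) + real i * a))"
    if "frac (real N * a) < a" "frac (real N * a) + real k * a < 1" "N + k < n" for N k
  proof -
    let ?t = "frac (real N * a)"
    have in01: "0 < ?t + real i * a \<and> ?t + real i * a < 1" if "i \<in> {1..k}" for i
    proof
      show "0 < ?t + real i * a" using a that by (intro add_nonneg_pos) auto
      have "real i * a \<le> real k * a" using a that by (intro mult_right_mono) auto
      then show "?t + real i * a < 1" using \<open>?t + real k * a < 1\<close> by linarith
    qed
    have pos: "sudler (N + k) a > 0" "sudler N a > 0"
      unfolding a_def using pn that by (auto intro!: sudler_pos)
    have nz: "sn (?t + real i * a) \<noteq> 0" if "i \<in> {1..k}" for i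
      using in01[OF that] sn_pos_iff[of "?t + real i * a"] by (auto elim!: Ints_cases)
    have "ln (sudler (N + k) a) = ln (sudler N a) + ln (\<Prod>i=1..k. sn (?t + real i * a))"
      unfolding split using pos nz by (subst ln_mult) (auto simp: prod_pos less_le)
    also have "ln (\<Prod>i=1..k. sn (?t + real i * a)) = (\<Sum>i=1..k. hh (?t + real i * a))"
      using nz in01 by (subst ln_prod) (auto intro!: sum.cong ln_sn_eq)
    finally show ?thesis .
  qed
  have Mlt: "nat \<lfloor>real N * a\<rfloor> < p" if "N < n" for N
  proof -
    have "real N * a < real p" using that pn by (simp add: a_def field_simps)
    then have "\<lfloor>real N * a\<rfloor> < int p" by (simp add: floor_less_iff)
    then show ?thesis using pn by simp
  qed
  have lna: "0 \<le> ln (1 / a)" using a by simp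
  {
    assume N: "N < n"
    \<comment> \<open>The number of steps since the last wrap. Going back by k reaches a position to
      which reciprocity applies, and the factors passed over form a progression below 1.\<close>
    define k where "k = nat \<lfloor>frac (real N * a) / a\<rfloor>"
    have k: "real k * a \<le> frac (real N * a)" "frac (real N * a) < (real k + 1) * a"
    proof -
      have "0 \<le> frac (real N * a) / a" using a by simp
      then have "real k \<le> frac (real N * a) / a" "frac (real N * a) / a < real k + 1"
        unfolding k_def by linarith+
      then show "real k * a \<le> frac (real N * a)" "frac (real N * a) < (real k + 1) * a"
        using a by (simp_all add: pos_le_divide_eq pos_divide_less_eq)
    qed
    have "real k * a \<le> real N * a" using k(1) a frac_def[of "real N * a"] by (smt (verit) floor_mono floor_zero mult_nonneg_nonneg of_int_0_le_iff of_nat_0_le_iff zero_le_floor)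
    then have kN: "k \<le> N" using a by simp
    define N' where "N' = N - k"
    have N': "N = N' + k" using kN by (simp add: N'_def)
    have e: "real N' * a = of_int \<lfloor>real N * a\<rfloor> + (frac (real N * a) - real k * a)"
      unfolding N' frac_def by (simp add: algebra_simps)
    have fl: "\<lfloor>real N' * a\<rfloor> = \<lfloor>real N * a\<rfloor>"
    proof -
      have "0 \<le> real k * a" using a by simp
      then show ?thesis
        unfolding e using k a frac_lt_1[of "real N * a"] by (intro floor_unique) linarith+
    qed
    then have fr: "frac (real N' * a) = frac (real N * a) - real k * a"
      using e by (simp add: frac_def)
    have t: "frac (real N' * a) < a" "frac (real N' * a) + real k * a < 1"
      unfolding fr using k frac_lt_1[of "real N * a"] by (auto simp: algebra_simps)
    let ?M = "nat \<lfloor>real N' * a\<rfloor>"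
    have "ln (sudler N a) = ln (sudler N' a) + (\<Sum>i=1..k. hh (frac (real N' * a) + real i * a))"
      unfolding N' using t N N' by (intro bracket) auto
    also have "(\<Sum>i=1..k. hh (frac (real N' * a) + real i * a)) \<le> kap / a + 2 * ln (1 / a) + 7"
      using t by (intro sum_hh_upper a) auto
    also have "ln (sudler N' a) \<le> ln (sudler ?M (1 / a)) + 2 * ln (1 / a)"
      using sudler_reciprocity[OF pn, of N'] N N' t(1) unfolding a_def by auto
    finally have "ln (sudler N a) \<le> ln (sudler ?M (1 / a)) + kap / a + 4 * ln (1 / a) + 7" by simp
    moreover have "?M < p" using N N' by (intro Mlt) simp
    ultimately show "\<exists>M<p. ln (sudler N a) \<le> ln (sudler M (1 / a)) + kap / a + 4 * ln (1 / a) + 7"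
      by blast
  next
    assume M: "M < p"
    \<comment> \<open>The first position at which \<open>real N * a\<close> reaches M, so that
      reciprocity returns exactly M.\<close>
    define N where "N = nat \<lceil>real M / a\<rceil>"
    have N: "real M / a \<le> real N" "real N < real M / a + 1"
      unfolding N_def using a by (auto simp: le_nat_iff) linarith+
    then have N2: "real M \<le> real N * a" "real N * a < real M + a"
      using a by (simp_all add: field_simps)
    then have fl: "\<lfloor>real N * a\<rfloor> = int M" using a by (intro floor_unique) auto
    have t: "0 \<le> frac (real N * a)" "frac (real N * a) < a" using N2 by (auto simp: frac_def fl)
    from sum_hh_lower[OF a(1,3) t] obtain k where k: "frac (real N * a) + real k * a < 1"
      "kap / a - 2 * ln (1 / a) - 7 \<le> (\<Sum>i=1..k. hh (frac (real N * a) + real i * a))" .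
    have Nk: "N + k < n"
    proof -
      have "frac (real N * a) = real N * a - real M" by (simp add: frac_def fl)
      then have "real (N + k) * a < real M + 1" using k(1) by (simp add: distrib_right)
      also have "real M + 1 \<le> real p" using M by simp
      finally have "real (N + k) * real p < real n * real p"
        using pn by (simp add: a_def field_simps)
      then show ?thesis by (simp add: mult_less_cancel_right)
    qed
    have "ln (sudler (N + k) a) = ln (sudler N a) + (\<Sum>i=1..k. hh (frac (real N * a) + real i * a))"
      using t k Nk by (intro bracket) auto
    moreover have "\<bar>ln (sudler N a) - ln (sudler M (1 / a))\<bar> \<le> 2 * ln (1 / a)"
      using sudler_reciprocity[OF pn, of N] Nk t(2) fl unfolding a_def by auto
    ultimately have "ln (sudler M (1 / a)) + kap / a - 4 * ln (1 / a) - 7 \<le> ln (sudler (N + k) a)"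
      using k(2) by linarith
    then show "\<exists>N<n. ln (sudler M (1 / a)) + kap / a - 4 * ln (1 / a) - 7 \<le> ln (sudler N a)"
      using Nk by blast
  }
qed

section \<open>Bounds along the continued fraction\<close>

text \<open>One step of the algorithm costs \<open>O(1 + ln b)\<close>. The same sum dominates
  \<open>ln n\<close> and so also pays for passing from the largest product to the sum of all
  squares.\<close>

definition cf_err :: "nat list \<Rightarrow> real" where
  "cf_err bs = (\<Sum>b\<leftarrow>bs. 1 + ln (real b))"

lemma cf_err_Cons [simp]: "cf_err (b # bs) = 1 + ln (real b) + cf_err bs"
  and cf_err_Nil [simp]: "cf_err [] = 0"
  by (simp_all add: cf_err_def)

text \<open>The pair \<open>(0, 1)\<close> represents the value of the empty continued fraction. A leading \<open>1\<close> is
  removed by \<open>\<alpha> \<mapsto> 1 - \<alpha>\<close>, which turns \<open>[0; 1, c, \<dots>]\<close> into \<open>[0; c + 1, \<dots>]\<close>.\<close>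

lemma sudler_cf_bounds:
  fixes bs :: "nat list" and p n :: nat
  defines "C \<equiv> 15 + 2 * kap"
  assumes "bs = [] \<or> cf_normal bs" "n > 0" "coprime p n" "cf_value bs = real p / real n"
  shows "(\<forall>N<n. ln (sudler N (real p / real n)) \<le> kap * real (sum_list bs) + C * cf_err bs) \<and>
    (\<exists>N<n. kap * real (sum_list bs) - C * cf_err bs \<le> ln (sudler N (real p / real n))) \<and>
    ln (real n) \<le> cf_err bs"
  using assms(2-)
\<comment> \<open>The induction is on the length: a leading 1 is merged into the next quotient, and
  the list so obtained is not a tail of the given one.\<close>
proof (induction bs arbitrary: p n rule: length_induct)
  case (1 bs)
  have C: "15 \<le> C" using kap_pos by (simp add: C_def)
  show ?case
  proof (cases bs)
    case Nil
    then have "p = 0" "n = 1" using 1 by auto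
    then show ?thesis using Nil by (auto simp: sudler_def)
  next
    case (Cons b cs)
    then have norm: "cf_normal (b # cs)" using 1 by auto
    then have b1: "b \<ge> 1" and cs: "cs = [] \<and> b > 1 \<or> cf_normal cs" using cf_tail by (auto simp: cf_normal_def)
    have val: "0 < cf_value (b # cs)" "cf_value (b # cs) < 1" using cf_value_bounds[OF norm] by auto
    then have "0 < real p / real n" "real p / real n < 1" using 1(5) Cons by (simp_all only:)
    then have pn: "0 < p" "p < n" using 1(3) by (auto simp: zero_less_divide_iff)
    have cv: "0 \<le> cf_value cs" "cf_value cs < 1" using cs cf_value_bounds[of cs] by auto
    have eq: "real n / real p = real b + cf_value cs"
    proof -
      have "1 / (real b + cf_value cs) = real p / real n" using 1(5) Cons by simp
      then have "real b + cf_value cs = 1 / (real p / real n)" using b1 cv by (metis div_by_1 divide_divide_eq_right mult_1)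
      then show ?thesis by simp
    qed
    show ?thesis
    proof (cases "b = 1")
      case False
      define a where "a = real p / real n"
      have b2: "b \<ge> 2" using False b1 by simp
      have cvp: "cf_value cs * real p = real n - real (b * p)" using eq pn by (simp add: field_simps)
      have le: "b * p \<le> n"
      proof -
        have "0 \<le> cf_value cs * real p" using cv by simp
        then show ?thesis unfolding cvp by (simp only: of_nat_le_iff diff_ge_0_iff_ge)
      qed
      define p' where "p' = n - b * p"
      have n: "n = b * p + p'" using le by (simp add: p'_def)
      have cop: "coprime p' p"
      proof -
        have "gcd p n = gcd p p'" unfolding n by (metis gcd_add_mult mult.commute add.commute)
        then show ?thesis using 1(4) by (simp add: coprime_iff_gcd_eq_1 gcd.commute)
      qed
      have cv': "cf_value cs = real p' / real p"
        using cvp pn le by (simp add: p'_def of_nat_diff field_simps)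
      have "length cs < length bs" "cs = [] \<or> cf_normal cs" using Cons cs by auto
      with 1(1) pn cop cv' have IH:
        "\<And>N. N < p \<Longrightarrow> ln (sudler N (real p' / real p)) \<le> kap * real (sum_list cs) + C * cf_err cs"
        "\<exists>N<p. kap * real (sum_list cs) - C * cf_err cs \<le> ln (sudler N (real p' / real p))"
        "ln (real p) \<le> cf_err cs" by blast+
      have ps: "sudler M (1 / a) = sudler M (real p' / real p)" for M
      proof (rule sudler_cong_int)
        have "1 / a - real p' / real p = of_nat b" using eq cv' by (simp add: a_def)
        then show "1 / a - real p' / real p \<in> \<int>" by simp
      qed
      have "2 * p \<le> b * p" using b2 by simp
      then have pn2: "2 * p \<le> n" using le by linarith
      note step = sudler_step_upper[OF 1(4) pn(1) pn2] sudler_step_lower[OF 1(4) pn(1) pn2]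
      have ainv: "1 / a = real b + cf_value cs" using eq by (simp add: a_def)
      have lnb: "0 \<le> ln (real b)" using b1 by simp
      have lna: "ln (1 / a) \<le> ln (real b) + 1"
      proof -
        have "1 / a \<le> 2 * real b" unfolding ainv using cv b1 by simp
        then have "ln (1 / a) \<le> ln (2 * real b)" using ainv cv b1 by (intro ln_mono) auto
        also have "\<dots> = ln 2 + ln (real b)" using b1 by (simp add: ln_mult)
        finally show ?thesis using ln_2_le_1 by linarith
      qed
      have ka: "kap * real b \<le> kap / a" "kap / a \<le> kap * real b + kap"
      proof -
        have "kap / a = kap * real b + kap * cf_value cs"
          using ainv by (metis distrib_left mult.right_neutral times_divide_eq_right)
        moreover have "0 \<le> kap * cf_value cs" "kap * cf_value cs \<le> kap * 1"
          using kap_pos cv by (auto intro!: mult_left_mono)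
        ultimately show "kap * real b \<le> kap / a" "kap / a \<le> kap * real b + kap" by auto
      qed
      \<comment> \<open>\<open>C = 15 + 2 kap\<close> covers the error
        \<open>4 ln (1 / a) + 7\<close> of one step together with the error \<open>kap\<close> of
        replacing \<open>kap / a\<close> by \<open>kap b\<close>.\<close>
      have err: "kap + 4 * ln (1 / a) + 7 \<le> C * (1 + ln (real b))"
      proof -
        have "15 * ln (real b) \<le> C * ln (real b)" using C lnb by (intro mult_right_mono) auto
        moreover have "0 \<le> kap * ln (real b)" using kap_pos lnb by simp
        moreover have "(15 + 2 * kap) * (1 + ln (real b)) = 15 + 15 * ln (real b) + 2 * kap + 2 * (kap * ln (real b))"
          by (simp add: algebra_simps)
        ultimately show ?thesis using lna lnb kap_pos unfolding C_def by linarith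
      qed
      have up: "ln (sudler N (real p / real n)) \<le> kap * real (sum_list bs) + C * cf_err bs" if N: "N < n" for N
      proof -
        from step(1)[OF N] obtain M where "M < p"
          "ln (sudler N a) \<le> ln (sudler M (1 / a)) + kap / a + 4 * ln (1 / a) + 7" unfolding a_def by blast
        with IH(1)[of M] ps[of M] ka err show ?thesis unfolding Cons a_def[symmetric] by (simp add: algebra_simps)
      qed
      moreover have "\<exists>N<n. kap * real (sum_list bs) - C * cf_err bs \<le> ln (sudler N (real p / real n))"
      proof -
        from IH(2) obtain M where M: "M < p" "kap * real (sum_list cs) - C * cf_err cs \<le> ln (sudler M (real p' / real p))" by blast
        from step(2)[OF M(1)] obtain N where N: "N < n"
          "ln (sudler M (1 / a)) + kap / a - 4 * ln (1 / a) - 7 \<le> ln (sudler N a)" unfolding a_def by blast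
        then have "kap * real (sum_list bs) - C * cf_err bs \<le> ln (sudler N a)"
          using M ps[of M] ka err kap_pos unfolding Cons by (simp add: algebra_simps)
        then show ?thesis using N unfolding a_def by blast
      qed
      moreover have "ln (real n) \<le> cf_err bs"
      proof -
        have "real n = (1 / a) * real p" using pn by (simp add: a_def)
        then have "ln (real n) = ln (1 / a) + ln (real p)" using pn a_def by (simp add: ln_mult ln_div)
        then show ?thesis using lna IH(3) unfolding Cons by simp
      qed
      ultimately show ?thesis by blast
    next
      case True
      then have csn: "cf_normal cs" using cs by auto
      then obtain c ds where cd: "cs = c # ds" by (cases cs) (auto simp: cf_normal_def)
      have c1: "c \<ge> 1" and ds: "ds = [] \<or> cf_normal ds" using csn cd cf_tail[of c ds] by (auto simp: cf_normal_def)
      have dv: "0 \<le> cf_value ds" using ds cf_value_bounds[of ds] by auto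
      have norm': "cf_normal (Suc c # ds)" using csn cd ds c1 by (auto simp: cf_normal_def)
      have vv: "cf_value (Suc c # ds) = real (n - p) / real n"
      proof -
        have "real n / real p = 1 + 1 / (real c + cf_value ds)" using eq True cd by simp
        then have "real n * (real c + cf_value ds) = real p * (real c + cf_value ds + 1)"
          using pn c1 dv by (simp add: field_simps)
        then show ?thesis using pn c1 dv by (simp add: of_nat_diff field_simps)
      qed
      have "coprime (n - p) n"
      proof -
        define d where "d = n - p"
        have nd: "n = p + d" using pn by (simp add: d_def)
        have "gcd p d = 1" using 1(4) unfolding nd by (simp add: coprime_iff_gcd_eq_1)
        then have "gcd d (d + p) = 1" by (simp add: gcd.commute)
        then show ?thesis unfolding d_def[symmetric] nd by (simp add: coprime_iff_gcd_eq_1 add.commute)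
      qed
      moreover have "length (Suc c # ds) < length bs" using Cons cd by simp
      ultimately have IH:
        "(\<forall>N<n. ln (sudler N (real (n - p) / real n)) \<le> kap * real (sum_list (Suc c # ds)) + C * cf_err (Suc c # ds)) \<and>
    (\<exists>N<n. kap * real (sum_list (Suc c # ds)) - C * cf_err (Suc c # ds) \<le> ln (sudler N (real (n - p) / real n))) \<and>
    ln (real n) \<le> cf_err (Suc c # ds)"
        using 1(1) norm' vv 1(3) by blast
      have se: "sudler N (real (n - p) / real n) = sudler N (real p / real n)" for N
      proof -
        have "real (n - p) / real n - - (real p / real n) = of_nat 1" using pn by (simp add: of_nat_diff field_simps)
        then have "sudler N (real (n - p) / real n) = sudler N (- (real p / real n))"
          by (intro sudler_cong_int) (simp only: Ints_of_nat)
        then show ?thesis by (simp add: sudler_minus)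
      qed
      have e1: "sum_list (Suc c # ds) = sum_list bs" using Cons cd True by simp
      have e2: "cf_err (Suc c # ds) \<le> cf_err bs"
      proof -
        have "ln (real (Suc c)) \<le> ln (2 * real c)" using c1 by (intro ln_mono) auto
        also have "\<dots> = ln 2 + ln (real c)" using c1 by (simp add: ln_mult)
        finally show ?thesis using ln_2_le_1 Cons cd True by simp
      qed
      then have "C * cf_err (Suc c # ds) \<le> C * cf_err bs" using C by (intro mult_left_mono) auto
      with IH e2 show ?thesis unfolding se e1 by (meson add_left_mono diff_left_mono order.trans)
    qed
  qed
qed

text \<open>The sum lies between its largest term and n times that term, and
  \<open>ln n \<le> cf_err bs\<close>.\<close>

theorem ln_J41_bounds:
  obtains C where "C > 0"
    "\<And>bs p n. cf_normal bs \<Longrightarrow> coprime p n \<Longrightarrow> n > 0 \<Longrightarrow> cf_value bs = real p / real n \<Longrightarrow>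
      \<bar>ln (J41 (ee (cf_value bs))) - 2 * kap * real (sum_list bs)\<bar> \<le> C * cf_err bs"
proof
  show "2 * (15 + 2 * kap) + 1 > 0" using kap_pos by simp
  fix bs :: "nat list" and p n :: nat
  assume bs: "cf_normal bs" "coprime p n" "n > 0" "cf_value bs = real p / real n"
  define a where "a = real p / real n"
  let ?C = "15 + 2 * kap"
  have B: "\<And>N. N < n \<Longrightarrow> ln (sudler N a) \<le> kap * real (sum_list bs) + ?C * cf_err bs"
    "\<exists>N<n. kap * real (sum_list bs) - ?C * cf_err bs \<le> ln (sudler N a)"
    "ln (real n) \<le> cf_err bs"
    using sudler_cf_bounds[of bs n p] bs unfolding a_def by blast+
  have pos: "0 < sudler N a" if "N < n" for N
    unfolding a_def using bs that by (intro sudler_pos)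
  have J: "J41 (ee (cf_value bs)) = (\<Sum>N<n. (sudler N a)\<^sup>2)"
    unfolding bs(4) a_def using bs by (intro J41_eq_sum_sudler)
  define U where "U = exp (2 * (kap * real (sum_list bs) + ?C * cf_err bs))"
  have "(sudler N a)\<^sup>2 \<le> U" if "N < n" for N
  proof -
    have "(sudler N a)\<^sup>2 = exp (2 * ln (sudler N a))"
      using pos[OF that] by (simp only: exp_double exp_ln)
    also have "\<dots> \<le> U" unfolding U_def using B(1)[OF that] by simp
    finally show ?thesis .
  qed
  then have Jle: "J41 (ee (cf_value bs)) \<le> real n * U"
    unfolding J using sum_bounded_above[of "{..<n}" "\<lambda>N. (sudler N a)\<^sup>2" U] by simp
  from B(2) obtain N where N: "N < n" "kap * real (sum_list bs) - ?C * cf_err bs \<le> ln (sudler N a)" by blast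
  have Jge: "(sudler N a)\<^sup>2 \<le> J41 (ee (cf_value bs))"
    unfolding J using N by (intro member_le_sum) auto
  have Npos: "0 < (sudler N a)\<^sup>2" using pos[OF N(1)] by simp
  have "0 < J41 (ee (cf_value bs))" using Jge Npos by linarith
  then have "ln (J41 (ee (cf_value bs))) \<le> ln (real n * U)"
    using Jle by (intro ln_mono)
  also have "\<dots> = ln (real n) + 2 * (kap * real (sum_list bs) + ?C * cf_err bs)"
    using bs by (simp add: U_def ln_mult)
  finally have up: "ln (J41 (ee (cf_value bs))) \<le> 2 * kap * real (sum_list bs) + (2 * ?C + 1) * cf_err bs"
    using B(3) by (simp add: algebra_simps)
  have "2 * ln (sudler N a) = ln ((sudler N a)\<^sup>2)" using pos[OF N(1)] by (simp add: ln_realpow)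
  also have "\<dots> \<le> ln (J41 (ee (cf_value bs)))" using Jge Npos by (intro ln_mono) auto
  finally have "2 * kap * real (sum_list bs) - 2 * ?C * cf_err bs \<le> ln (J41 (ee (cf_value bs)))"
    using N(2) by (simp add: algebra_simps)
  moreover have "0 \<le> ln (real n)" using bs by simp
  then have "0 \<le> cf_err bs" using B(3) by linarith
  ultimately show "\<bar>ln (J41 (ee (cf_value bs))) - 2 * kap * real (sum_list bs)\<bar> \<le> (2 * ?C + 1) * cf_err bs"
    using up by (simp add: algebra_simps abs_le_iff)
qed

section \<open>Statistics of the Euclidean algorithm\<close>

fun euclid_list :: "nat \<Rightarrow> nat \<Rightarrow> nat list" where
  "euclid_list n a = (if a = 0 then [] else n div a # euclid_list a (n mod a))"

declare euclid_list.simps [simp del]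

lemma euclid_list_0 [simp]: "euclid_list n 0 = []"
  by (simp add: euclid_list.simps)

lemma euclid_list_rec: "0 < a \<Longrightarrow> euclid_list n a = n div a # euclid_list a (n mod a)"
  by (simp add: euclid_list.simps)

text \<open>Euclidean steps run backwards: the product of the matrices with rows (b, 1) and (1, 0),
  applied to a column vector.\<close>

fun cf_mat :: "nat list \<Rightarrow> nat \<times> nat \<Rightarrow> nat \<times> nat" where
  "cf_mat [] z = z"
| "cf_mat (b # bs) z = (b * fst (cf_mat bs z) + snd (cf_mat bs z), fst (cf_mat bs z))"

definition pos_list :: "nat list \<Rightarrow> bool" where
  "pos_list bs \<longleftrightarrow> (\<forall>b\<in>set bs. 1 \<le> b)"

lemma pos_list_simps [simp]:
  "pos_list []" "pos_list (b # bs) \<longleftrightarrow> 1 \<le> b \<and> pos_list bs"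
  "pos_list (bs @ cs) \<longleftrightarrow> pos_list bs \<and> pos_list cs" "pos_list (rev bs) \<longleftrightarrow> pos_list bs"
  by (auto simp: pos_list_def)

lemma cf_mat_append: "cf_mat (bs @ cs) z = cf_mat bs (cf_mat cs z)"
  by (induction bs) auto

lemma cf_mat_less:
  assumes "pos_list bs" "snd z < fst z" "1 \<le> snd z"
  shows "1 \<le> snd (cf_mat bs z) \<and> snd (cf_mat bs z) < fst (cf_mat bs z)"
  using assms
proof (induction bs)
  case (Cons b bs)
  then have "1 \<le> snd (cf_mat bs z)" "snd (cf_mat bs z) < fst (cf_mat bs z)" "1 \<le> b" by auto
  moreover from this have "fst (cf_mat bs z) \<le> b * fst (cf_mat bs z)" by simp
  ultimately show ?case unfolding cf_mat.simps fst_conv snd_conv by linarith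
qed auto

lemma euclid_list_cf_mat:
  assumes "pos_list bs" "snd z < fst z" "1 \<le> snd z"
  shows "euclid_list (fst (cf_mat bs z)) (snd (cf_mat bs z)) = bs @ euclid_list (fst z) (snd z)"
  using assms
proof (induction bs)
  case (Cons b bs)
  then have "1 \<le> snd (cf_mat bs z)" "snd (cf_mat bs z) < fst (cf_mat bs z)"
    using cf_mat_less[of bs z] by auto
  then show ?case using Cons by (subst euclid_list_rec) auto
qed auto

lemma cf_mat_inj:
  assumes "cf_mat bs z = cf_mat bs w"
  shows "z = w"
  using assms
proof (induction bs)
  case (Cons b bs)
  from Cons.prems have c: "b * fst (cf_mat bs z) + snd (cf_mat bs z) = b * fst (cf_mat bs w) + snd (cf_mat bs w)
      \<and> fst (cf_mat bs z) = fst (cf_mat bs w)" unfolding cf_mat.simps prod.inject .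
  note f = conjunct2[OF c] and s = conjunct1[OF c]
  from s have "snd (cf_mat bs z) = snd (cf_mat bs w)" unfolding f by simp
  then show ?case using Cons.IH prod_eqI f by blast
qed simp

lemma euclid_list_split:
  assumes "1 \<le> a" "a < n" "i < length (euclid_list n a)"
  shows "\<exists>xs x y. length xs = i \<and> pos_list xs \<and> 1 \<le> y \<and> y < x \<and> cf_mat xs (x, y) = (n, a)"
  using assms
proof (induction i arbitrary: n a)
  case 0
  then show ?case by (intro exI[of _ "[]"] exI[of _ n] exI[of _ a]) simp
next
  case (Suc i)
  have e: "euclid_list n a = n div a # euclid_list a (n mod a)" using Suc.prems by (simp add: euclid_list_rec)
  then have l: "i < length (euclid_list a (n mod a))" using Suc.prems by simp
  then have "1 \<le> n mod a" using e by (cases "n mod a = 0") auto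
  moreover have "n mod a < a" using Suc.prems by simp
  ultimately obtain xs x y where xs: "length xs = i" "pos_list xs" "1 \<le> y" "y < x" "cf_mat xs (x, y) = (a, n mod a)"
    using Suc.IH[OF _ _ l] by metis
  have "1 \<le> n div a" using Suc.prems by (simp add: Suc_le_eq div_greater_zero_iff)
  then have "length (n div a # xs) = Suc i \<and> pos_list (n div a # xs) \<and> 1 \<le> y \<and> y < x
      \<and> cf_mat (n div a # xs) (x, y) = (n, a)" using xs by simp
  then show ?case by blast
qed

lemma cf_mat_snoc: "cf_mat (bs @ [b]) (x, y) = cf_mat bs (b * x + y, x)"
  by (simp add: cf_mat_append)

text \<open>The step matrices are symmetric, so transposing the product reverses the list: the first
  row for the reversed list is the first column for the list. With the earlier quotients fixed, n is
  thus a linear form in the current remainders.\<close>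

lemma fst_cf_mat_rev:
  "fst (cf_mat (rev ys) (x, y)) = fst (cf_mat ys (1, 0)) * x + snd (cf_mat ys (1, 0)) * y"
proof (induction ys arbitrary: x y)
  case (Cons b ys)
  show ?case using Cons[of "b * x + y" x] by (simp add: cf_mat_snoc algebra_simps)
qed simp

text \<open>Continuants: \<open>cU\<close> belongs to the list and, if the list is nonempty,
  \<open>cV\<close> to its tail.\<close>

abbreviation cU :: "nat list \<Rightarrow> nat" where "cU ys \<equiv> fst (cf_mat ys (1, 0))"
abbreviation cV :: "nat list \<Rightarrow> nat" where "cV ys \<equiv> snd (cf_mat ys (1, 0))"

lemma cU_pos: "pos_list ys \<Longrightarrow> 1 \<le> cU ys \<and> cV ys \<le> cU ys"
proof (induction ys)
  case (Cons b ys)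
  then have "cU ys \<le> b * cU ys" by simp
  moreover have "1 \<le> cU ys" using Cons by simp
  ultimately show ?case unfolding cf_mat.simps fst_conv snd_conv by linarith
qed simp

lemma cV_pos: "pos_list ys \<Longrightarrow> ys \<noteq> [] \<Longrightarrow> 1 \<le> cV ys"
  using cU_pos by (cases ys) auto

lemma coprime_cU_cV: "coprime (cU ys) (cV ys)"
proof (induction ys)
  case (Cons b ys)
  have "gcd (b * cU ys + cV ys) (cU ys) = gcd (cV ys) (cU ys)"
    by (metis gcd.commute gcd_add_mult add.commute mult.commute)
  then show ?case using Cons by (simp add: coprime_iff_gcd_eq_1 gcd.commute)
qed simp

lemma length_le_cU: "pos_list ys \<Longrightarrow> length ys \<le> cU ys"
proof (induction ys)
  case (Cons b ys)
  then have c: "cU ys \<le> b * cU ys" "1 \<le> b" by auto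
  show ?case
  proof (cases "ys = []")
    case True
    then show ?thesis using c by simp
  next
    case False
    then have "1 \<le> cV ys" "length ys \<le> cU ys" using cV_pos Cons by auto
    then show ?thesis using c unfolding cf_mat.simps fst_conv list.size by linarith
  qed
qed simp

lemma elem_le_cU: "pos_list ys \<Longrightarrow> b \<in> set ys \<Longrightarrow> b \<le> cU ys"
proof (induction ys)
  case (Cons c ys)
  then have p: "1 \<le> cU ys" using cU_pos by auto
  show ?case
  proof (cases "b = c")
    case True
    then show ?thesis using p by (simp add: trans_le_add1)
  next
    case False
    then have "b \<le> cU ys" using Cons by simp
    also have "\<dots> \<le> c * cU ys" using Cons by simp
    finally show ?thesis by simp
  qed
qed simp

text \<open>The prefixes, stored in reverse, that can occur in the expansion of a pair below N.
  Continuants bound both the entries and the length, hence the set is finite.\<close>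

definition PL :: "nat \<Rightarrow> nat list set" where
  "PL N = {ys. pos_list ys \<and> cU ys \<le> N}"

lemma finite_PL [simp]: "finite (PL N)"
proof (rule finite_subset)
  show "PL N \<subseteq> {ys. set ys \<subseteq> {..N} \<and> length ys \<le> N}"
  proof
    fix ys assume "ys \<in> PL N"
    then have p: "pos_list ys" "cU ys \<le> N" by (auto simp: PL_def)
    have "b \<le> N" if "b \<in> set ys" for b using elem_le_cU[OF p(1) that] p(2) by linarith
    moreover have "length ys \<le> N" using length_le_cU[OF p(1)] p(2) by linarith
    ultimately show "ys \<in> {ys. set ys \<subseteq> {..N} \<and> length ys \<le> N}" by auto
  qed
  show "finite {ys. set ys \<subseteq> {..N} \<and> length ys \<le> N}" by (rule finite_lists_length_le) simp
qed

definition pairs :: "nat \<Rightarrow> (nat \<times> nat) set" where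
  "pairs N = {(n, a). 1 \<le> a \<and> a < n \<and> n \<le> N}"

lemma finite_pairs [simp]: "finite (pairs N)"
  by (rule finite_subset[of _ "{..N} \<times> {..N}"]) (auto simp: pairs_def)

text \<open>The remainders \<open>(x, y)\<close> that, traced back through a prefix with continuants
  u and v, come from a pair whose first component is at most N.\<close>

definition tri :: "nat \<Rightarrow> nat \<Rightarrow> nat \<Rightarrow> (nat \<times> nat) set" where
  "tri N u v = {(x, y). 1 \<le> y \<and> y < x \<and> u * x + v * y \<le> N}"

lemma finite_tri [simp]: "1 \<le> u \<Longrightarrow> finite (tri N u v)"
proof (rule finite_subset[of _ "{..N} \<times> {..N}"])
  assume u: "1 \<le> u"
  show "tri N u v \<subseteq> {..N} \<times> {..N}"
  proof
    fix z assume "z \<in> tri N u v"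
    then obtain x y where z: "z = (x, y)" "y < x" "u * x + v * y \<le> N" by (auto simp: tri_def)
    have "x \<le> u * x" using u by simp
    then have "x \<le> N" "y \<le> N" using z(2,3) by linarith+
    then show "z \<in> {..N} \<times> {..N}" using z by simp
  qed
qed simp

text \<open>A position in the Euclidean expansion of a pair corresponds to the quotients before it
  together with the two current remainders.\<close>

lemma sum_pairs_positions:
  fixes F :: "nat \<Rightarrow> nat list \<Rightarrow> nat \<Rightarrow> real"
  shows "(\<Sum>(n, a)\<in>pairs N. \<Sum>i<length (euclid_list n a). F n (take i (euclid_list n a)) (euclid_list n a ! i))
    = (\<Sum>ys\<in>PL N. \<Sum>(x, y)\<in>tri N (cU ys) (cV ys). F (cU ys * x + cV ys * y) (rev ys) (x div y))"
proof -
  let ?A = "Sigma (pairs N) (\<lambda>(n, a). {..<length (euclid_list n a)})"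
  let ?B = "Sigma (PL N) (\<lambda>ys. tri N (cU ys) (cV ys))"
  let ?g = "\<lambda>(ys, z). (cf_mat (rev ys) z, length ys)"
  have B: "pos_list ys \<and> 1 \<le> y \<and> y < x \<and> fst (cf_mat (rev ys) (x, y)) \<le> N" if "(ys, x, y) \<in> ?B" for ys x y
    using that by (auto simp: PL_def tri_def fst_cf_mat_rev)
  have eu: "euclid_list (fst (cf_mat (rev ys) (x, y))) (snd (cf_mat (rev ys) (x, y))) = rev ys @ euclid_list x y"
    if "(ys, x, y) \<in> ?B" for ys x y
    using euclid_list_cf_mat[of "rev ys" "(x, y)"] B[OF that] by simp
  have bij: "bij_betw ?g ?B ?A"
  proof (rule bij_betw_imageI)
    show "inj_on ?g ?B"
    proof (rule inj_onI)
      fix w w' assume ww: "w \<in> ?B" "w' \<in> ?B" "?g w = ?g w'"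
      obtain ys x y ys' x' y' where w: "w = (ys, x, y)" "w' = (ys', x', y')" by (metis prod.exhaust)
      have m: "(ys, x, y) \<in> ?B" "(ys', x', y') \<in> ?B"
        and e: "cf_mat (rev ys) (x, y) = cf_mat (rev ys') (x', y')" "length ys = length ys'"
        using ww w by auto
      have "rev ys @ euclid_list x y = rev ys' @ euclid_list x' y'"
        using eu[OF m(1)] eu[OF m(2)] e(1) by simp
      then have "rev ys = rev ys'" using e(2) by (metis append_eq_append_conv length_rev)
      then have "ys = ys'" by simp
      moreover have "(x, y) = (x', y')" using cf_mat_inj e(1) \<open>ys = ys'\<close> by blast
      ultimately show "w = w'" using w by simp
    qed
    show "?g ` ?B = ?A"
    proof (intro equalityI subsetI)
      fix w assume "w \<in> ?g ` ?B"
      then obtain ys x y where w: "w = (cf_mat (rev ys) (x, y), length ys)" "(ys, x, y) \<in> ?B" by force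
      have "1 \<le> snd (cf_mat (rev ys) (x, y)) \<and> snd (cf_mat (rev ys) (x, y)) < fst (cf_mat (rev ys) (x, y))"
        using cf_mat_less[of "rev ys" "(x, y)"] B[OF w(2)] by simp
      moreover have "length ys < length (rev ys @ euclid_list x y)" using B[OF w(2)] by (simp add: euclid_list_rec)
      ultimately show "w \<in> ?A"
        using B[OF w(2)] eu[OF w(2)] unfolding w(1) pairs_def by (auto simp: case_prod_beta)
    next
      fix w assume "w \<in> ?A"
      then obtain n a i where w: "w = ((n, a), i)" "1 \<le> a" "a < n" "n \<le> N" "i < length (euclid_list n a)"
        by (auto simp: pairs_def)
      from euclid_list_split[OF w(2,3,5)] obtain xs x y where
        xs: "length xs = i" "pos_list xs" "1 \<le> y" "y < x" "cf_mat xs (x, y) = (n, a)" by blast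
      have n: "n = cU (rev xs) * x + cV (rev xs) * y"
        using fst_cf_mat_rev[of "rev xs" x y] xs(5) by simp
      have "cU (rev xs) \<le> cU (rev xs) * x" using xs by simp
      then have "cU (rev xs) \<le> N" using n w(4) by linarith
      then have "(rev xs, x, y) \<in> ?B" using xs n w by (auto simp: PL_def tri_def)
      moreover have "?g (rev xs, x, y) = w" using xs w by simp
      ultimately show "w \<in> ?g ` ?B" using image_eqI[of w ?g "(rev xs, x, y)" ?B] by simp
    qed
  qed
  let ?F = "\<lambda>((n, a), i). F n (take i (euclid_list n a)) (euclid_list n a ! i)"
  have "(\<Sum>(n, a)\<in>pairs N. \<Sum>i<length (euclid_list n a). F n (take i (euclid_list n a)) (euclid_list n a ! i))
    = sum ?F ?A"
    by (subst sum.Sigma[symmetric]) (auto simp: case_prod_beta)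
  also have "\<dots> = (\<Sum>w\<in>?B. ?F (?g w))"
    by (rule sum.reindex_bij_betw[OF bij, symmetric])
  also have "\<dots> = (\<Sum>(ys, x, y)\<in>?B. F (cU ys * x + cV ys * y) (rev ys) (x div y))"
  proof (intro sum.cong refl)
    fix w assume w: "w \<in> ?B"
    obtain ys x y where ww: "w = (ys, x, y)" by (metis prod.exhaust)
    then have m: "(ys, x, y) \<in> ?B" using w by simp
    have "euclid_list x y = x div y # euclid_list y (x mod y)" using B[OF m] by (simp add: euclid_list_rec)
    then show "?F (?g w) = (case w of (ys, x, y) \<Rightarrow> F (cU ys * x + cV ys * y) (rev ys) (x div y))"
      using eu[OF m] ww by (simp add: case_prod_beta nth_append fst_cf_mat_rev)
  qed
  also have "\<dots> = (\<Sum>ys\<in>PL N. \<Sum>(x, y)\<in>tri N (cU ys) (cV ys). F (cU ys * x + cV ys * y) (rev ys) (x div y))"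
  proof (subst sum.Sigma)
    show "\<forall>ys\<in>PL N. finite (tri N (cU ys) (cV ys))" using cU_pos by (auto simp: PL_def)
  qed (simp_all add: case_prod_beta)
  finally show ?thesis .
qed

definition cop :: "nat \<Rightarrow> (nat \<times> nat) set" where
  "cop N = {(u, v). 1 \<le> v \<and> v < u \<and> u \<le> N \<and> coprime u v}"

lemma cop_subset: "cop N \<subseteq> pairs N"
  by (auto simp: cop_def pairs_def)

lemma finite_cop [simp]: "finite (cop N)"
  by (rule finite_subset[OF cop_subset]) simp

lemma cf_mat_euclid_list:
  "coprime u v \<Longrightarrow> 1 \<le> v \<Longrightarrow> v < u \<Longrightarrow>
    cf_mat (euclid_list u v) (1, 0) = (u, v) \<and> pos_list (euclid_list u v) \<and> euclid_list u v \<noteq> []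
      \<and> 1 < last (euclid_list u v)"
proof (induction v arbitrary: u rule: less_induct)
  case (less v)
  have e: "euclid_list u v = u div v # euclid_list v (u mod v)" using less.prems by (simp add: euclid_list_rec)
  have q: "1 \<le> u div v" using less.prems by (simp add: Suc_le_eq div_greater_zero_iff)
  show ?case
  proof (cases "u mod v = 0")
    case True
    then have "v = 1" using less.prems by (metis coprime_absorb_left coprime_commute mod_0_imp_dvd nat_dvd_1_iff_1 coprime_absorb_right)
    then show ?thesis using e less.prems by simp
  next
    case False
    have "coprime v (u mod v)" using less.prems(1) by (metis coprime_commute coprime_mod_right_iff less.prems(2) not_one_le_zero)
    then have "cf_mat (euclid_list v (u mod v)) (1, 0) = (v, u mod v) \<and> pos_list (euclid_list v (u mod v))
      \<and> euclid_list v (u mod v) \<noteq> [] \<and> 1 < last (euclid_list v (u mod v))"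
      using False less.prems by (intro less.IH) auto
    then show ?thesis using e q by (simp add: mult.commute)
  qed
qed

lemma normal_list_euclid:
  "pos_list ys \<Longrightarrow> ys \<noteq> [] \<Longrightarrow> 1 < last ys \<Longrightarrow>
    cV ys < cU ys \<and> euclid_list (cU ys) (cV ys) = ys"
proof (induction ys)
  case (Cons b ys)
  show ?case
  proof (cases "ys = []")
    case True
    then show ?thesis using Cons by (simp add: euclid_list_rec)
  next
    case False
    then have IH: "cV ys < cU ys" "euclid_list (cU ys) (cV ys) = ys" "1 \<le> cV ys"
      using Cons cV_pos by auto
    have "cU ys \<le> b * cU ys" using Cons by simp
    then have "cU ys < b * cU ys + cV ys" using IH by linarith
    moreover have "(b * cU ys + cV ys) div cU ys = b" "(b * cU ys + cV ys) mod cU ys = cV ys" using IH by auto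
    ultimately show ?thesis using IH by (simp add: euclid_list_rec del: One_nat_def)
  qed
qed simp

definition decr_last :: "nat list \<Rightarrow> nat list" where
  "decr_last xs = butlast xs @ [last xs - 1, 1]"

lemma cf_mat_decr_last:
  assumes "xs \<noteq> []" "1 < last xs"
  shows "cf_mat (decr_last xs) (1, 0) = cf_mat xs (1, 0)"
proof -
  have "xs = butlast xs @ [last xs]" using assms by simp
  then have "cf_mat xs (1, 0) = cf_mat (butlast xs) (last xs, 1)"
    by (metis cf_mat_append cf_mat_snoc mult.right_neutral add.right_neutral)
  moreover have "last xs - 1 + 1 = last xs" using assms by simp
  ultimately show ?thesis by (simp add: decr_last_def cf_mat_append)
qed

text \<open>Every coprime pair has exactly two expansions, one of which ends in \<open>1\<close>.\<close>

lemma sum_PL_eq_sum_cop: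
  fixes G :: "nat list \<Rightarrow> real"
  assumes N: "1 \<le> N"
  shows "(\<Sum>ys\<in>PL N. G ys) = G [] + G [1] +
    (\<Sum>(u, v)\<in>cop N. G (euclid_list u v) + G (decr_last (euclid_list u v)))"
proof -
  let ?E = "\<lambda>(u, v). euclid_list u v" and ?D = "\<lambda>(u, v). decr_last (euclid_list u v)"
  note mat_dec = cf_mat_decr_last
  have cp: "cf_mat (euclid_list u v) (1, 0) = (u, v)" "pos_list (euclid_list u v)" "euclid_list u v \<noteq> []"
      "1 < last (euclid_list u v)" "u \<le> N" if "(u, v) \<in> cop N" for u v
    using that cf_mat_euclid_list[of u v] by (auto simp: cop_def)
  have injE: "inj_on ?E (cop N)"
    by (rule inj_on_inverseI[where g = "\<lambda>xs. cf_mat xs (1, 0)"]) (auto simp: cp simp del: One_nat_def)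
  have injD: "inj_on ?D (cop N)"
    by (rule inj_on_inverseI[where g = "\<lambda>xs. cf_mat xs (1, 0)"]) (auto simp: cp mat_dec simp del: One_nat_def)
  have PL: "PL N = {[], [1]} \<union> (?E ` cop N \<union> ?D ` cop N)"
  proof (intro equalityI subsetI)
    fix ys assume "ys \<in> PL N"
    then have ys: "pos_list ys" "cU ys \<le> N" by (auto simp: PL_def)
    have nor: "xs \<in> ?E ` cop N" if "pos_list xs" "xs \<noteq> []" "1 < last xs" "cU xs \<le> N" for xs
    proof -
      have "(cU xs, cV xs) \<in> cop N"
      proof -
        have "1 \<le> cV xs" "cV xs < cU xs"
          using cV_pos[OF that(1,2)] normal_list_euclid[OF that(1-3)] by blast+
        then show ?thesis using that(4) coprime_cU_cV[of xs] by (simp add: cop_def case_prod_beta del: One_nat_def)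
      qed
      then show ?thesis using normal_list_euclid[OF that(1-3)]
        by (intro image_eqI[of _ _ "(cU xs, cV xs)"]) (simp_all add: case_prod_beta)
    qed
    show "ys \<in> {[], [1]} \<union> (?E ` cop N \<union> ?D ` cop N)"
    proof (cases "ys = [] \<or> 1 < last ys")
      case True
      then show ?thesis using nor[of ys] ys by auto
    next
      case False
      then have ne: "ys \<noteq> []" and "last ys \<le> 1" by auto
      moreover have "1 \<le> last ys" using ys(1) ne by (auto simp: pos_list_def)
      ultimately have l1: "last ys = 1" by simp
      show ?thesis
      proof (cases "butlast ys = []")
        case True
        then have "ys = [1]" using l1 ne by (metis append_butlast_last_id append_Nil)
        then show ?thesis by simp
      next
        case ne2: False
        define zs b where "zs = butlast (butlast ys)" and "b = last (butlast ys)"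
        have eq: "ys = zs @ [b, 1]"
          using l1 ne ne2 append_butlast_last_id[of ys] append_butlast_last_id[of "butlast ys"]
          unfolding zs_def b_def by (metis append.assoc append_Cons append_Nil)
        have p: "pos_list (zs @ [b + 1])" and b: "1 \<le> b" using ys(1) unfolding eq by auto
        have d: "decr_last (zs @ [b + 1]) = ys" by (simp add: decr_last_def eq)
        have "cf_mat (zs @ [b + 1]) (1, 0) = cf_mat ys (1, 0)"
          using mat_dec[of "zs @ [b + 1]"] d b by simp
        then have "zs @ [b + 1] \<in> ?E ` cop N" using nor[of "zs @ [b + 1]"] p b ys(2) by auto
        then have "ys \<in> ?D ` cop N" unfolding d[symmetric] by force
        then show ?thesis by blast
      qed
    qed
  next
    fix ys assume "ys \<in> {[], [1]} \<union> (?E ` cop N \<union> ?D ` cop N)"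
    then consider "ys = []" | "ys = [1]" | u v where "(u, v) \<in> cop N" "ys = euclid_list u v"
      | u v where "(u, v) \<in> cop N" "ys = decr_last (euclid_list u v)" by auto
    then show "ys \<in> PL N"
    proof cases
      case (4 u v)
      have "pos_list (butlast (euclid_list u v))" using cp(2)[OF 4(1)] by (auto simp: pos_list_def dest: in_set_butlastD)
      then have "pos_list ys" using cp(4)[OF 4(1)] 4 by (simp add: decr_last_def)
      then show ?thesis using 4 cp[OF 4(1)] mat_dec[of "euclid_list u v"] by (simp add: PL_def)
    qed (use N cp in \<open>auto simp: PL_def\<close>)
  qed
  have disj1: "?E ` cop N \<inter> ?D ` cop N = {}"
  proof (rule ccontr)
    assume "?E ` cop N \<inter> ?D ` cop N \<noteq> {}"
    then obtain u v u' v' where "(u, v) \<in> cop N" "euclid_list u v = decr_last (euclid_list u' v')" by force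
    then have "last (euclid_list u v) = 1" by (simp add: decr_last_def)
    then show False using cp(4)[OF \<open>(u, v) \<in> cop N\<close>] by simp
  qed
  have disj2: "{[], [1]} \<inter> (?E ` cop N \<union> ?D ` cop N) = {}"
  proof -
    have "x \<notin> {[], [1]}" if "x \<in> ?E ` cop N \<union> ?D ` cop N" for x
    proof -
      from that consider u v where "(u, v) \<in> cop N" "x = euclid_list u v"
        | u v where "x = decr_last (euclid_list u v)" by auto
      then show ?thesis
      proof cases
        case (1 u v)
        then show ?thesis using cp(3,4)[OF 1(1)] by auto
      next
        case 2
        then show ?thesis by (auto simp: decr_last_def dest: arg_cong[of _ _ length])
      qed
    qed
    then show ?thesis by blast
  qed
  have "(\<Sum>ys\<in>PL N. G ys) = (\<Sum>ys\<in>{[], [1]}. G ys) + ((\<Sum>ys\<in>?E ` cop N. G ys) + (\<Sum>ys\<in>?D ` cop N. G ys))"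
    unfolding PL using disj1 disj2 by (subst sum.union_disjoint; simp add: sum.union_disjoint)
  also have "(\<Sum>ys\<in>?E ` cop N. G ys) = (\<Sum>(u, v)\<in>cop N. G (euclid_list u v))"
    by (subst sum.reindex[OF injE]) (simp add: case_prod_beta comp_def)
  also have "(\<Sum>ys\<in>?D ` cop N. G ys) = (\<Sum>(u, v)\<in>cop N. G (decr_last (euclid_list u v)))"
    by (subst sum.reindex[OF injD]) (simp add: case_prod_beta comp_def)
  finally show ?thesis by (simp add: sum.distrib case_prod_beta)
qed

section \<open>Truncated quotient sums and lattice points in triangles\<close>

text \<open>Quotients are truncated because the rare large ones would raise the mean from order
  \<open>ln N ln ln N\<close> to order \<open>(ln N)^2\<close>.\<close>

abbreviation wt :: "nat \<Rightarrow> nat \<Rightarrow> real" where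
  "wt B b \<equiv> real (min b B)"

definition XX :: "nat \<Rightarrow> nat list \<Rightarrow> real" where
  "XX B bs = (\<Sum>b\<leftarrow>bs. wt B b)"

lemma XX_simps [simp]: "XX B [] = 0" "XX B (b # bs) = wt B b + XX B bs" "XX B (bs @ cs) = XX B bs + XX B cs"
    "XX B (rev bs) = XX B bs"
  by (simp_all add: XX_def sum_list_rev flip: rev_map)

lemma XX_nonneg [simp]: "0 \<le> XX B bs"
  by (induction bs) auto

lemma XX_conv_sum: "XX B bs = (\<Sum>i<length bs. wt B (bs ! i))"
  by (simp add: XX_def sum_list_sum_nth atLeast0LessThan)

text \<open>Counting the levels \<open>k \<le> B\<close> that a quotient reaches reduces its sum to
  counting lattice points with \<open>x div y \<ge> k\<close>.\<close>

lemma wt_conv_sum: "wt B b = (\<Sum>k=1..B. if k \<le> b then 1 else 0)"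
proof -
  have "(\<Sum>k=1..B. if k \<le> b then 1 else 0 :: real) = real (card {k \<in> {1..B}. k \<le> b})"
    by (simp add: sum.If_cases Int_def)
  also have "{k \<in> {1..B}. k \<le> b} = {1..min b B}" by auto
  finally show ?thesis by simp
qed

text \<open>Each cross term is charged to its later position, which sees the earlier quotients as
  its prefix; \<open>sum_pairs_positions\<close> requires this shape.\<close>

lemma XX_square: "(XX B bs)\<^sup>2 = (\<Sum>i<length bs. (wt B (bs ! i))\<^sup>2 + 2 * (XX B (take i bs) * wt B (bs ! i)))"
proof (induction bs rule: rev_induct)
  case (snoc b bs)
  have "(\<Sum>i<length bs. (wt B ((bs @ [b]) ! i))\<^sup>2 + 2 * (XX B (take i (bs @ [b])) * wt B ((bs @ [b]) ! i)))
      = (\<Sum>i<length bs. (wt B (bs ! i))\<^sup>2 + 2 * (XX B (take i bs) * wt B (bs ! i)))"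
    by (intro sum.cong refl) (auto simp: nth_append)
  then show ?case using snoc by (simp add: power2_eq_square algebra_simps)
qed simp

definition tri_k :: "nat \<Rightarrow> nat \<Rightarrow> nat \<Rightarrow> nat \<Rightarrow> (nat \<times> nat) set" where
  "tri_k k N u v = {(x, y). 1 \<le> y \<and> y < x \<and> k * y \<le> x \<and> u * x + v * y \<le> N}"

lemma sum_tri_wt:
  assumes "1 \<le> u"
  shows "(\<Sum>(x, y)\<in>tri N u v. wt B (x div y)) = (\<Sum>k=1..B. real (card (tri_k k N u v)))"
proof -
  have "(\<Sum>(x, y)\<in>tri N u v. wt B (x div y)) = (\<Sum>z\<in>tri N u v. \<Sum>k=1..B. if k \<le> fst z div snd z then 1 else 0)"
    by (intro sum.cong refl) (auto simp only: wt_conv_sum fst_conv snd_conv split: prod.splits)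
  also have "\<dots> = (\<Sum>k=1..B. \<Sum>z\<in>tri N u v. if k \<le> fst z div snd z then 1 else 0)"
    by (rule sum.swap)
  also have "\<dots> = (\<Sum>k=1..B. real (card (tri_k k N u v)))"
  proof (intro sum.cong refl)
    fix k
    have "{z \<in> tri N u v. k \<le> fst z div snd z} = tri_k k N u v"
      by (auto simp: tri_def tri_k_def less_eq_div_iff_mult_less_eq mult.commute)
    then show "(\<Sum>z\<in>tri N u v. if k \<le> fst z div snd z then 1 else 0) = real (card (tri_k k N u v))"
      using finite_tri[OF assms, of N v] by (simp add: sum.If_cases Int_def)
  qed
  finally show ?thesis .
qed

lemma card_tri_k_eq:
  assumes u: "1 \<le> u"
  shows "card (tri_k k N u v) = (\<Sum>y=1..N. card {x. y < x \<and> k * y \<le> x \<and> u * x + v * y \<le> N})"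
proof -
  have fin: "finite {x. y < x \<and> k * y \<le> x \<and> u * x + v * y \<le> N}" for y
  proof (rule finite_subset[of _ "{..N}"])
    show "{x. y < x \<and> k * y \<le> x \<and> u * x + v * y \<le> N} \<subseteq> {..N}"
    proof
      fix x assume "x \<in> {x. y < x \<and> k * y \<le> x \<and> u * x + v * y \<le> N}"
      then have "u * x + v * y \<le> N" by simp
      moreover have "x \<le> u * x" using u by simp
      ultimately have "x \<le> N" by linarith
      then show "x \<in> {..N}" by simp
    qed
  qed simp
  have "tri_k k N u v = (\<lambda>(y, x). (x, y)) ` (SIGMA y:{1..N}. {x. y < x \<and> k * y \<le> x \<and> u * x + v * y \<le> N})"
  proof (intro equalityI subsetI)
    fix z assume "z \<in> tri_k k N u v"
    then obtain x y where z: "z = (x, y)" "1 \<le> y" "y < x" "k * y \<le> x" "u * x + v * y \<le> N"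
      by (auto simp: tri_k_def)
    have "x \<le> u * x" using u by simp
    then have "y \<le> N" using z by linarith
    then have "(y, x) \<in> (SIGMA y:{1..N}. {x. y < x \<and> k * y \<le> x \<and> u * x + v * y \<le> N})" using z by simp
    then show "z \<in> (\<lambda>(y, x). (x, y)) ` (SIGMA y:{1..N}. {x. y < x \<and> k * y \<le> x \<and> u * x + v * y \<le> N})"
      using z(1) by force
  qed (auto simp: tri_k_def)
  moreover have "inj_on (\<lambda>(y, x). (x, y)) (SIGMA y:{1..N}. {x. y < x \<and> k * y \<le> x \<and> u * x + v * y \<le> N})"
    by (auto simp: inj_on_def)
  ultimately show ?thesis using fin by (simp add: card_image)
qed

text \<open>The number of lattice points in the triangle cut out by \<open>k y \<le> x\<close> and \<open>u x + v y \<le> N\<close> is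
  compared with its area \<open>N\<^sup>2 / (2 u (k u + v))\<close>.\<close>

lemma sum_linear_upper:
  fixes c r :: real
  assumes "0 < c" "0 \<le> r"
  shows "(\<Sum>y=1..M. max 0 (r - c * real y)) \<le> r\<^sup>2 / (2 * c)"
proof -
  \<comment> \<open>The square left over is subtracted to make the induction telescope.\<close>
  have "(\<Sum>y=1..M. max 0 (r - c * real y)) \<le> r\<^sup>2 / (2 * c) - (max 0 (r - c * real M))\<^sup>2 / (2 * c)"
  proof (induction M)
    case (Suc M)
    let ?p = "max 0 (r - c * real M)" and ?q = "max 0 (r - c * real (Suc M))"
    have "?q * (2 * c) \<le> ?p\<^sup>2 - ?q\<^sup>2"
    proof (cases "r - c * real (Suc M) \<le> 0")
      case True
      then show ?thesis by simp
    next
      case False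
      then have q: "?q = r - c * real (Suc M)" "?q > 0" by auto
      have p: "?p = ?q + c" using q assms by (auto simp: algebra_simps max_def)
      show ?thesis unfolding p by (simp add: power2_eq_square algebra_simps)
    qed
    then have "?q \<le> (?p\<^sup>2 - ?q\<^sup>2) / (2 * c)" using assms by (subst pos_le_divide_eq) auto
    then have "?q \<le> ?p\<^sup>2 / (2 * c) - ?q\<^sup>2 / (2 * c)" by (simp only: diff_divide_distrib)
    moreover have "(\<Sum>y=1..Suc M. max 0 (r - c * real y)) = (\<Sum>y=1..M. max 0 (r - c * real y)) + ?q" by simp
    ultimately show ?case using Suc by linarith
  qed (use assms in simp)
  also have "\<dots> \<le> r\<^sup>2 / (2 * c)" using assms by simp
  finally show ?thesis .
qed

lemma sum_linear_lower:
  fixes c r :: real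
  assumes "0 < c" "0 \<le> r" "r \<le> c * (real M + 1)"
  shows "r\<^sup>2 / (2 * c) - r \<le> (\<Sum>y=1..M. max 0 (r - c * real y))"
proof -
  have "r\<^sup>2 / (2 * c) - (max 0 (r - c * real (M + 1)))\<^sup>2 / (2 * c) \<le> r + (\<Sum>y=1..M. max 0 (r - c * real y))"
  proof (induction M)
    case 0
    have "r\<^sup>2 - (max 0 (r - c))\<^sup>2 \<le> r * (2 * c)"
    proof (cases "r \<le> c")
      case True
      then have "r\<^sup>2 \<le> r * c" using assms by (simp add: power2_eq_square mult_left_mono)
      moreover have "0 \<le> r * c" using assms by simp
      moreover have m: "max 0 (r - c) = 0" using True by simp
      moreover have "r * (2 * c) = 2 * (r * c)" by simp
      ultimately show ?thesis unfolding m by simp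
    next
      case False
      then show ?thesis by (simp add: power2_eq_square algebra_simps max_def)
    qed
    then show ?case using assms by (simp add: field_simps)
  next
    case (Suc M)
    let ?p = "max 0 (r - c * real (M + 1))" and ?q = "max 0 (r - c * real (Suc M + 1))"
    have "?p\<^sup>2 - ?q\<^sup>2 \<le> ?p * (2 * c)"
    proof (cases "r - c * real (Suc M + 1) \<le> 0")
      case True
      then have "?q = 0" "?p \<le> c" using assms by (auto simp: algebra_simps)
      then have "?p * ?p \<le> ?p * c" "0 \<le> ?p * c" using assms by (auto intro: mult_left_mono)
      then show ?thesis using \<open>?q = 0\<close> by (simp add: power2_eq_square)
    next
      case False
      then have q: "?q = r - c * real (Suc M + 1)" "?q > 0" by auto
      have p: "?p = ?q + c" using q assms by (auto simp: algebra_simps max_def)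
      show ?thesis unfolding p using assms by (simp add: power2_eq_square algebra_simps)
    qed
    then have "(?p\<^sup>2 - ?q\<^sup>2) / (2 * c) \<le> ?p" using assms by (subst pos_divide_le_eq) auto
    then have "?p\<^sup>2 / (2 * c) - ?q\<^sup>2 / (2 * c) \<le> ?p" by (simp only: diff_divide_distrib)
    then show ?case using Suc by simp
  qed
  moreover have "max 0 (r - c * real (M + 1)) = 0" using assms by (simp add: max_def add.commute)
  ultimately show ?thesis by simp
qed

lemma card_tri_k_upper:
  assumes u: "1 \<le> u" and k: "1 \<le> k"
  shows "real (card (tri_k k N u v)) \<le> (real N)\<^sup>2 / (2 * real u * real (k * u + v)) + real N / real (k * u + v)"
proof -
  let ?c = "real (k * u + v)" and ?r = "real N"
  have "0 < k * u + v" using u k by (simp add: add_pos_nonneg)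
  then have c: "0 < ?c" by (simp only: of_nat_0_less_iff)
  \<comment> \<open>A row y contains points only if \<open>(k u + v) y \<le> N\<close>, and each
    such row exceeds its length by at most one point.\<close>
  define M where "M = N div (k * u + v)"
  have row: "real (card {x. y < x \<and> k * y \<le> x \<and> u * x + v * y \<le> N}) \<le> (if y \<le> M then max 0 (?r - ?c * real y) / real u + 1 else 0)" for y
  proof (cases "y \<le> M")
    case True
    have cy: "(k * u + v) * y \<le> N"
      using True u k unfolding M_def by (metis div_times_less_eq_dividend dual_order.trans mult.commute mult_le_mono2)
    then have ky: "k * u * y + v * y \<le> N" by (simp add: algebra_simps)
    define t where "t = (N - v * y) div u"
    have sub: "{x. y < x \<and> k * y \<le> x \<and> u * x + v * y \<le> N} \<subseteq> {k * y..t}"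
      using u by (auto simp: t_def less_eq_div_iff_mult_less_eq mult.commute)
    have kt: "k * y \<le> t" using ky u by (simp add: t_def less_eq_div_iff_mult_less_eq mult_ac)
    have "card {x. y < x \<and> k * y \<le> x \<and> u * x + v * y \<le> N} \<le> card {k * y..t}"
      by (rule card_mono[OF _ sub]) simp
    then have "real (card {x. y < x \<and> k * y \<le> x \<and> u * x + v * y \<le> N}) \<le> real (Suc t - k * y)" by simp
    also have "\<dots> = real t + 1 - real k * real y" using kt by (simp add: of_nat_diff)
    also have "real t \<le> (?r - real v * real y) / real u"
      using ky u of_nat_div_le_of_nat[of "N - v * y" u, where ?'a = real] unfolding t_def by (simp add: of_nat_diff)
    finally have "real (card {x. y < x \<and> k * y \<le> x \<and> u * x + v * y \<le> N}) \<le> (?r - ?c * real y) / real u + 1"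
      using u by (simp add: field_simps)
    also have "\<dots> \<le> max 0 (?r - ?c * real y) / real u + 1" by (simp add: divide_right_mono)
    finally show ?thesis using True by simp
  next
    case False
    have "{x. y < x \<and> k * y \<le> x \<and> u * x + v * y \<le> N} = {}"
    proof (rule ccontr)
      assume "{x. y < x \<and> k * y \<le> x \<and> u * x + v * y \<le> N} \<noteq> {}"
      then obtain x where x: "k * y \<le> x" "u * x + v * y \<le> N" by auto
      have "u * (k * y) \<le> u * x" using x by (intro mult_le_mono2)
      then have "u * (k * y) + v * y \<le> N" using x(2) by linarith
      then have "(k * u + v) * y \<le> N" by (simp add: algebra_simps)
      then have "y \<le> M" using u k unfolding M_def by (simp add: less_eq_div_iff_mult_less_eq mult.commute)
      then show False using False by simp
    qed
    then have "card {x. y < x \<and> k * y \<le> x \<and> u * x + v * y \<le> N} = 0" by (simp only: card.empty)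
    then show ?thesis using False by simp
  qed
  have MN: "M \<le> N" unfolding M_def by simp
  have "real (card (tri_k k N u v)) = (\<Sum>y=1..N. real (card {x. y < x \<and> k * y \<le> x \<and> u * x + v * y \<le> N}))"
    unfolding card_tri_k_eq[OF u] by simp
  also have "\<dots> \<le> (\<Sum>y=1..N. if y \<le> M then max 0 (?r - ?c * real y) / real u + 1 else 0)"
    by (intro sum_mono row)
  also have "\<dots> = (\<Sum>y=1..M. max 0 (?r - ?c * real y) / real u + 1)"
    using MN by (intro sum.mono_neutral_cong_right) auto
  also have "\<dots> = (\<Sum>y=1..M. max 0 (?r - ?c * real y)) / real u + real M"
    by (simp add: sum.distrib sum_divide_distrib)
  also have "\<dots> \<le> ?r\<^sup>2 / (2 * ?c) / real u + ?r / ?c"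
    using c sum_linear_upper[of ?c ?r M] of_nat_div_le_of_nat[of N "k * u + v", where ?'a = real] u
    unfolding M_def by (intro add_mono divide_right_mono) auto
  finally show ?thesis by (simp add: field_simps)
qed

lemma card_tri_k_lower:
  assumes u: "1 \<le> u" and k: "2 \<le> k"
  shows "(real N)\<^sup>2 / (2 * real u * real (k * u + v)) - real N / real u \<le> real (card (tri_k k N u v))"
proof -
  let ?c = "real (k * u + v)" and ?r = "real N"
  have "0 < k * u + v" using u k by (simp add: add_pos_nonneg)
  then have c: "0 < ?c" by (simp only: of_nat_0_less_iff)
  have row: "max 0 (?r - ?c * real y) / real u \<le> real (card {x. y < x \<and> k * y \<le> x \<and> u * x + v * y \<le> N})"
    if y: "1 \<le> y" for y
  proof (cases "(k * u + v) * y \<le> N")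
    case True
    then have ky: "k * u * y + v * y \<le> N" by (simp add: algebra_simps)
    define t where "t = (N - v * y) div u"
    \<comment> \<open>For \<open>k \<ge> 2\<close> the condition \<open>y < x\<close> follows from
      \<open>k y \<le> x\<close>, so the row is a full interval. For \<open>k = 1\<close> the point
      \<open>x = y\<close> would be missing.\<close>
    have yk: "y < x" if "k * y \<le> x" for x
    proof -
      have "y < k * y" using k y by simp
      then show ?thesis using that by (rule less_le_trans)
    qed
    then have eq: "{x. y < x \<and> k * y \<le> x \<and> u * x + v * y \<le> N} = {k * y..t}"
      using u ky by (auto simp: t_def less_eq_div_iff_mult_less_eq mult.commute)
    have kt: "k * y \<le> t" using ky u by (simp add: t_def less_eq_div_iff_mult_less_eq mult_ac)
    have "real (N - v * y) < (real t + 1) * real u"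
    proof -
      have "N - v * y < Suc t * u" unfolding t_def using u dividend_less_div_times[of u "N - v * y"] by simp
      then have "real (N - v * y) < real (Suc t * u)" by (simp only: of_nat_less_iff)
      then show ?thesis by (simp add: algebra_simps)
    qed
    then have "(?r - real v * real y) / real u \<le> real t + 1"
      using ky u by (simp add: of_nat_diff divide_le_eq)
    then have "(?r - ?c * real y) / real u \<le> real t + 1 - real k * real y"
      using u by (simp add: field_simps)
    also have "\<dots> = real (card {k * y..t})" using kt by (simp add: of_nat_diff)
    finally show ?thesis unfolding eq by simp
  next
    case False
    then have "real N < real ((k * u + v) * y)" by (simp only: of_nat_less_iff not_le)
    then have "?r - ?c * real y \<le> 0" by (simp only: of_nat_mult)
    then show ?thesis by (simp add: max_def)
  qed
  have "?r \<le> ?c * (real N + 1)"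
  proof -
    have "1 \<le> ?c" using u k by (simp add: Suc_le_eq flip: of_nat_mult of_nat_add)
    then have "1 * ?r \<le> ?c * ?r" by (intro mult_right_mono) auto
    then show ?thesis using c by (simp add: algebra_simps)
  qed
  then have "(?r\<^sup>2 / (2 * ?c) - ?r) / real u \<le> (\<Sum>y=1..N. max 0 (?r - ?c * real y)) / real u"
    using c by (intro divide_right_mono sum_linear_lower) auto
  also have "\<dots> \<le> (\<Sum>y=1..N. real (card {x. y < x \<and> k * y \<le> x \<and> u * x + v * y \<le> N}))"
    unfolding sum_divide_distrib by (intro sum_mono row) auto
  also have "\<dots> = real (card (tri_k k N u v))"
    unfolding card_tri_k_eq[OF u] by simp
  finally show ?thesis by (simp add: diff_divide_distrib field_simps)
qed

lemma sum_inverse_upper: "1 \<le> n \<Longrightarrow> (\<Sum>k=1..n. 1 / real k) \<le> 1 + ln (real n)"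
proof (induction n rule: dec_induct)
  case (step n)
  have "ln (real n / real (Suc n)) \<le> real n / real (Suc n) - 1"
    using step by (intro ln_le_minus_one) auto
  also have "\<dots> = - (1 / real (Suc n))" by (simp add: field_simps)
  finally have "1 / real (Suc n) \<le> ln (real (Suc n)) - ln (real n)" using step by (simp add: ln_div)
  then show ?case using step by simp
qed simp

lemma sum_inverse_lower: "ln (real n + 1) \<le> (\<Sum>k=1..n. 1 / real k)"
proof (induction n)
  case (Suc n)
  have "ln ((real n + 2) / (real n + 1)) \<le> (real n + 2) / (real n + 1) - 1"
    by (intro ln_le_minus_one) auto
  also have "\<dots> = 1 / real (Suc n)" by (simp add: field_simps)
  finally have "ln (real n + 2) - ln (real n + 1) \<le> 1 / real (Suc n)" by (simp add: ln_div)
  then show ?case using Suc by (simp add: add_ac)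
qed simp

lemma sum_tri_wt_upper:
  assumes u: "1 \<le> u" and B: "1 \<le> B"
  shows "(\<Sum>(x, y)\<in>tri N u v. wt B (x div y)) \<le> ((real N)\<^sup>2 / (2 * (real u)\<^sup>2) + real N / real u) * (1 + ln (real B))"
proof -
  have "(\<Sum>(x, y)\<in>tri N u v. wt B (x div y)) \<le> (\<Sum>k=1..B. ((real N)\<^sup>2 / (2 * (real u)\<^sup>2) + real N / real u) * (1 / real k))"
    unfolding sum_tri_wt[OF u]
  proof (rule sum_mono)
    fix k assume k: "k \<in> {1..B}"
    have c: "real k * real u \<le> real (k * u + v)" "0 < real k * real u" using k u by auto
    have "real (card (tri_k k N u v)) \<le> (real N)\<^sup>2 / (2 * real u * real (k * u + v)) + real N / real (k * u + v)"
      using k u by (intro card_tri_k_upper) auto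
    also have "\<dots> \<le> (real N)\<^sup>2 / (2 * real u * (real k * real u)) + real N / (real k * real u)"
      using c u k by (intro add_mono divide_left_mono mult_left_mono mult_pos_pos) (auto intro: add_pos_nonneg)
    also have "\<dots> = ((real N)\<^sup>2 / (2 * (real u)\<^sup>2) + real N / real u) * (1 / real k)"
      by (simp add: power2_eq_square add_divide_distrib mult_ac)
    finally show "real (card (tri_k k N u v)) \<le> ((real N)\<^sup>2 / (2 * (real u)\<^sup>2) + real N / real u) * (1 / real k)" .
  qed
  also have "\<dots> \<le> ((real N)\<^sup>2 / (2 * (real u)\<^sup>2) + real N / real u) * (1 + ln (real B))"
    unfolding sum_distrib_left[symmetric] using sum_inverse_upper[OF B] by (intro mult_left_mono) auto
  finally show ?thesis .
qed

text \<open>Level 1 is discarded and \<open>k u + v \<le> (k + 1) u\<close> is used for the others.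
  This leaves the harmonic sum from 1 / 3 on, which is at least \<open>ln B - 2\<close>.\<close>

lemma sum_tri_wt_lower:
  assumes u: "1 \<le> u" "v \<le> u" and B: "1 \<le> B"
  shows "(real N)\<^sup>2 / (2 * (real u)\<^sup>2) * (ln (real B) - 2) - real B * (real N / real u)
    \<le> (\<Sum>(x, y)\<in>tri N u v. wt B (x div y))"
proof -
  let ?A = "(real N)\<^sup>2 / (2 * (real u)\<^sup>2)"
  have "ln (real B) - 2 \<le> (\<Sum>k=2..B. 1 / real (Suc k))"
  proof -
    have "ln (real B) \<le> ln (real (Suc B) + 1)" using B by (intro ln_mono) auto
    also have "\<dots> \<le> (\<Sum>k=1..Suc B. 1 / real k)" by (rule sum_inverse_lower)
    also have "\<dots> = 1 + (\<Sum>k=Suc 1..Suc B. 1 / real k)" by (subst sum.atLeast_Suc_atMost) auto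
    also have "(\<Sum>k=Suc 1..Suc B. 1 / real k) = (\<Sum>k=1..B. 1 / real (Suc k))" by (rule sum.shift_bounds_cl_Suc_ivl)
    also have "\<dots> = 1 / 2 + (\<Sum>k=Suc 1..B. 1 / real (Suc k))" using B by (subst sum.atLeast_Suc_atMost) auto
    finally show ?thesis by (simp add: numeral_2_eq_2)
  qed
  then have "?A * (ln (real B) - 2) \<le> ?A * (\<Sum>k=2..B. 1 / real (Suc k))" by (intro mult_left_mono) auto
  moreover have "(\<Sum>k=2..B. real N / real u) \<le> real B * (real N / real u)" using u by (auto intro!: mult_right_mono divide_right_mono)
  ultimately have "?A * (ln (real B) - 2) - real B * (real N / real u) \<le> (\<Sum>k=2..B. ?A * (1 / real (Suc k)) - real N / real u)"
    by (simp only: sum_subtractf sum_distrib_left)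
  also have "\<dots> \<le> (\<Sum>k=2..B. real (card (tri_k k N u v)))"
  proof (rule sum_mono)
    fix k assume k: "k \<in> {2..B}"
    have c0: "k * u + v \<le> Suc k * u" "0 < k * u + v" using u k by auto
    then have c: "real (k * u + v) \<le> real (Suc k) * real u" "0 < real (k * u + v)"
      by (metis of_nat_le_iff of_nat_mult, simp only: of_nat_0_less_iff)
    have "?A * (1 / real (Suc k)) - real N / real u = (real N)\<^sup>2 / (2 * real u * (real (Suc k) * real u)) - real N / real u"
      by (simp add: power2_eq_square mult_ac)
    also have "\<dots> \<le> (real N)\<^sup>2 / (2 * real u * real (k * u + v)) - real N / real u"
      using c u by (intro diff_right_mono divide_left_mono mult_left_mono mult_pos_pos) auto
    also have "\<dots> \<le> real (card (tri_k k N u v))"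
      using k u by (intro card_tri_k_lower) auto
    finally show "?A * (1 / real (Suc k)) - real N / real u \<le> real (card (tri_k k N u v))" .
  qed
  also have "\<dots> \<le> (\<Sum>k=1..B. real (card (tri_k k N u v)))"
    by (intro sum_mono2) auto
  finally show ?thesis unfolding sum_tri_wt[OF u(1)] .
qed

lemma cop_cf: 
  assumes "(u, v) \<in> cop N"
  shows "cU (euclid_list u v) = u" "cV (euclid_list u v) = v" "pos_list (euclid_list u v)"
    "cU (decr_last (euclid_list u v)) = u" "euclid_list u v \<noteq> []" "1 < last (euclid_list u v)" "2 \<le> u" "u \<le> N"
  using cf_mat_euclid_list[of u v] cf_mat_decr_last[of "euclid_list u v"] assms by (auto simp: cop_def)

lemma sum_cop_fst:
  fixes g :: "nat \<Rightarrow> real"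
  shows "(\<Sum>(u, v)\<in>cop N. g u) = (\<Sum>u=2..N. real (totient u) * g u)"
proof -
  have t: "totatives u = {v. 1 \<le> v \<and> v < u \<and> coprime u v}" if "2 \<le> u" for u
    using that by (auto simp: totatives_def coprime_commute order_le_less)
  have "cop N = (SIGMA u:{2..N}. totatives u)"
    unfolding cop_def Sigma_def using t by auto
  then have "(\<Sum>(u, v)\<in>cop N. g u) = (\<Sum>u=2..N. \<Sum>v\<in>totatives u. g u)"
    by (simp only:) (subst sum.Sigma; simp)
  then show ?thesis by (simp add: totient_def)
qed

text \<open>Each \<open>u \<ge> 2\<close> is the continuant of two lists for every residue prime to
  u; the lists \<open>[]\<close> and \<open>[1]\<close> account for \<open>u = 1\<close>.\<close>

lemma sum_PL_cU:
  fixes g :: "nat \<Rightarrow> real"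
  assumes "1 \<le> N"
  shows "(\<Sum>ys\<in>PL N. g (cU ys)) = 2 * (\<Sum>u=1..N. real (totient u) * g u)"
proof -
  have "(\<Sum>(u, v)\<in>cop N. g (cU (euclid_list u v)) + g (cU (decr_last (euclid_list u v)))) = (\<Sum>(u, v)\<in>cop N. 2 * g u)"
    by (intro sum.cong refl) (auto simp: cop_cf simp del: One_nat_def)
  also have "\<dots> = (\<Sum>u=2..N. real (totient u) * (2 * g u))" by (rule sum_cop_fst)
  also have "\<dots> = 2 * (\<Sum>u=2..N. real (totient u) * g u)" by (simp add: sum_distrib_left mult_ac)
  finally have 1: "(\<Sum>(u, v)\<in>cop N. g (cU (euclid_list u v)) + g (cU (decr_last (euclid_list u v))))
    = 2 * (\<Sum>u=2..N. real (totient u) * g u)" .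
  have "(\<Sum>u=1..N. real (totient u) * g u) = g 1 + (\<Sum>u=2..N. real (totient u) * g u)"
    using assms by (subst sum.atLeast_Suc_atMost) (auto simp: numeral_2_eq_2)
  then show ?thesis
    using 1 sum_PL_eq_sum_cop[OF assms, of "\<lambda>ys. g (cU ys)"] by simp
qed

section \<open>Totient sums and weighted first moments\<close>

text \<open>It grows like \<open>6 / pi^2 ln R\<close>, by \<open>Zt_lower\<close> and
  \<open>Zt_upper\<close>; every factor \<open>6 / pi^2\<close> in the moments originates
  here.\<close>

definition Zt :: "nat \<Rightarrow> real" where
  "Zt R = (\<Sum>u=1..R. real (totient u) / (real u)\<^sup>2)"

definition zeta2 :: "nat \<Rightarrow> real" where
  "zeta2 K = (\<Sum>d=1..K. 1 / (real d)\<^sup>2)"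

lemma Zt_mono: "R \<le> R' \<Longrightarrow> Zt R \<le> Zt R'"
  unfolding Zt_def by (intro sum_mono2) auto

lemma Zt_nonneg [simp]: "0 \<le> Zt R"
  unfolding Zt_def by (intro sum_nonneg) auto

lemma zeta2_nonneg [simp]: "0 \<le> zeta2 K"
  unfolding zeta2_def by (intro sum_nonneg) auto

lemma zeta2_pos: "1 \<le> K \<Longrightarrow> 1 \<le> zeta2 K"
proof -
  assume "1 \<le> K"
  then have "(\<Sum>d\<in>{1}. 1 / (real d)\<^sup>2) \<le> zeta2 K"
    unfolding zeta2_def by (intro sum_mono2) auto
  then show ?thesis by simp
qed

lemma zeta2_tendsto: "zeta2 \<longlonglongrightarrow> pi\<^sup>2 / 6"
proof -
  have "zeta2 K = (\<Sum>n<K. 1 / real ((n + 1)\<^sup>2))" for K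
    unfolding zeta2_def by (rule sum.reindex_bij_witness[of _ "\<lambda>n. n + 1" "\<lambda>d. d - 1"]) auto
  then have "zeta2 = (\<lambda>K. \<Sum>n<K. 1 / real ((n + 1)\<^sup>2))" by (rule ext)
  moreover have "(\<lambda>n. 1 / real ((n + 1)\<^sup>2)) sums (pi\<^sup>2 / 6)" using inverse_squares_sums by (simp add: add_ac)
  ultimately show ?thesis by (simp only: sums_def)
qed

lemma zeta2_le: "zeta2 K \<le> pi\<^sup>2 / 6"
proof (rule incseq_le[OF _ zeta2_tendsto])
  show "incseq zeta2" unfolding incseq_def zeta2_def by (intro allI impI sum_mono2) auto
qed

text \<open>The totients of the divisors of n add up to n, so \<open>1 / n\<close> is the sum of
  \<open>totient u / n^2\<close> over the divisors u; writing \<open>n = d u\<close> gives the right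
  side. As \<open>Zt\<close> is monotone, the identity yields upper and lower bounds without Moebius
  inversion.\<close>

lemma harmonic_eq_Zt: "(\<Sum>n=1..R. 1 / real n) = (\<Sum>d=1..R. 1 / (real d)\<^sup>2 * Zt (R div d))"
proof -
  have "(\<Sum>n=1..R. 1 / real n) = (\<Sum>n=1..R. \<Sum>u | u dvd n. real (totient u) / (real n)\<^sup>2)"
  proof (intro sum.cong refl)
    fix n assume "n \<in> {1..R}"
    have "(\<Sum>u | u dvd n. real (totient u) / (real n)\<^sup>2) = real (\<Sum>u | u dvd n. totient u) / (real n)\<^sup>2"
      by (simp add: sum_divide_distrib)
    then show "1 / real n = (\<Sum>u | u dvd n. real (totient u) / (real n)\<^sup>2)"
      by (simp add: totient_divisor_sum power2_eq_square)
  qed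
  also have "\<dots> = (\<Sum>(n, u)\<in>(SIGMA n:{1..R}. {u. u dvd n}). real (totient u) / (real n)\<^sup>2)"
    by (rule sum.Sigma) auto
  also have "\<dots> = (\<Sum>(d, u)\<in>(SIGMA d:{1..R}. {1..R div d}). 1 / (real d)\<^sup>2 * (real (totient u) / (real u)\<^sup>2))"
  proof (rule sum.reindex_bij_witness[where i = "\<lambda>(d, u). (d * u, u)" and j = "\<lambda>(n, u). (n div u, u)"])
    fix w assume "w \<in> (SIGMA n:{1..R}. {u. u dvd n})"
    then obtain n u where w: "w = (n, u)" "1 \<le> n" "n \<le> R" "u dvd n" by auto
    obtain d where d: "n = u * d" using w(4) by blast
    then have du: "1 \<le> d" "1 \<le> u" using w(2) by (auto simp: Suc_le_eq)
    have "d \<le> u * d" using du by simp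
    then have "d \<le> R" using w(3) d by linarith
    then have dR: "d \<le> R" "u \<le> R div d" using w(3) d du by (auto simp: less_eq_div_iff_mult_less_eq)
    show "(case case w of (n, u) \<Rightarrow> (n div u, u) of (d, u) \<Rightarrow> (d * u, u)) = w" using w d du by simp
    show "(case w of (n, u) \<Rightarrow> (n div u, u)) \<in> (SIGMA d:{1..R}. {1..R div d})" using w d du dR by simp
    show "(case case w of (n, u) \<Rightarrow> (n div u, u) of (d, u) \<Rightarrow> 1 / (real d)\<^sup>2 * (real (totient u) / (real u)\<^sup>2)) =
         (case w of (n, u) \<Rightarrow> real (totient u) / (real n)\<^sup>2)" using w d du by (simp add: power_mult_distrib mult_ac)
  next
    fix w assume "w \<in> (SIGMA d:{1..R}. {1..R div d})"
    then obtain d u where w: "w = (d, u)" "1 \<le> d" "d \<le> R" "1 \<le> u" "u \<le> R div d" by auto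
    have "d * u \<le> R" using w by (simp add: less_eq_div_iff_mult_less_eq mult.commute)
    moreover have "1 \<le> d * u" using w by simp
    ultimately show "(case w of (d, u) \<Rightarrow> (d * u, u)) \<in> (SIGMA n:{1..R}. {u. u dvd n})" using w by simp
    show "(case case w of (d, u) \<Rightarrow> (d * u, u) of (n, u) \<Rightarrow> (n div u, u)) = w" using w by simp
  qed
  also have "\<dots> = (\<Sum>d=1..R. \<Sum>u=1..R div d. 1 / (real d)\<^sup>2 * (real (totient u) / (real u)\<^sup>2))"
    by (rule sum.Sigma[symmetric]) auto
  finally show ?thesis by (simp add: Zt_def sum_distrib_left)
qed

lemma Zt_lower: "ln (real R + 1) \<le> pi\<^sup>2 / 6 * Zt R"
proof -
  have "ln (real R + 1) \<le> (\<Sum>d=1..R. 1 / (real d)\<^sup>2 * Zt (R div d))"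
    using sum_inverse_lower[of R] harmonic_eq_Zt[of R] by simp
  also have "\<dots> \<le> (\<Sum>d=1..R. 1 / (real d)\<^sup>2 * Zt R)" by (intro sum_mono mult_left_mono Zt_mono) auto
  also have "\<dots> = zeta2 R * Zt R" by (simp add: zeta2_def sum_distrib_right)
  also have "\<dots> \<le> pi\<^sup>2 / 6 * Zt R" by (intro mult_right_mono zeta2_le) simp
  finally show ?thesis .
qed

text \<open>The identity is applied to \<open>R K\<close> in place of R: for
  \<open>d \<le> K\<close> the argument \<open>R K div d\<close> is still at least R, at the price
  of \<open>ln K\<close>. K remains fixed while N grows, and a large K brings \<open>zeta2 K\<close>
  close to \<open>pi^2 / 6\<close>.\<close>

lemma Zt_upper:
  assumes "1 \<le> K" "1 \<le> R"
  shows "zeta2 K * Zt R \<le> 1 + ln (real R) + ln (real K)"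
proof -
  have "zeta2 K * Zt R \<le> (\<Sum>d=1..K. 1 / (real d)\<^sup>2 * Zt (R * K div d))"
    unfolding zeta2_def sum_distrib_right
  proof (intro sum_mono mult_left_mono Zt_mono)
    fix d assume "d \<in> {1..K}"
    then show "R \<le> R * K div d" by (auto simp: less_eq_div_iff_mult_less_eq)
  qed auto
  also have "\<dots> \<le> (\<Sum>d=1..R * K. 1 / (real d)\<^sup>2 * Zt (R * K div d))"
    using assms by (intro sum_mono2) auto
  also have "\<dots> = (\<Sum>n=1..R * K. 1 / real n)" by (rule harmonic_eq_Zt[symmetric])
  also have "\<dots> \<le> 1 + ln (real (R * K))" using assms by (intro sum_inverse_upper) (simp add: Suc_le_eq)
  also have "\<dots> = 1 + ln (real R) + ln (real K)" using assms by (simp add: ln_mult)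
  finally show ?thesis .
qed

lemma euclid_list_mult: "1 \<le> d \<Longrightarrow> euclid_list (d * u) (d * v) = euclid_list u v"
proof (induction v arbitrary: u rule: less_induct)
  case (less v)
  show ?case
  proof (cases "v = 0")
    case False
    then have IH: "euclid_list (d * v) (d * (u mod v)) = euclid_list v (u mod v)"
      using less.IH[of "u mod v" v] less.prems by simp
    have "euclid_list (d * u) (d * v) = d * u div (d * v) # euclid_list (d * v) (d * u mod (d * v))"
      using False less.prems by (intro euclid_list_rec) simp
    also have "d * u mod (d * v) = d * (u mod v)" by (rule mult_mod_right[symmetric])
    also have "d * u div (d * v) = u div v" using less.prems by simp
    finally show ?thesis unfolding IH using False by (simp add: euclid_list_rec[of v u])
  qed simp
qed

text \<open>First moments weighted by \<open>1 / n^2\<close>. The coprime version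
  \<open>Dcop\<close> arises from the prefixes in the second moment; the version over all pairs is
  the one that can be counted.\<close>

definition Dall :: "nat \<Rightarrow> nat \<Rightarrow> real" where
  "Dall B R = (\<Sum>(n, a)\<in>pairs R. XX B (euclid_list n a) / (real n)\<^sup>2)"

definition Dcop :: "nat \<Rightarrow> nat \<Rightarrow> real" where
  "Dcop B R = (\<Sum>(n, a)\<in>cop R. XX B (euclid_list n a) / (real n)\<^sup>2)"

text \<open>The multiples of coprime pairs by \<open>d \<le> K\<close> are distinct pairs below
  \<open>R K\<close>. They have the same expansions, and their weights are divided by
  \<open>d^2\<close>.\<close>

lemma Dcop_le_Dall: "zeta2 K * Dcop B R \<le> Dall B (R * K)"
proof -
  let ?f = "\<lambda>(n, a). XX B (euclid_list n a) / (real n)\<^sup>2"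
  let ?g = "\<lambda>(d, (u, v)). (d * u, d * v)"
  have inj: "inj_on ?g ({1..K} \<times> cop R)"
  proof (rule inj_onI)
    fix w w' assume w: "w \<in> {1..K} \<times> cop R" "w' \<in> {1..K} \<times> cop R" "?g w = ?g w'"
    obtain d u v d' u' v' where e: "w = (d, u, v)" "w' = (d', u', v')" by (metis prod.exhaust)
    have c: "gcd u v = 1" "gcd u' v' = 1" "1 \<le> d" "d * u = d' * u'" "d * v = d' * v'"
      using w e by (auto simp: cop_def)
    have "d * gcd u v = d' * gcd u' v'" unfolding gcd_mult_distrib_nat c(4,5) ..
    then have "d = d'" using c by simp
    then show "w = w'" using e c by simp
  qed
  have sub: "?g ` ({1..K} \<times> cop R) \<subseteq> pairs (R * K)"
  proof
    fix z assume "z \<in> ?g ` ({1..K} \<times> cop R)"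
    then obtain d u v where z: "z = (d * u, d * v)" "1 \<le> d" "d \<le> K" "1 \<le> v" "v < u" "u \<le> R"
      by (auto simp: cop_def)
    then have "d * u \<le> K * R" by (intro mult_le_mono)
    then show "z \<in> pairs (R * K)" using z by (simp add: pairs_def mult.commute)
  qed
  have "zeta2 K * Dcop B R = (\<Sum>d=1..K. \<Sum>z\<in>cop R. ?f (?g (d, z)))"
    unfolding zeta2_def Dcop_def sum_product
    by (intro sum.cong refl) (auto simp: euclid_list_mult power_mult_distrib split: prod.splits)
  also have "\<dots> = (\<Sum>w\<in>{1..K} \<times> cop R. ?f (?g w))"
    by (simp add: sum.cartesian_product case_prod_beta)
  also have "\<dots> = (\<Sum>z\<in>?g ` ({1..K} \<times> cop R). ?f z)"
    by (subst sum.reindex[OF inj]) (simp add: comp_def)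
  also have "\<dots> \<le> Dall B (R * K)"
    unfolding Dall_def using sub by (intro sum_mono2) (auto simp: case_prod_beta)
  finally show ?thesis .
qed

lemma sum_tri_wt_mult:
  assumes "1 \<le> u"
  shows "(\<Sum>(x, y)\<in>tri N u v. wt B (x div y) * h x y) = (\<Sum>k=1..B. \<Sum>(x, y)\<in>tri_k k N u v. h x y)"
proof -
  have "(\<Sum>(x, y)\<in>tri N u v. wt B (x div y) * h x y)
      = (\<Sum>z\<in>tri N u v. \<Sum>k=1..B. if k \<le> fst z div snd z then h (fst z) (snd z) else 0)"
    unfolding wt_conv_sum sum_distrib_right
    by (intro sum.cong refl) (auto simp: case_prod_beta intro!: sum.cong)
  also have "\<dots> = (\<Sum>k=1..B. \<Sum>z\<in>tri N u v. if k \<le> fst z div snd z then h (fst z) (snd z) else 0)"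
    by (rule sum.swap)
  also have "\<dots> = (\<Sum>k=1..B. \<Sum>(x, y)\<in>tri_k k N u v. h x y)"
  proof (rule sum.cong[OF refl])
    fix k
    have e: "{z \<in> tri N u v. k \<le> fst z div snd z} = tri_k k N u v"
      by (auto simp: tri_def tri_k_def less_eq_div_iff_mult_less_eq mult.commute)
    show "(\<Sum>z\<in>tri N u v. if k \<le> fst z div snd z then h (fst z) (snd z) else 0) = (\<Sum>(x, y)\<in>tri_k k N u v. h x y)"
      using finite_tri[OF assms, of N v] e by (simp add: sum.inter_filter[symmetric] case_prod_beta)
  qed
  finally show ?thesis .
qed

text \<open>A telescoping form of the comparison with the integral of \<open>1 / (w + s u)^2\<close>
  over s.\<close>

lemma sum_inverse_square_progression:
  fixes w u :: real
  assumes "0 < w" "0 < u"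
  shows "(\<Sum>j=0..J. 1 / (w + real j * u)\<^sup>2) \<le> 1 / w\<^sup>2 + 1 / (u * w)"
proof -
  have "(\<Sum>j=0..J. 1 / (w + real j * u)\<^sup>2) \<le> 1 / w\<^sup>2 + 1 / (u * w) - 1 / (u * (w + real J * u))"
  proof (induction J)
    case (Suc J)
    let ?a = "w + real J * u" and ?b = "w + real (Suc J) * u"
    have p: "0 < ?a" "?b = ?a + u" using assms by (auto simp: add_pos_nonneg algebra_simps)
    have "1 / (?a + u)\<^sup>2 \<le> 1 / (?a * (?a + u))"
      using p assms by (intro divide_left_mono) (auto simp: power2_eq_square)
    also have "\<dots> = 1 / (u * ?a) - 1 / (u * (?a + u))"
      using p assms by (simp add: divide_simps)
    finally have st: "1 / (?a + u)\<^sup>2 \<le> 1 / (u * ?a) - 1 / (u * (?a + u))" .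
    have "(\<Sum>j=0..Suc J. 1 / (w + real j * u)\<^sup>2) = (\<Sum>j=0..J. 1 / (w + real j * u)\<^sup>2) + 1 / ?b\<^sup>2" by simp
    then show ?case unfolding p(2) using st Suc by linarith
  qed simp
  also have "\<dots> \<le> 1 / w\<^sup>2 + 1 / (u * w)" using assms by simp
  finally show ?thesis .
qed

lemma zeta2_le_3: "zeta2 K \<le> 3"
proof -
  have "pi\<^sup>2 \<le> 4\<^sup>2" using pi_less_4 by (intro power_mono) auto
  then show ?thesis using zeta2_le[of K] by simp
qed

text \<open>In the coordinates y and \<open>j = x - k y\<close> the linear form is
  \<open>(k u + v) y + j u\<close>, a progression in j for each y. The first terms of these
  progressions add up to a part of the series of inverse squares, the remaining ones to a harmonic
  sum.\<close>

lemma sum_tri_k_inverse_square: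
  assumes u: "1 \<le> u" "u \<le> R" and k: "1 \<le> k"
  shows "(\<Sum>(x, y)\<in>tri_k k R u v. 1 / (real (u * x + v * y))\<^sup>2)
    \<le> (1 / (real u)\<^sup>2) * (3 * (1 / (real k)\<^sup>2) + (1 + ln (real R / real u)) * (1 / real k))"
proof -
  define c where "c = k * u + v"
  define M where "M = R div c"
  have "u \<le> k * u" using k by simp
  then have cu: "u \<le> c" "0 < c" "k * u \<le> c" using u unfolding c_def by linarith+
  let ?S = "{1..M} \<times> {0..R}"
  let ?h = "\<lambda>(y, j). 1 / (real (c * y) + real j * real u)\<^sup>2"
  let ?g = "\<lambda>(x, y). (y, x - k * y)"
  have inj: "inj_on ?g (tri_k k R u v)" by (auto simp: inj_on_def tri_k_def)
  have val: "u * x + v * y = c * y + (x - k * y) * u" if "(x, y) \<in> tri_k k R u v" for x y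
  proof -
    have "x = k * y + (x - k * y)" using that by (simp add: tri_k_def)
    then have "u * x = u * (k * y + (x - k * y))" by simp
    then show ?thesis by (simp add: c_def algebra_simps)
  qed
  have sub: "?g ` tri_k k R u v \<subseteq> ?S"
  proof
    fix z assume "z \<in> ?g ` tri_k k R u v"
    then obtain x y where z: "z = (y, x - k * y)" and m: "(x, y) \<in> tri_k k R u v" by auto
    have xy: "1 \<le> y" "u * x + v * y \<le> R" using m by (auto simp: tri_k_def)
    have "c * y \<le> R" using val[OF m] xy by linarith
    then have "y \<le> M" using cu by (simp add: M_def less_eq_div_iff_mult_less_eq mult.commute)
    moreover have "x \<le> u * x" using u by simp
    then have "x \<le> R" using xy by linarith
    then have "x - k * y \<le> R" by simp
    ultimately show "z \<in> ?S" using z xy by simp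
  qed
  have "(\<Sum>(x, y)\<in>tri_k k R u v. 1 / (real (u * x + v * y))\<^sup>2) = (\<Sum>z\<in>tri_k k R u v. ?h (?g z))"
  proof (intro sum.cong refl)
    fix z assume z: "z \<in> tri_k k R u v"
    obtain x y where zz: "z = (x, y)" by (cases z)
    show "(case z of (x, y) \<Rightarrow> 1 / (real (u * x + v * y))\<^sup>2) = ?h (?g z)"
    proof -
      have "real (u * x + v * y) = real (c * y) + real (x - k * y) * real u"
        using val[of x y] z zz by (metis of_nat_add of_nat_mult)
      then show ?thesis unfolding zz by (simp only: split_conv)
    qed
  qed
  also have "\<dots> = (\<Sum>z\<in>?g ` tri_k k R u v. ?h z)"
    by (subst sum.reindex[OF inj]) (simp add: comp_def)
  also have "\<dots> \<le> (\<Sum>z\<in>?S. ?h z)" using sub by (intro sum_mono2) auto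
  also have "\<dots> = (\<Sum>y=1..M. \<Sum>j=0..R. 1 / (real (c * y) + real j * real u)\<^sup>2)"
    by (simp add: sum.cartesian_product case_prod_beta)
  also have "\<dots> \<le> (\<Sum>y=1..M. 1 / (real (c * y))\<^sup>2 + 1 / (real u * real (c * y)))"
    using cu u by (intro sum_mono sum_inverse_square_progression) auto
  also have "\<dots> = (1 / (real c)\<^sup>2) * zeta2 M + (1 / (real u * real c)) * (\<Sum>y=1..M. 1 / real y)"
    by (simp add: sum.distrib zeta2_def sum_distrib_left power_mult_distrib mult_ac)
  also have "\<dots> \<le> (1 / (real k * real u)\<^sup>2) * 3 + (1 / (real u * (real k * real u))) * (1 + ln (real R / real u))"
  proof (intro add_mono mult_mono)
    have kc: "real k * real u \<le> real c" "0 < real k * real u" using cu(3) u k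
      by (simp_all flip: of_nat_mult)
    then have "(real k * real u)\<^sup>2 \<le> (real c)\<^sup>2" by (intro power_mono) auto
    then show "1 / (real c)\<^sup>2 \<le> 1 / (real k * real u)\<^sup>2"
      using kc(2) by (intro frac_le zero_less_power) auto
    show "1 / (real u * real c) \<le> 1 / (real u * (real k * real u))"
      by (intro frac_le mult_left_mono mult_pos_pos) (use kc u k in auto)
    show "(\<Sum>y=1..M. 1 / real y) \<le> 1 + ln (real R / real u)"
    proof (cases "M = 0")
      case True
      then show ?thesis using u by (simp add: ln_div)
    next
      case False
      have "real M \<le> real R / real c" unfolding M_def by (rule of_nat_div_le_of_nat)
      also have "\<dots> \<le> real R / real u" using cu u by (intro divide_left_mono) auto
      finally have "ln (real M) \<le> ln (real R / real u)" using False by (intro ln_mono) auto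
      moreover have "(\<Sum>y=1..M. 1 / real y) \<le> 1 + ln (real M)" using False by (intro sum_inverse_upper) simp
      ultimately show ?thesis by linarith
    qed
  qed (use zeta2_le_3 u in \<open>auto intro!: sum_nonneg\<close>)
  also have "\<dots> = (1 / (real u)\<^sup>2) * (3 * (1 / (real k)\<^sup>2) + (1 + ln (real R / real u)) * (1 / real k))"
    using u k by (simp add: power2_eq_square distrib_left add_divide_distrib mult_ac)
  finally show ?thesis .
qed

lemma sum_pairs_wt:
  fixes g :: "nat \<Rightarrow> real"
  shows "(\<Sum>(n, a)\<in>pairs N. XX B (euclid_list n a) * g n)
    = (\<Sum>ys\<in>PL N. \<Sum>(x, y)\<in>tri N (cU ys) (cV ys). wt B (x div y) * g (cU ys * x + cV ys * y))"
  using sum_pairs_positions[of "\<lambda>n xs b. wt B b * g n" N]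
  by (simp add: XX_conv_sum sum_distrib_right)

text \<open>Carries the leading order of \<open>Dall\<close>; by \<open>Wt_upper\<close> it is at
  most about \<open>3 / pi^2 (ln R)^2\<close>.\<close>

definition Wt :: "nat \<Rightarrow> real" where
  "Wt R = (\<Sum>u=1..R. real (totient u) / (real u)\<^sup>2 * ln (real R / real u))"

lemma Dall_upper:
  assumes R: "1 \<le> R" and B: "1 \<le> B"
  shows "Dall B R \<le> 2 * (10 + ln (real B)) * Zt R + 2 * (1 + ln (real B)) * Wt R"
proof -
  have lnB: "0 \<le> ln (real B)" using B by simp
  have "Dall B R = (\<Sum>(n, a)\<in>pairs R. XX B (euclid_list n a) * (1 / (real n)\<^sup>2))"
    by (simp add: Dall_def)
  also have "\<dots> = (\<Sum>ys\<in>PL R. \<Sum>(x, y)\<in>tri R (cU ys) (cV ys). wt B (x div y) * (1 / (real (cU ys * x + cV ys * y))\<^sup>2))"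
    by (rule sum_pairs_wt)
  also have "\<dots> \<le> (\<Sum>ys\<in>PL R. (1 / (real (cU ys))\<^sup>2) * (9 + (1 + ln (real B)) * (1 + ln (real R / real (cU ys)))))"
  proof (rule sum_mono)
    fix ys assume "ys \<in> PL R"
    then have u: "1 \<le> cU ys" "cU ys \<le> R" using cU_pos by (auto simp: PL_def simp del: One_nat_def)
    let ?u = "cU ys"
    have L: "0 \<le> ln (real R / real ?u)" using u by simp
    have "(\<Sum>(x, y)\<in>tri R ?u (cV ys). wt B (x div y) * (1 / (real (?u * x + cV ys * y))\<^sup>2))
      = (\<Sum>k=1..B. \<Sum>(x, y)\<in>tri_k k R ?u (cV ys). 1 / (real (?u * x + cV ys * y))\<^sup>2)"
      by (rule sum_tri_wt_mult[OF u(1)])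
    also have "\<dots> \<le> (\<Sum>k=1..B. (1 / (real ?u)\<^sup>2) * (3 * (1 / (real k)\<^sup>2) + (1 + ln (real R / real ?u)) * (1 / real k)))"
      using u by (intro sum_mono sum_tri_k_inverse_square) auto
    also have "\<dots> = (1 / (real ?u)\<^sup>2) * (3 * zeta2 B + (1 + ln (real R / real ?u)) * (\<Sum>k=1..B. 1 / real k))"
      by (simp only: zeta2_def sum_distrib_left[symmetric] sum.distrib)
    also have "\<dots> \<le> (1 / (real ?u)\<^sup>2) * (3 * 3 + (1 + ln (real R / real ?u)) * (1 + ln (real B)))"
      using L zeta2_le_3[of B] sum_inverse_upper[OF B] by (intro mult_left_mono add_mono) auto
    finally show "(\<Sum>(x, y)\<in>tri R ?u (cV ys). wt B (x div y) * (1 / (real (?u * x + cV ys * y))\<^sup>2))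
      \<le> (1 / (real ?u)\<^sup>2) * (9 + (1 + ln (real B)) * (1 + ln (real R / real ?u)))" by (simp add: mult.commute)
  qed
  also have "\<dots> = 2 * (\<Sum>u=1..R. real (totient u) * ((1 / (real u)\<^sup>2) * (9 + (1 + ln (real B)) * (1 + ln (real R / real u)))))"
    by (rule sum_PL_cU[OF R])
  also have "\<dots> = 2 * (\<Sum>u=1..R. (10 + ln (real B)) * (real (totient u) / (real u)\<^sup>2) + (1 + ln (real B)) * (real (totient u) / (real u)\<^sup>2 * ln (real R / real u)))"
    by (intro arg_cong2[of _ _ _ _ "(*)"] refl sum.cong) (simp add: algebra_simps add_divide_distrib)
  also have "\<dots> = 2 * ((10 + ln (real B)) * Zt R + (1 + ln (real B)) * Wt R)"
    unfolding Zt_def Wt_def by (simp only: sum.distrib sum_distrib_left)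
  finally show ?thesis by (simp add: algebra_simps)
qed

text \<open>The term \<open>1 - 1 / R\<close> absorbs the errors \<open>1 / (R (R + 1))\<close> of
  the induction steps.\<close>

lemma sum_ln_over: "1 \<le> R \<Longrightarrow> (\<Sum>j=1..R. ln (real j) / real j) \<le> (ln (real R))\<^sup>2 / 2 + 1 - 1 / real R"
proof (induction R rule: dec_induct)
  case (step R)
  let ?a = "ln (real R)" and ?b = "ln (real (Suc R))"
  have R: "0 < real R" using step by simp
  have d1: "1 / real (Suc R) \<le> ?b - ?a"
  proof -
    have "ln (real R / real (Suc R)) \<le> real R / real (Suc R) - 1" using R by (intro ln_le_minus_one) auto
    also have "\<dots> = - (1 / real (Suc R))" by (simp add: field_simps)
    finally show ?thesis using R by (simp add: ln_div)
  qed
  have d2: "?b - ?a \<le> 1 / real R"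
  proof -
    have "ln (real (Suc R) / real R) \<le> real (Suc R) / real R - 1" using R by (intro ln_le_minus_one) auto
    also have "\<dots> = 1 / real R" using R by (simp add: field_simps)
    finally show ?thesis using R by (simp add: ln_div)
  qed
  have a: "0 \<le> ?a" using step by simp
  have "?b / real (Suc R) = ?a * (1 / real (Suc R)) + (?b - ?a) * (1 / real (Suc R))"
    by (simp only: distrib_right[symmetric]) simp
  also have "\<dots> \<le> ?a * (?b - ?a) + (1 / real R) * (1 / real (Suc R))"
    using a d1 d2 by (intro add_mono mult_left_mono mult_right_mono) auto
  also have "?a * (?b - ?a) \<le> ?b\<^sup>2 / 2 - ?a\<^sup>2 / 2"
    using sum_squares_ge_zero[of "?b - ?a" 0] by (simp add: power2_eq_square algebra_simps)
  also have "(1 / real R) * (1 / real (Suc R)) = 1 / real R - 1 / real (Suc R)"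
    using R by (simp add: field_simps)
  finally show ?case using step by simp
qed simp

text \<open>Abel summation: \<open>ln (R / u)\<close> is at most the sum of \<open>1 / j\<close>
  over \<open>u \<le> j < R\<close>, and exchanging the sums leaves \<open>Zt j / j\<close>, to
  which \<open>Zt_upper\<close> applies.\<close>

lemma Wt_upper:
  assumes K: "1 \<le> K" and R: "1 \<le> R"
  shows "zeta2 K * Wt R \<le> (1 + ln (real K)) * (1 + ln (real R)) + (ln (real R))\<^sup>2 / 2 + 1"
proof -
  have lnK: "0 \<le> ln (real K)" using K by simp
  have z: "0 \<le> zeta2 K" using zeta2_pos[OF K] by simp
  have ln_le: "ln (real R / real u) \<le> (\<Sum>j=u..<R. 1 / real j)" if u: "1 \<le> u" "u \<le> R" for u
    using u(2)
  proof (induction R rule: dec_induct)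
    case (step m)
    have m: "0 < real m" using step u by simp
    have "ln (real (Suc m) / real m) \<le> real (Suc m) / real m - 1" using m by (intro ln_le_minus_one) auto
    also have "\<dots> = 1 / real m" using m by (simp add: field_simps)
    finally have "ln (real (Suc m)) - ln (real m) \<le> 1 / real m" using m by (simp add: ln_div)
    then show ?case using step u m by (simp add: ln_div)
  qed (use u in simp)
  have "Wt R \<le> (\<Sum>u=1..R. real (totient u) / (real u)\<^sup>2 * (\<Sum>j=u..<R. 1 / real j))"
    unfolding Wt_def using ln_le by (intro sum_mono mult_left_mono) auto
  also have "\<dots> = (\<Sum>u=1..R. \<Sum>j=1..<R. if u \<le> j then real (totient u) / (real u)\<^sup>2 * (1 / real j) else 0)"
  proof (intro sum.cong refl)
    fix u assume u: "u \<in> {1..R}"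
    have "{j \<in> {1..<R}. u \<le> j} = {u..<R}" using u by auto
    then show "real (totient u) / (real u)\<^sup>2 * (\<Sum>j=u..<R. 1 / real j)
       = (\<Sum>j=1..<R. if u \<le> j then real (totient u) / (real u)\<^sup>2 * (1 / real j) else 0)"
      by (simp add: sum.inter_filter[symmetric] sum_distrib_left)
  qed
  also have "\<dots> = (\<Sum>j=1..<R. \<Sum>u=1..R. if u \<le> j then real (totient u) / (real u)\<^sup>2 * (1 / real j) else 0)"
    by (rule sum.swap)
  also have "\<dots> = (\<Sum>j=1..<R. Zt j * (1 / real j))"
  proof (intro sum.cong refl)
    fix j assume j: "j \<in> {1..<R}"
    have "{u \<in> {1..R}. u \<le> j} = {1..j}" using j by auto
    then show "(\<Sum>u=1..R. if u \<le> j then real (totient u) / (real u)\<^sup>2 * (1 / real j) else 0) = Zt j * (1 / real j)"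
      by (simp add: sum.inter_filter[symmetric] Zt_def sum_divide_distrib)
  qed
  finally have "zeta2 K * Wt R \<le> zeta2 K * (\<Sum>j=1..<R. Zt j * (1 / real j))" using z by (rule mult_left_mono)
  also have "\<dots> = (\<Sum>j=1..<R. (zeta2 K * Zt j) * (1 / real j))" by (simp add: sum_distrib_left mult_ac)
  also have "\<dots> \<le> (\<Sum>j=1..<R. (1 + ln (real j) + ln (real K)) * (1 / real j))"
    using K by (intro sum_mono mult_right_mono Zt_upper) auto
  also have "\<dots> \<le> (\<Sum>j=1..R. (1 + ln (real j) + ln (real K)) * (1 / real j))"
    using lnK by (intro sum_mono2) auto
  also have "\<dots> = (1 + ln (real K)) * (\<Sum>j=1..R. 1 / real j) + (\<Sum>j=1..R. ln (real j) / real j)"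
    by (simp add: sum_distrib_left sum.distrib[symmetric] algebra_simps add_divide_distrib)
  also have "\<dots> \<le> (1 + ln (real K)) * (1 + ln (real R)) + ((ln (real R))\<^sup>2 / 2 + 1 - 1 / real R)"
    using sum_inverse_upper[OF R] sum_ln_over[OF R] lnK by (intro add_mono mult_left_mono) auto
  also have "\<dots> \<le> (1 + ln (real K)) * (1 + ln (real R)) + (ln (real R))\<^sup>2 / 2 + 1" by simp
  finally show ?thesis .
qed

section \<open>First and second moments of the truncated sum\<close>

definition E1 :: "nat \<Rightarrow> nat \<Rightarrow> real" where
  "E1 B N = (\<Sum>(n, a)\<in>pairs N. XX B (euclid_list n a))"

definition E2 :: "nat \<Rightarrow> nat \<Rightarrow> real" where
  "E2 B N = (\<Sum>(n, a)\<in>pairs N. (XX B (euclid_list n a))\<^sup>2)"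

lemma E1_eq: "E1 B N = (\<Sum>ys\<in>PL N. \<Sum>(x, y)\<in>tri N (cU ys) (cV ys). wt B (x div y))"
  using sum_pairs_wt[of B "\<lambda>_. 1" N] by (simp add: E1_def)

lemma PL_D: "ys \<in> PL N \<Longrightarrow> 1 \<le> cU ys \<and> cU ys \<le> N \<and> cV ys \<le> cU ys"
  using cU_pos by (auto simp: PL_def simp del: One_nat_def)

lemma tri_weight_le: "1 \<le> u \<Longrightarrow> u \<le> N \<Longrightarrow>
    (real N)\<^sup>2 / (2 * (real u)\<^sup>2) + real N / real u \<le> 3 / 2 * ((real N)\<^sup>2 / (real u)\<^sup>2)"
proof -
  assume u: "1 \<le> u" "u \<le> N"
  then have "1 \<le> real N / real u" by simp
  then have "(real N / real u) * 1 \<le> (real N / real u) * (real N / real u)" by (intro mult_left_mono) auto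
  then show ?thesis by (simp add: power2_eq_square)
qed

lemma E1_upper:
  assumes N: "1 \<le> N" and B: "1 \<le> B"
  shows "E1 B N \<le> 3 * (1 + ln (real B)) * (real N)\<^sup>2 * Zt N"
proof -
  have "E1 B N \<le> (\<Sum>ys\<in>PL N. 3 / 2 * ((real N)\<^sup>2 / (real (cU ys))\<^sup>2) * (1 + ln (real B)))"
    unfolding E1_eq
  proof (rule sum_mono)
    fix ys assume "ys \<in> PL N"
    note u = PL_D[OF this]
    have "(\<Sum>(x, y)\<in>tri N (cU ys) (cV ys). wt B (x div y))
      \<le> ((real N)\<^sup>2 / (2 * (real (cU ys))\<^sup>2) + real N / real (cU ys)) * (1 + ln (real B))"
      using u B by (intro sum_tri_wt_upper) auto
    also have "\<dots> \<le> 3 / 2 * ((real N)\<^sup>2 / (real (cU ys))\<^sup>2) * (1 + ln (real B))"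
      using u B by (intro mult_right_mono tri_weight_le) auto
    finally show "(\<Sum>(x, y)\<in>tri N (cU ys) (cV ys). wt B (x div y))
      \<le> 3 / 2 * ((real N)\<^sup>2 / (real (cU ys))\<^sup>2) * (1 + ln (real B))" .
  qed
  also have "\<dots> = 2 * (\<Sum>u=1..N. real (totient u) * (3 / 2 * ((real N)\<^sup>2 / (real u)\<^sup>2) * (1 + ln (real B))))"
    by (rule sum_PL_cU[OF N])
  also have "\<dots> = 2 * (\<Sum>u=1..N. (3 / 2 * (real N)\<^sup>2 * (1 + ln (real B))) * (real (totient u) / (real u)\<^sup>2))"
    by (rule arg_cong[where f = "\<lambda>x. 2 * x"], rule sum.cong[OF refl]) simp
  also have "\<dots> = 3 * (1 + ln (real B)) * (real N)\<^sup>2 * Zt N"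
    unfolding Zt_def sum_distrib_left[symmetric] by simp
  finally show ?thesis .
qed

text \<open>Only the prefixes with continuant at most Q are kept. Since \<open>Q B \<le> N\<close>,
  their boundary errors \<open>B N / u\<close> add up to no more than a multiple of
  \<open>N^2\<close>.\<close>

lemma E1_lower:
  assumes N: "1 \<le> Q" "Q * B \<le> N" and B: "1 \<le> B"
  shows "(real N)\<^sup>2 * ((ln (real B) - 2) * Zt Q - 2) \<le> E1 B N"
proof -
  have "Q \<le> Q * B" using B by simp
  then have QN: "Q \<le> N" using N by linarith
  have sub: "PL Q \<subseteq> PL N" using QN by (auto simp: PL_def)
  have "2 * (\<Sum>u=1..Q. real (totient u) * ((real N)\<^sup>2 / (2 * (real u)\<^sup>2) * (ln (real B) - 2) - real B * (real N / real u)))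
     = (\<Sum>ys\<in>PL Q. (real N)\<^sup>2 / (2 * (real (cU ys))\<^sup>2) * (ln (real B) - 2) - real B * (real N / real (cU ys)))"
    by (rule sum_PL_cU[OF N(1), symmetric])
  also have "\<dots> \<le> (\<Sum>ys\<in>PL Q. \<Sum>(x, y)\<in>tri N (cU ys) (cV ys). wt B (x div y))"
    using PL_D B by (intro sum_mono sum_tri_wt_lower) blast+
  also have "\<dots> \<le> E1 B N" unfolding E1_eq using sub by (intro sum_mono2) (auto intro!: sum_nonneg)
  finally have *: "2 * (\<Sum>u=1..Q. real (totient u) * ((real N)\<^sup>2 / (2 * (real u)\<^sup>2) * (ln (real B) - 2) - real B * (real N / real u))) \<le> E1 B N" .
  have "(\<Sum>u=1..Q. real (totient u) * (real B * (real N / real u))) \<le> (\<Sum>u=1..Q. real B * real N)"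
  proof (rule sum_mono)
    fix u assume u: "u \<in> {1..Q}"
    have "real (totient u) \<le> real u" by (simp add: totient_le)
    then have "real (totient u) * (real B * (real N / real u)) \<le> real u * (real B * (real N / real u))"
      by (intro mult_right_mono) auto
    then show "real (totient u) * (real B * (real N / real u)) \<le> real B * real N" using u by simp
  qed
  also have "\<dots> = real (Q * B) * real N" by simp
  also have "\<dots> \<le> real N * real N" using N by (intro mult_right_mono) (simp_all only: of_nat_le_iff)
  finally have err: "(\<Sum>u=1..Q. real (totient u) * (real B * (real N / real u))) \<le> (real N)\<^sup>2"
    by (simp add: power2_eq_square)
  have "2 * (\<Sum>u=1..Q. real (totient u) * ((real N)\<^sup>2 / (2 * (real u)\<^sup>2) * (ln (real B) - 2) - real B * (real N / real u)))
    = 2 * (\<Sum>u=1..Q. ((real N)\<^sup>2 / 2 * (ln (real B) - 2)) * (real (totient u) / (real u)\<^sup>2) - real (totient u) * (real B * (real N / real u)))"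
    by (rule arg_cong[where f = "\<lambda>x. 2 * x"], rule sum.cong[OF refl]) (auto simp: field_simps)
  also have "\<dots> = 2 * ((real N)\<^sup>2 / 2 * (ln (real B) - 2) * Zt Q - (\<Sum>u=1..Q. real (totient u) * (real B * (real N / real u))))"
    unfolding Zt_def sum_distrib_left[symmetric] sum_subtractf ..
  finally show ?thesis using * err by (simp add: algebra_simps)
qed

text \<open>Of the two expansions of a fraction, the one ending in 1 has a truncated sum larger by
  at most 1.\<close>

lemma sum_PL_XX_le:
  fixes g :: "nat \<Rightarrow> real"
  assumes N: "1 \<le> N" and g: "\<And>u. 0 \<le> g u"
  shows "(\<Sum>ys\<in>PL N. XX B ys * g (cU ys)) \<le> g 1 + (\<Sum>(u, v)\<in>cop N. (2 * XX B (euclid_list u v) + 1) * g u)"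
proof -
  have dec: "XX B (decr_last xs) \<le> XX B xs + 1" if "xs \<noteq> []" for xs
  proof -
    have "XX B xs = XX B (butlast xs) + wt B (last xs)"
      using that by (metis XX_simps(1,2,3) append_butlast_last_id add.right_neutral)
    then show ?thesis by (simp add: decr_last_def)
  qed
  have "(\<Sum>ys\<in>PL N. XX B ys * g (cU ys)) = XX B [1] * g 1 +
    (\<Sum>(u, v)\<in>cop N. XX B (euclid_list u v) * g (cU (euclid_list u v)) + XX B (decr_last (euclid_list u v)) * g (cU (decr_last (euclid_list u v))))"
    by (subst sum_PL_eq_sum_cop[OF N]) simp
  also have "XX B [1] * g 1 \<le> 1 * g 1" using g by (intro mult_right_mono) auto
  also have "(\<Sum>(u, v)\<in>cop N. XX B (euclid_list u v) * g (cU (euclid_list u v)) + XX B (decr_last (euclid_list u v)) * g (cU (decr_last (euclid_list u v))))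
    \<le> (\<Sum>(u, v)\<in>cop N. (2 * XX B (euclid_list u v) + 1) * g u)"
  proof (rule sum_mono)
    fix z assume z: "z \<in> cop N"
    obtain u v where zz: "z = (u, v)" by (cases z)
    note c = cop_cf[OF z[unfolded zz]]
    have "XX B (decr_last (euclid_list u v)) * g u \<le> (XX B (euclid_list u v) + 1) * g u"
      using dec[OF c(5)] g by (rule mult_right_mono)
    then show "(case z of (u, v) \<Rightarrow> XX B (euclid_list u v) * g (cU (euclid_list u v)) + XX B (decr_last (euclid_list u v)) * g (cU (decr_last (euclid_list u v))))
      \<le> (case z of (u, v) \<Rightarrow> (2 * XX B (euclid_list u v) + 1) * g u)"
      unfolding zz split_conv c(1) c(4) by (simp add: algebra_simps)
  qed
  finally show ?thesis by simp
qed

lemma card_pairs: "real (card (pairs N)) \<le> (real N)\<^sup>2 / 2"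
proof -
  have "pairs N = (SIGMA n:{..N}. {1..<n})" by (auto simp: pairs_def)
  then have "card (pairs N) = (\<Sum>n\<le>N. card {1..<n})" by simp
  also have "\<dots> = (\<Sum>n\<le>N. n - 1)" by simp
  finally have c: "card (pairs N) = (\<Sum>n\<le>N. n - 1)" .
  have "2 * (\<Sum>n\<le>N. n - 1) \<le> N * N" by (induction N) auto
  then have "real (2 * card (pairs N)) \<le> real (N * N)" unfolding c by (simp only: of_nat_le_iff)
  then show ?thesis by (simp add: power2_eq_square)
qed

text \<open>The cross terms of \<open>X\<^sup>2\<close> are organised by the prefix before the later position; prefixes
  are again coprime pairs, so the first moment weighted by \<open>1 / n\<^sup>2\<close> appears.\<close>

lemma E2_upper:
  assumes N: "1 \<le> N" and B: "1 \<le> B" and \<delta>: "0 < \<delta>"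
  shows "E2 B N \<le> real B * E1 B N + 2 * (1 + ln (real B)) *
    ((1 / 2 + \<delta>) * (real N)\<^sup>2 * (1 + 2 * Dcop B N + Zt N) + 1 / (4 * \<delta>) * (1 + 2 * E1 B N + (real N)\<^sup>2))"
proof -
  have lnB: "0 \<le> ln (real B)" using B by simp
  have "E2 B N = (\<Sum>ys\<in>PL N. \<Sum>(x, y)\<in>tri N (cU ys) (cV ys). (wt B (x div y))\<^sup>2 + 2 * (XX B (rev ys) * wt B (x div y)))"
    unfolding E2_def XX_square
    using sum_pairs_positions[of "\<lambda>_ xs b. (wt B b)\<^sup>2 + 2 * (XX B xs * wt B b)" N] by simp
  also have "\<dots> \<le> (\<Sum>ys\<in>PL N. real B * (\<Sum>(x, y)\<in>tri N (cU ys) (cV ys). wt B (x div y))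
      + 2 * (XX B ys * (\<Sum>(x, y)\<in>tri N (cU ys) (cV ys). wt B (x div y))))"
  proof (rule sum_mono)
    fix ys assume "ys \<in> PL N"
    \<comment> \<open>On the diagonal one of the two equal factors is bounded by B.\<close>
    have "(\<Sum>(x, y)\<in>tri N (cU ys) (cV ys). (wt B (x div y))\<^sup>2 + 2 * (XX B (rev ys) * wt B (x div y)))
      \<le> (\<Sum>(x, y)\<in>tri N (cU ys) (cV ys). real B * wt B (x div y) + 2 * (XX B ys * wt B (x div y)))"
      by (intro sum_mono) (auto simp: power2_eq_square intro!: mult_right_mono split: prod.splits)
    then show "(\<Sum>(x, y)\<in>tri N (cU ys) (cV ys). (wt B (x div y))\<^sup>2 + 2 * (XX B (rev ys) * wt B (x div y)))
      \<le> real B * (\<Sum>(x, y)\<in>tri N (cU ys) (cV ys). wt B (x div y))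
      + 2 * (XX B ys * (\<Sum>(x, y)\<in>tri N (cU ys) (cV ys). wt B (x div y)))"
      by (simp add: sum.distrib sum_distrib_left case_prod_beta)
  qed
  also have "\<dots> = real B * E1 B N + 2 * (\<Sum>ys\<in>PL N. XX B ys * (\<Sum>(x, y)\<in>tri N (cU ys) (cV ys). wt B (x div y)))"
    unfolding E1_eq by (simp only: sum.distrib sum_distrib_left)
  finally have e0: "E2 B N \<le> real B * E1 B N + 2 * (\<Sum>ys\<in>PL N. XX B ys * (\<Sum>(x, y)\<in>tri N (cU ys) (cV ys). wt B (x div y)))" .
  have "(\<Sum>ys\<in>PL N. XX B ys * (\<Sum>(x, y)\<in>tri N (cU ys) (cV ys). wt B (x div y)))
    \<le> (\<Sum>ys\<in>PL N. XX B ys * (((1 / 2 + \<delta>) * ((real N)\<^sup>2 / (real (cU ys))\<^sup>2) + 1 / (4 * \<delta>)) * (1 + ln (real B))))"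
  proof (intro sum_mono mult_left_mono)
    fix ys assume "ys \<in> PL N"
    note u = PL_D[OF this]
    define t where "t = real N / real (cU ys)"
    \<comment> \<open>The boundary term t of the lattice count is split so that the leading constant
      1 / 2 grows only by \<delta>. The part \<open>1 / (4 \<delta>)\<close> lacks the factor
      \<open>N^2 / u^2\<close> and is of lower order after summation.\<close>
    have "0 \<le> (2 * \<delta> * t - 1)\<^sup>2 / (4 * \<delta>)" using \<delta> by simp
    also have "\<dots> = \<delta> * t\<^sup>2 - t + 1 / (4 * \<delta>)" using \<delta> by (simp add: field_simps power2_eq_square)
    finally have t: "t \<le> \<delta> * t\<^sup>2 + 1 / (4 * \<delta>)" by simp
    have "(\<Sum>(x, y)\<in>tri N (cU ys) (cV ys). wt B (x div y))
      \<le> ((real N)\<^sup>2 / (2 * (real (cU ys))\<^sup>2) + real N / real (cU ys)) * (1 + ln (real B))"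
      using u B by (intro sum_tri_wt_upper) auto
    also have "(real N)\<^sup>2 / (2 * (real (cU ys))\<^sup>2) + real N / real (cU ys) = t\<^sup>2 / 2 + t"
      by (simp add: t_def power_divide)
    also have "(t\<^sup>2 / 2 + t) * (1 + ln (real B)) \<le> ((1 / 2 + \<delta>) * t\<^sup>2 + 1 / (4 * \<delta>)) * (1 + ln (real B))"
      using t lnB by (intro mult_right_mono) (auto simp: algebra_simps)
    finally show "(\<Sum>(x, y)\<in>tri N (cU ys) (cV ys). wt B (x div y))
      \<le> ((1 / 2 + \<delta>) * ((real N)\<^sup>2 / (real (cU ys))\<^sup>2) + 1 / (4 * \<delta>)) * (1 + ln (real B))"
      by (simp add: t_def power_divide)
  qed simp
  also have "(\<Sum>ys\<in>PL N. XX B ys * (((1 / 2 + \<delta>) * ((real N)\<^sup>2 / (real (cU ys))\<^sup>2) + 1 / (4 * \<delta>)) * (1 + ln (real B))))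
    = (1 + ln (real B)) * ((1 / 2 + \<delta>) * (real N)\<^sup>2 * (\<Sum>ys\<in>PL N. XX B ys * (1 / (real (cU ys))\<^sup>2)) + 1 / (4 * \<delta>) * (\<Sum>ys\<in>PL N. XX B ys * 1))"
  proof -
    have g: "X * ((c1 * (n * w) + c2) * L) = L * (c1 * n * (X * w)) + L * (c2 * (X * 1))" for X c1 n w c2 L :: real
      by (simp add: algebra_simps)
    show ?thesis
      unfolding sum_distrib_left sum.distrib[symmetric] distrib_left[of "1 + ln (real B)"]
    proof (rule sum.cong[OF refl])
      fix ys
      show "XX B ys * (((1 / 2 + \<delta>) * ((real N)\<^sup>2 / (real (cU ys))\<^sup>2) + 1 / (4 * \<delta>)) * (1 + ln (real B))) =
        (1 + ln (real B)) * ((1 / 2 + \<delta>) * (real N)\<^sup>2 * (XX B ys * (1 / (real (cU ys))\<^sup>2)))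
        + (1 + ln (real B)) * (1 / (4 * \<delta>) * (XX B ys * 1))"
        using g[of "XX B ys" "1 / 2 + \<delta>" "(real N)\<^sup>2" "1 / (real (cU ys))\<^sup>2" "1 / (4 * \<delta>)" "1 + ln (real B)"] by simp
    qed
  qed
  finally have e1: "(\<Sum>ys\<in>PL N. XX B ys * (\<Sum>(x, y)\<in>tri N (cU ys) (cV ys). wt B (x div y)))
    \<le> (1 + ln (real B)) * ((1 / 2 + \<delta>) * (real N)\<^sup>2 * (\<Sum>ys\<in>PL N. XX B ys * (1 / (real (cU ys))\<^sup>2)) + 1 / (4 * \<delta>) * (\<Sum>ys\<in>PL N. XX B ys * 1))" .
  have i1: "(\<Sum>ys\<in>PL N. XX B ys * (1 / (real (cU ys))\<^sup>2)) \<le> 1 + 2 * Dcop B N + Zt N"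
  proof -
    have "(\<Sum>ys\<in>PL N. XX B ys * (1 / (real (cU ys))\<^sup>2))
      \<le> 1 / (real 1)\<^sup>2 + (\<Sum>(u, v)\<in>cop N. (2 * XX B (euclid_list u v) + 1) * (1 / (real u)\<^sup>2))"
      by (rule sum_PL_XX_le[OF N]) simp
    also have "(\<Sum>(u, v)\<in>cop N. (2 * XX B (euclid_list u v) + 1) * (1 / (real u)\<^sup>2)) = 2 * Dcop B N + (\<Sum>(u, v)\<in>cop N. 1 / (real u)\<^sup>2)"
      unfolding Dcop_def sum_distrib_left sum.distrib[symmetric]
      by (intro sum.cong refl) (auto simp: add_divide_distrib)
    also have "(\<Sum>(u, v)\<in>cop N. 1 / (real u)\<^sup>2) \<le> Zt N"
      unfolding sum_cop_fst Zt_def by (simp, intro sum_mono2) auto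
    finally show ?thesis by simp
  qed
  have i2: "(\<Sum>ys\<in>PL N. XX B ys * 1) \<le> 1 + 2 * E1 B N + (real N)\<^sup>2"
  proof -
    have "(\<Sum>ys\<in>PL N. XX B ys * 1) \<le> 1 + (\<Sum>(u, v)\<in>cop N. (2 * XX B (euclid_list u v) + 1) * 1)"
      by (rule sum_PL_XX_le[OF N]) simp
    also have "(\<Sum>(u, v)\<in>cop N. (2 * XX B (euclid_list u v) + 1) * 1) \<le> (\<Sum>(u, v)\<in>pairs N. (2 * XX B (euclid_list u v) + 1) * 1)"
      using cop_subset by (intro sum_mono2) auto
    also have "\<dots> = 2 * E1 B N + real (card (pairs N))"
      by (simp add: E1_def case_prod_beta sum.distrib sum_distrib_left)
    also have "\<dots> \<le> 2 * E1 B N + (real N)\<^sup>2"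
      using card_pairs[of N] zero_le_power2[of "real N"] by linarith
    finally show ?thesis by simp
  qed
  have "(1 + ln (real B)) * ((1 / 2 + \<delta>) * (real N)\<^sup>2 * (\<Sum>ys\<in>PL N. XX B ys * (1 / (real (cU ys))\<^sup>2)) + 1 / (4 * \<delta>) * (\<Sum>ys\<in>PL N. XX B ys * 1))
    \<le> (1 + ln (real B)) * ((1 / 2 + \<delta>) * (real N)\<^sup>2 * (1 + 2 * Dcop B N + Zt N) + 1 / (4 * \<delta>) * (1 + 2 * E1 B N + (real N)\<^sup>2))"
    using lnB \<delta> by (intro mult_left_mono add_mono i1 i2) auto
  with e0 e1 show ?thesis by linarith
qed

text \<open>A union bound over the positions: a quotient above B corresponds to a lattice point in a
  triangle of level \<open>B + 1\<close>, and the number of these points is smaller by a factor of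
  order \<open>B + 1\<close>.\<close>

lemma tail_count:
  assumes N: "1 \<le> N"
  shows "real (card {(n, a) \<in> pairs N. \<exists>b\<in>set (euclid_list n a). B < b}) \<le> 3 * (real N)\<^sup>2 * Zt N / (real B + 1)"
proof -
  let ?I = "\<lambda>b. if B < b then 1 else 0 :: real"
  have "real (card {(n, a) \<in> pairs N. \<exists>b\<in>set (euclid_list n a). B < b})
      = (\<Sum>z\<in>{z \<in> pairs N. \<exists>b\<in>set (euclid_list (fst z) (snd z)). B < b}. 1)"
  proof -
    have "{(n, a) \<in> pairs N. \<exists>b\<in>set (euclid_list n a). B < b} = {z \<in> pairs N. \<exists>b\<in>set (euclid_list (fst z) (snd z)). B < b}"
      by auto
    then show ?thesis by (simp only: card_eq_sum of_nat_sum of_nat_1)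
  qed
  also have "\<dots> \<le> (\<Sum>z\<in>{z \<in> pairs N. \<exists>b\<in>set (euclid_list (fst z) (snd z)). B < b}. \<Sum>i<length (euclid_list (fst z) (snd z)). ?I (euclid_list (fst z) (snd z) ! i))"
  proof (rule sum_mono)
    fix z assume "z \<in> {z \<in> pairs N. \<exists>b\<in>set (euclid_list (fst z) (snd z)). B < b}"
    then obtain i where i: "i < length (euclid_list (fst z) (snd z))" "B < euclid_list (fst z) (snd z) ! i"
      by (auto simp: in_set_conv_nth)
    then have "?I (euclid_list (fst z) (snd z) ! i) \<le> (\<Sum>i<length (euclid_list (fst z) (snd z)). ?I (euclid_list (fst z) (snd z) ! i))"
      by (intro member_le_sum) auto
    then show "1 \<le> (\<Sum>i<length (euclid_list (fst z) (snd z)). ?I (euclid_list (fst z) (snd z) ! i))" using i by simp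
  qed
  also have "\<dots> \<le> (\<Sum>z\<in>pairs N. \<Sum>i<length (euclid_list (fst z) (snd z)). ?I (euclid_list (fst z) (snd z) ! i))"
    by (intro sum_mono2) (auto intro!: sum_nonneg)
  also have "\<dots> = (\<Sum>ys\<in>PL N. \<Sum>(x, y)\<in>tri N (cU ys) (cV ys). ?I (x div y))"
    using sum_pairs_positions[of "\<lambda>_ _ b. ?I b" N] by (simp add: case_prod_beta)
  also have "\<dots> = (\<Sum>ys\<in>PL N. real (card (tri_k (Suc B) N (cU ys) (cV ys))))"
  proof (rule sum.cong[OF refl])
    fix ys assume "ys \<in> PL N"
    then have fin: "finite (tri N (cU ys) (cV ys))" using PL_D by (intro finite_tri) blast
    have e: "{z \<in> tri N (cU ys) (cV ys). B < fst z div snd z} = tri_k (Suc B) N (cU ys) (cV ys)"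
      by (auto simp: tri_def tri_k_def less_eq_div_iff_mult_less_eq mult.commute simp flip: Suc_le_eq simp del: mult_Suc mult_Suc_right)
    have "(\<Sum>(x, y)\<in>tri N (cU ys) (cV ys). ?I (x div y)) = (\<Sum>z\<in>tri N (cU ys) (cV ys). ?I (fst z div snd z))"
      by (simp add: case_prod_beta)
    also have "\<dots> = (\<Sum>z\<in>{z \<in> tri N (cU ys) (cV ys). B < fst z div snd z}. 1)"
      using fin by (rule sum.inter_filter[symmetric])
    finally show "(\<Sum>(x, y)\<in>tri N (cU ys) (cV ys). ?I (x div y)) = real (card (tri_k (Suc B) N (cU ys) (cV ys)))"
      unfolding e by simp
  qed
  also have "\<dots> \<le> (\<Sum>ys\<in>PL N. 3 / 2 * ((real N)\<^sup>2 / (real (cU ys))\<^sup>2) / (real B + 1))"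
  proof (rule sum_mono)
    fix ys assume "ys \<in> PL N"
    note u = PL_D[OF this]
    let ?u = "real (cU ys)" and ?c = "real (Suc B * cU ys + cV ys)"
    have c: "(real B + 1) * ?u \<le> ?c" by (simp add: algebra_simps)
    have c0: "0 < (real B + 1) * ?u" using u by (intro mult_pos_pos) auto
    have "real (card (tri_k (Suc B) N (cU ys) (cV ys))) \<le> (real N)\<^sup>2 / (2 * ?u * ?c) + real N / ?c"
      using u by (intro card_tri_k_upper) auto
    also have "\<dots> \<le> (real N)\<^sup>2 / (2 * ?u * ((real B + 1) * ?u)) + real N / ((real B + 1) * ?u)"
    proof -
      have "A / (2 * w * c) + M / c \<le> A / (2 * w * D) + M / D"
        if "0 < D" "D \<le> c" "0 < w" "0 \<le> A" "0 \<le> M" for A w c D M :: real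
        using that by (intro add_mono frac_le) auto
      from this[OF c0 c] show ?thesis using u by simp
    qed
    also have "\<dots> = ((real N)\<^sup>2 / (2 * ?u\<^sup>2) + real N / ?u) / (real B + 1)"
      by (simp add: power2_eq_square add_divide_distrib mult_ac)
    also have "\<dots> \<le> 3 / 2 * ((real N)\<^sup>2 / ?u\<^sup>2) / (real B + 1)"
      using u by (intro divide_right_mono tri_weight_le) auto
    finally show "real (card (tri_k (Suc B) N (cU ys) (cV ys))) \<le> 3 / 2 * ((real N)\<^sup>2 / ?u\<^sup>2) / (real B + 1)" .
  qed
  also have "\<dots> = 2 * (\<Sum>u=1..N. real (totient u) * (3 / 2 * ((real N)\<^sup>2 / (real u)\<^sup>2) / (real B + 1)))"
    by (rule sum_PL_cU[OF N])
  also have "\<dots> = 2 * (\<Sum>u=1..N. (3 / 2 * (real N)\<^sup>2 / (real B + 1)) * (real (totient u) / (real u)\<^sup>2))"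
    by (rule arg_cong[where f = "\<lambda>x. 2 * x"], rule sum.cong[OF refl]) (simp add: mult_ac)
  also have "\<dots> = 3 * (real N)\<^sup>2 * Zt N / (real B + 1)"
  proof -
    have "2 * (3 / 2 * w / d * z) = 3 * w * z / d" for w d z :: real by simp
    then show ?thesis unfolding Zt_def sum_distrib_left[symmetric] .
  qed
  finally show ?thesis .
qed

section \<open>Concentration of the truncated sum\<close>

text \<open>The factor \<open>sqrt (ln ln N)\<close> meets two demands. The truncation must outgrow
  \<open>ln N\<close>, so that quotients beyond it occur for only \<open>o(N^2)\<close> pairs, and
  it must be \<open>o(ln N ln ln N)\<close>, so that the diagonal term \<open>B E1\<close> is
  negligible against the square of the mean.\<close>

definition Bf :: "nat \<Rightarrow> nat" where
  "Bf N = nat \<lfloor>ln (real N) * sqrt (ln (ln (real N)))\<rfloor>"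

text \<open>The asymptotic mean of the truncated sum, as there are about \<open>N^2 / 2\<close>
  pairs.\<close>

definition mf :: "nat \<Rightarrow> real" where
  "mf N = 12 / pi\<^sup>2 * (ln (real N) * ln (ln (real N)))"

lemma ln_at_top_nat: "filterlim (\<lambda>N. ln (real N)) at_top sequentially"
  by real_asymp

lemma eventually_ln_nat: "eventually P at_top \<Longrightarrow> eventually (\<lambda>N. P (ln (real N))) sequentially"
  by (rule eventually_compose_filterlim[OF _ ln_at_top_nat])

lemma Bf_bounds:
  "\<forall>\<^sub>F N in sequentially. 1 \<le> Bf N \<and> real (Bf N) \<le> ln (real N) * sqrt (ln (ln (real N)))
     \<and> ln (real N) * sqrt (ln (ln (real N))) \<le> real (Bf N) + 1
     \<and> ln (ln (real N)) \<le> ln (real (Bf N)) \<and> ln (real (Bf N)) \<le> ln (ln (real N)) + ln (ln (ln (real N))) / 2"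
proof -
  have "\<forall>\<^sub>F L in at_top. L \<le> L * sqrt (ln L) - 1 \<and> exp 1 \<le> ln L \<and> (1::real) \<le> L"
    by (intro eventually_conj) real_asymp+
  from eventually_ln_nat[OF this] show ?thesis
  proof eventually_elim
    case (elim N)
    define L where "L = ln (real N)"
    have L: "L \<le> L * sqrt (ln L) - 1" "exp 1 \<le> ln L" "1 \<le> L" using elim by (auto simp: L_def)
    have lnL: "1 < ln L" using L(2) exp_ge_add_one_self[of 1] by linarith
    have B: "real (Bf N) \<le> L * sqrt (ln L)" "L * sqrt (ln L) < real (Bf N) + 1"
      unfolding Bf_def L_def[symmetric] using L by linarith+
    then have BL: "L \<le> real (Bf N)" using L by linarith
    then have B1: "1 \<le> Bf N" using L by simp
    have "ln (real (Bf N)) \<le> ln (L * sqrt (ln L))" using B B1 by (intro ln_mono) auto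
    also have "\<dots> = ln L + ln (ln L) / 2" using L lnL by (simp add: ln_mult ln_sqrt)
    finally have "ln (real (Bf N)) \<le> ln L + ln (ln L) / 2" .
    moreover have "ln L \<le> ln (real (Bf N))" using BL L by (intro ln_mono) auto
    ultimately show ?case using B B1 unfolding L_def by auto
  qed
qed

lemma E1_asymp:
  assumes \<eta>: "0 < \<eta>"
  shows "\<forall>\<^sub>F N in sequentially. (1 / 2 - \<eta>) * mf N * (real N)\<^sup>2 \<le> E1 (Bf N) N"
proof -
  have "((\<lambda>L::real. ((ln L - 2) * (6 / pi\<^sup>2 * (L - (ln L + ln (ln L) / 2))) - 2) / (12 / pi\<^sup>2 * (L * ln L))) \<longlongrightarrow> 1 / 2) at_top"
    by real_asymp
  then have "\<forall>\<^sub>F L in at_top. 1 / 2 - \<eta> < ((ln L - 2) * (6 / pi\<^sup>2 * (L - (ln L + ln (ln L) / 2))) - 2) / (12 / pi\<^sup>2 * (L * ln L))"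
    using \<eta> by (intro order_tendstoD(1)[of _ "1 / 2"]) auto
  moreover have "\<forall>\<^sub>F L in at_top. (2::real) < ln L \<and> 0 < L \<and> L * sqrt (ln L) < exp L \<and> 0 < L - (ln L + ln (ln L) / 2)"
    by (intro eventually_conj) real_asymp+
  ultimately have "\<forall>\<^sub>F L in at_top. 1 / 2 - \<eta> < ((ln L - 2) * (6 / pi\<^sup>2 * (L - (ln L + ln (ln L) / 2))) - 2) / (12 / pi\<^sup>2 * (L * ln L))
      \<and> 2 < ln L \<and> 0 < L \<and> L * sqrt (ln L) < exp L \<and> 0 < L - (ln L + ln (ln L) / 2)" by eventually_elim auto
  from eventually_ln_nat[OF this] Bf_bounds eventually_gt_at_top[of 0] show ?thesis
  proof eventually_elim
    case (elim N)
    define L where "L = ln (real N)"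
    define B where "B = Bf N"
    have L: "1 / 2 - \<eta> < ((ln L - 2) * (6 / pi\<^sup>2 * (L - (ln L + ln (ln L) / 2))) - 2) / (12 / pi\<^sup>2 * (L * ln L))"
      "2 < ln L" "0 < L" "L * sqrt (ln L) < exp L" "0 < L - (ln L + ln (ln L) / 2)"
      and B: "1 \<le> B" "real B \<le> L * sqrt (ln L)" "ln L \<le> ln (real B)" "ln (real B) \<le> ln L + ln (ln L) / 2"
      and N: "0 < N" using elim by (auto simp: L_def B_def)
    \<comment> \<open>The largest value allowed in \<open>E1_lower\<close>; its logarithm differs
      from \<open>ln N\<close> by little more than \<open>ln B\<close>, which is negligible.\<close>
    define Q where "Q = N div B"
    have "real B < real N" using B L N by (simp add: L_def)
    then have "B \<le> N" by simp
    then have Q: "1 \<le> Q" "Q * B \<le> N" using B by (auto simp: Q_def Suc_le_eq div_greater_zero_iff)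
    have "N < (Q + 1) * B" unfolding Q_def using dividend_less_div_times[of B N] B by (simp add: algebra_simps)
    then have "real N < real ((Q + 1) * B)" by (simp only: of_nat_less_iff)
    then have "real N / real B \<le> real Q + 1" using B by (simp add: pos_divide_le_eq algebra_simps)
    then have "ln (real N / real B) \<le> ln (real Q + 1)" using N B by (intro ln_mono) auto
    also have "\<dots> \<le> pi\<^sup>2 / 6 * Zt Q" by (rule Zt_lower)
    finally have "L - ln (real B) \<le> pi\<^sup>2 / 6 * Zt Q" using N B by (simp add: ln_div L_def)
    then have "L - (ln L + ln (ln L) / 2) \<le> pi\<^sup>2 / 6 * Zt Q" using B by linarith
    then have "6 / pi\<^sup>2 * (L - (ln L + ln (ln L) / 2)) \<le> 6 / pi\<^sup>2 * (pi\<^sup>2 / 6 * Zt Q)"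
      by (intro mult_left_mono) auto
    also have "\<dots> = Zt Q" by simp
    finally have Z: "6 / pi\<^sup>2 * (L - (ln L + ln (ln L) / 2)) \<le> Zt Q" .
    have "(1 / 2 - \<eta>) * (12 / pi\<^sup>2 * (L * ln L)) \<le> (ln L - 2) * (6 / pi\<^sup>2 * (L - (ln L + ln (ln L) / 2))) - 2"
    proof -
      have "0 < 12 / pi\<^sup>2 * (L * ln L)" using L(3) less_trans[OF zero_less_numeral L(2)] by (intro mult_pos_pos divide_pos_pos) (simp_all only: zero_less_numeral zero_less_power pi_gt_zero)
      then show ?thesis using L(1) by (simp only: pos_less_divide_eq less_imp_le)
    qed
    also have "\<dots> \<le> (ln (real B) - 2) * Zt Q - 2"
    proof (intro diff_right_mono mult_mono)
      have lnLB: "ln L \<le> ln (real B)" using B(3) .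
      show "ln L \<le> ln (real B)" by (rule lnLB)
      show "0 \<le> ln (real B) - 2" using lnLB L(2) by linarith
      show "0 \<le> 6 / pi\<^sup>2 * (L - (ln L + ln (ln L) / 2))" using L(5) by (intro mult_nonneg_nonneg) auto
    qed (rule Z)
    finally have "(real N)\<^sup>2 * ((1 / 2 - \<eta>) * (12 / pi\<^sup>2 * (L * ln L))) \<le> (real N)\<^sup>2 * ((ln (real B) - 2) * Zt Q - 2)"
      by (intro mult_left_mono) auto
    also have "\<dots> \<le> E1 B N" using Q B by (intro E1_lower)
    finally show ?case unfolding mf_def L_def[symmetric] B_def[symmetric] by (simp add: mult_ac)
  qed
qed

text \<open>The factor \<open>N^2\<close> is taken out. What remains depends on N only through
  \<open>L = ln N\<close> and through the majorants b and \<beta> of \<open>ln B\<close> and B, so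
  the limit can be taken in the single variable L.\<close>

lemma E2_explicit:
  assumes N: "1 \<le> N" and B: "1 \<le> B" and K: "1 \<le> K" and \<delta>: "0 < \<delta>"
    and L: "L = ln (real N)" and b: "ln (real B) \<le> b" and \<beta>: "real B \<le> \<beta>"
    and c: "c = 1 / zeta2 K" and k: "k = ln (real K)"
  shows "E2 B N \<le> (real N)\<^sup>2 * (\<beta> * (3 * (1 + b) * (c * (1 + L + k))) + 2 * (1 + b) *
    ((1 / 2 + \<delta>) * (1 + 2 * (c * (2 * (10 + b) * (c * (1 + L + 2 * k))
         + 2 * (1 + b) * (c * ((1 + k) * (1 + L + k) + (L + k)\<^sup>2 / 2 + 1)))) + c * (1 + L + k))
     + 1 / (4 * \<delta>) * (2 + 2 * (3 * (1 + b) * (c * (1 + L + k))))))"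
proof -
  have z: "1 \<le> zeta2 K" using zeta2_pos[OF K] .
  have cz: "x \<le> c * y" if "zeta2 K * x \<le> y" for x y
    using that z unfolding c by (simp add: field_simps)
  have c0: "0 < c" using z by (simp add: c)
  have b0: "0 \<le> ln (real B)" "0 \<le> L" "0 \<le> k" using B N K by (simp_all add: L k)
  have NK: "1 \<le> N * K" "ln (real (N * K)) = L + k" using N K by (auto simp: L k ln_mult Suc_le_eq)
  have Z: "Zt N \<le> c * (1 + L + k)" using Zt_upper[OF K N] unfolding L k by (intro cz)
  have Z2: "Zt (N * K) \<le> c * (1 + L + 2 * k)" using Zt_upper[OF K NK(1)] unfolding NK k[symmetric] by (intro cz) simp
  have W2: "Wt (N * K) \<le> c * ((1 + k) * (1 + L + k) + (L + k)\<^sup>2 / 2 + 1)"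
    using Wt_upper[OF K NK(1)] unfolding NK k[symmetric] by (intro cz) (simp add: add_ac)
  have W0: "0 \<le> Wt (N * K)" unfolding Wt_def
  proof (intro sum_nonneg mult_nonneg_nonneg)
    fix u assume "u \<in> {1..N * K}"
    then have "1 \<le> real (N * K) / real u" by (subst le_divide_eq_1_pos) (auto simp flip: of_nat_mult)
    then show "0 \<le> ln (real (N * K) / real u)" by simp
  qed auto
  have "Dall B (N * K) \<le> 2 * (10 + b) * (c * (1 + L + 2 * k)) + 2 * (1 + b) * (c * ((1 + k) * (1 + L + k) + (L + k)\<^sup>2 / 2 + 1))"
    by (rule order.trans[OF Dall_upper[OF NK(1) B]])
       (use b b0 Z2 W2 W0 c0 in \<open>intro add_mono mult_mono\<close>, auto)
  then have D: "Dcop B N \<le> c * (2 * (10 + b) * (c * (1 + L + 2 * k)) + 2 * (1 + b) * (c * ((1 + k) * (1 + L + k) + (L + k)\<^sup>2 / 2 + 1)))"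
    using Dcop_le_Dall[of K B N] by (intro cz) linarith
  have D0: "0 \<le> Dcop B N" unfolding Dcop_def by (intro sum_nonneg) auto
  have E: "E1 B N \<le> (real N)\<^sup>2 * (3 * (1 + b) * (c * (1 + L + k)))"
  proof -
    have "E1 B N \<le> 3 * (1 + ln (real B)) * (real N)\<^sup>2 * Zt N" by (rule E1_upper[OF N B])
    also have "\<dots> = (real N)\<^sup>2 * (3 * (1 + ln (real B)) * Zt N)" by simp
    also have "\<dots> \<le> (real N)\<^sup>2 * (3 * (1 + b) * (c * (1 + L + k)))"
      using b b0 Z by (intro mult_left_mono mult_mono) auto
    finally show ?thesis .
  qed
  have E0: "0 \<le> E1 B N" unfolding E1_def by (intro sum_nonneg) auto
  have N1: "1 \<le> (real N)\<^sup>2" using N by simp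
  have "E2 B N \<le> real B * E1 B N + 2 * (1 + ln (real B)) *
    ((1 / 2 + \<delta>) * (real N)\<^sup>2 * (1 + 2 * Dcop B N + Zt N) + 1 / (4 * \<delta>) * (1 + 2 * E1 B N + (real N)\<^sup>2))"
    by (rule E2_upper[OF N B \<delta>])
  also have "\<dots> \<le> \<beta> * ((real N)\<^sup>2 * (3 * (1 + b) * (c * (1 + L + k)))) + 2 * (1 + b) *
    ((1 / 2 + \<delta>) * (real N)\<^sup>2 * (1 + 2 * (c * (2 * (10 + b) * (c * (1 + L + 2 * k))
         + 2 * (1 + b) * (c * ((1 + k) * (1 + L + k) + (L + k)\<^sup>2 / 2 + 1)))) + c * (1 + L + k))
     + 1 / (4 * \<delta>) * ((real N)\<^sup>2 + 2 * ((real N)\<^sup>2 * (3 * (1 + b) * (c * (1 + L + k)))) + (real N)\<^sup>2))"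
    using b b0 \<beta> D D0 Z E E0 N1 \<delta>
    by (intro add_mono mult_mono order_refl) (auto intro!: add_nonneg_nonneg mult_nonneg_nonneg)
  also have "\<dots> = (real N)\<^sup>2 * (\<beta> * (3 * (1 + b) * (c * (1 + L + k))) + 2 * (1 + b) *
    ((1 / 2 + \<delta>) * (1 + 2 * (c * (2 * (10 + b) * (c * (1 + L + 2 * k))
         + 2 * (1 + b) * (c * ((1 + k) * (1 + L + k) + (L + k)\<^sup>2 / 2 + 1)))) + c * (1 + L + k))
     + 1 / (4 * \<delta>) * (2 + 2 * (3 * (1 + b) * (c * (1 + L + k))))))"
  proof -
    have "\<beta> * (n * X) + 2 * (1 + b) * (h * n * Y + e * (n + 2 * (n * X) + n))
      = n * (\<beta> * X + 2 * (1 + b) * (h * Y + e * (2 + 2 * X)))" for n X h Y e :: real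
      by (simp add: algebra_simps)
    then show ?thesis .
  qed
  finally show ?thesis .
qed

lemma E2_asymp:
  assumes \<eta>: "0 < \<eta>"
  shows "\<forall>\<^sub>F N in sequentially. E2 (Bf N) N \<le> (1 / 2 + \<eta>) * (mf N)\<^sup>2 * (real N)\<^sup>2"
proof -
  \<comment> \<open>K and \<open>\<delta> = 1 / K\<close> are fixed before N grows. The leading
    coefficient \<open>4 (1 / 2 + \<delta>) / (zeta2 K)^2\<close> tends to \<open>72 / pi^4\<close>,
    which is half of the square of \<open>12 / pi^2\<close>.\<close>
  have "(\<lambda>K. 4 * (1 / 2 + 1 / real K) * (1 / zeta2 K)\<^sup>2 / (12 / pi\<^sup>2)\<^sup>2) \<longlonglongrightarrow> 4 * (1 / 2 + 0) * (1 / (pi\<^sup>2 / 6))\<^sup>2 / (12 / pi\<^sup>2)\<^sup>2"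
    by (intro tendsto_intros zeta2_tendsto lim_const_over_n) auto
  also have "4 * (1 / 2 + 0) * (1 / (pi\<^sup>2 / 6))\<^sup>2 / (12 / pi\<^sup>2)\<^sup>2 = (1 / 2 :: real)"
    by (simp add: power_divide field_simps)
  finally have "\<forall>\<^sub>F K in sequentially. 4 * (1 / 2 + 1 / real K) * (1 / zeta2 K)\<^sup>2 / (12 / pi\<^sup>2)\<^sup>2 < 1 / 2 + \<eta>"
    by (rule order_tendstoD) (use \<eta> in simp)
  then have "\<forall>\<^sub>F K in sequentially. 4 * (1 / 2 + 1 / real K) * (1 / zeta2 K)\<^sup>2 / (12 / pi\<^sup>2)\<^sup>2 < 1 / 2 + \<eta> \<and> 1 \<le> K"
    using eventually_ge_at_top[of 1] by eventually_elim auto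
  then obtain K where K: "4 * (1 / 2 + 1 / real K) * (1 / zeta2 K)\<^sup>2 / (12 / pi\<^sup>2)\<^sup>2 < 1 / 2 + \<eta>" "1 \<le> K"
    using eventually_happens trivial_limit_sequentially by blast
  define \<delta> where "\<delta> = 1 / real K"
  define c where "c = 1 / zeta2 K"
  define k where "k = ln (real K)"
  have \<delta>: "0 < \<delta>" using K by (simp add: \<delta>_def)
  have c0: "0 < c" using zeta2_pos[OF K(2)] by (simp add: c_def)
  define G where "G = (\<lambda>L::real. (L * sqrt (ln L)) * (3 * (1 + (ln L + ln (ln L) / 2)) * (c * (1 + L + k))) + 2 * (1 + (ln L + ln (ln L) / 2)) *
    ((1 / 2 + \<delta>) * (1 + 2 * (c * (2 * (10 + (ln L + ln (ln L) / 2)) * (c * (1 + L + 2 * k))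
         + 2 * (1 + (ln L + ln (ln L) / 2)) * (c * ((1 + k) * (1 + L + k) + (L + k)\<^sup>2 / 2 + 1)))) + c * (1 + L + k))
     + 1 / (4 * \<delta>) * (2 + 2 * (3 * (1 + (ln L + ln (ln L) / 2)) * (c * (1 + L + k))))))"
  have lim: "((\<lambda>L. G L / (L * ln L)\<^sup>2) \<longlongrightarrow> 4 * (1 / 2 + \<delta>) * c\<^sup>2) at_top"
  proof -
    let ?b = "\<lambda>L::real. 1 + (ln L + ln (ln L) / 2)"
    have l1: "((\<lambda>L::real. (L * sqrt (ln L)) * ?b L * L / (L * ln L)\<^sup>2) \<longlongrightarrow> 0) at_top" by real_asymp
    have l2: "((\<lambda>L::real. ?b L / ln L) \<longlongrightarrow> 1) at_top" by real_asymp
    have l3: "((\<lambda>L::real. (10 + (ln L + ln (ln L) / 2)) / ln L) \<longlongrightarrow> 1) at_top" by real_asymp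
    have l4: "((\<lambda>L::real. (1 + L + k) / L) \<longlongrightarrow> 1) at_top" "((\<lambda>L::real. (1 + L + 2 * k) / L) \<longlongrightarrow> 1) at_top"
      "((\<lambda>L::real. (L + k) / L) \<longlongrightarrow> 1) at_top" by real_asymp+
    have l5: "((\<lambda>L::real. 1 / L) \<longlongrightarrow> 0) at_top" by real_asymp
    have l6: "((\<lambda>L::real. 1 / ln L) \<longlongrightarrow> 0) at_top" by real_asymp
    \<comment> \<open>The quotient \<open>G L / (L ln L)^2\<close>, with the denominator distributed
      over factors whose limits are known separately.\<close>
    define H where "H = (\<lambda>L::real. ((L * sqrt (ln L)) * ?b L * L / (L * ln L)\<^sup>2) * (3 * c * ((1 + L + k) / L))
      + 2 * (?b L / ln L) * ((1 / 2 + \<delta>) * ((1 / L) * (1 / L) * (1 / ln L) + 2 * (c * (2 * ((10 + (ln L + ln (ln L) / 2)) / ln L) * (c * ((1 + L + 2 * k) / L) * (1 / L))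
         + 2 * (?b L / ln L) * (c * ((1 + k) * ((1 + L + k) / L) * (1 / L) + ((L + k) / L)\<^sup>2 / 2 + (1 / L) * (1 / L))))) + c * ((1 + L + k) / L) * (1 / L) * (1 / ln L))
       + 1 / (4 * \<delta>) * (2 * (1 / L) * (1 / L) * (1 / ln L) + 6 * (?b L / ln L) * (c * ((1 + L + k) / L) * (1 / L)))))"
    have "(H \<longlongrightarrow> 0 * (3 * c * 1)
      + 2 * 1 * ((1 / 2 + \<delta>) * (0 * 0 * 0 + 2 * (c * (2 * 1 * (c * 1 * 0)
         + 2 * 1 * (c * ((1 + k) * 1 * 0 + 1\<^sup>2 / 2 + 0 * 0)))) + c * 1 * 0 * 0)
       + 1 / (4 * \<delta>) * (2 * 0 * 0 * 0 + 6 * 1 * (c * 1 * 0)))) at_top"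
      unfolding H_def by (intro tendsto_add tendsto_mult tendsto_divide tendsto_power tendsto_const l1 l2 l3 l4 l5 l6) auto
    then have "(H \<longlongrightarrow> 4 * (1 / 2 + \<delta>) * c\<^sup>2) at_top" by (simp add: power2_eq_square mult_ac)
    moreover have "\<forall>\<^sub>F L::real in at_top. 0 < L \<and> 0 < ln L" by (intro eventually_conj) real_asymp+
    then have "\<forall>\<^sub>F L in at_top. H L = G L / (L * ln L)\<^sup>2"
    proof eventually_elim
      case (elim L)
      define l where "l = ln L"
      define b where "b = 1 + (l + ln l / 2)"
      have b10: "10 + (l + ln l / 2) = b + 9" by (simp add: b_def)
      have nz: "L \<noteq> 0" "l \<noteq> 0" using elim by (auto simp: l_def)
      have e1: "A * (3 * b * (c * P)) / (L * l)\<^sup>2 = (A * b * L / (L * l)\<^sup>2) * (3 * c * (P / L))" for A P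
        using nz by simp
      have e2: "2 * b * (h * (1 + 2 * (c * (2 * (b + 9) * (c * P2) + 2 * b * (c * ((1 + k) * P + P3\<^sup>2 / 2 + 1)))) + c * P)
            + e * (2 + 2 * (3 * b * (c * P)))) / (L * l)\<^sup>2
          = 2 * (b / l) * (h * ((1 / L) * (1 / L) * (1 / l) + 2 * (c * (2 * ((b + 9) / l) * (c * (P2 / L) * (1 / L))
         + 2 * (b / l) * (c * ((1 + k) * (P / L) * (1 / L) + (P3 / L)\<^sup>2 / 2 + (1 / L) * (1 / L))))) + c * (P / L) * (1 / L) * (1 / l))
       + e * (2 * (1 / L) * (1 / L) * (1 / l) + 6 * (b / l) * (c * (P / L) * (1 / L))))" for h e P P2 P3
        unfolding divide_inverse power_mult_distrib inverse_mult_distrib power2_eq_square mult_1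
        by (simp add: algebra_simps)
      show ?case
        unfolding H_def G_def l_def[symmetric]
        unfolding b10 b_def[symmetric] add_divide_distrib[of _ _ "(L * l)\<^sup>2"] e1 e2 ..
    qed
    ultimately show ?thesis using tendsto_cong by fastforce
  qed
  have "4 * (1 / 2 + \<delta>) * c\<^sup>2 < (1 / 2 + \<eta>) * (12 / pi\<^sup>2)\<^sup>2"
    using K unfolding \<delta>_def[symmetric] c_def[symmetric] by (subst (asm) pos_divide_less_eq) auto
  from order_tendstoD(2)[OF lim this]
  have "\<forall>\<^sub>F L in at_top. G L / (L * ln L)\<^sup>2 < (1 / 2 + \<eta>) * (12 / pi\<^sup>2)\<^sup>2 \<and> 0 < L * ln L"
    by (rule eventually_conj) real_asymp
  from eventually_ln_nat[OF this] Bf_bounds eventually_gt_at_top[of 0] show ?thesis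
  proof eventually_elim
    case (elim N)
    define L where "L = ln (real N)"
    have L: "G L / (L * ln L)\<^sup>2 < (1 / 2 + \<eta>) * (12 / pi\<^sup>2)\<^sup>2" "0 < L * ln L" using elim by (auto simp: L_def)
    have "0 < (L * ln L)\<^sup>2" using L(2) by (rule zero_less_power)
    then have G: "G L < (1 / 2 + \<eta>) * (12 / pi\<^sup>2)\<^sup>2 * (L * ln L)\<^sup>2"
      using L(1) pos_divide_less_eq by blast
    have "E2 (Bf N) N \<le> (real N)\<^sup>2 * G L"
      unfolding G_def
      by (rule E2_explicit[OF _ _ K(2) \<delta> L_def _ _ c_def k_def]) (use elim in \<open>auto simp: L_def\<close>)
    also have "\<dots> \<le> (real N)\<^sup>2 * ((1 / 2 + \<eta>) * (12 / pi\<^sup>2)\<^sup>2 * (L * ln L)\<^sup>2)"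
      using G by (intro mult_left_mono) auto
    also have "\<dots> = (1 / 2 + \<eta>) * (12 / pi\<^sup>2 * (L * ln L))\<^sup>2 * (real N)\<^sup>2"
      unfolding power_mult_distrib[of "12 / pi\<^sup>2"] by (simp only: mult_ac)
    finally show ?case unfolding mf_def L_def[symmetric] .
  qed
qed

lemma tail_asymp:
  assumes \<eta>: "0 < \<eta>"
  shows "\<forall>\<^sub>F N in sequentially. real (card {(n, a) \<in> pairs N. \<exists>b\<in>set (euclid_list n a). Bf N < b}) \<le> \<eta> * (real N)\<^sup>2"
proof -
  have "((\<lambda>L::real. 3 * (1 + L) / (L * sqrt (ln L))) \<longlongrightarrow> 0) at_top" by real_asymp
  from order_tendstoD(2)[OF this \<eta>] have "\<forall>\<^sub>F L::real in at_top. 3 * (1 + L) / (L * sqrt (ln L)) < \<eta> \<and> 0 < L * sqrt (ln L)"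
    by (rule eventually_conj) real_asymp
  from eventually_ln_nat[OF this] Bf_bounds eventually_gt_at_top[of 0] show ?thesis
  proof eventually_elim
    case (elim N)
    define L where "L = ln (real N)"
    have L: "3 * (1 + L) / (L * sqrt (ln L)) < \<eta>" "0 < L * sqrt (ln L)" "L * sqrt (ln L) \<le> real (Bf N) + 1" and N: "1 \<le> N"
      using elim by (auto simp: L_def)
    have Z: "Zt N \<le> 1 + L" using Zt_upper[of 1 N] N by (simp add: zeta2_def L_def)
    have "real (card {(n, a) \<in> pairs N. \<exists>b\<in>set (euclid_list n a). Bf N < b}) \<le> 3 * (real N)\<^sup>2 * Zt N / (real (Bf N) + 1)"
      by (rule tail_count[OF N])
    also have "\<dots> \<le> 3 * (real N)\<^sup>2 * (1 + L) / (L * sqrt (ln L))"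
      using L Z N by (intro frac_le mult_left_mono) (auto simp: L_def)
    also have "\<dots> = (3 * (1 + L) / (L * sqrt (ln L))) * (real N)\<^sup>2" by simp
    also have "\<dots> \<le> \<eta> * (real N)\<^sup>2" using L by (intro mult_right_mono) auto
    finally show ?case .
  qed
qed

text \<open>Chebyshev's inequality. In the sum of \<open>(X - m)^2\<close> the first moment has a
  negative sign, so an upper bound for \<open>E2\<close> and a lower bound for \<open>E1\<close>
  suffice. With about \<open>N^2 / 2\<close> pairs the leading coefficients
  \<open>1 / 2 - 1 + 1 / 2\<close> cancel.\<close>

lemma concentration:
  assumes \<theta>: "0 < \<theta>" and \<eta>: "0 < \<eta>"
  shows "\<forall>\<^sub>F N in sequentially.
    real (card {(n, a) \<in> pairs N. \<theta> * mf N < \<bar>XX (Bf N) (euclid_list n a) - mf N\<bar>}) \<le> \<eta> * (real N)\<^sup>2"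
proof -
  define \<eta>' where "\<eta>' = \<eta> * \<theta>\<^sup>2 / 3"
  have \<eta>': "0 < \<eta>'" using \<theta> \<eta> by (simp add: \<eta>'_def)
  have "\<forall>\<^sub>F L::real in at_top. 0 < L * ln L" by real_asymp
  from eventually_ln_nat[OF this] E1_asymp[OF \<eta>'] E2_asymp[OF \<eta>'] show ?thesis
  proof eventually_elim
    case (elim N)
    let ?X = "\<lambda>z. XX (Bf N) (euclid_list (fst z) (snd z))" and ?m = "mf N"
    let ?A = "{z \<in> pairs N. \<theta> * ?m < \<bar>?X z - ?m\<bar>}"
    have m: "0 < ?m" using elim(1) by (simp add: mf_def)
    have "real (card ?A) * (\<theta> * ?m)\<^sup>2 = (\<Sum>z\<in>?A. (\<theta> * ?m)\<^sup>2)" by simp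
    also have "\<dots> \<le> (\<Sum>z\<in>?A. (?X z - ?m)\<^sup>2)"
    proof (rule sum_mono)
      fix z assume "z \<in> ?A"
      then have "(\<theta> * ?m)\<^sup>2 \<le> \<bar>?X z - ?m\<bar>\<^sup>2" using \<theta> m by (intro power_mono) auto
      then show "(\<theta> * ?m)\<^sup>2 \<le> (?X z - ?m)\<^sup>2" by simp
    qed
    also have "\<dots> \<le> (\<Sum>z\<in>pairs N. (?X z - ?m)\<^sup>2)" by (intro sum_mono2) auto
    also have "\<dots> = (\<Sum>z\<in>pairs N. (?X z)\<^sup>2 - 2 * ?m * ?X z + ?m\<^sup>2)"
      by (intro sum.cong refl) (simp add: power2_eq_square algebra_simps)
    also have "\<dots> = E2 (Bf N) N - 2 * ?m * E1 (Bf N) N + real (card (pairs N)) * ?m\<^sup>2"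
      by (simp add: E1_def E2_def case_prod_beta sum.distrib sum_subtractf sum_distrib_left)
    also have "\<dots> \<le> (1 / 2 + \<eta>') * ?m\<^sup>2 * (real N)\<^sup>2 - 2 * ?m * ((1 / 2 - \<eta>') * ?m * (real N)\<^sup>2) + (real N)\<^sup>2 / 2 * ?m\<^sup>2"
      using elim m card_pairs[of N] by (intro add_mono diff_mono mult_left_mono mult_right_mono) auto
    also have "\<dots> = 3 * \<eta>' * (real N)\<^sup>2 * ?m\<^sup>2" by (simp add: power2_eq_square algebra_simps)
    also have "\<dots> = \<eta> * (real N)\<^sup>2 * (\<theta> * ?m)\<^sup>2" by (simp add: \<eta>'_def power_mult_distrib)
    finally have "real (card ?A) \<le> \<eta> * (real N)\<^sup>2" using \<theta> m by (simp add: mult_le_cancel_right)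
    moreover have "?A = {(n, a) \<in> pairs N. \<theta> * mf N < \<bar>XX (Bf N) (euclid_list n a) - mf N\<bar>}" by auto
    ultimately show ?case by simp
  qed
qed

section \<open>Roots of unity\<close>

lemma euclid_list_cf:
  "coprime u v \<Longrightarrow> 1 \<le> v \<Longrightarrow> v < u \<Longrightarrow> cf_normal (euclid_list u v) \<and> cf_value (euclid_list u v) = real v / real u"
proof (induction v arbitrary: u rule: less_induct)
  case (less v)
  have props: "pos_list (euclid_list u v)" "euclid_list u v \<noteq> []" "1 < last (euclid_list u v)"
    using cf_mat_euclid_list[OF less.prems] by auto
  then have "cf_normal (euclid_list u v)" by (auto simp: cf_normal_def pos_list_def)
  moreover have "cf_value (euclid_list u v) = real v / real u"
  proof -
    have e: "euclid_list u v = u div v # euclid_list v (u mod v)" using less.prems by (simp add: euclid_list_rec)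
    have "real u = real (u div v * v + u mod v)" by simp
    then have d: "real (u div v) + real (u mod v) / real v = real u / real v"
      using less.prems by (simp only: of_nat_add of_nat_mult) (simp add: field_simps)
    have "cf_value (euclid_list v (u mod v)) = real (u mod v) / real v"
    proof (cases "u mod v = 0")
      case False
      have "coprime v (u mod v)" using less.prems(1) by (metis coprime_commute coprime_mod_right_iff less.prems(2) not_one_le_zero)
      then show ?thesis using less.IH[of "u mod v" v] False less.prems by simp
    qed simp
    then show ?thesis unfolding e by (simp add: d)
  qed
  ultimately show ?case by simp
qed

text \<open>Two further quotients at least double the continuant. The length of an expansion is
  therefore \<open>O(ln n)\<close>, which is negligible against the typical sum
  \<open>ln n ln ln n\<close>.\<close>

lemma two_power_length_le: "pos_list ys \<Longrightarrow> 2 ^ (length ys div 2) \<le> cU ys"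
proof (induction ys rule: induct_list012)
  case (2 b)
  then show ?case by simp
next
  case (3 b c ys)
  have "1 * (1 * cU ys) \<le> b * (c * cU ys)" using 3 by (intro mult_le_mono) auto
  then have "cU ys \<le> b * (c * cU ys)" by (simp only: mult_1)
  then have "2 * cU ys \<le> b * (c * cU ys + cV ys) + cU ys" unfolding distrib_left by linarith
  moreover have "2 ^ (length ys div 2) \<le> cU ys" using 3 by simp
  ultimately show ?case by simp
qed simp

lemma length_euclid_list_le:
  assumes "coprime u v" "1 \<le> v" "v < u"
  shows "real (length (euclid_list u v)) \<le> 4 * ln (real u) + 1"
proof -
  let ?l = "length (euclid_list u v)"
  have "2 ^ (?l div 2) \<le> u"
    using two_power_length_le[of "euclid_list u v"] cf_mat_euclid_list[OF assms] by simp
  then have "real (2 ^ (?l div 2)) \<le> real u" by (simp only: of_nat_le_iff)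
  then have "ln (2 ^ (?l div 2)) \<le> ln (real u)" by (intro ln_mono) auto
  then have "real (?l div 2) * ln 2 \<le> ln (real u)" by (simp add: ln_realpow)
  moreover have "1 / 2 \<le> ln (2::real)"
  proof -
    have "ln (1 / 2 :: real) \<le> 1 / 2 - 1" by (rule ln_le_minus_one) simp
    then show ?thesis by (simp add: ln_div)
  qed
  then have "real (?l div 2) * (1 / 2) \<le> real (?l div 2) * ln 2" by (intro mult_left_mono) auto
  moreover have "?l \<le> 2 * (?l div 2) + 1" by simp
  then have "real ?l \<le> real (2 * (?l div 2) + 1)" by (simp only: of_nat_le_iff)
  ultimately show ?thesis by simp
qed

text \<open>From \<open>ln (\<epsilon> b) \<le> \<epsilon> b - 1\<close>: the logarithms cost an
  arbitrarily small share of the sum and a constant per quotient. The second part is small exactly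
  when the sum is large compared with the length.\<close>

lemma cf_err_le:
  fixes \<epsilon> :: real
  assumes "0 < \<epsilon>"
  obtains K where "0 < K" "\<And>bs. \<forall>b\<in>set bs. 1 \<le> b \<Longrightarrow> cf_err bs \<le> \<epsilon> * real (sum_list bs) + K * real (length bs)"
proof
  define K where "K = 1 + \<bar>ln \<epsilon>\<bar>"
  show "0 < K" by (simp add: K_def)
  fix bs :: "nat list" assume "\<forall>b\<in>set bs. 1 \<le> b"
  then show "cf_err bs \<le> \<epsilon> * real (sum_list bs) + K * real (length bs)"
  proof (induction bs)
    case (Cons b bs)
    have b: "0 < real b" using Cons by simp
    have "ln (\<epsilon> * real b) \<le> \<epsilon> * real b - 1" using assms b by (intro ln_le_minus_one) simp
    then have "ln (real b) \<le> \<epsilon> * real b - 1 - ln \<epsilon>" using assms b by (simp add: ln_mult)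
    then have "1 + ln (real b) \<le> \<epsilon> * real b + K" unfolding K_def by linarith
    then show ?case using Cons by (simp add: algebra_simps)
  qed simp
qed

theorem ln_J41_asymp_cf_sum:
  assumes \<epsilon>: "0 < (\<epsilon>::real)"
  shows "\<exists>A::real. \<forall>\<alpha>::real. \<alpha> \<in> \<rat> \<and> 0 < \<alpha> \<and> \<alpha> < 1 \<and> real (cf_sum \<alpha>) > A * real (cf_len \<alpha>) \<longrightarrow>
            \<bar>ln (J41 (ee \<alpha>)) / (2 * kap * real (cf_sum \<alpha>)) - 1\<bar> < \<epsilon>"
proof -
  obtain C where C: "C > 0" "\<And>bs p n. cf_normal bs \<Longrightarrow> coprime p n \<Longrightarrow> n > 0 \<Longrightarrow> cf_value bs = real p / real n \<Longrightarrow>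
      \<bar>ln (J41 (ee (cf_value bs))) - 2 * kap * real (sum_list bs)\<bar> \<le> C * cf_err bs" by (rule ln_J41_bounds) blast
  \<comment> \<open>Both parts of the error are at most \<epsilon>' times the sum, and
    \<open>2 C\<close> times \<epsilon>' equals \<open>\<epsilon> kap\<close>.\<close>
  define \<epsilon>' where "\<epsilon>' = \<epsilon> * kap / (2 * C)"
  have \<epsilon>': "0 < \<epsilon>'" using \<epsilon> C kap_pos by (simp add: \<epsilon>'_def)
  obtain K where K: "0 < K" "\<And>bs. \<forall>b\<in>set bs. 1 \<le> b \<Longrightarrow> cf_err bs \<le> \<epsilon>' * real (sum_list bs) + K * real (length bs)"
    using cf_err_le[OF \<epsilon>'] by blast
  show ?thesis
  proof (intro exI[of _ "K / \<epsilon>'"] allI impI)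
    fix \<alpha> :: real
    assume \<alpha>: "\<alpha> \<in> \<rat> \<and> 0 < \<alpha> \<and> \<alpha> < 1 \<and> real (cf_sum \<alpha>) > K / \<epsilon>' * real (cf_len \<alpha>)"
    then have "cf_normal (cf_of \<alpha>) \<and> cf_value (cf_of \<alpha>) = \<alpha>"
      unfolding cf_of_def by (intro theI'[OF cf_of_unique_existence]) simp_all
    then have bs: "cf_normal (cf_of \<alpha>)" "cf_value (cf_of \<alpha>) = \<alpha>" by auto
    from \<alpha> obtain p n where pn: "n \<noteq> 0" "\<bar>\<alpha>\<bar> = real p / real n" "coprime p n"
      using Rats_abs_nat_div_natE by blast
    then have "cf_value (cf_of \<alpha>) = real p / real n" using bs \<alpha> by simp
    from C(2)[OF bs(1) pn(3) _ this] have J: "\<bar>ln (J41 (ee \<alpha>)) - 2 * kap * real (cf_sum \<alpha>)\<bar> \<le> C * cf_err (cf_of \<alpha>)"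
      using pn bs by (simp add: cf_sum_def)
    let ?S = "real (cf_sum \<alpha>)"
    have "cf_err (cf_of \<alpha>) \<le> \<epsilon>' * ?S + K * real (cf_len \<alpha>)"
      using K(2)[of "cf_of \<alpha>"] bs by (auto simp: cf_normal_def cf_sum_def cf_len_def)
    moreover have lt: "K * real (cf_len \<alpha>) < \<epsilon>' * ?S" using \<alpha> \<epsilon>' by (simp add: field_simps)
    moreover have "0 \<le> K * real (cf_len \<alpha>)" using K by simp
    ultimately have e: "cf_err (cf_of \<alpha>) < 2 * \<epsilon>' * ?S" and "0 < \<epsilon>' * ?S" by linarith+
    then have S: "0 < ?S" using \<epsilon>' zero_less_mult_pos by blast
    have "C * cf_err (cf_of \<alpha>) < C * (2 * \<epsilon>' * ?S)" using e C by (intro mult_strict_left_mono)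
    also have "\<dots> = \<epsilon> * (kap * ?S)" using C by (simp add: \<epsilon>'_def)
    also have "\<dots> \<le> \<epsilon> * (2 * kap * ?S)" using \<epsilon> kap_pos S by (intro mult_left_mono) auto
    finally have lt2: "\<bar>ln (J41 (ee \<alpha>)) - 2 * kap * ?S\<bar> < \<epsilon> * (2 * kap * ?S)" using J by linarith
    have D: "0 < 2 * kap * ?S" using kap_pos S by simp
    then have D0: "2 * kap * ?S \<noteq> 0" by linarith
    have "ln (J41 (ee \<alpha>)) / (2 * kap * ?S) - 1 = (ln (J41 (ee \<alpha>)) - 2 * kap * ?S) / (2 * kap * ?S)"
      by (simp only: diff_divide_distrib divide_self[OF D0])
    then have "\<bar>ln (J41 (ee \<alpha>)) / (2 * kap * ?S) - 1\<bar> = \<bar>ln (J41 (ee \<alpha>)) - 2 * kap * ?S\<bar> / (2 * kap * ?S)"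
      using D by (simp only: abs_divide abs_of_pos)
    also have "\<dots> < \<epsilon>" using lt2 D by (simp only: pos_divide_less_eq)
    finally show "\<bar>ln (J41 (ee \<alpha>)) / (2 * kap * real (cf_sum \<alpha>)) - 1\<bar> < \<epsilon>" .
  qed
qed

text \<open>Every pair is a multiple of a coprime one. Hence the other pairs make up at most the
  fraction \<open>pi^2 / 6 - 1 < 1\<close>, the sum of \<open>1 / d^2\<close> over
  \<open>d \<ge> 2\<close>, of \<open>N^2 / 2\<close>.\<close>

lemma cop_count_lower: "\<forall>\<^sub>F N in sequentially. (real N)\<^sup>2 / 20 \<le> real (card (cop N))"
proof -
  define P where "P N = real (card (cop N))" for N
  have P_le: "P N \<le> (real N)\<^sup>2 / 2" for N
    unfolding P_def using card_pairs[of N] card_mono[OF finite_pairs cop_subset, of N] by linarith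
  have sub: "pairs N \<subseteq> (\<Union>d\<in>{1..N}. (\<lambda>(u, v). (d * u, d * v)) ` cop (N div d))" for N
  proof
    fix z assume "z \<in> pairs N"
    then obtain n a where z: "z = (n, a)" "1 \<le> a" "a < n" "n \<le> N" by (auto simp: pairs_def)
    define d where "d = gcd n a"
    have d: "1 \<le> d" using z by (simp add: d_def Suc_le_eq)
    obtain u v where uv: "n = d * u" "a = d * v" "coprime u v"
      using gcd_coprime_exists[of n a] z unfolding d_def by (metis gcd_pos_nat mult.commute not_gr_zero not_one_le_zero gcd_eq_0_iff)
    have "1 \<le> v" "v < u" "u \<le> N div d" using z uv d by (auto simp: less_eq_div_iff_mult_less_eq mult.commute Suc_le_eq)
    moreover have "d \<le> d * u" using \<open>v < u\<close> by simp
    then have "d \<le> N" using z uv by linarith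
    ultimately show "z \<in> (\<Union>d\<in>{1..N}. (\<lambda>(u, v). (d * u, d * v)) ` cop (N div d))"
      using d uv z by (intro UN_I[of d] image_eqI[of _ _ "(u, v)"]) (auto simp: cop_def)
  qed
  have main: "(real N)\<^sup>2 / 2 - real N / 2 \<le> P N + (pi\<^sup>2 / 6 - 1) * ((real N)\<^sup>2 / 2)" if N: "1 \<le> N" for N
  proof -
    have "pairs N = (SIGMA n:{..N}. {1..<n})" by (auto simp: pairs_def)
    then have c: "card (pairs N) = (\<Sum>n\<le>N. n - 1)" by simp
    have "2 * (\<Sum>n\<le>N. n - 1) + N = N * N" by (induction N) auto
    then have "real (2 * (\<Sum>n\<le>N. n - 1) + N) = real (N * N)" by (simp only:)
    then have cp: "(real N)\<^sup>2 / 2 - real N / 2 = real (card (pairs N))"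
      unfolding c by (simp add: power2_eq_square)
    have "card (pairs N) \<le> card (\<Union>d\<in>{1..N}. (\<lambda>(u, v). (d * u, d * v)) ` cop (N div d))"
      by (rule card_mono[OF _ sub]) auto
    also have "\<dots> \<le> (\<Sum>d=1..N. card ((\<lambda>(u, v). (d * u, d * v)) ` cop (N div d)))"
      by (rule card_UN_le) simp
    also have "\<dots> \<le> (\<Sum>d=1..N. card (cop (N div d)))" by (intro sum_mono card_image_le) simp
    finally have "real (card (pairs N)) \<le> (\<Sum>d=1..N. P (N div d))" unfolding P_def by (simp flip: of_nat_sum)
    also have "\<dots> = P N + (\<Sum>d=2..N. P (N div d))" using N by (subst sum.atLeast_Suc_atMost) (auto simp: numeral_2_eq_2)
    also have "(\<Sum>d=2..N. P (N div d)) \<le> (\<Sum>d=2..N. 1 / (real d)\<^sup>2 * ((real N)\<^sup>2 / 2))"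
    proof (rule sum_mono)
      fix d
      have "P (N div d) \<le> (real (N div d))\<^sup>2 / 2" by (rule P_le)
      also have "\<dots> \<le> (real N / real d)\<^sup>2 / 2" by (intro divide_right_mono power_mono of_nat_div_le_of_nat) auto
      finally show "P (N div d) \<le> 1 / (real d)\<^sup>2 * ((real N)\<^sup>2 / 2)" by (simp add: power_divide)
    qed
    also have "\<dots> = (zeta2 N - 1) * ((real N)\<^sup>2 / 2)"
    proof -
      have "zeta2 N = 1 + (\<Sum>d=2..N. 1 / (real d)\<^sup>2)"
        unfolding zeta2_def using N by (subst sum.atLeast_Suc_atMost) (auto simp: numeral_2_eq_2)
      then show ?thesis by (simp add: sum_distrib_right)
    qed
    also have "\<dots> \<le> (pi\<^sup>2 / 6 - 1) * ((real N)\<^sup>2 / 2)" using zeta2_le[of N] by (intro mult_right_mono) auto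
    finally show ?thesis unfolding cp by simp
  qed
  have "pi < 32 / 10" using pi_approx by simp
  then have "pi * pi \<le> (32 / 10) * (32 / 10)" by (intro mult_mono) auto
  then have pi2: "pi\<^sup>2 / 6 - 1 \<le> 18 / 25" by (simp add: power2_eq_square)
  have "\<forall>\<^sub>F N in sequentially. (10::nat) \<le> N" by (rule eventually_ge_at_top)
  then show ?thesis
  proof eventually_elim
    case (elim N)
    define Q where "Q = (pi\<^sup>2 / 6 - 1) * ((real N)\<^sup>2 / 2)"
    have "Q \<le> 18 / 25 * ((real N)\<^sup>2 / 2)" unfolding Q_def using pi2 by (intro mult_right_mono) auto
    moreover have "real N * 10 \<le> real N * real N" using elim by (intro mult_left_mono) auto
    then have "real N * 10 \<le> (real N)\<^sup>2" by (simp only: power2_eq_square)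
    moreover have "(real N)\<^sup>2 / 2 - real N / 2 \<le> P N + Q" unfolding Q_def using main[of N] elim by simp
    ultimately have "(real N)\<^sup>2 / 20 \<le> P N" by linarith
    then show ?case by (simp add: P_def)
  qed
qed

lemma ee_power: "ee x ^ j = ee (real j * x)"
  by (simp add: ee_def exp_of_nat_mult[symmetric] mult_ac)

lemma ee_eq_1_iff: "ee x = 1 \<longleftrightarrow> x \<in> \<int>"
proof -
  have "cmod (1 - ee x) = sn x" using cmod_one_minus_ee[of x 1] by simp
  then have "ee x = 1 \<longleftrightarrow> sn x = 0" by (metis norm_eq_zero right_minus_eq)
  then show ?thesis using sn_pos_iff[of x] sn_nonneg[of x] by linarith
qed

lemma ee_eq_iff: "ee x = ee y \<longleftrightarrow> x - y \<in> \<int>"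
proof -
  have "ee y \<noteq> 0" by (simp add: ee_def)
  moreover have "ee (x - y) = ee x / ee y" by (simp add: ee_def exp_diff right_diff_distrib)
  ultimately show ?thesis using ee_eq_1_iff[of "x - y"] by simp
qed

lemma unity_order_ee:
  assumes "coprime a n" "0 < n"
  shows "unity_order (ee (real a / real n)) = n"
  unfolding unity_order_def
proof (rule Least_equality)
  have "real n * (real a / real n) = of_nat a" using assms by simp
  then have "ee (real a / real n) ^ n = 1" unfolding ee_power ee_eq_1_iff by (simp only: Ints_of_nat)
  then show "0 < n \<and> ee (real a / real n) ^ n = 1" using assms by simp
next
  fix m assume m: "0 < m \<and> ee (real a / real n) ^ m = 1"
  then have "real m * (real a / real n) \<in> \<int>" unfolding ee_power ee_eq_1_iff by simp
  then show "n \<le> m" using rational_multiple_not_int[OF assms(1), of m] m by (meson not_le)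
qed

text \<open>Roots of exact order \<open>n \<ge> 2\<close> correspond to the residues prime to n;
  \<open>cop\<close> misses only the root 1.\<close>

lemma unity_roots_upto_eq:
  "unity_roots_upto N \<subseteq> insert 1 ((\<lambda>(n, a). ee (real a / real n)) ` cop N)"
  "(\<lambda>(n, a). ee (real a / real n)) ` cop N \<subseteq> unity_roots_upto N"
  "inj_on (\<lambda>(n, a). ee (real a / real n)) (cop N)"
proof -
  show "unity_roots_upto N \<subseteq> insert 1 ((\<lambda>(n, a). ee (real a / real n)) ` cop N)"
  proof
    fix q assume "q \<in> unity_roots_upto N"
    then obtain n0 where n0: "0 < n0" "q ^ n0 = 1" and oN: "unity_order q \<le> N" by (auto simp: unity_roots_upto_def)
    from n0 obtain k where k: "k < n0" "q = cis (2 * pi * real k / real n0)"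
      using Complex.bij_betw_roots_unity[OF n0(1)] unfolding bij_betw_def by blast
    have q: "q = ee (real k / real n0)"
      unfolding k ee_def cis_conv_exp by (simp add: mult_ac)
    show "q \<in> insert 1 ((\<lambda>(n, a). ee (real a / real n)) ` cop N)"
    proof (cases "k = 0")
      case True
      then show ?thesis using q by (simp add: ee_def)
    next
      case False
      define g where "g = gcd k n0"
      have g: "0 < g" using False by (simp add: g_def)
      obtain a n where an: "k = a * g" "n0 = n * g" "coprime a n"
        using gcd_coprime_exists[of k n0] g unfolding g_def by auto
      have n: "0 < n" "0 < a" "a < n" using an n0 k False by auto
      have e: "real k / real n0 = real a / real n" using an g by simp
      have "unity_order q = n" unfolding q e using an n by (intro unity_order_ee)
      then have "(n, a) \<in> cop N" using n an oN by (auto simp: cop_def coprime_commute)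
      then show ?thesis unfolding q e by force
    qed
  qed
  have cop: "coprime a n \<and> 0 < n \<and> 0 < a \<and> a < n \<and> n \<le> N" if "(n, a) \<in> cop N" for n a
    using that by (auto simp: cop_def coprime_commute)
  show "(\<lambda>(n, a). ee (real a / real n)) ` cop N \<subseteq> unity_roots_upto N"
  proof
    fix q assume "q \<in> (\<lambda>(n, a). ee (real a / real n)) ` cop N"
    then obtain n a where q: "q = ee (real a / real n)" "(n, a) \<in> cop N" by auto
    have "real n * (real a / real n) = of_nat a" using cop[OF q(2)] by simp
    then have "q ^ n = 1" unfolding q ee_power ee_eq_1_iff by (simp only: Ints_of_nat)
    then show "q \<in> unity_roots_upto N"
      using unity_order_ee[of a n] cop[OF q(2)] q by (auto simp: unity_roots_upto_def)
  qed
  show "inj_on (\<lambda>(n, a). ee (real a / real n)) (cop N)"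
  proof (rule inj_onI)
    fix z w assume z: "z \<in> cop N" "w \<in> cop N" "(case z of (n, a) \<Rightarrow> ee (real a / real n)) = (case w of (n, a) \<Rightarrow> ee (real a / real n))"
    obtain n a n' a' where e: "z = (n, a)" "w = (n', a')" by (metis prod.exhaust)
    have c: "coprime a n \<and> 0 < n \<and> 0 < a \<and> a < n \<and> n \<le> N" "coprime a' n' \<and> 0 < n' \<and> 0 < a' \<and> a' < n' \<and> n' \<le> N"
      using cop z e by auto
    have eq: "ee (real a / real n) = ee (real a' / real n')" using z e by simp
    then have nn: "n = n'" using unity_order_ee c by metis
    from eq obtain k :: int where "real a / real n - real a' / real n' = of_int k"
      unfolding ee_eq_iff by (auto elim: Ints_cases)
    then have "real a - real a' = of_int k * real n" using nn c by (simp add: field_simps)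
    then have "int a - int a' = k * int n"
      by (metis of_int_diff of_int_eq_iff of_int_mult of_int_of_nat_eq)
    moreover have "\<bar>int a - int a'\<bar> < int n" using c nn by auto
    ultimately have "int a - int a' = 0"
      by (metis dvd_triv_right dvd_imp_le_int linorder_not_le abs_of_nat)
    then show "z = w" using nn e by simp
  qed
qed

lemma finite_unity_roots_upto: "finite (unity_roots_upto N)"
  using unity_roots_upto_eq(1) by (rule finite_subset) simp

lemma XX_eq_sum_list: "\<forall>b\<in>set bs. b \<le> B \<Longrightarrow> XX B bs = real (sum_list bs)"
  by (induction bs) auto

text \<open>For \<open>n \<ge> N / ln N\<close> the quantities \<open>ln n ln ln n\<close> and
  \<open>ln N ln ln N\<close> are asymptotically equal, which converts concentration around
  \<open>mf N\<close> into a statement about n.\<close>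

lemma typical_J41:
  assumes \<epsilon>: "0 < (\<epsilon>::real)"
  obtains \<theta> where "0 < \<theta>" "\<forall>\<^sub>F N in sequentially. \<forall>n a. (n, a) \<in> cop N \<longrightarrow> real N / ln (real N) \<le> real n \<longrightarrow>
      \<not> (\<exists>b\<in>set (euclid_list n a). Bf N < b) \<longrightarrow> \<bar>XX (Bf N) (euclid_list n a) - mf N\<bar> \<le> \<theta> * mf N \<longrightarrow>
      \<bar>ln (J41 (ee (real a / real n))) - 12 / pi\<^sup>2 * (2 * kap) * ln (real n) * ln (ln (real n))\<bar>
        \<le> \<epsilon> * ln (real n) * ln (ln (real n))"
proof -
  obtain C where C: "C > 0" "\<And>bs p n. cf_normal bs \<Longrightarrow> coprime p n \<Longrightarrow> n > 0 \<Longrightarrow> cf_value bs = real p / real n \<Longrightarrow>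
      \<bar>ln (J41 (ee (cf_value bs))) - 2 * kap * real (sum_list bs)\<bar> \<le> C * cf_err bs" by (rule ln_J41_bounds) blast
  \<comment> \<open>The errors below add up to \<theta> times
    \<open>(16 kap + 8) ln n ln ln n\<close>; the bound 1 / 2 ensures that m is at most twice
    M.\<close>
  define \<theta> where "\<theta> = min (1 / 2) (\<epsilon> / (16 * kap + 12))"
  have \<theta>: "0 < \<theta>" "\<theta> \<le> 1 / 2" "\<theta> * (16 * kap + 12) \<le> \<epsilon>"
  proof -
    show "0 < \<theta>" using \<epsilon> kap_pos by (simp add: \<theta>_def)
    show "\<theta> \<le> 1 / 2" unfolding \<theta>_def by (rule min.cobounded1)
    have "\<theta> \<le> \<epsilon> / (16 * kap + 12)" unfolding \<theta>_def by (rule min.cobounded2)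
    then show "\<theta> * (16 * kap + 12) \<le> \<epsilon>" using kap_pos by (subst (asm) pos_le_divide_eq) auto
  qed
  define \<epsilon>' where "\<epsilon>' = \<theta> / (2 * C)"
  have \<epsilon>': "0 < \<epsilon>'" using \<theta> C by (simp add: \<epsilon>'_def)
  obtain K where K: "0 < K" "\<And>bs. \<forall>b\<in>set bs. 1 \<le> b \<Longrightarrow> cf_err bs \<le> \<epsilon>' * real (sum_list bs) + K * real (length bs)"
    using cf_err_le[OF \<epsilon>'] by blast
  let ?c = "12 / pi\<^sup>2"
  have pi3: "9 \<le> pi\<^sup>2" using pi_gt3 power_mono[of 3 pi 2] by simp
  then have c2: "0 < ?c" "?c \<le> 2" by (auto simp: divide_le_eq)
  have "((\<lambda>L::real. (L - ln L) * ln (L - ln L) / (L * ln L)) \<longlongrightarrow> 1) at_top" by real_asymp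
  then have "\<forall>\<^sub>F L::real in at_top. 1 - \<theta> < (L - ln L) * ln (L - ln L) / (L * ln L)"
    using \<theta> by (intro order_tendstoD(1)) auto
  moreover have "((\<lambda>L::real. C * K * (4 * L + 1) / (?c * (L * ln L))) \<longlongrightarrow> 0) at_top"
  proof -
    have "((\<lambda>L::real. (4 * L + 1) / (L * ln L)) \<longlongrightarrow> 0) at_top" by real_asymp
    then have "((\<lambda>L::real. (C * K / ?c) * ((4 * L + 1) / (L * ln L))) \<longlongrightarrow> (C * K / ?c) * 0) at_top" by (rule tendsto_mult[OF tendsto_const])
    then show ?thesis by (simp add: mult_ac)
  qed
  then have "\<forall>\<^sub>F L::real in at_top. C * K * (4 * L + 1) / (?c * (L * ln L)) < \<theta>"
    using \<theta> by (intro order_tendstoD(2)) auto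
  moreover have "\<forall>\<^sub>F L::real in at_top. 1 < L - ln L \<and> 0 < ln L \<and> 1 < L \<and> 0 < L * ln L" by (intro eventually_conj) real_asymp+
  ultimately have "\<forall>\<^sub>F L::real in at_top. 1 - \<theta> < (L - ln L) * ln (L - ln L) / (L * ln L) \<and>
     C * K * (4 * L + 1) / (?c * (L * ln L)) < \<theta> \<and> 1 < L - ln L \<and> 0 < ln L \<and> 1 < L \<and> 0 < L * ln L" by eventually_elim auto
  from eventually_ln_nat[OF this] eventually_gt_at_top[of 0] have ev: "\<forall>\<^sub>F N in sequentially. \<forall>n a. (n, a) \<in> cop N \<longrightarrow> real N / ln (real N) \<le> real n \<longrightarrow>
      \<not> (\<exists>b\<in>set (euclid_list n a). Bf N < b) \<longrightarrow> \<bar>XX (Bf N) (euclid_list n a) - mf N\<bar> \<le> \<theta> * mf N \<longrightarrow>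
      \<bar>ln (J41 (ee (real a / real n))) - ?c * (2 * kap) * ln (real n) * ln (ln (real n))\<bar>
        \<le> \<epsilon> * ln (real n) * ln (ln (real n))"
  proof eventually_elim
    case (elim N)
    define L where "L = ln (real N)"
    define m where "m = mf N"
    have L: "1 - \<theta> < (L - ln L) * ln (L - ln L) / (L * ln L)" "C * K * (4 * L + 1) / (?c * (L * ln L)) < \<theta>"
      "1 < L - ln L" "0 < ln L" "1 < L" "0 < L * ln L" and N: "0 < N" using elim unfolding L_def by blast+
    have m: "m = ?c * (L * ln L)" by (simp add: m_def mf_def L_def)
    have m0: "0 < m" unfolding m using c2(1) L(6) by (rule mult_pos_pos)
    show ?case
    proof (intro allI impI)
      fix n a assume na: "(n, a) \<in> cop N" "real N / ln (real N) \<le> real n"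
        "\<not> (\<exists>b\<in>set (euclid_list n a). Bf N < b)" "\<bar>XX (Bf N) (euclid_list n a) - mf N\<bar> \<le> \<theta> * mf N"
      let ?bs = "euclid_list n a"
      have cp: "coprime n a" "1 \<le> a" "a < n" "n \<le> N" using na(1) by (auto simp: cop_def)
      note cf = euclid_list_cf[OF cp(1-3)]
      define S where "S = real (sum_list ?bs)"
      have "XX (Bf N) ?bs = S" unfolding S_def using na(3) by (intro XX_eq_sum_list) (auto simp: not_less)
      then have Sm: "\<bar>S - m\<bar> \<le> \<theta> * m" using na(4) by (simp add: m_def)
      then have S2: "S \<le> 2 * m" using \<theta>(2) m0 mult_right_mono[of \<theta> "1 / 2" m] by linarith
      have "\<bar>ln (J41 (ee (cf_value ?bs))) - 2 * kap * real (sum_list ?bs)\<bar> \<le> C * cf_err ?bs"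
        using cf cp by (intro C(2)[of ?bs a n]) (auto simp: coprime_commute)
      then have J: "\<bar>ln (J41 (ee (real a / real n))) - 2 * kap * S\<bar> \<le> C * cf_err ?bs"
        using cf by (simp add: S_def)
      have lnn: "ln (real n) \<le> L" using cp unfolding L_def by (intro ln_mono) auto
      have "cf_err ?bs \<le> \<epsilon>' * S + K * real (length ?bs)"
        unfolding S_def using cf by (intro K(2)) (auto simp: cf_normal_def)
      also have "\<epsilon>' * S \<le> \<epsilon>' * (2 * m)" using S2 \<epsilon>' by (intro mult_left_mono) auto
      also have "K * real (length ?bs) \<le> K * (4 * L + 1)"
        using length_euclid_list_le[OF cp(1-3)] lnn K(1) by (intro mult_left_mono) auto
      finally have "cf_err ?bs \<le> \<epsilon>' * (2 * m) + K * (4 * L + 1)" by simp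
      then have "C * cf_err ?bs \<le> C * (\<epsilon>' * (2 * m) + K * (4 * L + 1))" using C(1) by (intro mult_left_mono) auto
      also have "\<dots> = \<theta> * m + C * K * (4 * L + 1)" using C(1) by (simp add: \<epsilon>'_def distrib_left)
      also have "C * K * (4 * L + 1) \<le> \<theta> * m"
        using L(2) m0 unfolding m[symmetric] by (simp only: pos_divide_less_eq less_imp_le)
      finally have J1: "\<bar>ln (J41 (ee (real a / real n))) - 2 * kap * S\<bar> \<le> 2 * (\<theta> * m)" using J by linarith
      have "\<bar>2 * kap * S - 2 * kap * m\<bar> = 2 * kap * \<bar>S - m\<bar>"
        using kap_pos by (simp add: right_diff_distrib[symmetric] abs_mult)
      also have "\<dots> \<le> 2 * kap * (\<theta> * m)" using Sm kap_pos by (intro mult_left_mono) auto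
      finally have J2: "\<bar>2 * kap * S - 2 * kap * m\<bar> \<le> 2 * kap * (\<theta> * m)" .
      define M where "M = ?c * (ln (real n) * ln (ln (real n)))"
      have n0: "0 < real n" using cp by simp
      have "ln (real N / ln (real N)) \<le> ln (real n)"
        using na(2) N L unfolding L_def[symmetric] by (intro ln_mono) auto
      then have lnl: "L - ln L \<le> ln (real n)" using N L by (simp add: ln_div L_def[symmetric])
      have ll: "ln (L - ln L) \<le> ln (ln (real n))" "ln (ln (real n)) \<le> ln L" "0 \<le> ln (L - ln L)"
        using lnl lnn L by (auto intro!: ln_mono)
      have "(1 - \<theta>) * (L * ln L) \<le> (L - ln L) * ln (L - ln L)"
        using L(1,6) by (simp only: pos_less_divide_eq less_imp_le)
      also have "\<dots> \<le> ln (real n) * ln (ln (real n))" using lnl ll L by (intro mult_mono) auto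
      finally have "?c * ((1 - \<theta>) * (L * ln L)) \<le> M" unfolding M_def using c2 by (intro mult_left_mono) auto
      then have M1: "(1 - \<theta>) * m \<le> M" unfolding m by (simp add: mult_ac)
      have "0 \<le> ln (ln (real n))" using ll by linarith
      then have "ln (real n) * ln (ln (real n)) \<le> L * ln L" using lnn ll L(5) by (intro mult_mono) linarith+
      then have M2: "M \<le> m" unfolding M_def m using c2 by (intro mult_left_mono) auto
      have "\<bar>2 * kap * m - 2 * kap * M\<bar> = 2 * kap * (m - M)"
        using kap_pos M2 by (simp add: right_diff_distrib[symmetric] abs_mult)
      also have "\<dots> \<le> 2 * kap * (\<theta> * m)" using M1 kap_pos by (intro mult_left_mono) (auto simp: algebra_simps)
      finally have J3: "\<bar>2 * kap * m - 2 * kap * M\<bar> \<le> 2 * kap * (\<theta> * m)" .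
      have "(1 / 2) * m \<le> (1 - \<theta>) * m" using \<theta> m0 by (intro mult_right_mono) auto
      then have mM: "m \<le> 2 * M" using M1 by linarith
      have "\<bar>ln (J41 (ee (real a / real n))) - 2 * kap * M\<bar> \<le> 2 * (\<theta> * m) + 2 * kap * (\<theta> * m) + 2 * kap * (\<theta> * m)"
        using J1 J2 J3 by linarith
      also have "\<dots> = (2 * \<theta> + 4 * kap * \<theta>) * m" by (simp add: algebra_simps)
      also have "\<dots> \<le> (2 * \<theta> + 4 * kap * \<theta>) * (2 * M)" using mM \<theta> kap_pos by (intro mult_left_mono) auto
      also have "\<dots> \<le> (2 * \<theta> + 4 * kap * \<theta>) * (4 * (ln (real n) * ln (ln (real n))))"
      proof (intro mult_left_mono)
        have "0 \<le> ln (real n) * ln (ln (real n))" using lnl ll L by (intro mult_nonneg_nonneg) auto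
        then have "M \<le> 2 * (ln (real n) * ln (ln (real n)))" unfolding M_def using c2 by (intro mult_right_mono)
        then show "2 * M \<le> 4 * (ln (real n) * ln (ln (real n)))" by simp
      qed (use \<theta> kap_pos in auto)
      also have "\<dots> = (\<theta> * (16 * kap + 8)) * (ln (real n) * ln (ln (real n)))" by (simp add: algebra_simps)
      also have "\<dots> \<le> \<epsilon> * (ln (real n) * ln (ln (real n)))"
      proof (intro mult_right_mono)
        have "\<theta> * (16 * kap + 8) \<le> \<theta> * (16 * kap + 12)" using \<theta> by (intro mult_left_mono) auto
        then show "\<theta> * (16 * kap + 8) \<le> \<epsilon>" using \<theta> by linarith
        show "0 \<le> ln (real n) * ln (ln (real n))" using lnl ll L by (intro mult_nonneg_nonneg) auto
      qed
      finally show "\<bar>ln (J41 (ee (real a / real n))) - ?c * (2 * kap) * ln (real n) * ln (ln (real n))\<bar>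
        \<le> \<epsilon> * ln (real n) * ln (ln (real n))" by (simp add: M_def mult_ac)
    qed
  qed
  show ?thesis by (rule that[OF \<theta>(1) ev])
qed

theorem ln_J41_almost_all:
  assumes \<epsilon>: "0 < (\<epsilon>::real)"
  shows "(\<lambda>N::nat. real (card {q \<in> unity_roots_upto N.
            \<bar>ln (J41 q) - 12 / pi\<^sup>2 * (2 * kap) * ln (real (unity_order q)) * ln (ln (real (unity_order q)))\<bar>
              > \<epsilon> * ln (real (unity_order q)) * ln (ln (real (unity_order q)))})
         / real (card (unity_roots_upto N))) \<longlonglongrightarrow> 0"
proof -
  define bad where "bad q \<longleftrightarrow> \<bar>ln (J41 q) - 12 / pi\<^sup>2 * (2 * kap) * ln (real (unity_order q)) * ln (ln (real (unity_order q)))\<bar>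
              > \<epsilon> * ln (real (unity_order q)) * ln (ln (real (unity_order q)))" for q
  let ?R = "\<lambda>N. real (card {q \<in> unity_roots_upto N. bad q}) / real (card (unity_roots_upto N))"
  obtain \<theta> where \<theta>: "0 < \<theta>" "\<forall>\<^sub>F N in sequentially. \<forall>n a. (n, a) \<in> cop N \<longrightarrow> real N / ln (real N) \<le> real n \<longrightarrow>
      \<not> (\<exists>b\<in>set (euclid_list n a). Bf N < b) \<longrightarrow> \<bar>XX (Bf N) (euclid_list n a) - mf N\<bar> \<le> \<theta> * mf N \<longrightarrow>
      \<bar>ln (J41 (ee (real a / real n))) - 12 / pi\<^sup>2 * (2 * kap) * ln (real n) * ln (ln (real n))\<bar>
        \<le> \<epsilon> * ln (real n) * ln (ln (real n))"
    using typical_J41[OF \<epsilon>] by blast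
  have "\<forall>\<^sub>F N in sequentially. ?R N < \<eta>" if \<eta>: "0 < \<eta>" for \<eta>
  proof -
    \<comment> \<open>At most \<open>5 h N^2\<close> exceptional roots among at least
      \<open>N^2 / 20\<close> give the proportion \<open>100 h\<close>.\<close>
    define h where "h = \<eta> / 200"
    have h: "0 < h" using \<eta> by (simp add: h_def)
    have "((\<lambda>N. 1 / ln (real N)) \<longlongrightarrow> 0) sequentially" by real_asymp
    then have "\<forall>\<^sub>F N in sequentially. 1 / ln (real N) < h" using h by (rule order_tendstoD(2))
    moreover have "((\<lambda>N. 1 / real N) \<longlongrightarrow> 0) sequentially" by real_asymp
    then have "\<forall>\<^sub>F N in sequentially. 1 / real N < h" using h by (rule order_tendstoD(2))
    moreover note \<theta>(2) tail_asymp[OF h] concentration[OF \<theta>(1) h] cop_count_lower eventually_gt_at_top[of 0]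
    ultimately show ?thesis
    proof eventually_elim
      case (elim N)
      have N: "0 < (real N)\<^sup>2" using elim by simp
      let ?T = "{(n, a) \<in> pairs N. \<exists>b\<in>set (euclid_list n a). Bf N < b}"
      let ?D = "{(n, a) \<in> pairs N. \<theta> * mf N < \<bar>XX (Bf N) (euclid_list n a) - mf N\<bar>}"
      let ?Y = "{n. real n < real N / ln (real N)} \<inter> {..N}"
      let ?g = "\<lambda>(n, a). ee (real a / real n)"
      \<comment> \<open>Four ways to be exceptional: the root 1, a small denominator, a quotient
        above the truncation, or a truncated sum far from its mean.\<close>
      have sub: "{q \<in> unity_roots_upto N. bad q} \<subseteq> insert 1 (?g ` (?Y \<times> {..<N} \<union> (?T \<union> ?D)))"
      proof
        fix q assume q: "q \<in> {q \<in> unity_roots_upto N. bad q}"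
        show "q \<in> insert 1 (?g ` (?Y \<times> {..<N} \<union> (?T \<union> ?D)))"
        proof (cases "q = 1")
          case False
          then obtain n a where na: "(n, a) \<in> cop N" "q = ee (real a / real n)"
            using q unity_roots_upto_eq(1)[of N] by auto
          have c: "coprime a n" "0 < n" "a < n" "n \<le> N" using na(1) by (auto simp: cop_def coprime_commute)
          have o: "unity_order q = n" unfolding na(2) using c by (intro unity_order_ee)
          have p: "(n, a) \<in> pairs N" using na(1) cop_subset by blast
          have "(n, a) \<in> ?Y \<times> {..<N} \<union> (?T \<union> ?D)"
          proof (rule ccontr)
            assume n: "(n, a) \<notin> ?Y \<times> {..<N} \<union> (?T \<union> ?D)"
            then have "real N / ln (real N) \<le> real n" "\<not> (\<exists>b\<in>set (euclid_list n a). Bf N < b)"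
              "\<bar>XX (Bf N) (euclid_list n a) - mf N\<bar> \<le> \<theta> * mf N" using p c by auto
            then have "\<bar>ln (J41 (ee (real a / real n))) - 12 / pi\<^sup>2 * (2 * kap) * ln (real n) * ln (ln (real n))\<bar>
              \<le> \<epsilon> * ln (real n) * ln (ln (real n))" using elim(3) na(1) by blast
            then have "\<not> bad q" unfolding bad_def o unfolding na(2) by linarith
            then show False using q by simp
          qed
          then show ?thesis unfolding na(2) by force
        qed simp
      qed
      have fin: "finite (?Y \<times> {..<N})" "finite ?T" "finite ?D"
        by (auto intro: finite_subset[OF _ finite_pairs[of N]])
      have cY: "real (card ?Y) \<le> real N / ln (real N) + 1"
      proof (cases "?Y = {}")
        case False
        have "?Y \<subseteq> {..nat \<lfloor>real N / ln (real N)\<rfloor>}" by (auto simp: le_nat_iff le_floor_iff)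
        then have "card ?Y \<le> card {..nat \<lfloor>real N / ln (real N)\<rfloor>}" by (intro card_mono) auto
        then have "real (card ?Y) \<le> real (nat \<lfloor>real N / ln (real N)\<rfloor>) + 1" by simp
        moreover have "0 \<le> real N / ln (real N)" using False by (auto intro: order.trans[of _ "real _"] less_imp_le)
        ultimately show ?thesis by linarith
      qed (use elim in simp)
      have "card {q \<in> unity_roots_upto N. bad q} \<le> card (insert 1 (?g ` (?Y \<times> {..<N} \<union> (?T \<union> ?D))))"
        by (rule card_mono[OF _ sub]) (use fin in auto)
      also have "\<dots> \<le> Suc (card (?g ` (?Y \<times> {..<N} \<union> (?T \<union> ?D))))" by (rule card_insert_le_m1) auto
      also have "\<dots> \<le> Suc (card (?Y \<times> {..<N} \<union> (?T \<union> ?D)))" using fin by (intro Suc_le_mono[THEN iffD2] card_image_le) auto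
      also have "\<dots> \<le> Suc (card (?Y \<times> {..<N}) + (card ?T + card ?D))"
        using card_Un_le[of "?Y \<times> {..<N}" "?T \<union> ?D"] card_Un_le[of ?T ?D] by linarith
      also have "\<dots> = Suc (card ?Y * N + (card ?T + card ?D))" by (simp add: card_cartesian_product)
      finally have "real (card {q \<in> unity_roots_upto N. bad q}) \<le> real (Suc (card ?Y * N + (card ?T + card ?D)))"
        by (simp only: of_nat_le_iff)
      also have "\<dots> = 1 + real (card ?Y) * real N + (real (card ?T) + real (card ?D))" by simp
      also have "real (card ?Y) * real N \<le> (real N / ln (real N) + 1) * real N" using cY by (intro mult_right_mono) auto
      also have "\<dots> = (1 / ln (real N)) * (real N)\<^sup>2 + real N" by (simp add: power2_eq_square algebra_simps)
      also have "\<dots> \<le> h * (real N)\<^sup>2 + real N" using elim(1) by (intro add_right_mono mult_right_mono) auto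
      finally have up: "real (card {q \<in> unity_roots_upto N. bad q}) \<le> 1 + real N + 3 * (h * (real N)\<^sup>2)"
        using elim(4,5) by simp
      have "1 < h * real N" using elim(2) elim by (simp add: divide_less_eq)
      then have "real N * 1 \<le> real N * (h * real N)" by (intro mult_left_mono) auto
      then have "real N \<le> h * (real N)\<^sup>2" by (simp add: power2_eq_square mult_ac)
      moreover have "1 \<le> real N" using elim by simp
      ultimately have up2: "real (card {q \<in> unity_roots_upto N. bad q}) \<le> 5 * (h * (real N)\<^sup>2)"
        using up by linarith
      have "card (cop N) = card (?g ` cop N)" using unity_roots_upto_eq(3) by (simp add: card_image)
      also have "\<dots> \<le> card (unity_roots_upto N)"
        by (rule card_mono[OF finite_unity_roots_upto unity_roots_upto_eq(2)])
      finally have "real (card (cop N)) \<le> real (card (unity_roots_upto N))" by simp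
      then have low: "(real N)\<^sup>2 / 20 \<le> real (card (unity_roots_upto N))" using elim(6) by linarith
      have "?R N \<le> (5 * (h * (real N)\<^sup>2)) / ((real N)\<^sup>2 / 20)"
        using up2 low N h by (intro frac_le) auto
      also have "\<dots> = 100 * h" using N by simp
      also have "\<dots> < \<eta>" using \<eta> by (simp add: h_def)
      finally show ?case .
    qed
  qed
  moreover have "\<forall>\<^sub>F N in sequentially. x < ?R N" if "x < 0" for x
  proof (intro always_eventually allI)
    fix N
    have "0 \<le> ?R N" by simp
    then show "x < ?R N" using that by (rule less_le_trans[rotated])
  qed
  ultimately have "?R \<longlonglongrightarrow> 0" by (intro order_tendstoI)
  then show ?thesis unfolding bad_def .
qed

section \<open>The figure-eight knot group\<close>

definition omg :: complex where
  "omg = cis (2 * pi / 3)"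

definition eis :: "int \<Rightarrow> int \<Rightarrow> complex" where
  "eis m n = of_int m + of_int n * omg"

lemma omg_Re: "Re omg = - 1 / 2" and omg_Im: "Im omg = sqrt 3 / 2"
  by (simp_all add: omg_def cos_120 sin_120)

lemma omg_sq: "omg * omg = - 1 - omg"
  by (simp add: complex_eq_iff omg_Re omg_Im)

lemma Re_eis: "Re (eis m n) = of_int m - of_int n / 2"
  by (simp add: eis_def omg_Re)

lemma Im_eis: "Im (eis m n) = of_int n * sqrt 3 / 2"
  by (simp add: eis_def omg_Im)

lemma eis_eq_iff: "eis m n = eis m' n' \<longleftrightarrow> m = m' \<and> n = n'"
  by (auto simp: complex_eq_iff Re_eis Im_eis)

lemma cmod_eis: "(cmod (eis m n))\<^sup>2 = of_int (m * m - m * n + n * n)"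
proof -
  have "sqrt 3 * sqrt 3 = (3::real)" by simp
  then show ?thesis
    unfolding cmod_power2 Re_eis Im_eis by (simp add: power2_eq_square algebra_simps)
qed

lemma eis_add: "eis m n + eis m' n' = eis (m + m') (n + n')"
  by (simp add: eis_def algebra_simps)

lemma eis_diff: "eis m n - eis m' n' = eis (m - m') (n - n')"
  by (simp add: eis_def algebra_simps)

lemma eis_minus: "- eis m n = eis (- m) (- n)"
  by (simp add: eis_def algebra_simps)

lemma eis_mult: "eis m n * eis m' n' = eis (m * m' - n * n') (m * n' + n * m' - n * n')"
proof -
  have "eis m n * eis m' n' = of_int (m * m') + of_int (m * n' + n * m') * omg + of_int (n * n') * (omg * omg)"
    by (simp add: eis_def algebra_simps)
  then show ?thesis by (simp only: omg_sq) (simp add: eis_def algebra_simps)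
qed

lemma eis_omg_mult: "omg * eis m n = eis (- n) (m - n)"
  using eis_mult[of 0 1 m n] by (simp add: eis_def[of 0 1])

lemma eis_simps: "eis 0 0 = 0" "eis 1 0 = 1" "eis 0 1 = omg" "eis (-1) 0 = -1"
  by (simp_all add: eis_def)

definition mat2 :: "'a \<Rightarrow> 'a \<Rightarrow> 'a \<Rightarrow> 'a \<Rightarrow> 'a::zero^2^2" where
  "mat2 a b c d = vector [vector [a, b], vector [c, d]]"

lemma mat2_nth [simp]:
  "mat2 a b c d $ 1 $ 1 = a" "mat2 a b c d $ 1 $ 2 = b"
  "mat2 a b c d $ 2 $ 1 = c" "mat2 a b c d $ 2 $ 2 = d"
  by (simp_all add: mat2_def vector_2)

lemma mat2_exhaust:
  obtains a b c d where "A = mat2 a b c d"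
proof -
  have "A = mat2 (A$1$1) (A$1$2) (A$2$1) (A$2$2)" by (simp add: vec_eq_iff forall_2)
  then show ?thesis using that by blast
qed

lemma mat2_eq_iff: "mat2 a b c d = mat2 a' b' c' d' \<longleftrightarrow> a = a' \<and> b = b' \<and> c = c' \<and> d = d'"
  by (auto simp: vec_eq_iff forall_2)

lemma mat2_mult:
  fixes a :: "'a::comm_ring_1"
  shows "mat2 a b c d ** mat2 a' b' c' d' =
    mat2 (a * a' + b * c') (a * b' + b * d') (c * a' + d * c') (c * b' + d * d')"
  by (simp add: vec_eq_iff forall_2 matrix_matrix_mult_def sum_2)

lemma mat2_minus: "- mat2 a b c d = mat2 (- a) (- b) (- c) (- d :: 'a::comm_ring_1)"
  by (simp add: vec_eq_iff forall_2)

lemma mat2_one: "mat 1 = mat2 1 0 0 (1 :: 'a::comm_ring_1)"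
  by (simp add: vec_eq_iff forall_2 mat_def)

lemma mat2_det: "det (mat2 a b c d) = a * d - b * (c :: 'a::comm_ring_1)"
  by (simp add: det_2)

text \<open>Quadratic forms in the coordinates of the four entries that vanish on the image of the group
  modulo 4, found by computer: their span is stable under right multiplication by the generators.
  For a translation by \<open>b\<^sub>0 + b\<^sub>1 \<omega>\<close> the first one says that \<open>4\<close> divides \<open>b\<^sub>1\<close>.\<close>

definition fig8_cong :: "int \<Rightarrow> int \<Rightarrow> int \<Rightarrow> int \<Rightarrow> int \<Rightarrow> int \<Rightarrow> int \<Rightarrow> int \<Rightarrow> bool" where
  "fig8_cong a0 a1 b0 b1 c0 c1 d0 d1 \<longleftrightarrow>
     4 dvd -a0*a1 + a0*b1 - a0*c0 - a1*a1 + a1*b0 + 2*a1*b1 + a1*c0 + a1*c1 + 2*a1*d1 + 2*b0*c0 + 2*b1*b1 + 2*b1*c0 \<and>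
     4 dvd a0*b0 + a0*b1 - a1*b1 + 2*a1*d1 - b0*b1 + 2*b0*c0 - b0*d0 + 2*b1*c0 - b1*d0 + b1*d1 \<and>
     4 dvd a0*a0 + a0*a1 - a0*d0 + 2*a1*b1 + 2*a1*c0 - a1*d0 - a1*d1 + b0*c0 + 2*b1*b1 + b1*c0 + b1*c1 \<and>
     4 dvd 2*a0*b0 - a0*d1 + 2*a1*b0 - a1*d0 - b0*b1 + b0*c0 - b0*c1 + 2*b0*d0 + 2*b0*d1 + b1*b1 + 2*b1*c0 + b1*c1 \<and>
     2 dvd b0*b0 + b0*d0 + b1*d0 + b1*d1 \<and>
     2 dvd a0*b1 + a0*c0 + a1*b0 + a1*c0 + a1*c1 \<and>
     2 dvd b0*b1 \<and>
     2 dvd a0*b1 + a0*d1 + a1*a1 + a1*b0 + a1*d0 + b0*c0 + b0*c1 + b1*b1 + b1*c1"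

text \<open>Under the generator each form turns into an integer combination of the old forms plus a
  multiple of its modulus; the witness is the resulting quotient. The same holds for the other three
  generators below.\<close>

lemma fig8_cong_x:
  assumes "fig8_cong a0 a1 b0 b1 c0 c1 d0 d1"
  shows "fig8_cong a0 a1 (a0 + b0) (a1 + b1) c0 c1 (c0 + d0) (c1 + d1)"
proof -
  obtain k1 k2 k3 k4 k5 k6 k7 k8 where k: "-a0*a1 + a0*b1 - a0*c0 - a1*a1 + a1*b0 + 2*a1*b1 + a1*c0 + a1*c1 + 2*a1*d1 + 2*b0*c0 + 2*b1*b1 + 2*b1*c0 = 4 * k1" "a0*b0 + a0*b1 - a1*b1 + 2*a1*d1 - b0*b1 + 2*b0*c0 - b0*d0 + 2*b1*c0 - b1*d0 + b1*d1 = 4 * k2" "a0*a0 + a0*a1 - a0*d0 + 2*a1*b1 + 2*a1*c0 - a1*d0 - a1*d1 + b0*c0 + 2*b1*b1 + b1*c0 + b1*c1 = 4 * k3" "2*a0*b0 - a0*d1 + 2*a1*b0 - a1*d0 - b0*b1 + b0*c0 - b0*c1 + 2*b0*d0 + 2*b0*d1 + b1*b1 + 2*b1*c0 + b1*c1 = 4 * k4" "b0*b0 + b0*d0 + b1*d0 + b1*d1 = 2 * k5" "a0*b1 + a0*c0 + a1*b0 + a1*c0 + a1*c1 = 2 * k6" "b0*b1 = 2 * k7" "a0*b1 + a0*d1 + a1*a1 + a1*b0 + a1*d0 + b0*c0 + b0*c1 + b1*b1 + b1*c1 = 2 * k8"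
    using assms unfolding fig8_cong_def dvd_def by blast
  show ?thesis unfolding fig8_cong_def
    apply (intro conjI)
    subgoal by (rule dvdI[of _ _ "- k1 + 2*k4 + k7 + k8 + (-a0*b0 - a1*b0 + 2*a1*b1 + a1*c0 + a1*c1 + a1*d1 - b0*d0 - b0*d1 - b1*c1)"]) (use k in algebra)
    subgoal by (rule dvdI[of _ _ "k1 + k2 + k3 + k6 + (-a0*b1 - a1*b0 - a1*b1 - a1*c0 - b0*c0 - b1*b1 - b1*c0)"]) (use k in algebra)
    subgoal by (rule dvdI[of _ _ "k3 + (a1*a1 + a1*b1)"]) (use k in algebra)
    subgoal by (rule dvdI[of _ _ "k1 + 2*k3 + k4 + k8 + (-a0*b1 + a0*c0 + a0*d0 - a1*b0 - a1*b1 - a1*c0 - b0*c0 - 2*b1*b1 - b1*c0 - b1*c1)"]) (use k in algebra)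
    subgoal by (rule dvdI[of _ _ "2*k1 + 2*k3 + 2*k4 + k5 + k7 + k8 + (-a0*b1 + a0*c0 + a0*d0 - 2*a1*b0 - 2*a1*b1 - a1*c0 + a1*d0 - 2*b0*c0 - b0*d0 - b0*d1 - 3*b1*b1 - 2*b1*c0 - b1*c1)"]) (use k in algebra)
    subgoal by (rule dvdI[of _ _ "k6 + (a0*a1)"]) (use k in algebra)
    subgoal by (rule dvdI[of _ _ "2*k1 + 2*k4 + k6 + k8 + (a0*a1 - a0*b0 - a0*b1 - 2*a1*b0 - a1*b1 - a1*c0 - a1*c1 - a1*d1 + b0*b1 - 2*b0*c0 - b0*d0 - b0*d1 - 2*b1*b1 - 2*b1*c0 - b1*c1)"]) (use k in algebra)
    subgoal by (rule dvdI[of _ _ "2*k4 + k6 + k7 + (a0*a1 - a0*b0 + a0*c1 + a0*d1 + a1*a1 - a1*b0 + a1*b1 + a1*d0 + b0*c1 - b0*d0 - b0*d1 - b1*c0)"]) (use k in algebra)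
    done
qed

lemma fig8_cong_xi:
  assumes "fig8_cong a0 a1 b0 b1 c0 c1 d0 d1"
  shows "fig8_cong a0 a1 (-a0 + b0) (-a1 + b1) c0 c1 (-c0 + d0) (-c1 + d1)"
proof -
  obtain k1 k2 k3 k4 k5 k6 k7 k8 where k: "-a0*a1 + a0*b1 - a0*c0 - a1*a1 + a1*b0 + 2*a1*b1 + a1*c0 + a1*c1 + 2*a1*d1 + 2*b0*c0 + 2*b1*b1 + 2*b1*c0 = 4 * k1" "a0*b0 + a0*b1 - a1*b1 + 2*a1*d1 - b0*b1 + 2*b0*c0 - b0*d0 + 2*b1*c0 - b1*d0 + b1*d1 = 4 * k2" "a0*a0 + a0*a1 - a0*d0 + 2*a1*b1 + 2*a1*c0 - a1*d0 - a1*d1 + b0*c0 + 2*b1*b1 + b1*c0 + b1*c1 = 4 * k3" "2*a0*b0 - a0*d1 + 2*a1*b0 - a1*d0 - b0*b1 + b0*c0 - b0*c1 + 2*b0*d0 + 2*b0*d1 + b1*b1 + 2*b1*c0 + b1*c1 = 4 * k4" "b0*b0 + b0*d0 + b1*d0 + b1*d1 = 2 * k5" "a0*b1 + a0*c0 + a1*b0 + a1*c0 + a1*c1 = 2 * k6" "b0*b1 = 2 * k7" "a0*b1 + a0*d1 + a1*a1 + a1*b0 + a1*d0 + b0*c0 + b0*c1 + b1*b1 + b1*c1 = 2 * k8"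
    using assms unfolding fig8_cong_def dvd_def by blast
  show ?thesis unfolding fig8_cong_def
    apply (intro conjI)
    subgoal by (rule dvdI[of _ _ "- k1 + 2*k4 + k7 + k8 + (-a0*a1 - a0*b0 - a0*c0 - a1*a1 - a1*b0 + a1*d1 - b0*d0 - b0*d1 - b1*c1)"]) (use k in algebra)
    subgoal by (rule dvdI[of _ _ "k1 + k2 - k3 + 2*k4 + k6 + k7 + k8 + (-a0*b0 - a0*b1 - a0*c0 - 2*a1*b0 - a1*c0 - a1*c1 - a1*d1 - b0*c0 - b0*d0 - b0*d1 - b1*b1 - b1*c0 - b1*c1)"]) (use k in algebra)
    subgoal by (rule dvdI[of _ _ "k3 + (-a1*b1)"]) (use k in algebra)
    subgoal by (rule dvdI[of _ _ "k1 + 2*k3 + k4 + k6 + k8 + (-a0*a0 - a0*a1 - a0*b1 + a0*c1 - a0*d1 - a1*b0 - 2*a1*b1 - 2*a1*c0 - a1*c1 - 2*b0*c0 - b0*c1 - 2*b1*b1 - b1*c0 - b1*c1)"]) (use k in algebra)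
    subgoal by (rule dvdI[of _ _ "2*k1 + 2*k3 + 2*k4 + k5 + k7 + k8 + (-2*a0*b0 - a0*b1 + a0*c0 - 2*a1*b0 - 2*a1*b1 - a1*c0 - a1*d1 - 3*b0*c0 - b0*d0 - b0*d1 - 3*b1*b1 - 3*b1*c0 - 2*b1*c1)"]) (use k in algebra)
    subgoal by (rule dvdI[of _ _ "k6 + (-a0*a1)"]) (use k in algebra)
    subgoal by (rule dvdI[of _ _ "2*k1 + 2*k4 + k6 + k8 + (a0*a1 - a0*b0 - 2*a0*b1 - 3*a1*b0 - a1*b1 - a1*c0 - a1*c1 - a1*d1 + b0*b1 - 2*b0*c0 - b0*d0 - b0*d1 - 2*b1*b1 - 2*b1*c0 - b1*c1)"]) (use k in algebra)
    subgoal by (rule dvdI[of _ _ "2*k4 + k6 + k7 + (-a0*a1 - a0*b0 - a0*c0 - a0*c1 + a0*d1 + a1*a1 - a1*b0 - a1*b1 - a1*c0 - a1*c1 + a1*d0 + b0*c1 - b0*d0 - b0*d1 - b1*c0)"]) (use k in algebra)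
    done
qed

lemma fig8_cong_y:
  assumes "fig8_cong a0 a1 b0 b1 c0 c1 d0 d1"
  shows "fig8_cong (a0 + b1) (a1 - b0 + b1) b0 b1 (c0 + d1) (c1 - d0 + d1) d0 d1"
proof -
  obtain k1 k2 k3 k4 k5 k6 k7 k8 where k: "-a0*a1 + a0*b1 - a0*c0 - a1*a1 + a1*b0 + 2*a1*b1 + a1*c0 + a1*c1 + 2*a1*d1 + 2*b0*c0 + 2*b1*b1 + 2*b1*c0 = 4 * k1" "a0*b0 + a0*b1 - a1*b1 + 2*a1*d1 - b0*b1 + 2*b0*c0 - b0*d0 + 2*b1*c0 - b1*d0 + b1*d1 = 4 * k2" "a0*a0 + a0*a1 - a0*d0 + 2*a1*b1 + 2*a1*c0 - a1*d0 - a1*d1 + b0*c0 + 2*b1*b1 + b1*c0 + b1*c1 = 4 * k3" "2*a0*b0 - a0*d1 + 2*a1*b0 - a1*d0 - b0*b1 + b0*c0 - b0*c1 + 2*b0*d0 + 2*b0*d1 + b1*b1 + 2*b1*c0 + b1*c1 = 4 * k4" "b0*b0 + b0*d0 + b1*d0 + b1*d1 = 2 * k5" "a0*b1 + a0*c0 + a1*b0 + a1*c0 + a1*c1 = 2 * k6" "b0*b1 = 2 * k7" "a0*b1 + a0*d1 + a1*a1 + a1*b0 + a1*d0 + b0*c0 + b0*c1 + b1*b1 + b1*c1 = 2 * k8"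
    using assms unfolding fig8_cong_def dvd_def by blast
  show ?thesis unfolding fig8_cong_def
    apply (intro conjI)
    subgoal by (rule dvdI[of _ _ "k1 - k2 + k4 + k5 + k7 + (-a1*b1 + a1*d1 - b0*b0 - b0*d0 - b0*d1 - b1*d0 + b1*d1)"]) (use k in algebra)
    subgoal by (rule dvdI[of _ _ "k2 + k7 + (b1*d1)"]) (use k in algebra)
    subgoal by (rule dvdI[of _ _ "- k2 + k3 + (a0*b1 + a1*d1 - b0*b1 + b1*b1 + b1*c0 - b1*d0 + b1*d1)"]) (use k in algebra)
    subgoal by (rule dvdI[of _ _ "k4 + k5 + (-b0*b0 + b0*b1 - b1*d0)"]) (use k in algebra)
    subgoal by (rule dvdI[of _ _ "k5"]) (use k in algebra)
    subgoal by (rule dvdI[of _ _ "2*k4 + k5 + k6 + (-a0*b0 + a0*d1 - a1*b0 + a1*d1 - b0*b0 + b0*b1 - b0*c0 - b0*d0 - 2*b0*d1 - b1*d0 + b1*d1)"]) (use k in algebra)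
    subgoal by (rule dvdI[of _ _ "k7"]) (use k in algebra)
    subgoal by (rule dvdI[of _ _ "k7 + k8 + (-a1*b0 + a1*b1 - b0*b1 - b0*d0 + b0*d1 + b1*b1 + b1*d1)"]) (use k in algebra)
    done
qed

lemma fig8_cong_yi:
  assumes "fig8_cong a0 a1 b0 b1 c0 c1 d0 d1"
  shows "fig8_cong (a0 - b1) (a1 + b0 - b1) b0 b1 (c0 - d1) (c1 + d0 - d1) d0 d1"
proof -
  obtain k1 k2 k3 k4 k5 k6 k7 k8 where k: "-a0*a1 + a0*b1 - a0*c0 - a1*a1 + a1*b0 + 2*a1*b1 + a1*c0 + a1*c1 + 2*a1*d1 + 2*b0*c0 + 2*b1*b1 + 2*b1*c0 = 4 * k1" "a0*b0 + a0*b1 - a1*b1 + 2*a1*d1 - b0*b1 + 2*b0*c0 - b0*d0 + 2*b1*c0 - b1*d0 + b1*d1 = 4 * k2" "a0*a0 + a0*a1 - a0*d0 + 2*a1*b1 + 2*a1*c0 - a1*d0 - a1*d1 + b0*c0 + 2*b1*b1 + b1*c0 + b1*c1 = 4 * k3" "2*a0*b0 - a0*d1 + 2*a1*b0 - a1*d0 - b0*b1 + b0*c0 - b0*c1 + 2*b0*d0 + 2*b0*d1 + b1*b1 + 2*b1*c0 + b1*c1 = 4 * k4" "b0*b0 + b0*d0 + b1*d0 + b1*d1 = 2 * k5" "a0*b1 + a0*c0 + a1*b0 + a1*c0 + a1*c1 = 2 * k6" "b0*b1 = 2 * k7" "a0*b1 + a0*d1 + a1*a1 + a1*b0 + a1*d0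 + b0*c0 + b0*c1 + b1*b1 + b1*c1 = 2 * k8"
    using assms unfolding fig8_cong_def dvd_def by blast
  show ?thesis unfolding fig8_cong_def
    apply (intro conjI)
    subgoal by (rule dvdI[of _ _ "k1 + k2 - k4 + (a1*b1 - a1*d1 + b0*b1 + b0*d0 - b1*b1 - b1*d1)"]) (use k in algebra)
    subgoal by (rule dvdI[of _ _ "k2 + k7 + (-b0*b1 - b1*d1)"]) (use k in algebra)
    subgoal by (rule dvdI[of _ _ "k2 + k3 + k7 + (-a0*b1 - a1*d1 - b0*d1 - b1*c0 + b1*d0)"]) (use k in algebra)
    subgoal by (rule dvdI[of _ _ "k4 + k5 + (-b0*b1 - b0*d0 - b1*d1)"]) (use k in algebra)
    subgoal by (rule dvdI[of _ _ "k5"]) (use k in algebra)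
    subgoal by (rule dvdI[of _ _ "2*k4 + k5 + k6 + (-a0*b0 - a1*b0 + a1*d0 - a1*d1 + b0*c1 - b0*d0 - 2*b0*d1 - b1*b1 - 2*b1*c0 - b1*c1 - b1*d0 + b1*d1)"]) (use k in algebra)
    subgoal by (rule dvdI[of _ _ "k7"]) (use k in algebra)
    subgoal by (rule dvdI[of _ _ "k7 + k8 + (a1*b0 - a1*b1 + b0*b0 - 2*b0*b1 + b0*d0 - b0*d1 - b1*d1)"]) (use k in algebra)
    done
qed

abbreviation fig8_xi :: "complex^2^2" where "fig8_xi \<equiv> mat2 1 (- 1) 0 1"
abbreviation fig8_yi :: "complex^2^2" where "fig8_yi \<equiv> mat2 1 0 omg 1"

lemma fig8_x_eq: "fig8_x = mat2 1 1 0 1" and fig8_y_eq: "fig8_y = mat2 1 0 (- omg) 1"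
  by (simp_all add: fig8_x_def fig8_y_def mat2_def omg_def)

lemma fig8_inv_eq: "inv\<^bsub>SL2C\<^esub> fig8_x = fig8_xi" "inv\<^bsub>SL2C\<^esub> fig8_y = fig8_yi"
  unfolding fig8_inverses by (simp_all add: mat2_def omg_def)

lemma fig8_mult: "A \<in> fig8_group \<Longrightarrow> B \<in> fig8_group \<Longrightarrow> A ** B \<in> fig8_group"
  using generate.eng[of A SL2C _ B] by (simp add: fig8_group_def SL2C_def)

lemma fig8_gens: "mat 1 \<in> fig8_group" "fig8_x \<in> fig8_group" "fig8_y \<in> fig8_group"
  "fig8_xi \<in> fig8_group" "fig8_yi \<in> fig8_group"
proof -
  have "\<one>\<^bsub>SL2C\<^esub> \<in> fig8_group" unfolding fig8_group_def by (rule generate.one)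
  then show "mat 1 \<in> fig8_group" by (simp add: SL2C_def)
  show "fig8_x \<in> fig8_group" "fig8_y \<in> fig8_group"
    unfolding fig8_group_def by (auto intro: generate.incl)
  show "fig8_xi \<in> fig8_group" "fig8_yi \<in> fig8_group"
    unfolding fig8_group_def fig8_inv_eq[symmetric] by (auto intro: generate.inv)
qed

lemma fig8_carrier: "A \<in> fig8_group \<Longrightarrow> A \<in> carrier SL2C"
  using group.generate_incl[OF group_SL2C, of "{fig8_x, fig8_y}"] fig8_in_SL2C
  by (auto simp: fig8_group_def)

lemma fig8_det: "mat2 a b c d \<in> fig8_group \<Longrightarrow> a * d - b * c = 1"
  using fig8_carrier[of "mat2 a b c d"] by (simp add: SL2C_def mat2_det)

lemma fig8_inv:
  assumes "mat2 a b c d \<in> fig8_group"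
  shows "mat2 d (- b) (- c) a \<in> fig8_group"
proof -
  have D: "a * d - b * c = 1" using assms fig8_det by blast
  have "inv\<^bsub>SL2C\<^esub> (mat2 a b c d) = mat2 d (- b) (- c) a"
  proof (rule group.inv_equality[OF group_SL2C])
    show "mat2 d (- b) (- c) a \<otimes>\<^bsub>SL2C\<^esub> mat2 a b c d = \<one>\<^bsub>SL2C\<^esub>"
      using D by (simp add: SL2C_def mat2_mult mat2_one mat2_eq_iff algebra_simps)
    show "mat2 a b c d \<in> carrier SL2C" using assms by (rule fig8_carrier)
    show "mat2 d (- b) (- c) a \<in> carrier SL2C" using D by (simp add: SL2C_def mat2_det algebra_simps)
  qed
  moreover have "inv\<^bsub>SL2C\<^esub> (mat2 a b c d) \<in> fig8_group"
    using group.generate_m_inv_closed[OF group_SL2C, of "{fig8_x, fig8_y}" "mat2 a b c d"] assms fig8_in_SL2C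
    by (auto simp: fig8_group_def)
  ultimately show ?thesis by simp
qed

text \<open>Generators are appended on the right because the congruences are propagated by right
  multiplication.\<close>

lemma fig8_induct [consumes 1, case_names one x xi y yi]:
  assumes "A \<in> fig8_group" and one: "P (mat 1)"
    and x: "\<And>A. P A \<Longrightarrow> P (A ** fig8_x)" and xi: "\<And>A. P A \<Longrightarrow> P (A ** fig8_xi)"
    and y: "\<And>A. P A \<Longrightarrow> P (A ** fig8_y)" and yi: "\<And>A. P A \<Longrightarrow> P (A ** fig8_yi)"
  shows "P A"
proof -
  \<comment> \<open>The left factor is generalised because \<open>generate\<close> closes under
    products of two arbitrary elements.\<close>
  have "P B \<Longrightarrow> P (B ** A)" for B
    using assms(1) unfolding fig8_group_def
  proof (induction arbitrary: B rule: generate.induct)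
    case one
    then show ?case by (simp add: SL2C_def)
  next
    case (incl h)
    then show ?case using x y by auto
  next
    case (inv h)
    then show ?case using xi yi fig8_inv_eq by auto
  next
    case (eng h1 h2)
    then show ?case by (simp add: SL2C_def matrix_mul_assoc)
  qed
  from this[OF one] show ?thesis by simp
qed

lemma fig8_entries:
  assumes "A \<in> fig8_group"
  shows "\<exists>a0 a1 b0 b1 c0 c1 d0 d1. A = mat2 (eis a0 a1) (eis b0 b1) (eis c0 c1) (eis d0 d1)
    \<and> fig8_cong a0 a1 b0 b1 c0 c1 d0 d1"
  using assms
proof (induction rule: fig8_induct)
  case one
  have "mat 1 = mat2 (eis 1 0) (eis 0 0) (eis 0 0) (eis 1 0)" by (simp add: mat2_one eis_simps)
  moreover have "fig8_cong 1 0 0 0 0 0 1 0" by (simp add: fig8_cong_def)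
  ultimately show ?case by blast
next
  case (x A)
  then obtain a0 a1 b0 b1 c0 c1 d0 d1 where A: "A = mat2 (eis a0 a1) (eis b0 b1) (eis c0 c1) (eis d0 d1)"
    and "fig8_cong a0 a1 b0 b1 c0 c1 d0 d1" by blast
  from fig8_cong_x[OF this(2)] show ?case unfolding A fig8_x_eq mat2_mult
    by (simp add: eis_add mat2_eq_iff) blast
next
  case (xi A)
  then obtain a0 a1 b0 b1 c0 c1 d0 d1 where A: "A = mat2 (eis a0 a1) (eis b0 b1) (eis c0 c1) (eis d0 d1)"
    and "fig8_cong a0 a1 b0 b1 c0 c1 d0 d1" by blast
  from fig8_cong_xi[OF this(2)] show ?case unfolding A mat2_mult
    by (simp add: eis_minus eis_add mat2_eq_iff) blast
next
  case (y A)
  then obtain a0 a1 b0 b1 c0 c1 d0 d1 where A: "A = mat2 (eis a0 a1) (eis b0 b1) (eis c0 c1) (eis d0 d1)"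
    and c: "fig8_cong a0 a1 b0 b1 c0 c1 d0 d1" by blast
  have e: "eis m n * 1 + eis m' n' * - omg = eis (m + n') (n - m' + n')" for m n m' n'
    using eis_omg_mult[of m' n'] by (simp add: eis_diff mult.commute eis_eq_iff)
  have "A ** fig8_y = mat2 (eis (a0 + b1) (a1 - b0 + b1)) (eis b0 b1) (eis (c0 + d1) (c1 - d0 + d1)) (eis d0 d1)"
    unfolding A fig8_y_eq mat2_mult e by simp
  with fig8_cong_y[OF c] show ?case by blast
next
  case (yi A)
  then obtain a0 a1 b0 b1 c0 c1 d0 d1 where A: "A = mat2 (eis a0 a1) (eis b0 b1) (eis c0 c1) (eis d0 d1)"
    and c: "fig8_cong a0 a1 b0 b1 c0 c1 d0 d1" by blast
  have e: "eis m n * 1 + eis m' n' * omg = eis (m - n') (n + m' - n')" for m n m' n'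
    using eis_omg_mult[of m' n'] by (simp add: eis_add mult.commute eis_eq_iff)
  have "A ** fig8_yi = mat2 (eis (a0 - b1) (a1 + b0 - b1)) (eis b0 b1) (eis (c0 - d1) (c1 + d0 - d1)) (eis d0 d1)"
    unfolding A mat2_mult e by simp
  with fig8_cong_yi[OF c] show ?case by blast
qed

lemma fig8_translation:
  assumes "mat2 a b 0 d \<in> fig8_group" "a = 1 \<or> a = - 1"
  shows "\<exists>k l. b = eis k (4 * l)" and "d = a"
proof -
  show d: "d = a" using fig8_det[OF assms(1)] assms(2) by (auto simp: algebra_simps minus_equation_iff)
  obtain a0 a1 b0 b1 c0 c1 d0 d1 where
    A: "mat2 a b 0 d = mat2 (eis a0 a1) (eis b0 b1) (eis c0 c1) (eis d0 d1)"
    and c: "fig8_cong a0 a1 b0 b1 c0 c1 d0 d1" using fig8_entries[OF assms(1)] by blast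
  have "a = eis 1 0 \<or> a = eis (- 1) 0" using assms by (simp add: eis_simps)
  moreover have "eis c0 c1 = eis 0 0" using A by (simp add: mat2_eq_iff eis_simps)
  ultimately have e: "(a0 = 1 \<or> a0 = - 1) \<and> a1 = 0 \<and> c0 = 0 \<and> c1 = 0 \<and> d1 = 0"
    using A d by (auto simp: mat2_eq_iff eis_eq_iff)
  \<comment> \<open>The first form, with \<open>a1\<close>, the lower left entry and
    \<open>d1\<close> equal to 0. Its cofactor \<open>a0 + 2 b1\<close> is odd since
    \<open>a0\<close> is 1 or -1.\<close>
  then have "4 dvd a0 * b1 + 2 * b1 * b1" using c by (auto simp: fig8_cong_def)
  then have "4 dvd b1 * (a0 + 2 * b1)" by (simp add: algebra_simps)
  moreover have "coprime 4 (a0 + 2 * b1)"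
  proof -
    have "coprime (2 ^ 2) (a0 + 2 * b1)" using e by (subst coprime_power_left_iff) auto
    then show ?thesis by simp
  qed
  ultimately have "4 dvd b1" by (simp add: coprime_dvd_mult_left_iff)
  then show "\<exists>k l. b = eis k (4 * l)" using A by (auto simp: mat2_eq_iff elim!: dvdE)
qed

text \<open>The norm is \<open>((2 m - n)^2 + 3 n^2) / 4\<close>, too large once
  \<open>|n| \<ge> 4\<close>.\<close>

lemma eis_norm_one_iff: "m * m - m * n + n * n = (1::int) \<Longrightarrow> 4 dvd n \<Longrightarrow> n = 0"
proof (rule ccontr)
  assume m: "m * m - m * n + n * n = 1" and "4 dvd n" "n \<noteq> 0"
  then have "1 < \<bar>n\<bar>" by (auto elim!: dvdE)
  then have "1 * 1 < \<bar>n\<bar> * \<bar>n\<bar>" by (intro mult_strict_mono) auto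
  moreover have "4 * (m * m - m * n + n * n) = (2 * m - n) * (2 * m - n) + 3 * (n * n)" by (simp add: algebra_simps)
  moreover have "0 \<le> (2 * m - n) * (2 * m - n)" by simp
  ultimately show False using m by simp
qed

text \<open>Conjugating the translation \<open>x\<close> by the matrix gives the translation by \<open>a\<^sup>2\<close>, so the
  description of the translations restricts \<open>a\<close>.\<close>

lemma fig8_stabilizer:
  assumes A: "mat2 a b 0 d \<in> fig8_group"
  shows "a = 1 \<or> a = - 1"
proof -
  have ad: "a * d = 1" using fig8_det[OF A] by simp
  obtain a0 a1 d0 d1 where e: "a = eis a0 a1" "d = eis d0 d1"
    using fig8_entries[OF A] by (auto simp: mat2_eq_iff)
  have "(cmod a)\<^sup>2 * (cmod d)\<^sup>2 = 1" using ad by (simp flip: power_mult_distrib norm_mult)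
  then have "real_of_int ((a0 * a0 - a0 * a1 + a1 * a1) * (d0 * d0 - d0 * d1 + d1 * d1)) = 1"
    unfolding e cmod_eis by simp
  then have N: "(a0 * a0 - a0 * a1 + a1 * a1) * (d0 * d0 - d0 * d1 + d1 * d1) = 1" by linarith
  have "0 \<le> (2 * a0 - a1) * (2 * a0 - a1) + 3 * (a1 * a1)" by (intro add_nonneg_nonneg) auto
  also have "\<dots> = 4 * (a0 * a0 - a0 * a1 + a1 * a1)" by (simp add: algebra_simps)
  finally have N1: "a0 * a0 - a0 * a1 + a1 * a1 = 1" using N zmult_eq_1_iff by auto
  have "mat2 a b 0 d ** fig8_x ** mat2 d (- b) (- 0) a \<in> fig8_group"
    by (intro fig8_mult A fig8_gens fig8_inv)
  moreover have "mat2 a b 0 d ** fig8_x ** mat2 d (- b) (- 0) a = mat2 1 (a * a) 0 1"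
    unfolding fig8_x_eq mat2_mult using ad by (simp add: mat2_eq_iff algebra_simps)
  ultimately obtain k l where "a * a = eis k (4 * l)" using fig8_translation(1)[of 1 "a * a" 1] by auto
  then have kl: "a0 * a0 - a1 * a1 = k" "a0 * a1 + a1 * a0 - a1 * a1 = 4 * l"
    unfolding e eis_mult eis_eq_iff by auto
  \<comment> \<open>\<open>a^2\<close> also has norm 1, and among the admissible translations
    \<open>k + 4 l \<omega>\<close> only those with \<open>l = 0\<close> do; so \<open>a^2\<close>
    is a rational integer.\<close>
  have "k * k - k * (4 * l) + 4 * l * (4 * l) = (a0 * a0 - a0 * a1 + a1 * a1) ^ 2"
    unfolding kl[symmetric] by (simp add: power2_eq_square algebra_simps)
  then have "k * k - k * (4 * l) + 4 * l * (4 * l) = 1" using N1 by simp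
  from eis_norm_one_iff[OF this] have "l = 0" by simp
  then have "a1 * (2 * a0 - a1) = 0" using kl by (simp add: algebra_simps)
  then consider "a1 = 0" | "a1 = 2 * a0" by auto
  then show ?thesis
  proof cases
    case 1
    then have "a0 * a0 = 1" using N1 by simp
    then have "a0 = 1 \<or> a0 = - 1" by (auto simp: zmult_eq_1_iff)
    then show ?thesis using 1 e by (auto simp: eis_simps)
  next
    case 2
    then have "3 * (a0 * a0) = 1" using N1 by (simp add: algebra_simps)
    then show ?thesis by presburger
  qed
qed

text \<open>Signs act trivially on hyperbolic space, and the longitude of the knot is represented by
  minus a translation; membership is therefore tracked up to sign.\<close>

definition fig8_pm :: "complex^2^2 \<Rightarrow> bool" where
  "fig8_pm A \<longleftrightarrow> A \<in> fig8_group \<or> - A \<in> fig8_group"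

lemma mat2_minus_mult:
  "- A ** B = - (A ** B)" "A ** - B = - (A ** (B :: 'a::comm_ring_1^2^2))"
  by (simp_all add: vec_eq_iff forall_2 matrix_matrix_mult_def sum_2)

lemma fig8_pm_mult: "fig8_pm A \<Longrightarrow> fig8_pm B \<Longrightarrow> fig8_pm (A ** B)"
  unfolding fig8_pm_def using fig8_mult[of A B] fig8_mult[of "- A" B] fig8_mult[of A "- B"] fig8_mult[of "- A" "- B"]
  by (auto simp: mat2_minus_mult)

lemma fig8_pm_inv: "fig8_pm (mat2 1 b 0 1) \<Longrightarrow> fig8_pm (mat2 1 (- b) 0 1)"
  unfolding fig8_pm_def using fig8_inv[of 1 b 0 1] fig8_inv[of "- 1" "- b" 0 "- 1"]
  by (auto simp: mat2_minus)

lemma fig8_pm_translation_mult: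
  assumes "fig8_pm (mat2 1 b 0 1)"
  shows "fig8_pm (mat2 1 (of_int k * b) 0 1)"
proof (induction k rule: int_induct[where k = 0])
  case base
  then show ?case using fig8_gens by (simp add: fig8_pm_def mat2_one)
next
  case (step1 i)
  show ?case using fig8_pm_mult[OF step1(2) assms] by (simp add: mat2_mult algebra_simps)
next
  case (step2 i)
  show ?case using fig8_pm_mult[OF step2(2) fig8_pm_inv[OF assms]] by (simp add: mat2_mult algebra_simps)
qed


lemma fig8_pm_translations: "fig8_pm (mat2 1 (eis k (4 * l)) 0 1)"
proof -
  have 1: "fig8_pm (mat2 1 1 0 1)" using fig8_gens by (simp add: fig8_pm_def fig8_x_eq)
  \<comment> \<open>A longitude, whose exponent sums in x and y are 0. It is minus the translation
    by \<open>2 + 4 \<omega>\<close> and, together with the meridian x, yields all translations by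
    \<open>k + 4 l \<omega>\<close>.\<close>
  have "(fig8_y ** fig8_xi ** fig8_yi ** fig8_x) ** (fig8_x ** fig8_yi ** fig8_xi ** fig8_y) \<in> fig8_group"
    by (intro fig8_mult fig8_gens)
  moreover have "fig8_y ** fig8_xi ** fig8_yi ** fig8_x = mat2 (1 - omg) (- omg) (- 1 - omg) 0"
    by (simp add: fig8_x_eq fig8_y_eq mat2_mult mat2_eq_iff algebra_simps omg_sq)
  moreover have "fig8_x ** fig8_yi ** fig8_xi ** fig8_y = mat2 0 (- omg) (- 1 - omg) (1 - omg)"
    by (simp add: fig8_x_eq fig8_y_eq mat2_mult mat2_eq_iff algebra_simps omg_sq)
  moreover have "mat2 (1 - omg) (- omg) (- 1 - omg) 0 ** mat2 0 (- omg) (- 1 - omg) (1 - omg)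
      = - mat2 1 (2 + 4 * omg) 0 1"
    by (simp add: mat2_mult mat2_minus mat2_eq_iff algebra_simps omg_sq)
  ultimately have 2: "fig8_pm (mat2 1 (2 + 4 * omg) 0 1)" by (simp add: fig8_pm_def)
  have "fig8_pm (mat2 1 (of_int (k - 2 * l) * 1) 0 1 ** mat2 1 (of_int l * (2 + 4 * omg)) 0 1)"
    by (intro fig8_pm_mult fig8_pm_translation_mult 1 2)
  then show ?thesis by (simp add: mat2_mult eis_def algebra_simps)
qed

lemma fig8_pm_entry:
  "fig8_pm A \<Longrightarrow> \<exists>B\<in>fig8_group. \<exists>s. (s = 1 \<or> s = - 1) \<and> (\<forall>i j. B $ i $ j = s * A $ i $ j)"
  unfolding fig8_pm_def
proof (elim disjE)
  assume "A \<in> fig8_group"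
  then show ?thesis by (intro bexI[of _ A] exI[of _ 1]) auto
next
  assume "- A \<in> fig8_group"
  then show ?thesis by (intro bexI[of _ "- A"] exI[of _ "- 1"]) auto
qed

text \<open>Such an element sends the lattice point to infinity, and its height factor is 1 exactly
  on the unit sphere around that point. Four short words provide one point for each residue of n
  modulo 4; translations on the right reach the others.\<close>

lemma fig8_horosphere_at:
  "\<exists>a b c d. mat2 a b c d \<in> fig8_group \<and> cmod c = 1 \<and> d = - c * eis m n"
proof -
  have base: "\<exists>a b c d. mat2 a b c d \<in> fig8_group \<and> cmod c = 1 \<and> d = - c * eis m n"
    if A: "mat2 a' b' c' d' \<in> fig8_group" "cmod c' = 1" "d' = - c' * eis m0 n0" and n: "4 dvd n0 - n"
    for a' b' c' d' m0 n0
  proof -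
    obtain l where l: "n0 - n = 4 * l" using n by blast
    have "fig8_pm (mat2 a' b' c' d' ** mat2 1 (eis (m0 - m) (4 * l)) 0 1)"
      using A fig8_pm_translations by (intro fig8_pm_mult) (auto simp: fig8_pm_def)
    from fig8_pm_entry[OF this] obtain B s where B: "B \<in> fig8_group" "s = 1 \<or> s = (- 1 :: complex)"
      "\<And>i j. B $ i $ j = s * (mat2 a' b' c' d' ** mat2 1 (eis (m0 - m) (4 * l)) 0 1) $ i $ j" by blast
    obtain a b c d where Be: "B = mat2 a b c d" using mat2_exhaust by blast
    have "c = s * c'" "d = s * (c' * eis (m0 - m) (4 * l) + d')"
      using B(3)[of 2 1] B(3)[of 2 2] unfolding Be by (simp_all add: mat2_mult)
    moreover have "eis (m0 - m) (4 * l) = eis m0 n0 - eis m n" by (simp add: eis_diff flip: l)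
    ultimately have "c = s * c'" "d = s * (c' * (eis m0 n0 - eis m n) + - c' * eis m0 n0)" using A(3) by simp_all
    then have "c = s * c'" "d = - c * eis m n" by (simp_all add: algebra_simps)
    moreover have "cmod c = 1" using calculation(1) B(2) A(2) by auto
    ultimately show ?thesis using B(1) Be by blast
  qed
  have om2: "omg * (omg * u) = - u - omg * u" for u
    by (simp only: mult.assoc[symmetric] omg_sq) (simp add: algebra_simps)
  have n1: "cmod omg = 1" by (simp add: omg_def)
  have n2: "cmod (1 + omg) = 1"
  proof -
    have "1 + omg = - (omg * omg)" by (simp add: omg_sq)
    then show ?thesis using n1 by (simp add: norm_mult)
  qed
  have n3: "cmod (- 1 - omg) = 1" using n2 norm_minus_cancel[of "1 + omg"] by simp
  have y1: "mat2 1 0 (- omg) 1 \<in> fig8_group" and y2: "mat2 1 0 omg 1 \<in> fig8_group"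
    using fig8_gens by (auto simp: fig8_y_eq)
  have "fig8_y ** fig8_x ** fig8_yi \<in> fig8_group" by (intro fig8_mult fig8_gens)
  moreover have "fig8_y ** fig8_x ** fig8_yi = mat2 (1 + omg) 1 (1 + omg) (1 - omg)"
    by (simp add: fig8_x_eq fig8_y_eq mat2_mult mat2_eq_iff algebra_simps omg_sq)
  ultimately have y3: "mat2 (1 + omg) 1 (1 + omg) (1 - omg) \<in> fig8_group" by simp
  have "fig8_y ** fig8_xi ** fig8_yi \<in> fig8_group" by (intro fig8_mult fig8_gens)
  moreover have "fig8_y ** fig8_xi ** fig8_yi = mat2 (1 - omg) (- 1) (- 1 - omg) (1 + omg)"
    by (simp add: fig8_x_eq fig8_y_eq mat2_mult mat2_eq_iff algebra_simps omg_sq)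
  ultimately have y4: "mat2 (1 - omg) (- 1) (- 1 - omg) (1 + omg) \<in> fig8_group" by simp
  have "4 dvd - 1 - n \<or> 4 dvd 1 - n \<or> 4 dvd 2 - n \<or> 4 dvd 0 - n" by presburger
  then consider "4 dvd - 1 - n" | "4 dvd 1 - n" | "4 dvd 2 - n" | "4 dvd 0 - n" by blast
  then show ?thesis
  proof cases
    case 1
    show ?thesis by (rule base[OF y1 _ _ 1, of "-1"]) (auto simp: n1 eis_def algebra_simps omg_sq)
  next
    case 2
    show ?thesis by (rule base[OF y2 _ _ 2, of 1]) (auto simp: n1 eis_def algebra_simps omg_sq)
  next
    case 3
    show ?thesis by (rule base[OF y3 _ _ 3, of 1]) (auto simp: n2 eis_def algebra_simps omg_sq om2)
  next
    case 4
    show ?thesis by (rule base[OF y4 _ _ 4, of 1]) (use n3 in \<open>auto simp: eis_def algebra_simps omg_sq\<close>)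
  qed
qed

section \<open>The action on upper half-space\<close>

text \<open>The factor by which a matrix with lower row \<open>(c, d)\<close> divides the height of
  a point.\<close>

definition kden :: "complex \<Rightarrow> complex \<Rightarrow> complex \<times> real \<Rightarrow> real" where
  "kden c d p = (cmod (c * fst p + d))\<^sup>2 + (cmod c)\<^sup>2 * (snd p)\<^sup>2"

lemma hyp3_act_mat2:
  "hyp3_act (mat2 a b c d) (z, t) =
    (((a * z + b) * cnj (c * z + d) + a * cnj c * of_real (t\<^sup>2)) / of_real (kden c d (z, t)), t / kden c d (z, t))"
  by (simp add: hyp3_act_def kden_def Let_def)

lemma kden_complex:
  "of_real (kden c d (z, t)) = (c * z + d) * cnj (c * z + d) + c * cnj c * of_real (t\<^sup>2)"
  unfolding kden_def fst_conv snd_conv of_real_add of_real_mult complex_norm_square ..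

lemma kden_pos:
  assumes "a * d - b * c = 1" "0 < t"
  shows "0 < kden c d (z, t)"
proof (cases "c = 0")
  case True
  then have "d \<noteq> 0" using assms by auto
  then show ?thesis using True by (simp add: kden_def)
next
  case False
  then show ?thesis using assms by (simp add: kden_def add_nonneg_pos)
qed

lemma hyp3_act_in: "a * d - b * c = 1 \<Longrightarrow> p \<in> hyp3 \<Longrightarrow> hyp3_act (mat2 a b c d) p \<in> hyp3"
  using kden_pos by (cases p) (auto simp: hyp3_def hyp3_act_mat2)

text \<open>\<open>hyp3_act\<close> is the action \<open>H \<mapsto> A H A\<^sup>*\<close> on the Hermitian matrices
  \<open>H = t\<^sup>-\<^sup>1 ((|z|\<^sup>2 + t\<^sup>2, z), (cnj z, 1))\<close> of determinant 1; below \<open>P\<close>, \<open>Q\<close>, \<open>K\<close> are the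
  entries of \<open>t A H A\<^sup>*\<close>.\<close>

lemma hyp3_act_mult:
  assumes det: "a * d - b * c = 1" "a' * d' - b' * c' = 1" and p: "p \<in> hyp3"
  shows "hyp3_act (mat2 a' b' c' d' ** mat2 a b c d) p = hyp3_act (mat2 a' b' c' d') (hyp3_act (mat2 a b c d) p)"
proof -
  obtain z t where zt: "p = (z, t)" and t: "0 < t" using p by (auto simp: hyp3_def)
  define T :: complex where "T = of_real (t\<^sup>2)"
  define k where "k = kden c d (z, t)"
  define K where "K = (c * z + d) * cnj (c * z + d) + c * cnj c * T"
  define P where "P = (a * z + b) * cnj (a * z + b) + a * cnj a * T"
  define Q where "Q = (a * z + b) * cnj (c * z + d) + a * cnj c * T"
  have cT: "cnj T = T" by (simp add: T_def)
  have Kk: "of_real k = K" unfolding k_def K_def T_def kden_complex ..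
  have cK: "cnj K = K" by (simp flip: Kk)
  have k0: "0 < k" unfolding k_def using det t by (intro kden_pos)
  then have K0: "K \<noteq> 0" by (simp flip: Kk)
  have "P * K - Q * cnj Q = T * ((a * d - b * c) * cnj (a * d - b * c))"
    unfolding P_def K_def Q_def by (simp add: cT algebra_simps)
  then have PK: "Q * cnj Q + T = P * K" using det by (simp add: algebra_simps)
  define z1 where "z1 = Q / K"
  define t1 where "t1 = t / k"
  have act1: "hyp3_act (mat2 a b c d) (z, t) = (z1, t1)"
    unfolding hyp3_act_mat2 z1_def t1_def k_def[symmetric] Kk Q_def T_def ..
  have T1: "of_real (t1\<^sup>2) = T / (K * K)" by (simp add: t1_def T_def power2_eq_square flip: Kk)
  have gen: "(u * z1 + v) * cnj (u' * z1 + v') + u * cnj u' * of_real (t1\<^sup>2) =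
     (u * cnj u' * P + u * cnj v' * Q + v * cnj u' * cnj Q + v * cnj v' * K) / K" for u v u' v'
  proof -
    have "(u * z1 + v) * cnj (u' * z1 + v') + u * cnj u' * of_real (t1\<^sup>2) =
       (u * cnj u' * (Q * cnj Q + T) + (u * cnj v' * Q + v * cnj u' * cnj Q + v * cnj v' * K) * K) / (K * K)"
      unfolding T1 z1_def using K0 by (simp add: cK field_simps)
    also have "\<dots> = (u * cnj u' * P + u * cnj v' * Q + v * cnj u' * cnj Q + v * cnj v' * K) / K"
      unfolding PK using K0 by (simp add: field_simps)
    finally show ?thesis .
  qed
  have gen2: "((u * a + v * c) * z + (u * b + v * d)) * cnj ((u' * a + v' * c) * z + (u' * b + v' * d))
      + (u * a + v * c) * cnj (u' * a + v' * c) * T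
      = u * cnj u' * P + u * cnj v' * Q + v * cnj u' * cnj Q + v * cnj v' * K" for u v u' v'
    unfolding P_def Q_def K_def by (simp add: cT algebra_simps)
  define k1 where "k1 = kden c' d' (z1, t1)"
  define k2 where "k2 = kden (c' * a + d' * c) (c' * b + d' * d) (z, t)"
  have k1K: "of_real k1 * K = of_real k2"
    unfolding k1_def k2_def kden_complex gen gen2[folded T_def] T_def[symmetric] using K0 by (simp add: gen2)
  then have "complex_of_real (k1 * k) = of_real k2" by (simp add: Kk)
  then have kk: "k1 * k = k2" using of_real_eq_iff by blast
  have t1: "0 < t1" using k0 t by (simp add: t1_def)
  have k1p: "0 < k1" unfolding k1_def using det t1 by (intro kden_pos)
  have "hyp3_act (mat2 a' b' c' d' ** mat2 a b c d) (z, t) =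
    ((a' * cnj c' * P + a' * cnj d' * Q + b' * cnj c' * cnj Q + b' * cnj d' * K) / of_real k2, t / k2)"
    unfolding mat2_mult hyp3_act_mat2 k2_def[symmetric] T_def[symmetric] gen2 ..
  moreover have "hyp3_act (mat2 a' b' c' d') (z1, t1) =
    ((a' * cnj c' * P + a' * cnj d' * Q + b' * cnj c' * cnj Q + b' * cnj d' * K) / K / of_real k1, t1 / k1)"
    unfolding hyp3_act_mat2 k1_def[symmetric] gen ..
  moreover have "t / k2 = t1 / k1" unfolding t1_def kk[symmetric] by (simp add: mult.commute)
  moreover have "X / of_real k2 = X / K / of_real k1" for X :: complex
    unfolding k1K[symmetric] by (simp add: mult.commute)
  ultimately show ?thesis unfolding zt act1 by simp
qed

section \<open>Invariance of the hyperbolic measure\<close>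

lemma sets_hyp3_measure [simp, measurable_cong]: "sets hyp3_measure = sets borel"
  by (simp add: hyp3_measure_def)

lemma hyp3_density_measurable:
  "(\<lambda>(z :: complex, t :: real). if 0 < t then ennreal (1 / t ^ 3) else 0) \<in> borel_measurable borel"
proof -
  have "(\<lambda>(z, t). if 0 < t then ennreal (1 / t ^ 3) else 0) \<in> borel_measurable ((borel :: complex measure) \<Otimes>\<^sub>M (borel :: real measure))"
    by measurable
  then show ?thesis by (simp only: borel_prod)
qed

lemma hyp3_emeasure_gen:
  assumes F: "F \<in> sets borel"
  shows "emeasure hyp3_measure F =
    (\<integral>\<^sup>+t. \<integral>\<^sup>+z. (if 0 < t then ennreal (1 / t ^ 3) else 0) * indicator F (z, t) \<partial>lborel \<partial>lborel)"
proof -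
  have F': "F \<in> sets (lborel \<Otimes>\<^sub>M lborel)" using F by (simp only: lborel_prod sets_lborel)
  have "emeasure hyp3_measure F =
    (\<integral>\<^sup>+p. (case p of (z, t) \<Rightarrow> if 0 < t then ennreal (1 / t ^ 3) else 0) * indicator F p \<partial>(lborel \<Otimes>\<^sub>M lborel))"
    unfolding hyp3_measure_def using F by (subst emeasure_density) (auto simp: lborel_prod hyp3_density_measurable)
  also have "\<dots> = (\<integral>\<^sup>+t. \<integral>\<^sup>+z. (if 0 < t then ennreal (1 / t ^ 3) else 0) * indicator F (z, t) \<partial>lborel \<partial>lborel)"
    using F' by (subst lborel_pair.nn_integral_snd[symmetric]) auto
  finally show ?thesis .
qed

lemma nn_integral_complex_scale:
  fixes g :: "complex \<Rightarrow> ennreal"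
  assumes [measurable]: "g \<in> borel_measurable borel" and t: "0 < t"
  shows "(\<integral>\<^sup>+z. g z \<partial>lborel) = ennreal (t\<^sup>2) * (\<integral>\<^sup>+w. g (t *\<^sub>R w) \<partial>lborel)"
proof -
  have "(\<integral>\<^sup>+z. g z \<partial>lborel) = (\<integral>\<^sup>+z. g z \<partial>density (distr lborel borel (\<lambda>x. 0 + t *\<^sub>R x)) (\<lambda>_. ennreal (\<bar>t\<bar> ^ DIM(complex))))"
    using lborel_affine[of t "0 :: complex"] t by simp
  also have "\<dots> = ennreal (t\<^sup>2) * (\<integral>\<^sup>+w. g (t *\<^sub>R w) \<partial>lborel)"
    by (subst nn_integral_density, simp, simp, subst nn_integral_distr)
       (simp_all add: nn_integral_cmult)
  finally show ?thesis .
qed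

text \<open>In the coordinates \<open>(z, t) = (t w, t)\<close> the hyperbolic measure is \<open>dw dt / t\<close>.\<close>

lemma hyp3_emeasure_chart:
  assumes F: "F \<in> sets borel"
  shows "emeasure hyp3_measure F =
    (\<integral>\<^sup>+w. \<integral>\<^sup>+t. (if 0 < t then ennreal (1 / t) else 0) * indicator F (t *\<^sub>R w, t) \<partial>lborel \<partial>lborel)"
proof -
  have F'[measurable]: "F \<in> sets (borel \<Otimes>\<^sub>M borel)" using F by (simp only: borel_prod)
  have *: "(\<integral>\<^sup>+z. (if 0 < t then ennreal (1 / t ^ 3) else 0) * indicator F (z, t) \<partial>lborel) =
      (\<integral>\<^sup>+w. (if 0 < t then ennreal (1 / t) else 0) * indicator F (t *\<^sub>R w, t) \<partial>lborel)" for t :: real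
  proof (cases "0 < t")
    case True
    have e: "ennreal (1 / t) = ennreal (1 / t ^ 3) * ennreal (t\<^sup>2)"
      using True by (simp add: power3_eq_cube power2_eq_square flip: ennreal_mult')
    have "(\<integral>\<^sup>+z. ennreal (1 / t ^ 3) * indicator F (z, t) \<partial>lborel) =
      ennreal (1 / t ^ 3) * (\<integral>\<^sup>+z. indicator F (z, t) \<partial>lborel)"
      by (rule nn_integral_cmult) measurable
    also have "(\<integral>\<^sup>+z. indicator F (z, t) \<partial>lborel) = ennreal (t\<^sup>2) * (\<integral>\<^sup>+w. indicator F (t *\<^sub>R w, t) \<partial>lborel)"
      by (rule nn_integral_complex_scale) (use True in measurable)
    also have "ennreal (1 / t ^ 3) * \<dots> = ennreal (1 / t) * (\<integral>\<^sup>+w. indicator F (t *\<^sub>R w, t) \<partial>lborel)"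
      unfolding e by (simp add: mult.assoc)
    also have "\<dots> = (\<integral>\<^sup>+w. ennreal (1 / t) * indicator F (t *\<^sub>R w, t) \<partial>lborel)"
      by (rule nn_integral_cmult[symmetric]) measurable
    finally show ?thesis using True by simp
  qed simp
  show ?thesis
    unfolding hyp3_emeasure_gen[OF F] *
    by (rule lborel_pair.Fubini') measurable
qed

text \<open>Substitution on an interval exhausted by compact ones, used for the exponential function
  on the line and for the tangent on \<open>(0, \<pi> / 2)\<close>.\<close>

lemma nn_integral_substitution_UN:
  fixes f :: "real \<Rightarrow> ennreal" and a b :: "nat \<Rightarrow> real"
  assumes [measurable]: "f \<in> borel_measurable borel" "g \<in> borel_measurable borel" "g' \<in> borel_measurable borel"
    and deriv: "\<And>n x. x \<in> {a n..b n} \<Longrightarrow> (g has_real_derivative g' x) (at x)"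
    and cont: "\<And>n. continuous_on {a n..b n} g'"
    and nonneg: "\<And>n x. x \<in> {a n..b n} \<Longrightarrow> 0 \<le> g' x"
    and ab: "\<And>n. a n < b n" and mono: "decseq a" "incseq b"
  shows "(\<integral>\<^sup>+x. f x * indicator (\<Union>n. {g (a n)..g (b n)}) x \<partial>lborel) =
    (\<integral>\<^sup>+x. f (g x) * ennreal (g' x) * indicator (\<Union>n. {a n..b n}) x \<partial>lborel)"
proof -
  have step: "a (Suc n) \<le> a n" "b n \<le> b (Suc n)" for n
    using mono by (auto dest: decseq_SucD incseq_SucD)
  have g_mono: "g x \<le> g y" if "x \<in> {a n..b n}" "y \<in> {a n..b n}" "x \<le> y" for n x y
  proof (rule DERIV_nonneg_imp_nondecreasing[OF that(3)])
    fix z assume "x \<le> z" "z \<le> y"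
    then have "z \<in> {a n..b n}" using that by auto
    then show "\<exists>d. (g has_real_derivative d) (at z) \<and> 0 \<le> d" using deriv nonneg by blast
  qed
  have gs: "g (a (Suc n)) \<le> g (a n)" "g (b n) \<le> g (b (Suc n))" for n
    using step[of n] ab[of n] by (auto intro!: g_mono[of _ "Suc n"])
  have "(\<integral>\<^sup>+x. f x * indicator (\<Union>n. {g (a n)..g (b n)}) x \<partial>lborel) =
      emeasure (density lborel f) (\<Union>n. {g (a n)..g (b n)})"
    by (subst emeasure_density) auto
  also have "\<dots> = (SUP n. emeasure (density lborel f) {g (a n)..g (b n)})"
    by (rule SUP_emeasure_incseq[symmetric]) (auto intro!: incseq_SucI intro: order_trans[OF gs(1)] order_trans[OF _ gs(2)])
  also have "\<dots> = (SUP n. emeasure (density lborel (\<lambda>x. f (g x) * ennreal (g' x))) {a n..b n})"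
  proof (rule SUP_cong[OF refl])
    fix n
    have "(\<integral>\<^sup>+x. f x * indicator {g (a n)..g (b n)} x \<partial>lborel) =
        (\<integral>\<^sup>+x. f (g x) * ennreal (g' x) * indicator {a n..b n} x \<partial>lborel)"
      by (rule nn_integral_substitution_aux) (auto intro: deriv cont nonneg ab)
    then show "emeasure (density lborel f) {g (a n)..g (b n)} =
        emeasure (density lborel (\<lambda>x. f (g x) * ennreal (g' x))) {a n..b n}"
      by (simp add: emeasure_density)
  qed
  also have "\<dots> = emeasure (density lborel (\<lambda>x. f (g x) * ennreal (g' x))) (\<Union>n. {a n..b n})"
    by (rule SUP_emeasure_incseq) (auto intro!: incseq_SucI intro: order_trans[OF step(1)] order_trans[OF _ step(2)])
  also have "\<dots> = (\<integral>\<^sup>+x. f (g x) * ennreal (g' x) * indicator (\<Union>n. {a n..b n}) x \<partial>lborel)"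
    by (subst emeasure_density) auto
  finally show ?thesis .
qed

lemma nn_integral_exp_substitution:
  fixes G :: "real \<Rightarrow> ennreal"
  assumes [measurable]: "G \<in> borel_measurable borel"
  shows "(\<integral>\<^sup>+t. (if 0 < t then ennreal (1 / t) else 0) * G t \<partial>lborel) = (\<integral>\<^sup>+s. G (exp s) \<partial>lborel)"
proof -
  have ex: "\<exists>n. \<bar>s\<bar> \<le> real n + 1" for s :: real
  proof -
    obtain n where "\<bar>s\<bar> \<le> real n" using real_arch_simple by blast
    then have "\<bar>s\<bar> \<le> real n + 1" by linarith
    then show ?thesis by blast
  qed
  have I: "(\<Union>n. {- (real n + 1)..real n + 1}) = UNIV"
  proof -
    have "s \<in> (\<Union>n. {- (real n + 1)..real n + 1})" for s
    proof -
      obtain n where "\<bar>s\<bar> \<le> real n + 1" using ex by blast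
      then have "s \<in> {- (real n + 1)..real n + 1}" unfolding atLeastAtMost_iff by linarith
      then show ?thesis by blast
    qed
    then show ?thesis by blast
  qed
  have J: "(\<Union>n. {exp (- (real n + 1))..exp (real n + 1)}) = {0<..}"
  proof (intro equalityI subsetI)
    fix t :: real assume t: "t \<in> {0<..}"
    obtain n where "\<bar>ln t\<bar> \<le> real n + 1" using ex by blast
    then have "- (real n + 1) \<le> ln t" "ln t \<le> real n + 1" by linarith+
    then have "exp (- (real n + 1)) \<le> exp (ln t)" "exp (ln t) \<le> exp (real n + 1)" by (simp_all only: exp_le_cancel_iff)
    moreover have "exp (ln t) = t" using t by simp
    ultimately have "t \<in> {exp (- (real n + 1))..exp (real n + 1)}" by (simp only: atLeastAtMost_iff)
    then show "t \<in> (\<Union>n. {exp (- (real n + 1))..exp (real n + 1)})" by blast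
  next
    fix t :: real assume "t \<in> (\<Union>n. {exp (- (real n + 1))..exp (real n + 1)})"
    then show "t \<in> {0<..}" by (auto intro: less_le_trans[OF exp_gt_zero])
  qed
  define h :: "real \<Rightarrow> ennreal" where "h t = (if 0 < t then ennreal (1 / t) else 0) * G t" for t
  have h: "h \<in> borel_measurable borel" unfolding h_def by measurable
  have e: "h (exp s) * ennreal (exp s) = G (exp s)" for s
  proof -
    have "ennreal (1 / exp s) * ennreal (exp s) = 1"
      by (simp flip: ennreal_mult')
    moreover have "h (exp s) * ennreal (exp s) = (ennreal (1 / exp s) * ennreal (exp s)) * G (exp s)"
      by (simp add: h_def mult_ac)
    ultimately show ?thesis by simp
  qed
  have "(\<integral>\<^sup>+t. h t * indicator {0<..} t \<partial>lborel) = (\<integral>\<^sup>+s. h (exp s) * ennreal (exp s) * indicator UNIV s \<partial>lborel)"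
    unfolding I[symmetric] J[symmetric] using h
    by (intro nn_integral_substitution_UN) (auto intro!: derivative_eq_intros continuous_intros decseq_SucI incseq_SucI)
  moreover have "h t * indicator {0<..} t = h t" for t
    by (simp add: h_def indicator_def)
  ultimately show ?thesis unfolding e by (simp add: h_def)
qed

text \<open>In the variable \<open>ln t\<close> the measure \<open>dt / t\<close> is Lebesgue
  measure, and \<open>t \<mapsto> 1 / (t k)\<close> becomes a reflection of the line.\<close>

lemma nn_integral_inversion:
  fixes G :: "real \<Rightarrow> ennreal"
  assumes [measurable]: "G \<in> borel_measurable borel" and k: "0 < k"
  shows "(\<integral>\<^sup>+t. (if 0 < t then ennreal (1 / t) else 0) * G (1 / (t * k)) \<partial>lborel) =
    (\<integral>\<^sup>+t. (if 0 < t then ennreal (1 / t) else 0) * G t \<partial>lborel)"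
proof -
  have "(\<integral>\<^sup>+t. (if 0 < t then ennreal (1 / t) else 0) * G (1 / (t * k)) \<partial>lborel) = (\<integral>\<^sup>+s. G (1 / (exp s * k)) \<partial>lborel)"
    by (rule nn_integral_exp_substitution) measurable
  also have "\<dots> = (\<integral>\<^sup>+s. G (exp (- ln k + (- 1) * s)) \<partial>lborel)"
    using k by (simp add: exp_minus exp_diff field_simps)
  also have "\<dots> = (\<integral>\<^sup>+s. G (exp s) \<partial>lborel)"
    using nn_integral_real_affine[of "\<lambda>s. G (exp s)" "- 1" "- ln k"] by simp
  also have "\<dots> = (\<integral>\<^sup>+t. (if 0 < t then ennreal (1 / t) else 0) * G t \<partial>lborel)"
    by (rule nn_integral_exp_substitution[symmetric]) measurable
  finally show ?thesis .
qed

lemma lborel_complex_reflect: "distr lborel borel (\<lambda>w. - cnj w) = lborel"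
proof (rule lborel_eqI[symmetric])
  have [measurable]: "cnj \<in> borel_measurable borel"
    by (intro borel_measurable_continuous_onI continuous_intros)
  fix l u :: complex
  assume lu: "\<And>b. b \<in> Basis \<Longrightarrow> l \<bullet> b \<le> u \<bullet> b"
  have le: "Re l \<le> Re u" "Im l \<le> Im u"
    using lu[of 1] lu[of \<i>] by (auto simp: Basis_complex_def)
  have "emeasure (distr lborel borel (\<lambda>w. - cnj w)) (box l u) =
      emeasure lborel ((\<lambda>w. - cnj w) -` box l u)"
    by (subst emeasure_distr) auto
  also have "(\<lambda>w. - cnj w) -` box l u = box (Complex (- Re u) (Im l)) (Complex (- Re l) (Im u))"
    by (auto simp: box_def Basis_complex_def)
  also have "emeasure lborel \<dots> = (\<Prod>b\<in>Basis. (u - l) \<bullet> b)"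
    using le by (subst emeasure_lborel_box) (auto simp: Basis_complex_def)
  finally show "emeasure (distr lborel borel (\<lambda>w. - cnj w)) (box l u) = (\<Prod>b\<in>Basis. (u - l) \<bullet> b)" .
qed simp

definition hyp3_pres :: "complex^2^2 \<Rightarrow> bool" where
  "hyp3_pres A \<longleftrightarrow> det A = 1 \<and> (\<forall>F\<in>sets borel. F \<subseteq> hyp3 \<longrightarrow> hyp3_act A ` F \<in> sets borel \<and>
     hyp3_act A ` F \<subseteq> hyp3 \<and> emeasure hyp3_measure (hyp3_act A ` F) = emeasure hyp3_measure F)"

lemma hyp3_act_mult': "det A = 1 \<Longrightarrow> det B = 1 \<Longrightarrow> p \<in> hyp3 \<Longrightarrow> hyp3_act (A ** B) p = hyp3_act A (hyp3_act B p)"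
  by (rule mat2_exhaust[of A], rule mat2_exhaust[of B]) (simp add: hyp3_act_mult mat2_det)

lemma hyp3_act_in': "det A = 1 \<Longrightarrow> p \<in> hyp3 \<Longrightarrow> hyp3_act A p \<in> hyp3"
  by (rule mat2_exhaust[of A]) (simp add: hyp3_act_in mat2_det)

lemma hyp3_act_one [simp]: "hyp3_act (mat 1) p = p"
  by (cases p) (simp add: mat2_one hyp3_act_mat2 kden_def)

lemma hyp3_act_minus: "hyp3_act (- A) = hyp3_act A"
proof (rule mat2_exhaust[of A])
  fix a b c d assume A: "A = mat2 a b c d"
  have k: "kden (- c) (- d) p = kden c d p" for p
  proof -
    have "- c * fst p + - d = - (c * fst p + d)" by simp
    then show ?thesis unfolding kden_def by (metis norm_minus_cancel)
  qed
  show ?thesis unfolding A mat2_minus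
    by (auto simp: fun_eq_iff hyp3_act_mat2 k algebra_simps)
qed

lemma hyp3_pres_mult:
  assumes A: "hyp3_pres A" and B: "hyp3_pres B"
  shows "hyp3_pres (A ** B)"
  unfolding hyp3_pres_def
proof (intro conjI ballI impI)
  show "det (A ** B) = 1" using A B by (simp add: hyp3_pres_def det_mul)
  fix F :: "(complex \<times> real) set" assume F: "F \<in> sets borel" "F \<subseteq> hyp3"
  have e: "hyp3_act (A ** B) ` F = hyp3_act A ` (hyp3_act B ` F)"
    using F A B hyp3_act_mult' unfolding hyp3_pres_def image_image by (intro image_cong) auto
  show "hyp3_act (A ** B) ` F \<in> sets borel" "hyp3_act (A ** B) ` F \<subseteq> hyp3"
    "emeasure hyp3_measure (hyp3_act (A ** B) ` F) = emeasure hyp3_measure F"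
    unfolding e using A B F unfolding hyp3_pres_def by auto
qed

lemma hyp3_pres_translation: "hyp3_pres (mat2 1 u 0 1)"
  unfolding hyp3_pres_def
proof (intro conjI ballI impI)
  show "det (mat2 1 u 0 1) = 1" by (simp add: mat2_det)
  fix F :: "(complex \<times> real) set" assume F: "F \<in> sets borel" "F \<subseteq> hyp3"
  then have F'[measurable]: "F \<in> sets (borel \<Otimes>\<^sub>M borel)" by (simp only: borel_prod)
  have act: "hyp3_act (mat2 1 u 0 1) (z, t) = (z + u, t)" for z t
    by (simp add: hyp3_act_mat2 kden_def)
  have im: "hyp3_act (mat2 1 u 0 1) ` F = (\<lambda>p. (fst p - u, snd p)) -` F"
  proof (intro equalityI subsetI)
    fix p assume "p \<in> (\<lambda>p. (fst p - u, snd p)) -` F"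
    then have "(fst p - u, snd p) \<in> F" by simp
    then have "hyp3_act (mat2 1 u 0 1) (fst p - u, snd p) \<in> hyp3_act (mat2 1 u 0 1) ` F" by blast
    then show "p \<in> hyp3_act (mat2 1 u 0 1) ` F" by (simp add: act)
  qed (auto simp: act)
  have m: "(\<lambda>p. (fst p - u, snd p)) \<in> borel_measurable (borel :: (complex \<times> real) measure)"
    by (intro borel_measurable_continuous_onI continuous_intros)
  show B: "hyp3_act (mat2 1 u 0 1) ` F \<in> sets borel"
    unfolding im using measurable_sets[OF m F(1)] by simp
  show "hyp3_act (mat2 1 u 0 1) ` F \<subseteq> hyp3" using F by (auto simp: act hyp3_def)
  have "(\<integral>\<^sup>+z. (if 0 < t then ennreal (1 / t ^ 3) else 0) * indicator ((\<lambda>p. (fst p - u, snd p)) -` F) (z, t) \<partial>lborel) =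
      (\<integral>\<^sup>+z. (if 0 < t then ennreal (1 / t ^ 3) else 0) * indicator F (z, t) \<partial>lborel)" for t :: real
  proof -
    have "(\<integral>\<^sup>+z. (if 0 < t then ennreal (1 / t ^ 3) else 0) * indicator F (z, t) \<partial>lborel) =
        (\<integral>\<^sup>+z. (if 0 < t then ennreal (1 / t ^ 3) else 0) * indicator F (z, t) \<partial>distr lborel borel ((+) (- u)))"
      by (simp only: lborel_distr_plus)
    also have "\<dots> = (\<integral>\<^sup>+z. (if 0 < t then ennreal (1 / t ^ 3) else 0) * indicator F (- u + z, t) \<partial>lborel)"
      by (rule nn_integral_distr) measurable
    finally show ?thesis by (simp add: indicator_def)
  qed
  then show "emeasure hyp3_measure (hyp3_act (mat2 1 u 0 1) ` F) = emeasure hyp3_measure F"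
    unfolding hyp3_emeasure_gen[OF B] hyp3_emeasure_gen[OF F(1)] unfolding im by simp
qed

text \<open>The inversion in the unit sphere combined with the reflection in a vertical
  plane.\<close>

definition hyp3_inversion :: "complex \<times> real \<Rightarrow> complex \<times> real" where
  "hyp3_inversion p = (inverse ((cmod (fst p))\<^sup>2 + (snd p)\<^sup>2)) *\<^sub>R (- cnj (fst p), snd p)"

lemma hyp3_act_inversion: "hyp3_act (mat2 0 (- 1) 1 0) = hyp3_inversion" "hyp3_act (mat2 0 1 (- 1) 0) = hyp3_inversion"
  by (auto simp: fun_eq_iff hyp3_act_mat2 kden_def hyp3_inversion_def scaleR_conv_of_real field_simps)

lemma hyp3_inversion_involution:
  assumes "p \<in> hyp3"
  shows "hyp3_inversion (hyp3_inversion p) = p"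
proof -
  have "hyp3_act (mat2 0 (- 1) 1 0 ** mat2 0 1 (- 1) 0) p = hyp3_inversion (hyp3_inversion p)"
    using hyp3_act_mult[of 0 0 1 "- 1" 0 0 "- 1" 1 p] assms by (simp add: hyp3_act_inversion)
  then show ?thesis by (simp add: mat2_mult flip: mat2_one)
qed

text \<open>In the coordinates \<open>(t w, t)\<close> the map is \<open>w \<mapsto> - cnj w\<close>
  together with \<open>t \<mapsto> 1 / (t (1 + |w|^2))\<close>: a Euclidean reflection, and an
  inversion on the multiplicative half-line. Both preserve \<open>dw dt / t\<close>.\<close>

lemma hyp3_pres_inversion: "hyp3_pres (mat2 0 (- 1) 1 0)" "hyp3_pres (mat2 0 1 (- 1) 0)"
proof -
  have main: "hyp3_inversion ` F \<in> sets borel \<and> hyp3_inversion ` F \<subseteq> hyp3 \<and>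
      emeasure hyp3_measure (hyp3_inversion ` F) = emeasure hyp3_measure F"
    if F: "F \<in> sets borel" "F \<subseteq> hyp3" for F
  proof -
    have F'[measurable]: "F \<in> sets (borel \<Otimes>\<^sub>M borel)" using F by (simp only: borel_prod)
    have inh: "hyp3_inversion p \<in> hyp3" if "p \<in> hyp3" for p
      using hyp3_act_in[of 0 0 "- 1" 1 p] that by (simp add: hyp3_act_inversion)
    have im: "hyp3_inversion ` F = hyp3_inversion -` F \<inter> hyp3"
    proof (intro equalityI subsetI)
      fix p assume "p \<in> hyp3_inversion -` F \<inter> hyp3"
      then show "p \<in> hyp3_inversion ` F" by (metis IntE hyp3_inversion_involution image_eqI vimageE)
    qed (use F inh hyp3_inversion_involution in auto)
    have m: "hyp3_inversion \<in> borel_measurable borel"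
      unfolding hyp3_inversion_def[abs_def]
      by (intro borel_measurable_scaleR borel_measurable_inverse borel_measurable_continuous_onI continuous_intros)
    have h: "hyp3 \<in> sets borel"
    proof -
      have "hyp3 = {p. 0 < snd p}" by (auto simp: hyp3_def)
      moreover have "open {p :: complex \<times> real. 0 < snd p}" by (intro open_Collect_less continuous_intros)
      ultimately show ?thesis by simp
    qed
    have B: "hyp3_inversion ` F \<in> sets borel"
      unfolding im using measurable_sets[OF m F(1)] h by simp
    have inner: "(\<integral>\<^sup>+t. (if 0 < t then ennreal (1 / t) else 0) * indicator (hyp3_inversion ` F) (t *\<^sub>R w, t) \<partial>lborel) =
       (\<integral>\<^sup>+t. (if 0 < t then ennreal (1 / t) else 0) * indicator F (t *\<^sub>R (- cnj w), t) \<partial>lborel)" for w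
    proof -
      define k where "k = 1 + (cmod w)\<^sup>2"
      have k: "0 < k" unfolding k_def by (simp add: add_pos_nonneg)
      have iv: "hyp3_inversion (t *\<^sub>R w, t) = ((1 / (t * k)) *\<^sub>R (- cnj w), 1 / (t * k))" if "0 < t" for t
      proof -
        have "(cmod (t *\<^sub>R w))\<^sup>2 + t\<^sup>2 = t * (t * k)" by (simp add: k_def power_mult_distrib power2_eq_square algebra_simps)
        then show ?thesis using that k by (simp add: hyp3_inversion_def field_simps)
      qed
      have "(if 0 < t then ennreal (1 / t) else 0) * indicator (hyp3_inversion ` F) (t *\<^sub>R w, t) =
          (if 0 < t then ennreal (1 / t) else 0) * indicator F ((1 / (t * k)) *\<^sub>R (- cnj w), 1 / (t * k))" for t :: real
      proof (cases "0 < t")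
        case True
        then show ?thesis unfolding im by (simp add: indicator_def iv hyp3_def)
      qed simp
      then have "(\<integral>\<^sup>+t. (if 0 < t then ennreal (1 / t) else 0) * indicator (hyp3_inversion ` F) (t *\<^sub>R w, t) \<partial>lborel) =
         (\<integral>\<^sup>+t. (if 0 < t then ennreal (1 / t) else 0) * indicator F ((1 / (t * k)) *\<^sub>R (- cnj w), 1 / (t * k)) \<partial>lborel)"
        by simp
      also have "\<dots> = (\<integral>\<^sup>+t. (if 0 < t then ennreal (1 / t) else 0) * indicator F (t *\<^sub>R (- cnj w), t) \<partial>lborel)"
        by (rule nn_integral_inversion[where G = "\<lambda>s. indicator F (s *\<^sub>R (- cnj w), s)", OF _ k]) measurable
      finally show ?thesis .
    qed
    have cm: "(\<lambda>w. - cnj w) \<in> borel_measurable borel"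
      by (intro borel_measurable_continuous_onI continuous_intros)
    have bm: "(\<lambda>w. \<integral>\<^sup>+t. (if 0 < t then ennreal (1 / t) else 0) * indicator F (t *\<^sub>R w, t) \<partial>lborel) \<in> borel_measurable borel"
      by measurable
    have "emeasure hyp3_measure (hyp3_inversion ` F) =
      (\<integral>\<^sup>+w. \<integral>\<^sup>+t. (if 0 < t then ennreal (1 / t) else 0) * indicator F (t *\<^sub>R (- cnj w), t) \<partial>lborel \<partial>lborel)"
      unfolding hyp3_emeasure_chart[OF B] inner ..
    also have "\<dots> = (\<integral>\<^sup>+w. \<integral>\<^sup>+t. (if 0 < t then ennreal (1 / t) else 0) * indicator F (t *\<^sub>R w, t) \<partial>lborel \<partial>distr lborel borel (\<lambda>w. - cnj w))"
      by (rule nn_integral_distr[symmetric]) (use cm bm in \<open>simp_all add: measurable_distr_eq1\<close>)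
    also have "\<dots> = emeasure hyp3_measure F"
      unfolding lborel_complex_reflect hyp3_emeasure_chart[OF F(1)] ..
    finally show ?thesis using B im by auto
  qed
  show "hyp3_pres (mat2 0 (- 1) 1 0)" "hyp3_pres (mat2 0 1 (- 1) 0)"
    using main unfolding hyp3_pres_def hyp3_act_inversion by (auto simp: mat2_det)
qed

text \<open>Lower triangular unipotent matrices are conjugates of translations by the inversion, so
  translations and the inversion cover all generators.\<close>

lemma hyp3_pres_fig8: "A \<in> fig8_group \<Longrightarrow> hyp3_pres A"
proof (induction rule: fig8_induct)
  have "hyp3_pres (mat2 0 (- 1) 1 0 ** mat2 1 (- u) 0 1 ** mat2 0 1 (- 1) 0)" for u
    by (intro hyp3_pres_mult hyp3_pres_inversion hyp3_pres_translation)
  then have py: "hyp3_pres (mat2 1 0 u 1)" for u by (simp add: mat2_mult)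
  case one
  show ?case using hyp3_pres_translation[of 0] by (simp add: mat2_one)
  {
    case (x A)
    then show ?case unfolding fig8_x_eq by (intro hyp3_pres_mult hyp3_pres_translation)
  next
    case (xi A)
    then show ?case by (intro hyp3_pres_mult hyp3_pres_translation)
  next
    case (y A)
    then show ?case unfolding fig8_y_eq by (intro hyp3_pres_mult py)
  next
    case (yi A)
    then show ?case by (intro hyp3_pres_mult py)
  }
qed

section \<open>A fundamental domain\<close>

text \<open>The open Voronoi cell of 0 in the lattice of Eisenstein integers; the six inequalities
  compare 0 with the six units.\<close>

definition hex :: "complex \<Rightarrow> bool" where
  "hex z \<longleftrightarrow> \<bar>Re z\<bar> < 1 / 2 \<and> \<bar>Re z\<bar> + sqrt 3 * \<bar>Im z\<bar> < 1"

lemma cmod_diff_eis: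
  "(cmod (z - eis m n))\<^sup>2 = (cmod z)\<^sup>2 - (Re z * (2 * m - n) + sqrt 3 * Im z * n) + of_int (m * m - m * n + n * n)"
proof -
  have "sqrt 3 * sqrt 3 = (3::real)" by simp
  then show ?thesis
    unfolding cmod_power2 by (simp add: Re_eis Im_eis power2_eq_square algebra_simps)
qed

text \<open>\<alpha> and \<beta> stand for twice the inner products of z with two neighbouring
  units, and the right side is the norm of the combination with coefficients p and q. The claim
  follows from \<open>p + q \<le> p^2 + p q + q^2\<close>.\<close>

lemma two_vectors_bound:
  fixes \<alpha> \<beta> :: real and p q :: int
  assumes "\<alpha> < 1" "\<beta> < 1" "0 \<le> p" "0 \<le> q" "p \<noteq> 0 \<or> q \<noteq> 0"
  shows "p * \<alpha> + q * \<beta> < of_int (p * p + p * q + q * q)"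
proof -
  have "of_int p * \<alpha> \<le> of_int p * (1 :: real)" by (rule mult_left_mono) (use assms in auto)
  moreover have "of_int q * \<beta> \<le> of_int q * (1 :: real)" by (rule mult_left_mono) (use assms in auto)
  moreover have "of_int p * \<alpha> < of_int p * (1 :: real) \<or> of_int q * \<beta> < of_int q * (1 :: real)"
    using assms by auto
  ultimately have "p * \<alpha> + q * \<beta> < of_int (p + q)" by auto
  moreover have "p \<le> p * p" "q \<le> q * q" "0 \<le> p * q"
    using assms mult_left_mono[of 1 p p] mult_left_mono[of 1 q q] by (cases "p = 0"; cases "q = 0"; simp)+
  then have "p + q \<le> p * p + p * q + q * q" by linarith
  then have "real_of_int (p + q) \<le> of_int (p * p + p * q + q * q)" by (simp only: of_int_le_iff)
  ultimately show ?thesis by linarith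
qed

text \<open>A nonzero lattice point is a combination with coefficients \<open>p, q \<ge> 0\<close> of two units that
  are 60 degrees apart.\<close>

lemma hex_less:
  assumes h: "hex z" and 0: "m \<noteq> 0 \<or> n \<noteq> 0"
  shows "cmod z < cmod (z - eis m n)"
proof -
  define x where "x = Re z"
  define Y where "Y = sqrt 3 * Im z"
  have "\<bar>Y\<bar> = sqrt 3 * \<bar>Im z\<bar>" by (simp add: Y_def abs_mult)
  then have "\<bar>x\<bar> < 1 / 2" "\<bar>x\<bar> + \<bar>Y\<bar> < 1" using h by (simp_all add: hex_def x_def)
  then have b: "2 * x < 1" "x + Y < 1" "Y - x < 1" "- 2 * x < 1" "- x - Y < 1" "x - Y < 1" by linarith+
  have "x * (2 * m - n) + Y * n < of_int (m * m - m * n + n * n)"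
  proof -
    have 0: "m \<noteq> 0 \<or> n \<noteq> 0" "n \<noteq> 0 \<or> m \<noteq> 0" using 0 by auto
    consider "0 \<le> n" "n \<le> m" | "0 \<le> m" "m \<le> n" | "m \<le> 0" "0 \<le> n"
      | "n \<le> 0" "m \<le> n" | "m \<le> 0" "n \<le> m" | "0 \<le> m" "n \<le> 0" by linarith
    then show ?thesis
    proof cases
      case 1
      then show ?thesis using two_vectors_bound[of "2 * x" "x + Y" "m - n" n] b 0 by (simp add: algebra_simps)
    next
      case 2
      then show ?thesis using two_vectors_bound[of "x + Y" "Y - x" m "n - m"] b 0 by (simp add: algebra_simps)
    next
      case 3
      then show ?thesis using two_vectors_bound[of "Y - x" "- 2 * x" n "- m"] b 0 by (simp add: algebra_simps)
    next
      case 4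
      then show ?thesis using two_vectors_bound[of "- 2 * x" "- x - Y" "n - m" "- n"] b 0 by (simp add: algebra_simps)
    next
      case 5
      then show ?thesis using two_vectors_bound[of "- x - Y" "x - Y" "- m" "m - n"] b 0 by (simp add: algebra_simps)
    next
      case 6
      then show ?thesis using two_vectors_bound[of "x - Y" "2 * x" "- n" m] b 0 by (simp add: algebra_simps)
    qed
  qed
  then have "(cmod z)\<^sup>2 < (cmod (z - eis m n))\<^sup>2" unfolding cmod_diff_eis x_def Y_def by (simp add: algebra_simps)
  then show ?thesis by (rule power_less_imp_less_base) simp
qed

lemma hexI:
  assumes "\<And>m n. m \<noteq> 0 \<or> n \<noteq> 0 \<Longrightarrow> cmod z < cmod (z - eis m n)"
  shows "hex z"
proof -
  have *: "Re z * (2 * m - n) + sqrt 3 * Im z * n < of_int (m * m - m * n + n * n)" if "m \<noteq> 0 \<or> n \<noteq> 0" for m n :: int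
  proof -
    have "(cmod z)\<^sup>2 < (cmod (z - eis m n))\<^sup>2" using assms[OF that] by (intro power_strict_mono) auto
    then show ?thesis unfolding cmod_diff_eis by linarith
  qed
  have "\<bar>sqrt 3 * Im z\<bar> = sqrt 3 * \<bar>Im z\<bar>" by (simp add: abs_mult)
  then show ?thesis
    using *[of 1 0] *[of 1 1] *[of 0 1] *[of "- 1" 0] *[of "- 1" "- 1"] *[of 0 "- 1"]
    unfolding hex_def by simp linarith
qed

lemma hex_unique:
  assumes "hex (z - eis m n)" "hex (z - eis m' n')"
  shows "m = m' \<and> n = n'"
proof (rule ccontr)
  assume ne: "\<not> (m = m' \<and> n = n')"
  have e: "z - eis m n - eis (m' - m) (n' - n) = z - eis m' n'" "z - eis m' n' - eis (m - m') (n - n') = z - eis m n"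
    by (simp_all flip: eis_diff)
  have "cmod (z - eis m n) < cmod (z - eis m' n')"
    using hex_less[OF assms(1), of "m' - m" "n' - n"] ne unfolding e by auto
  moreover have "cmod (z - eis m' n') < cmod (z - eis m n)"
    using hex_less[OF assms(2), of "m - m'" "n - n'"] ne unfolding e by auto
  ultimately show False by simp
qed

lemma hex_nearest: "hex (z - eis m n) \<Longrightarrow> cmod (z - eis m n) \<le> cmod (z - eis m' n')"
  using hex_less[of "z - eis m n" "m' - m" "n' - n"] eis_diff[of m' n' m n]
  by (cases "m' = m \<and> n' = n") (auto simp: algebra_simps)

text \<open>The corners of the hexagon are at distance \<open>1 / sqrt 3\<close> from its centre.
  Points of the domain therefore have squared height at least 2 / 3.\<close>

lemma hex_norm: "hex z \<Longrightarrow> (cmod z)\<^sup>2 \<le> 1 / 3"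
proof -
  assume h: "hex z"
  have "(sqrt 3 * \<bar>Im z\<bar>)\<^sup>2 \<le> (1 - \<bar>Re z\<bar>)\<^sup>2" using h by (intro power_mono) (auto simp: hex_def)
  then have "3 * (Im z)\<^sup>2 \<le> (1 - \<bar>Re z\<bar>)\<^sup>2" by (simp add: power_mult_distrib)
  moreover have "\<bar>Re z\<bar> * \<bar>Re z\<bar> \<le> \<bar>Re z\<bar> * (1 / 2)" using h by (intro mult_left_mono) (auto simp: hex_def)
  ultimately show ?thesis unfolding cmod_power2 by (simp add: power2_eq_square algebra_simps)
qed

lemma finite_eis_ball: "finite {(m, n). cmod (eis m n - z) \<le> R}"
proof -
  obtain K where K: "cmod z + R \<le> real_of_int K" using ex_le_of_int by blast
  have "{(m, n). cmod (eis m n - z) \<le> R} \<subseteq> {- 3 * K..3 * K} \<times> {- 3 * K..3 * K}"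
  proof safe
    fix m n assume "cmod (eis m n - z) \<le> R"
    then have "cmod (eis m n) \<le> K" using K norm_triangle_sub[of "eis m n" z] by linarith
    then have b: "\<bar>Re (eis m n)\<bar> \<le> K" "\<bar>Im (eis m n)\<bar> \<le> K"
      using abs_Re_le_cmod[of "eis m n"] abs_Im_le_cmod[of "eis m n"] by linarith+
    have "1 \<le> sqrt (3::real)" by simp
    then have "\<bar>real_of_int n\<bar> * 1 \<le> \<bar>real_of_int n\<bar> * sqrt 3" by (intro mult_left_mono) auto
    then have n: "\<bar>real_of_int n\<bar> \<le> 2 * K" using b(2) by (simp add: Im_eis abs_mult)
    then have m: "\<bar>real_of_int m\<bar> \<le> 3 * K" using b(1) by (simp add: Re_eis)
    have "0 \<le> K" using n by linarith
    show "m \<in> {- 3 * K..3 * K}" "n \<in> {- 3 * K..3 * K}" using m n \<open>0 \<le> K\<close> by auto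
  qed
  then show ?thesis by (rule finite_subset) simp
qed

lemma nearest_eis: "\<exists>m n. \<forall>m' n'. cmod (z - eis m n) \<le> cmod (z - eis m' n')"
proof -
  define S where "S = {(m, n). cmod (eis m n - z) \<le> cmod (eis 0 0 - z)}"
  have S: "finite S" "(0, 0) \<in> S" unfolding S_def using finite_eis_ball by auto
  define v where "v = Min ((\<lambda>(m, n). cmod (eis m n - z)) ` S)"
  have "v \<in> (\<lambda>(m, n). cmod (eis m n - z)) ` S" unfolding v_def using S by (intro Min_in) auto
  then obtain m n where mn: "(m, n) \<in> S" "cmod (eis m n - z) = v" by auto
  have "cmod (eis m n - z) \<le> cmod (eis m' n' - z)" for m' n'
  proof (cases "(m', n') \<in> S")
    case True
    then have "v \<le> cmod (eis m' n' - z)" unfolding v_def using S by (intro Min_le) (auto intro: rev_image_eqI)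
    then show ?thesis using mn by simp
  next
    case False
    then show ?thesis using mn by (auto simp: S_def)
  qed
  then show ?thesis by (metis norm_minus_commute)
qed

text \<open>The translations of the group are those by \<open>k + 4 l \<omega>\<close>, hence four hexagonal cells.\<close>

definition fig8_domain :: "(complex \<times> real) set" where
  "fig8_domain = {p. 0 < snd p \<and> (\<exists>j\<in>{0, 1, 2, 3}. hex (fst p - eis 0 j) \<and> 1 < (cmod (fst p - eis 0 j))\<^sup>2 + (snd p)\<^sup>2)}"

lemma fig8_domain_sub: "fig8_domain \<subseteq> hyp3"
  by (auto simp: fig8_domain_def hyp3_def)

lemma open_fig8_domain: "open fig8_domain"
proof -
  have "open {p :: complex \<times> real. 0 < snd p \<and> hex (fst p - u) \<and> 1 < (cmod (fst p - u))\<^sup>2 + (snd p)\<^sup>2}" for u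
    unfolding hex_def by (intro open_Collect_conj open_Collect_less continuous_intros)
  then have "open (\<Union>j\<in>{0, 1, 2, 3}. {p :: complex \<times> real. 0 < snd p \<and> hex (fst p - eis 0 j) \<and> 1 < (cmod (fst p - eis 0 j))\<^sup>2 + (snd p)\<^sup>2})"
    by blast
  also have "(\<Union>j\<in>{0, 1, 2, 3}. {p :: complex \<times> real. 0 < snd p \<and> hex (fst p - eis 0 j) \<and> 1 < (cmod (fst p - eis 0 j))\<^sup>2 + (snd p)\<^sup>2}) = fig8_domain"
    unfolding fig8_domain_def by blast
  finally show ?thesis .
qed

lemma cnj_eis: "cnj (eis m n) = eis (m - n) (- n)"
  by (simp add: complex_eq_iff Re_eis Im_eis)

text \<open>The norm of c is a positive integer. If it is 1, then \<open>- d / c\<close> is a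
  lattice point, and p lies outside the unit sphere around it because it does so for the nearest
  lattice point. If it is at least 2, the height alone contributes \<open>4 / 3\<close>.\<close>

lemma fig8_domain_kden:
  assumes A: "mat2 a b c d \<in> fig8_group" and c: "c \<noteq> 0" and p: "p \<in> fig8_domain"
  shows "1 < kden c d p"
proof -
  obtain c0 c1 d0 d1 where e: "c = eis c0 c1" "d = eis d0 d1"
    using fig8_entries[OF A] by (auto simp: mat2_eq_iff)
  obtain j where j: "hex (fst p - eis 0 j)" "1 < (cmod (fst p - eis 0 j))\<^sup>2 + (snd p)\<^sup>2"
    using p by (auto simp: fig8_domain_def)
  define N where "N = c0 * c0 - c0 * c1 + c1 * c1"
  have N: "(cmod c)\<^sup>2 = of_int N" unfolding e cmod_eis N_def ..
  have "0 < (cmod c)\<^sup>2" using c by simp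
  then have "1 \<le> N" unfolding N by simp
  then consider "N = 1" | "2 \<le> N" by linarith
  then show ?thesis
  proof cases
    case 1
    then have c1: "(cmod c)\<^sup>2 = 1" using N by simp
    then have cc: "c * cnj c = 1" by (simp flip: complex_norm_square)
    obtain m n where mn: "- (cnj c * d) = eis m n" unfolding e cnj_eis eis_mult eis_minus by blast
    have "c * fst p + d = c * (fst p - eis m n)" unfolding mn[symmetric] using cc by (simp add: algebra_simps)
    then have "(cmod (c * fst p + d))\<^sup>2 = (cmod (fst p - eis m n))\<^sup>2"
      using c1 by (simp add: norm_mult power_mult_distrib)
    moreover have "(cmod (fst p - eis 0 j))\<^sup>2 \<le> (cmod (fst p - eis m n))\<^sup>2"
      using hex_nearest[OF j(1)] by (intro power_mono) auto
    ultimately show ?thesis using j(2) unfolding kden_def c1 by linarith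
  next
    case 2
    have t: "2 / 3 \<le> (snd p)\<^sup>2" using hex_norm[OF j(1)] j(2) by linarith
    have "2 * (2 / 3) \<le> (cmod c)\<^sup>2 * (snd p)\<^sup>2" unfolding N using 2 t by (intro mult_mono) auto
    then show ?thesis unfolding kden_def using zero_le_power2[of "cmod (c * fst p + d)"] by linarith
  qed
qed

lemma fig8_act_inv:
  assumes A: "mat2 a b c d \<in> fig8_group" and p: "p \<in> hyp3"
  shows "hyp3_act (mat2 d (- b) (- c) a) (hyp3_act (mat2 a b c d) p) = p"
proof -
  have D: "a * d - b * c = 1" using A fig8_det by blast
  have "hyp3_act (mat2 d (- b) (- c) a) (hyp3_act (mat2 a b c d) p) = hyp3_act (mat2 d (- b) (- c) a ** mat2 a b c d) p"
    using D p by (intro hyp3_act_mult[symmetric]) (auto simp: algebra_simps)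
  also have "mat2 d (- b) (- c) a ** mat2 a b c d = mat 1"
    using D by (simp add: mat2_mult mat2_one mat2_eq_iff algebra_simps)
  finally show ?thesis by simp
qed

lemma snd_hyp3_act: "snd (hyp3_act (mat2 a b c d) p) = snd p / kden c d p"
  by (cases p) (simp add: hyp3_act_mat2)

lemma fig8_act_height:
  assumes A: "mat2 a b c d \<in> fig8_group" and c: "c \<noteq> 0" and p: "p \<in> fig8_domain"
  shows "snd (hyp3_act (mat2 a b c d) p) < snd p"
proof -
  have "snd p / kden c d p < snd p / 1"
    using fig8_domain_kden[OF assms] p by (intro divide_strict_left_mono) (auto simp: fig8_domain_def)
  then show ?thesis by (simp add: snd_hyp3_act)
qed

lemma act_translation: "a = 1 \<or> a = - 1 \<Longrightarrow> hyp3_act (mat2 a b 0 a) (z, t) = (z + a * b, t)"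
  by (auto simp: hyp3_act_mat2 kden_def)

text \<open>An element with \<open>c \<noteq> 0\<close> strictly lowers every point of the domain,
  and so does its inverse, a contradiction for two points of the domain. The remaining elements are,
  up to sign, translations by \<open>k + 4 l \<omega>\<close>, and two of the four cells never
  differ by such a vector unless it is 0.\<close>

lemma fig8_domain_disjoint:
  assumes A: "A \<in> fig8_group" "A \<noteq> mat 1" "A \<noteq> - mat 1"
  shows "fig8_domain \<inter> hyp3_act A ` fig8_domain = {}"
proof (rule ccontr)
  obtain a b c d where Ae: "A = mat2 a b c d" using mat2_exhaust by blast
  assume "fig8_domain \<inter> hyp3_act A ` fig8_domain \<noteq> {}"
  then obtain q where q: "q \<in> fig8_domain" "hyp3_act (mat2 a b c d) q \<in> fig8_domain" using Ae by blast
  have g: "mat2 a b c d \<in> fig8_group" using A Ae by simp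
  show False
  proof (cases "c = 0")
    case False
    have "snd (hyp3_act (mat2 a b c d) q) < snd q" using fig8_act_height[OF g False q(1)] .
    moreover have "snd (hyp3_act (mat2 d (- b) (- c) a) (hyp3_act (mat2 a b c d) q)) < snd (hyp3_act (mat2 a b c d) q)"
      using False by (intro fig8_act_height fig8_inv g q) simp
    moreover have "hyp3_act (mat2 d (- b) (- c) a) (hyp3_act (mat2 a b c d) q) = q"
      using g q fig8_domain_sub by (intro fig8_act_inv) auto
    ultimately show False by simp
  next
    case True
    then have g0: "mat2 a b 0 d \<in> fig8_group" using g by simp
    have a: "a = 1 \<or> a = - 1" using fig8_stabilizer[OF g0] .
    obtain k l where b: "b = eis k (4 * l)" and d: "d = a" using fig8_translation[OF g0 a] by blast
    obtain k' l' where ab: "a * b = eis k' (4 * l')"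
    proof -
      have "a * b = eis k (4 * l) \<or> a * b = eis (- k) (4 * - l)" using a b by (auto simp: eis_minus)
      then show ?thesis using that by blast
    qed
    obtain z t where zt: "q = (z, t)" by (cases q)
    have "hyp3_act (mat2 a b c d) q = (z + a * b, t)" unfolding zt True d using a by (rule act_translation)
    then have q2: "(z + a * b, t) \<in> fig8_domain" using q by simp
    obtain j where j: "j \<in> {0, 1, 2, 3}" "hex (z - eis 0 j)" using q unfolding zt fig8_domain_def by auto
    obtain j' where j': "j' \<in> {0, 1, 2, 3}" "hex (z + a * b - eis 0 j')" using q2 unfolding fig8_domain_def by auto
    have "z + a * b - eis 0 j' = z - eis (- k') (j' - 4 * l')"
      unfolding ab by (simp add: eis_def algebra_simps)
    then have "hex (z - eis (- k') (j' - 4 * l'))" using j'(2) by (simp only:)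
    from hex_unique[OF j(2) this] have kl: "k' = 0" "j = j' - 4 * l'" by auto
    then have "l' = 0" using j(1) j'(1) by auto
    then have "a * b = 0" using ab kl by (simp add: eis_simps)
    then have "b = 0" using a by auto
    then show False using A Ae True d a by (auto simp: mat2_one mat2_minus)
  qed
qed

text \<open>Discreteness: the lower rows consist of Eisenstein integers, so only finitely many of
  the values of \<open>kden\<close> at the point are at most 1, and a smallest one exists.\<close>

lemma fig8_max_height:
  assumes p: "p \<in> hyp3"
  shows "\<exists>A\<in>fig8_group. \<forall>B\<in>fig8_group. snd (hyp3_act B p) \<le> snd (hyp3_act A p)"
proof -
  obtain z t where zt: "p = (z, t)" and t: "0 < t" using p by (auto simp: hyp3_def)
  define R where "R = {A \<in> fig8_group. kden (A$2$1) (A$2$2) p \<le> 1}"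
  \<comment> \<open>\<open>kden \<le> 1\<close> forces \<open>|c| \<le> 1 / t\<close> and then
    places d within distance 1 of \<open>- c z\<close>.\<close>
  define C where "C = {(m, n). cmod (eis m n - 0) \<le> 1 / t}"
  define D where "D c = {(m, n). cmod (eis m n - (- (c * z))) \<le> 1}" for c
  define V where "V = (\<lambda>A :: complex^2^2. kden (A$2$1) (A$2$2) p) ` R"
  have "V \<subseteq> (\<lambda>((m, n), (m', n')). kden (eis m n) (eis m' n') p) ` (SIGMA x:C. D (eis (fst x) (snd x)))"
  proof
    fix v assume "v \<in> V"
    then obtain A where A: "A \<in> fig8_group" "v = kden (A$2$1) (A$2$2) p" "v \<le> 1" by (auto simp: V_def R_def)
    obtain m n m' n' where e: "A$2$1 = eis m n" "A$2$2 = eis m' n'" using fig8_entries[OF A(1)] by auto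
    have v: "v = (cmod (eis m n * z + eis m' n'))\<^sup>2 + (cmod (eis m n) * t)\<^sup>2"
      using A e zt by (simp add: kden_def power_mult_distrib)
    then have "(cmod (eis m n * z + eis m' n'))\<^sup>2 \<le> 1\<^sup>2" "(cmod (eis m n) * t)\<^sup>2 \<le> 1\<^sup>2"
      using A(3) by (smt (verit) one_power2 zero_le_power2)+
    then have "cmod (eis m n * z + eis m' n') \<le> 1" "cmod (eis m n) * t \<le> 1"
      using power2_le_imp_le[of "cmod (eis m n * z + eis m' n')" 1] power2_le_imp_le[of "cmod (eis m n) * t" 1] by simp_all
    then have "(m, n) \<in> C" "(m', n') \<in> D (eis m n)" using t by (auto simp: C_def D_def field_simps)
    then show "v \<in> (\<lambda>((m, n), (m', n')). kden (eis m n) (eis m' n') p) ` (SIGMA x:C. D (eis (fst x) (snd x)))"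
      unfolding A(2) e by (intro rev_image_eqI[of "((m, n), (m', n'))"]) auto
  qed
  moreover have "finite (SIGMA x:C. D (eis (fst x) (snd x)))"
    unfolding C_def D_def by (intro finite_SigmaI finite_eis_ball)
  ultimately have fin: "finite V" using finite_surj by blast
  have "mat 1 \<in> R" using fig8_gens zt by (simp add: R_def mat2_one kden_def)
  then have ne: "V \<noteq> {}" by (auto simp: V_def)
  obtain A where A: "A \<in> R" "kden (A$2$1) (A$2$2) p = Min V" using Min_in[OF fin ne] by (auto simp: V_def)
  have min: "Min V \<le> kden (B$2$1) (B$2$2) p" if "B \<in> fig8_group" for B
  proof (cases "B \<in> R")
    case True
    then show ?thesis using fin by (intro Min_le) (auto simp: V_def)
  next
    case False
    then have "1 < kden (B$2$1) (B$2$2) p" using that by (auto simp: R_def)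
    moreover have "Min V \<le> 1" using A by (auto simp: R_def)
    ultimately show ?thesis by linarith
  qed
  have h: "snd (hyp3_act B p) = t / kden (B$2$1) (B$2$2) p" for B
    by (rule mat2_exhaust[of B]) (simp add: snd_hyp3_act zt)
  have pos: "0 < kden (B$2$1) (B$2$2) p" if "B \<in> fig8_group" for B
  proof -
    obtain a b c d where B: "B = mat2 a b c d" using mat2_exhaust by blast
    then show ?thesis using kden_pos[OF fig8_det t, of a b c d z] that zt by simp
  qed
  have "snd (hyp3_act B p) \<le> snd (hyp3_act A p)" if "B \<in> fig8_group" for B
    unfolding h using min[OF that] A pos[OF that] pos[of A] t by (intro divide_left_mono) (auto simp: R_def)
  then show ?thesis using A by (auto simp: R_def)
qed

text \<open>A null set containing every point where one of the strict inequalities of the domain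
  could become an equality.\<close>

definition fig8_walls :: "(complex \<times> real) set" where
  "fig8_walls = (\<Union>m n. {p. (cmod (fst p - eis m n))\<^sup>2 + (snd p)\<^sup>2 = 1}) \<union>
     (\<Union>m n m' n'. {p. (m, n) \<noteq> (m', n') \<and> cmod (fst p - eis m n) = cmod (fst p - eis m' n')})"

lemma fig8_walls_bisector:
  "(m, n) \<noteq> (m', n') \<Longrightarrow> cmod (fst p - eis m n) = cmod (fst p - eis m' n') \<Longrightarrow> p \<in> fig8_walls"
  unfolding fig8_walls_def by (intro UnI2 UN_I[OF UNIV_I] CollectI conjI)

lemma fig8_walls_sphere: "(cmod (fst p - eis m n))\<^sup>2 + (snd p)\<^sup>2 = 1 \<Longrightarrow> p \<in> fig8_walls"
  unfolding fig8_walls_def by (intro UnI1 UN_I[OF UNIV_I] CollectI)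

text \<open>A highest point of the orbit lies inside no unit sphere around a lattice point, since an
  element with \<open>|c| = 1\<close> would raise it. A translation moves it above one of the four
  cells without changing its height.\<close>

lemma fig8_cover:
  assumes p: "p \<in> hyp3" and w: "\<And>A. A \<in> fig8_group \<Longrightarrow> hyp3_act A p \<notin> fig8_walls"
  shows "\<exists>A\<in>fig8_group. p \<in> hyp3_act A ` fig8_domain"
proof -
  obtain A where A: "A \<in> fig8_group" and max: "\<And>B. B \<in> fig8_group \<Longrightarrow> snd (hyp3_act B p) \<le> snd (hyp3_act A p)"
    using fig8_max_height[OF p] by blast
  have det: "det B = 1" if "B \<in> fig8_group" for B using fig8_carrier[OF that] by (simp add: SL2C_def)
  obtain z t where zt: "hyp3_act A p = (z, t)" by (cases "hyp3_act A p")
  have t: "0 < t" using hyp3_act_in'[OF det[OF A] p] zt by (simp add: hyp3_def)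
  have sph: "1 \<le> (cmod (z - eis m n))\<^sup>2 + t\<^sup>2" for m n
  proof -
    obtain a b c d where B: "mat2 a b c d \<in> fig8_group" "cmod c = 1" "d = - c * eis m n"
      using fig8_horosphere_at by blast
    have "snd (hyp3_act (mat2 a b c d ** A) p) \<le> t" using max[OF fig8_mult[OF B(1) A]] zt by simp
    then have "t / kden c d (z, t) \<le> t"
      using hyp3_act_mult'[OF det[OF B(1)] det[OF A] p] zt by (simp add: snd_hyp3_act)
    moreover have "0 < kden c d (z, t)" using kden_pos[OF fig8_det[OF B(1)] t] .
    ultimately have "1 \<le> kden c d (z, t)" using t by (simp add: divide_le_eq)
    moreover have "c * z + d = c * (z - eis m n)" using B(3) by (simp add: algebra_simps)
    ultimately show ?thesis using B(2) by (simp add: kden_def norm_mult)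
  qed
  obtain m n where near: "\<And>m' n'. cmod (z - eis m n) \<le> cmod (z - eis m' n')" using nearest_eis by blast
  define j where "j = n mod 4"
  have "j \<in> {0..3}" by (simp add: j_def)
  then have j: "j \<in> {0, 1, 2, 3}" by auto
  \<comment> \<open>Moves the nearest lattice point \<open>m + n \<omega>\<close> to
    \<open>j \<omega>\<close>, where j is the residue of n modulo 4.\<close>
  define u where "u = eis (- m) (4 * - (n div 4))"
  have "fig8_pm (mat2 1 u 0 1)" unfolding u_def by (rule fig8_pm_translations)
  then obtain B where B: "B \<in> fig8_group" "B = mat2 1 u 0 1 \<or> B = - mat2 1 u 0 1"
    unfolding fig8_pm_def by (metis minus_minus)
  have "hyp3_act B (z, t) = (z + u, t)" using B(2) act_translation[of 1 u z t] by (auto simp: hyp3_act_minus)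
  then have BA: "hyp3_act (B ** A) p = (z + u, t)" using hyp3_act_mult'[OF det[OF B(1)] det[OF A] p] zt by simp
  have gBA: "B ** A \<in> fig8_group" using A B fig8_mult by blast
  have nw: "(z + u, t) \<notin> fig8_walls" using w[OF gBA] BA by simp
  have eq: "z + u - eis m' n' = z - eis (m + m') (4 * (n div 4) + n')" for m' n'
    by (simp add: u_def eis_def algebra_simps)
  have n: "4 * (n div 4) + j = n" by (simp add: j_def)
  have "hex (z + u - eis 0 j)"
  proof (rule hexI)
    fix m' n' :: int assume ne: "m' \<noteq> 0 \<or> n' \<noteq> 0"
    have e: "z + u - eis 0 j - eis m' n' = z + u - eis m' (j + n')" by (simp add: eis_def algebra_simps)
    have "cmod (z + u - eis 0 j) \<le> cmod (z + u - eis m' (j + n'))"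
      unfolding eq using near n by simp
    moreover have "cmod (z + u - eis 0 j) \<noteq> cmod (z + u - eis m' (j + n'))"
      using nw ne fig8_walls_bisector[of 0 j m' "j + n'" "(z + u, t)"] by auto
    ultimately show "cmod (z + u - eis 0 j) < cmod (z + u - eis 0 j - eis m' n')" unfolding e by simp
  qed
  moreover have "1 < (cmod (z + u - eis 0 j))\<^sup>2 + t\<^sup>2"
  proof -
    have "1 \<le> (cmod (z + u - eis 0 j))\<^sup>2 + t\<^sup>2" unfolding eq by (rule sph)
    moreover have "(cmod (z + u - eis 0 j))\<^sup>2 + t\<^sup>2 \<noteq> 1" using nw fig8_walls_sphere[of "(z + u, t)" 0 j] by auto
    ultimately show ?thesis by linarith
  qed
  ultimately have "hyp3_act (B ** A) p \<in> fig8_domain" unfolding BA fig8_domain_def using j t by auto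
  moreover obtain a b c d where e: "B ** A = mat2 a b c d" using mat2_exhaust by blast
  ultimately have "p \<in> hyp3_act (mat2 d (- b) (- c) a) ` fig8_domain"
    using fig8_act_inv[of a b c d p] gBA p by (metis imageI)
  then show ?thesis using fig8_inv[of a b c d] gBA e by auto
qed

lemma closed_negligible_null_sets:
  fixes S :: "'a::euclidean_space set"
  assumes "closed S" "negligible S"
  shows "S \<in> null_sets lborel"
  using assms null_sets_completion_iff[of S lborel] by (auto simp: negligible_iff_null_sets)

lemma fig8_walls_null: "fig8_walls \<in> null_sets lborel"
proof -
  have 1: "{p :: complex \<times> real. (cmod (fst p - u))\<^sup>2 + (snd p)\<^sup>2 = 1} \<in> null_sets lborel" for u
  proof -
    have "{p :: complex \<times> real. (cmod (fst p - u))\<^sup>2 + (snd p)\<^sup>2 = 1} = sphere (u, 0) 1"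
      by (auto simp: sphere_def dist_prod_def dist_norm norm_minus_commute)
    then show ?thesis by (intro closed_negligible_null_sets) (auto intro: negligible_sphere)
  qed
  have 2: "{p :: complex \<times> real. u \<noteq> v \<and> cmod (fst p - u) = cmod (fst p - v)} \<in> null_sets lborel" for u v
  proof (cases "u = v")
    case False
    have "cmod (z - u) = cmod (z - v) \<longleftrightarrow> 2 * ((v - u) \<bullet> z) = v \<bullet> v - u \<bullet> u" for z
    proof -
      have "cmod (z - u) = cmod (z - v) \<longleftrightarrow> (z - u) \<bullet> (z - u) = (z - v) \<bullet> (z - v)"
        by (simp add: norm_eq_sqrt_inner)
      then show ?thesis by (auto simp: inner_diff_left inner_diff_right inner_commute)
    qed
    then have "{p :: complex \<times> real. u \<noteq> v \<and> cmod (fst p - u) = cmod (fst p - v)} =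
        {p. (2 *\<^sub>R (v - u), 0 :: real) \<bullet> p = v \<bullet> v - u \<bullet> u}"
      using False by (auto simp: inner_prod_def)
    then show ?thesis using False
      by (intro closed_negligible_null_sets) (auto intro: closed_hyperplane negligible_hyperplane simp: zero_prod_def)
  qed simp
  have 3: "{p :: complex \<times> real. (m, n) \<noteq> (m', n') \<and> cmod (fst p - eis m n) = cmod (fst p - eis m' n')} \<in> null_sets lborel"
    for m n m' n' using 2[of "eis m n" "eis m' n'"] by (simp add: eis_eq_iff)
  show ?thesis unfolding fig8_walls_def
    by (intro null_sets.Un null_sets_UN 1 3)
qed

lemma hyp3_null_sets: "S \<in> null_sets lborel \<Longrightarrow> S \<in> null_sets hyp3_measure"
proof -
  have "absolutely_continuous lborel hyp3_measure"
    unfolding hyp3_measure_def by (intro absolutely_continuousI_density) (simp add: hyp3_density_measurable)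
  then show "S \<in> null_sets lborel \<Longrightarrow> S \<in> null_sets hyp3_measure"
    by (auto simp: absolutely_continuous_def)
qed

lemma open_hyp3: "open hyp3"
proof -
  have "hyp3 = {p. 0 < snd p}" by (auto simp: hyp3_def)
  moreover have "open {p :: complex \<times> real. 0 < snd p}" by (intro open_Collect_less continuous_intros)
  ultimately show ?thesis by simp
qed

lemma hyp3_compl_null: "- hyp3 \<in> null_sets hyp3_measure"
proof -
  have "emeasure hyp3_measure (- hyp3) = 0"
    using open_hyp3 by (subst hyp3_emeasure_gen) (auto simp: hyp3_def intro!: nn_integral_0_iff_AE[THEN iffD2])
  then show ?thesis using open_hyp3 by (intro null_setsI) auto
qed

lemma countable_fig8: "countable fig8_group"
proof -
  have "fig8_group \<subseteq> (\<lambda>(a0, a1, b0, b1, c0, c1, d0, d1). mat2 (eis a0 a1) (eis b0 b1) (eis c0 c1) (eis d0 d1)) ` UNIV"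
  proof
    fix A assume "A \<in> fig8_group"
    from fig8_entries[OF this] obtain a0 a1 b0 b1 c0 c1 d0 d1 where
      "A = mat2 (eis a0 a1) (eis b0 b1) (eis c0 c1) (eis d0 d1)" by blast
    then show "A \<in> (\<lambda>(a0, a1, b0, b1, c0, c1, d0, d1). mat2 (eis a0 a1) (eis b0 b1) (eis c0 c1) (eis d0 d1)) ` UNIV"
      by (intro rev_image_eqI[of "(a0, a1, b0, b1, c0, c1, d0, d1)"]) auto
  qed
  then show ?thesis by (rule countable_subset) auto
qed

definition adj2 :: "complex^2^2 \<Rightarrow> complex^2^2" where
  "adj2 A = mat2 (A$2$2) (- A$1$2) (- A$2$1) (A$1$1)"

lemma adj2_mat2: "adj2 (mat2 a b c d) = mat2 d (- b) (- c) a"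
  by (simp add: adj2_def)

lemma adj2_fig8: "A \<in> fig8_group \<Longrightarrow> adj2 A \<in> fig8_group"
  by (rule mat2_exhaust[of A]) (simp add: adj2_mat2 fig8_inv)

lemma adj2_act: "A \<in> fig8_group \<Longrightarrow> p \<in> hyp3 \<Longrightarrow> hyp3_act (adj2 A) (hyp3_act A p) = p"
  by (rule mat2_exhaust[of A]) (simp add: adj2_mat2 fig8_act_inv)

lemma act_adj2: "A \<in> fig8_group \<Longrightarrow> p \<in> hyp3 \<Longrightarrow> hyp3_act A (hyp3_act (adj2 A) p) = p"
proof -
  have "adj2 (adj2 A) = A" by (rule mat2_exhaust[of A]) (simp add: adj2_mat2)
  then show "A \<in> fig8_group \<Longrightarrow> p \<in> hyp3 \<Longrightarrow> hyp3_act A (hyp3_act (adj2 A) p) = p"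
    using adj2_act[of "adj2 A" p] adj2_fig8[of A] by simp
qed

lemma fig8_pres:
  assumes "A \<in> fig8_group" "F \<in> sets borel" "F \<subseteq> hyp3"
  shows "hyp3_act A ` F \<in> sets borel" "hyp3_act A ` F \<subseteq> hyp3"
    "emeasure hyp3_measure (hyp3_act A ` F) = emeasure hyp3_measure F"
  using hyp3_pres_fig8[OF assms(1)] assms unfolding hyp3_pres_def by blast+

lemma fig8_detA: "A \<in> fig8_group \<Longrightarrow> det A = 1"
  using fig8_carrier by (simp add: SL2C_def)

lemma fundamental_domain_fig8: "fundamental_domain fig8_group fig8_domain"
proof -
  \<comment> \<open>The points whose orbits meet a wall: countably many images of a null
    set.\<close>
  define E where "E = (\<Union>A\<in>fig8_group. hyp3_act A ` (fig8_walls \<inter> hyp3))"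
  have W: "fig8_walls \<inter> hyp3 \<in> sets borel" using fig8_walls_null open_hyp3 by (auto simp: null_sets_def)
  have "emeasure hyp3_measure (fig8_walls \<inter> hyp3) \<le> emeasure hyp3_measure fig8_walls"
    using hyp3_null_sets[OF fig8_walls_null] by (intro emeasure_mono) auto
  then have "emeasure hyp3_measure (fig8_walls \<inter> hyp3) = 0"
    using hyp3_null_sets[OF fig8_walls_null] by (simp add: null_sets_def)
  then have "E \<in> null_sets hyp3_measure" unfolding E_def using W
    by (intro null_sets_UN' countable_fig8 null_setsI) (auto simp: fig8_pres)
  then have N: "E \<union> - hyp3 \<in> null_sets hyp3_measure" using hyp3_compl_null by (rule null_sets.Un)
  have cov: "\<exists>A\<in>fig8_group. p \<in> hyp3_act A ` fig8_domain" if p: "p \<notin> E \<union> - hyp3" for p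
  proof (rule fig8_cover)
    show "p \<in> hyp3" using p by simp
    fix A assume A: "A \<in> fig8_group"
    show "hyp3_act A p \<notin> fig8_walls"
    proof
      assume "hyp3_act A p \<in> fig8_walls"
      then have "hyp3_act A p \<in> fig8_walls \<inter> hyp3"
        using hyp3_act_in'[OF fig8_detA[OF A] \<open>p \<in> hyp3\<close>] by simp
      then have "hyp3_act (adj2 A) (hyp3_act A p) \<in> E" unfolding E_def using adj2_fig8[OF A] by blast
      then show False using p adj2_act[OF A \<open>p \<in> hyp3\<close>] by simp
    qed
  qed
  show ?thesis unfolding fundamental_domain_def
  proof (intro conjI ballI impI)
    show "fig8_domain \<in> sets borel" using open_fig8_domain by simp
    show "fig8_domain \<subseteq> hyp3" by (rule fig8_domain_sub)
    show "AE p in hyp3_measure. \<exists>A\<in>fig8_group. p \<in> hyp3_act A ` fig8_domain"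
      using N by (rule AE_I') (use cov in blast)
    fix A assume "A \<in> fig8_group" "A \<noteq> mat 1 \<and> A \<noteq> - mat 1"
    then have "fig8_domain \<inter> hyp3_act A ` fig8_domain = {}" using fig8_domain_disjoint by blast
    then show "AE p in hyp3_measure. p \<notin> fig8_domain \<inter> hyp3_act A ` fig8_domain" by simp
  qed
qed

text \<open>The pieces of \<open>F\<^sub>1\<close> in the translates of \<open>F\<^sub>2\<close> move to almost disjoint subsets of \<open>F\<^sub>2\<close>.\<close>

lemma fundamental_domain_emeasure_le:
  assumes F1: "fundamental_domain fig8_group F1" and F2: "fundamental_domain fig8_group F2"
  shows "emeasure hyp3_measure F1 \<le> emeasure hyp3_measure F2"
proof -
  let ?M = hyp3_measure
  have b: "F1 \<in> sets borel" "F1 \<subseteq> hyp3" "F2 \<in> sets borel" "F2 \<subseteq> hyp3"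
    using F1 F2 by (auto simp: fundamental_domain_def)
  define e where "e = from_nat_into fig8_group"
  have re: "range e = fig8_group"
    unfolding e_def using fig8_gens(1) countable_fig8 by (intro range_from_nat_into) auto
  then have e: "e n \<in> fig8_group" for n by blast
  \<comment> \<open>The overlaps of \<open>F1\<close> with its own translates. Away from them, two
    points of \<open>F1\<close> in the same orbit coincide, which later makes the moved pieces
    disjoint.\<close>
  define Nul where "Nul = (\<Union>B\<in>{B \<in> fig8_group. B \<noteq> mat 1 \<and> B \<noteq> - mat 1}. F1 \<inter> hyp3_act B ` F1)"
  have Nul: "Nul \<in> null_sets ?M"
    unfolding Nul_def
  proof (rule null_sets_UN')
    show "countable {B \<in> fig8_group. B \<noteq> mat 1 \<and> B \<noteq> - mat 1}"
      using countable_fig8 by (rule countable_subset[rotated]) auto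
    fix B assume B: "B \<in> {B \<in> fig8_group. B \<noteq> mat 1 \<and> B \<noteq> - mat 1}"
    then have "AE p in ?M. p \<notin> F1 \<inter> hyp3_act B ` F1" using F1 by (auto simp: fundamental_domain_def)
    moreover have "F1 \<inter> hyp3_act B ` F1 \<in> sets ?M" using B b fig8_pres(1)[of B F1] by auto
    ultimately show "F1 \<inter> hyp3_act B ` F1 \<in> null_sets ?M" by (subst AE_iff_null_sets)
  qed
  define G where "G n = F1 \<inter> hyp3_act (e n) ` F2 - Nul" for n
  have G: "range G \<subseteq> sets ?M"
    using b fig8_pres(1)[OF e] Nul by (auto simp: G_def null_sets_def)
  \<comment> \<open>Assigns each point to the first translate of \<open>F2\<close> that contains
    it.\<close>
  define X where "X = disjointed G"
  have X: "range X \<subseteq> sets ?M" unfolding X_def using G by (rule sets.range_disjointed_sets)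
  have XG: "X n \<subseteq> G n" for n unfolding X_def by (rule disjointed_subset)
  have dX: "disjoint_family X" unfolding X_def by (rule disjoint_family_disjointed)
  have Xh: "X n \<subseteq> hyp3" "X n \<in> sets borel" for n using XG[of n] b X by (auto simp: G_def)
  define Y where "Y n = hyp3_act (adj2 (e n)) ` X n" for n
  note pY = fig8_pres[OF adj2_fig8[OF e] Xh(2,1)]
  have Y: "range Y \<subseteq> sets ?M" using pY by (auto simp: Y_def)
  have YF: "Y n \<subseteq> F2" for n
  proof
    fix r assume "r \<in> Y n"
    then obtain p where p: "p \<in> X n" "r = hyp3_act (adj2 (e n)) p" by (auto simp: Y_def)
    then obtain q where q: "q \<in> F2" "p = hyp3_act (e n) q" using XG[of n] by (auto simp: G_def)
    then have "q \<in> hyp3" using b by blast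
    then have "r = q" using p q adj2_act[OF e] by simp
    then show "r \<in> F2" using q by simp
  qed
  have dY: "disjoint_family Y"
    unfolding disjoint_family_on_def
  proof (intro ballI impI)
    fix i j :: nat assume ij: "i \<noteq> j"
    show "Y i \<inter> Y j = {}"
    proof (rule ccontr)
      assume "Y i \<inter> Y j \<noteq> {}"
      then obtain r where "r \<in> hyp3_act (adj2 (e i)) ` X i" "r \<in> hyp3_act (adj2 (e j)) ` X j"
        unfolding Y_def by blast
      then obtain p p' where p: "p \<in> X i" "p' \<in> X j" "hyp3_act (adj2 (e i)) p = hyp3_act (adj2 (e j)) p'"
        by (metis imageE)
      have h: "p \<in> hyp3" "p' \<in> hyp3" using p Xh by auto
      define B where "B = e j ** adj2 (e i)"
      have B: "B \<in> fig8_group" unfolding B_def by (intro fig8_mult e adj2_fig8)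
      have "hyp3_act B p = hyp3_act (e j) (hyp3_act (adj2 (e i)) p)"
        unfolding B_def using h by (intro hyp3_act_mult' fig8_detA e adj2_fig8)
      also have "\<dots> = p'" unfolding p(3) using h by (intro act_adj2 e)
      finally have Bp: "hyp3_act B p = p'" .
      show False
      proof (cases "B = mat 1 \<or> B = - mat 1")
        case True
        then have "p' = p" using Bp by (auto simp: hyp3_act_minus)
        then show False using p dX ij by (auto simp: disjoint_family_on_def)
      next
        case False
        have "p \<in> F1" "p' \<in> F1" "p' \<notin> Nul" using p XG by (auto simp: G_def)
        then show False using Bp B False unfolding Nul_def by blast
      qed
    qed
  qed
  have "AE p in ?M. p \<notin> Nul" using Nul by (rule AE_not_in)
  moreover have "AE p in ?M. \<exists>A\<in>fig8_group. p \<in> hyp3_act A ` F2" using F2 by (auto simp: fundamental_domain_def)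
  ultimately have "AE p in ?M. p \<in> F1 \<longleftrightarrow> p \<in> (\<Union>n. X n)"
  proof eventually_elim
    case (elim p)
    then obtain n where "p \<in> hyp3_act (e n) ` F2" using re by (metis imageE)
    then show ?case using elim unfolding X_def UN_disjointed_eq by (auto simp: G_def)
  qed
  then have "emeasure ?M F1 = emeasure ?M (\<Union>n. X n)" using b X by (intro emeasure_eq_AE) auto
  also have "\<dots> = (\<Sum>n. emeasure ?M (X n))" using X dX by (rule suminf_emeasure[symmetric])
  also have "\<dots> = (\<Sum>n. emeasure ?M (Y n))" unfolding Y_def pY ..
  also have "\<dots> = emeasure ?M (\<Union>n. Y n)" using Y dY by (rule suminf_emeasure)
  also have "\<dots> \<le> emeasure ?M F2" using YF b by (intro emeasure_mono) auto
  finally show ?thesis .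
qed

text \<open>The inequality between two fundamental domains, applied in both directions, makes the
  covolume well defined.\<close>

lemma Vol41_eq: "Vol41 = measure hyp3_measure fig8_domain"
  unfolding Vol41_def hyp3_covolume_def
proof (rule the_equality)
  show "\<exists>F. fundamental_domain fig8_group F \<and> measure hyp3_measure fig8_domain = measure hyp3_measure F"
    using fundamental_domain_fig8 by blast
  fix v assume "\<exists>F. fundamental_domain fig8_group F \<and> v = measure hyp3_measure F"
  then obtain F where F: "fundamental_domain fig8_group F" "v = measure hyp3_measure F" by blast
  have "emeasure hyp3_measure F = emeasure hyp3_measure fig8_domain"
    using F fundamental_domain_fig8 by (intro antisym fundamental_domain_emeasure_le)
  then show "v = measure hyp3_measure fig8_domain" using F by (simp add: measure_def)
qed

section \<open>The volume\<close>

definition lncos :: "real \<Rightarrow> real" where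
  "lncos x = ln (2 * cos x)"

text \<open>In terms of Lobachevsky's function this is \<open>\<Lambda> (\<pi> / 2 - x)\<close>. The
  integral starts at \<open>- 5 \<pi> / 12\<close> to be differentiable on both sides of 0;
  \<open>5 \<pi> / 12\<close> lies between \<open>\<pi> / 3\<close>, the largest argument needed,
  and the singularity at \<open>\<pi> / 2\<close>.\<close>

definition Lob :: "real \<Rightarrow> real" where
  "Lob x = integral {- 5 * pi / 12..x} lncos - integral {- 5 * pi / 12..0} lncos"

lemma cos_pos_Lob: "- 5 * pi / 12 \<le> x \<Longrightarrow> x \<le> 5 * pi / 12 \<Longrightarrow> 0 < cos x"
  using pi_gt_zero by (intro cos_gt_zero_pi) linarith+

lemma Lob_deriv:
  assumes "- 5 * pi / 12 < x" "x < 5 * pi / 12"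
  shows "(Lob has_real_derivative lncos x) (at x)"
proof -
  have "continuous_on {- 5 * pi / 12..5 * pi / 12} lncos"
    unfolding lncos_def using cos_pos_Lob by (intro continuous_intros) (auto simp: less_imp_neq[THEN not_sym])
  from integral_has_real_derivative[OF this, of x] assms
  have "((\<lambda>u. integral {- 5 * pi / 12..u} lncos) has_real_derivative lncos x) (at x within {- 5 * pi / 12..5 * pi / 12})"
    by simp
  then have "((\<lambda>u. integral {- 5 * pi / 12..u} lncos) has_real_derivative lncos x) (at x)"
    using assms at_within_Icc_at[of "- 5 * pi / 12" x "5 * pi / 12"] by simp
  then show ?thesis unfolding Lob_def[abs_def] by (auto intro!: derivative_eq_intros)
qed

lemma Lob_deriv' [derivative_intros]:
  assumes "(f has_real_derivative f') (at x)" "- 5 * pi / 12 < f x" "f x < 5 * pi / 12"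
  shows "((\<lambda>x. Lob (f x)) has_real_derivative lncos (f x) * f') (at x)"
  using DERIV_chain2[OF Lob_deriv assms(1)] assms by simp

lemma Lob_0 [simp]: "Lob 0 = 0"
  by (simp add: Lob_def)

lemma FTC_real:
  fixes f :: "real \<Rightarrow> real"
  assumes "a \<le> b" "\<And>x. a \<le> x \<Longrightarrow> x \<le> b \<Longrightarrow> (f has_real_derivative f' x) (at x)"
  shows "(f' has_integral f b - f a) {a..b}"
  using assms by (intro fundamental_theorem_of_calculus)
    (auto simp flip: has_real_derivative_iff_has_vector_derivative intro: has_field_derivative_at_within)

lemma Lob_minus:
  assumes "0 \<le> x" "x < 5 * pi / 12"
  shows "Lob (- x) = - Lob x"
proof -
  have "((\<lambda>y. lncos y + lncos (- y) * (- 1)) has_integral (Lob x + Lob (- x)) - (Lob 0 + Lob (- 0))) {0..x}"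
    using assms by (intro FTC_real[where f = "\<lambda>y. Lob y + Lob (- y)"]) (auto intro!: derivative_eq_intros)
  moreover have "(\<lambda>y. lncos y + lncos (- y) * (- 1)) = (\<lambda>_. 0)" by (simp add: lncos_def)
  ultimately have "((\<lambda>_. 0) has_integral Lob x + Lob (- x)) {0..x}" by simp
  then have "Lob x + Lob (- x) = 0" using has_integral_unique has_integral_0 by blast
  then show ?thesis by simp
qed

text \<open>The duplication formula \<open>2 sin (2 x) = (2 sin x) (2 cos x)\<close>, integrated over \<open>[\<pi>/6, \<pi>/3]\<close>.\<close>

lemma Lob_duplication: "2 * Lob (pi / 3) = 3 * Lob (pi / 6)"
proof -
  have p: "0 < pi" by simp
  have 1: "((\<lambda>x. - (lncos (pi / 2 - 2 * x) * (- 2)) / 2) has_integral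
      (- Lob (pi / 2 - 2 * (pi / 3)) / 2) - (- Lob (pi / 2 - 2 * (pi / 6)) / 2)) {pi / 6..pi / 3}"
    by (intro FTC_real[where f = "\<lambda>x. - Lob (pi / 2 - 2 * x) / 2"]; auto intro!: derivative_eq_intros; insert p; linarith)
  have 2: "((\<lambda>x. lncos x + lncos (pi / 2 - x)) has_integral
      (Lob (pi / 3) - Lob (pi / 2 - pi / 3)) - (Lob (pi / 6) - Lob (pi / 2 - pi / 6))) {pi / 6..pi / 3}"
    by (intro FTC_real[where f = "\<lambda>x. Lob x - Lob (pi / 2 - x)"]; auto intro!: derivative_eq_intros; insert p; linarith)
  have eq: "- (lncos (pi / 2 - 2 * x) * (- 2)) / 2 = lncos x + lncos (pi / 2 - x)" if x: "x \<in> {pi / 6..pi / 3}" for x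
  proof -
    have "0 < x" "x < pi / 2" using x p by (simp_all, linarith+)
    then have c: "0 < cos x" "0 < sin x" by (auto intro: cos_gt_zero_pi sin_gt_zero2)
    have "2 * cos (pi / 2 - 2 * x) = (2 * cos x) * (2 * sin x)"
      using cos_sin_eq[of "pi / 2 - 2 * x"] by (simp add: sin_double)
    then have "lncos (pi / 2 - 2 * x) = ln ((2 * cos x) * (2 * sin x))" by (simp only: lncos_def)
    also have "\<dots> = ln (2 * cos x) + ln (2 * sin x)" using c by (intro ln_mult_pos) auto
    finally have "lncos (pi / 2 - 2 * x) = ln (2 * cos x) + ln (2 * sin x)" .
    moreover have "cos (pi / 2 - x) = sin x" using cos_sin_eq[of "pi / 2 - x"] by simp
    ultimately show ?thesis by (simp add: lncos_def)
  qed
  from 1 have "((\<lambda>x. lncos x + lncos (pi / 2 - x)) has_integral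
      (- Lob (pi / 2 - 2 * (pi / 3)) / 2) - (- Lob (pi / 2 - 2 * (pi / 6)) / 2)) {pi / 6..pi / 3}"
    by (rule has_integral_eq[rotated]) (rule eq)
  from has_integral_unique[OF this 2]
  have "- Lob (pi / 2 - 2 * (pi / 3)) / 2 + Lob (pi / 2 - 2 * (pi / 6)) / 2 =
      Lob (pi / 3) - Lob (pi / 2 - pi / 3) - Lob (pi / 6) + Lob (pi / 2 - pi / 6)" by simp
  moreover have "pi / 2 - 2 * (pi / 3) = - (pi / 6)" "pi / 2 - 2 * (pi / 6) = pi / 6"
    "pi / 2 - pi / 3 = pi / 6" "pi / 2 - pi / 6 = pi / 3" by simp_all
  moreover have "Lob (- (pi / 6)) = - Lob (pi / 6)" by (rule Lob_minus) simp_all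
  ultimately show ?thesis by simp
qed

text \<open>The substitution \<open>x \<mapsto> \<pi> x - \<pi> / 2\<close> turns the sine into a
  cosine and the endpoint 5 / 6 into \<open>\<pi> / 3\<close>.\<close>

lemma kap_Lob: "pi * kap = Lob (pi / 3)"
proof -
  have "((\<lambda>x. lncos (pi * x - pi / 2) * pi) has_integral Lob (pi * (5 / 6) - pi / 2) - Lob (pi * (1 / 2) - pi / 2)) {1 / 2..5 / 6}"
  proof (rule FTC_real[where f = "\<lambda>x. Lob (pi * x - pi / 2)"])
    fix x :: real assume x: "1 / 2 \<le> x" "x \<le> 5 / 6"
    then have "pi * (1 / 2) \<le> pi * x" "pi * x \<le> pi * (5 / 6)" by (intro mult_left_mono; simp)+
    then have "- 5 * pi / 12 < pi * x - pi / 2" "pi * x - pi / 2 < 5 * pi / 12" using pi_gt_zero by linarith+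
    then show "((\<lambda>x. Lob (pi * x - pi / 2)) has_real_derivative lncos (pi * x - pi / 2) * pi) (at x)"
      by (intro Lob_deriv') (auto intro!: derivative_eq_intros)
  qed simp
  moreover have "lncos (pi * x - pi / 2) * pi = pi * hh x" for x
    using cos_sin_eq[of "pi * x - pi / 2"] cos_minus[of "pi * x - pi / 2"]
    by (simp add: lncos_def hh_def cos_diff)
  moreover have "pi * (5 / 6) - pi / 2 = pi / 3" "pi * (1 / 2) - pi / 2 = 0" by simp_all
  ultimately have "((\<lambda>x. pi * hh x) has_integral Lob (pi / 3)) {1 / 2..5 / 6}" by simp
  then have "integral {1 / 2..5 / 6} (\<lambda>x. pi * hh x) = Lob (pi / 3)" by (rule integral_unique)
  then show ?thesis by (simp add: kap_def)
qed

section \<open>Integration over the hexagon\<close>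

text \<open>The integral of \<open>r / (2 (1 - r^2))\<close> from 0 to \<open>1 / (2 cos u)\<close>,
  that is, along the ray at angle u from the perpendicular to a side of the hexagon; the sides are
  at distance 1 / 2 from the centre.\<close>

definition sector :: "real \<Rightarrow> real" where
  "sector u = - ln (1 - 1 / (4 * (cos u)\<^sup>2)) / 4"

lemma cos_sq_sector:
  assumes "- (pi / 6) \<le> u" "u \<le> pi / 6"
  shows "3 / 4 \<le> (cos u)\<^sup>2" "0 < cos u"
proof -
  have "cos (pi / 6) \<le> cos \<bar>u\<bar>" using assms by (intro cos_monotone_0_pi_le) auto
  then have c: "sqrt 3 / 2 \<le> cos u" by (simp add: cos_30)
  then have "(sqrt 3 / 2)\<^sup>2 \<le> (cos u)\<^sup>2" by (intro power_mono) auto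
  then show "3 / 4 \<le> (cos u)\<^sup>2" by (simp add: power_divide)
  show "0 < cos u" using c by (rule less_le_trans[rotated]) simp
qed

lemma sector_nonneg:
  assumes "- (pi / 6) \<le> u" "u \<le> pi / 6"
  shows "0 \<le> sector u"
proof -
  have "1 / (4 * (cos u)\<^sup>2) < 1" "0 < 1 / (4 * (cos u)\<^sup>2)" using cos_sq_sector[OF assms] by (simp_all add: divide_less_eq)
  then show ?thesis by (simp add: sector_def ln_le_zero_iff)
qed

text \<open>By \<open>4 (cos u)^2 - 1 = 4 cos (\<pi> / 6 - u) cos (\<pi> / 6 + u)\<close>.\<close>

lemma sector_eq:
  assumes "- (pi / 6) \<le> u" "u \<le> pi / 6"
  shows "sector u = - (lncos (pi / 6 - u) + lncos (pi / 6 + u) - 2 * lncos u) / 4"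
proof -
  note c = cos_sq_sector[OF assms]
  have p: "0 < cos (pi / 6 - u)" "0 < cos (pi / 6 + u)"
    using assms pi_gt_zero by (intro cos_gt_zero_pi; linarith)+
  have "4 * (cos (pi / 6 - u) * cos (pi / 6 + u)) = 4 * ((3 / 4) * (cos u)\<^sup>2 - (sin u)\<^sup>2 / 4)"
    by (simp add: cos_add cos_diff cos_30 sin_30 power2_eq_square algebra_simps)
  also have "\<dots> = 4 * (cos u)\<^sup>2 - 1" by (simp add: sin_squared_eq field_simps)
  finally have e: "(2 * cos (pi / 6 - u)) * (2 * cos (pi / 6 + u)) = 4 * (cos u)\<^sup>2 - 1" by simp
  have "1 - 1 / (4 * (cos u)\<^sup>2) = (4 * (cos u)\<^sup>2 - 1) / (4 * (cos u)\<^sup>2)" using c by (simp add: field_simps)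
  also have "\<dots> = (2 * cos (pi / 6 - u)) * (2 * cos (pi / 6 + u)) / ((2 * cos u) * (2 * cos u))"
    unfolding e by (simp add: power2_eq_square)
  finally have "ln (1 - 1 / (4 * (cos u)\<^sup>2)) = ln ((2 * cos (pi / 6 - u)) * (2 * cos (pi / 6 + u)) / ((2 * cos u) * (2 * cos u)))" by simp
  also have "\<dots> = ln (2 * cos (pi / 6 - u)) + ln (2 * cos (pi / 6 + u)) - (ln (2 * cos u) + ln (2 * cos u))"
    using p c by (subst ln_div) (simp_all add: ln_mult)
  finally show ?thesis by (simp add: sector_def lncos_def)
qed

lemma sector_integral:
  assumes "- (pi / 6) \<le> a" "a \<le> b" "b \<le> pi / 6"
  defines "\<Gamma> \<equiv> \<lambda>u. - (Lob (pi / 6 + u) - Lob (pi / 6 - u) - 2 * Lob u) / 4"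
  shows "(sector has_integral \<Gamma> b - \<Gamma> a) {a..b}"
proof -
  have "((\<lambda>u. - (lncos (pi / 6 + u) * 1 - lncos (pi / 6 - u) * (- 1) - 2 * (lncos u * 1)) / 4) has_integral \<Gamma> b - \<Gamma> a) {a..b}"
  proof (rule FTC_real)
    fix x assume "a \<le> x" "x \<le> b"
    then show "(\<Gamma> has_real_derivative - (lncos (pi / 6 + x) * 1 - lncos (pi / 6 - x) * (- 1) - 2 * (lncos x * 1)) / 4) (at x)"
      unfolding \<Gamma>_def using assms(1,3)
      by (auto intro!: derivative_eq_intros; insert pi_gt_zero; linarith)
  qed fact
  then show ?thesis
    by (rule has_integral_eq[rotated]) (use assms in \<open>auto simp: sector_eq\<close>)
qed

text \<open>The first quadrant sees two sides of the hexagon, with perpendiculars at the angles 0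
  and \<open>\<pi> / 3\<close>; they share the corner at angle \<open>\<pi> / 6\<close>.\<close>

definition quarter :: "real \<Rightarrow> real" where
  "quarter \<theta> = (if \<theta> \<le> pi / 6 then sector \<theta> else sector (\<theta> - pi / 3))"

lemma quarter_nonneg: "0 \<le> \<theta> \<Longrightarrow> \<theta> \<le> pi / 2 \<Longrightarrow> 0 \<le> quarter \<theta>"
  unfolding quarter_def by (auto intro!: sector_nonneg)

text \<open>Three half sectors of equal value
  \<open>(2 Lob (\<pi> / 6) - Lob (\<pi> / 3)) / 4\<close>; the duplication formula reduces their
  sum to \<open>Lob (\<pi> / 3) / 4\<close>.\<close>

lemma quarter_integral: "(quarter has_integral pi * kap / 4) {0..pi / 2}"
proof -
  define P3 where "P3 = Lob (pi / 3)"
  define P6 where "P6 = Lob (pi / 6)"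
  have m: "Lob (- (pi / 6)) = - P6" unfolding P6_def by (rule Lob_minus) simp_all
  have i1: "(sector has_integral - (P3 - 2 * P6) / 4) {0..pi / 6}"
    using sector_integral[of 0 "pi / 6"] by (simp add: P3_def P6_def)
  have i2: "(sector has_integral - (P3 - 2 * P6) / 2) {- (pi / 6)..pi / 6}"
  proof -
    have e: "(2 * P6 - P3) / 4 - (P3 - 2 * P6) / 4 = - (P3 - 2 * P6) / 2" by (simp add: field_simps)
    have "(sector has_integral (2 * P6 - P3) / 4 - (P3 - 2 * P6) / 4) {- (pi / 6)..pi / 6}"
      using sector_integral[of "- (pi / 6)" "pi / 6"] m by (simp add: P3_def P6_def)
    then show ?thesis unfolding e .
  qed
  have j1: "(quarter has_integral - (P3 - 2 * P6) / 4) {0..pi / 6}"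
    using i1 by (rule has_integral_eq[rotated]) (simp add: quarter_def)
  have "((\<lambda>x. sector (1 * x + - (pi / 3))) has_integral - (P3 - 2 * P6) / 2) {pi / 6..pi / 2}"
    using has_integral_affinity[of sector "- (P3 - 2 * P6) / 2" "- (pi / 6)" "pi / 6" 1 "- (pi / 3)"] i2 by simp
  then have j2: "(quarter has_integral - (P3 - 2 * P6) / 2) {pi / 6..pi / 2}"
  proof (rule has_integral_eq[rotated])
    show "sector (1 * x + - (pi / 3)) = quarter x" if x: "x \<in> {pi / 6..pi / 2}" for x
    proof (cases "x = pi / 6")
      case True
      then have "1 * x + - (pi / 3) = - x" by simp
      then have "sector (1 * x + - (pi / 3)) = sector x" by (simp only: sector_def cos_minus)
      then show ?thesis using True by (simp only: quarter_def order.refl if_True)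
    next
      case False
      then show ?thesis using x by (simp add: quarter_def)
    qed
  qed
  have "(quarter has_integral - (P3 - 2 * P6) / 4 + - (P3 - 2 * P6) / 2) {0..pi / 2}"
    using j1 j2 by (rule has_integral_combine[rotated 2]) simp_all
  moreover have e: "- (P3 - 2 * P6) / 4 + - (P3 - 2 * P6) / 2 = pi * kap / 4"
    using Lob_duplication by (simp add: kap_Lob P3_def P6_def)
  ultimately show ?thesis by (simp only: e)
qed

lemma lborel_complex: "distr (lborel \<Otimes>\<^sub>M lborel) borel (\<lambda>(x, y). Complex x y) = lborel"
proof (rule lborel_eqI[symmetric])
  have "(\<lambda>p. Complex (fst p) (snd p)) \<in> borel_measurable borel"
    unfolding Complex_eq by (intro borel_measurable_continuous_onI continuous_intros)
  then have m: "(\<lambda>(x, y). Complex x y) \<in> borel_measurable (lborel \<Otimes>\<^sub>M lborel)"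
    by (simp add: case_prod_unfold lborel_prod)
  fix l u :: complex
  assume lu: "\<And>b. b \<in> Basis \<Longrightarrow> l \<bullet> b \<le> u \<bullet> b"
  have le: "Re l \<le> Re u" "Im l \<le> Im u"
    using lu[of 1] lu[of \<i>] by (auto simp: Basis_complex_def)
  have "emeasure (distr (lborel \<Otimes>\<^sub>M lborel) borel (\<lambda>(x, y). Complex x y)) (box l u) =
      emeasure (lborel \<Otimes>\<^sub>M lborel) ({Re l<..<Re u} \<times> {Im l<..<Im u})"
    using m by (subst emeasure_distr)
      (auto simp: box_def Basis_complex_def space_pair_measure intro!: arg_cong[where f = "emeasure (lborel \<Otimes>\<^sub>M lborel)"])
  also have "\<dots> = emeasure lborel {Re l<..<Re u} * emeasure lborel {Im l<..<Im u}"
    by (rule lborel.emeasure_pair_measure_Times) auto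
  also have "\<dots> = (\<Prod>b\<in>Basis. (u - l) \<bullet> b)"
    using le by (auto simp: Basis_complex_def ennreal_mult)
  finally show "emeasure (distr (lborel \<Otimes>\<^sub>M lborel) borel (\<lambda>(x, y). Complex x y)) (box l u) = (\<Prod>b\<in>Basis. (u - l) \<bullet> b)" .
qed simp

lemma nn_integral_complex:
  fixes f :: "complex \<Rightarrow> ennreal"
  assumes f: "f \<in> borel_measurable borel"
  shows "(\<integral>\<^sup>+z. f z \<partial>lborel) = (\<integral>\<^sup>+x. \<integral>\<^sup>+y. f (Complex x y) \<partial>lborel \<partial>lborel)"
proof -
  have "(\<lambda>p. Complex (fst p) (snd p)) \<in> borel_measurable borel"
    unfolding Complex_eq by (intro borel_measurable_continuous_onI continuous_intros)
  then have m: "(\<lambda>(x, y). Complex x y) \<in> borel_measurable (lborel \<Otimes>\<^sub>M lborel)"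
    by (simp add: case_prod_unfold lborel_prod)
  have "(\<integral>\<^sup>+z. f z \<partial>lborel) = (\<integral>\<^sup>+z. f z \<partial>distr (lborel \<Otimes>\<^sub>M lborel) borel (\<lambda>(x, y). Complex x y))"
    unfolding lborel_complex ..
  also have "\<dots> = (\<integral>\<^sup>+p. f (case p of (x, y) \<Rightarrow> Complex x y) \<partial>(lborel \<Otimes>\<^sub>M lborel))"
    using f m by (intro nn_integral_distr) auto
  also have "\<dots> = (\<integral>\<^sup>+x. \<integral>\<^sup>+y. f (Complex x y) \<partial>lborel \<partial>lborel)"
    using measurable_compose[OF m f] by (subst lborel.nn_integral_fst[symmetric]) auto
  finally show ?thesis .
qed

lemma nn_integral_even:
  fixes g :: "real \<Rightarrow> ennreal"
  assumes [measurable]: "g \<in> borel_measurable borel" and even: "\<And>x. g (- x) = g x"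
  shows "(\<integral>\<^sup>+x. g x \<partial>lborel) = 2 * (\<integral>\<^sup>+x. g x * indicator {0<..} x \<partial>lborel)"
proof -
  have "AE x in lborel. x \<noteq> (0 :: real)" by (rule AE_lborel_singleton)
  then have "(\<integral>\<^sup>+x. g x \<partial>lborel) = (\<integral>\<^sup>+x. g x * indicator {0<..} x + g x * indicator {..<0} x \<partial>lborel)"
    by (intro nn_integral_cong_AE) (auto elim!: eventually_mono simp: indicator_def)
  also have "\<dots> = (\<integral>\<^sup>+x. g x * indicator {0<..} x \<partial>lborel) + (\<integral>\<^sup>+x. g x * indicator {..<0} x \<partial>lborel)"
    by (rule nn_integral_add) measurable
  also have "(\<integral>\<^sup>+x. g x * indicator {..<0} x \<partial>lborel) = (\<integral>\<^sup>+x. g (0 + - 1 * x) * indicator {..<0} (0 + - 1 * x) \<partial>lborel)"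
    using nn_integral_real_affine[of "\<lambda>x. g x * indicator {..<0} x" "- 1" 0] by simp
  also have "\<dots> = (\<integral>\<^sup>+x. g x * indicator {0<..} x \<partial>lborel)"
    by (simp add: even indicator_def)
  finally show ?thesis by (simp add: mult_2)
qed

definition hexprism :: "(complex \<times> real) set" where
  "hexprism = {p. 0 < snd p \<and> hex (fst p) \<and> 1 < (cmod (fst p))\<^sup>2 + (snd p)\<^sup>2}"

lemma open_hexprism: "open hexprism"
  unfolding hexprism_def hex_def by (intro open_Collect_conj open_Collect_less continuous_intros)

lemma emeasure_fig8_domain: "emeasure hyp3_measure fig8_domain = 4 * emeasure hyp3_measure hexprism"
proof -
  define T where "T j = hyp3_act (mat2 1 (eis 0 j) 0 1) ` hexprism" for j
  have sub: "hexprism \<subseteq> hyp3" by (auto simp: hexprism_def hyp3_def)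
  have pres: "T j \<in> sets borel \<and> emeasure hyp3_measure (T j) = emeasure hyp3_measure hexprism" for j
    using hyp3_pres_translation[of "eis 0 j"] sub open_hexprism unfolding hyp3_pres_def T_def by auto
  have T: "T j = {p. 0 < snd p \<and> hex (fst p - eis 0 j) \<and> 1 < (cmod (fst p - eis 0 j))\<^sup>2 + (snd p)\<^sup>2}" for j
  proof (intro equalityI subsetI)
    fix p assume p: "p \<in> {p. 0 < snd p \<and> hex (fst p - eis 0 j) \<and> 1 < (cmod (fst p - eis 0 j))\<^sup>2 + (snd p)\<^sup>2}"
    then have "(fst p - eis 0 j, snd p) \<in> hexprism" by (simp add: hexprism_def)
    then have "hyp3_act (mat2 1 (eis 0 j) 0 1) (fst p - eis 0 j, snd p) \<in> T j" unfolding T_def by blast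
    then show "p \<in> T j" by (simp add: act_translation)
  next
    fix p assume "p \<in> T j"
    then obtain z t where "(z, t) \<in> hexprism" "p = hyp3_act (mat2 1 (eis 0 j) 0 1) (z, t)" unfolding T_def by auto
    then show "p \<in> {p. 0 < snd p \<and> hex (fst p - eis 0 j) \<and> 1 < (cmod (fst p - eis 0 j))\<^sup>2 + (snd p)\<^sup>2}"
      by (simp add: act_translation hexprism_def)
  qed
  have "fig8_domain = (\<Union>j\<in>{0, 1, 2, 3}. T j)" unfolding T fig8_domain_def by blast
  moreover have "(\<Sum>j\<in>{0, 1, 2, 3 :: int}. emeasure hyp3_measure (T j)) = emeasure hyp3_measure (\<Union>j\<in>{0, 1, 2, 3}. T j)"
  proof (rule sum_emeasure)
    show "disjoint_family_on T {0, 1, 2, 3}" unfolding disjoint_family_on_def T using hex_unique by blast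
  qed (use pres in auto)
  ultimately show ?thesis using pres by (simp add: numeral_eq_Suc algebra_simps)
qed

text \<open>Above z the prism begins at the height \<open>sqrt (1 - |z|^2)\<close>, from where
  \<open>1 / t^3\<close> is integrated to infinity.\<close>

lemma emeasure_hexprism:
  "emeasure hyp3_measure hexprism = (\<integral>\<^sup>+z. (if hex z then ennreal (1 / (2 * (1 - (cmod z)\<^sup>2))) else 0) \<partial>lborel)"
proof -
  have B: "hexprism \<in> sets borel" using open_hexprism by simp
  then have [measurable]: "hexprism \<in> sets (borel \<Otimes>\<^sub>M borel)" by (simp only: borel_prod)
  have inner: "(\<integral>\<^sup>+t. (if 0 < t then ennreal (1 / t ^ 3) else 0) * indicator hexprism (z, t) \<partial>lborel) =
      (if hex z then ennreal (1 / (2 * (1 - (cmod z)\<^sup>2))) else 0)" for z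
  proof (cases "hex z")
    case False
    then show ?thesis by (simp add: hexprism_def)
  next
    case True
    define h where "h = sqrt (1 - (cmod z)\<^sup>2)"
    have z: "(cmod z)\<^sup>2 \<le> 1 / 3" using hex_norm[OF True] .
    then have h: "0 < h" "h\<^sup>2 = 1 - (cmod z)\<^sup>2" by (simp_all add: h_def)
    have "1 < (cmod z)\<^sup>2 + t\<^sup>2 \<longleftrightarrow> h < t" if "0 < t" for t
    proof -
      have "h < t \<longleftrightarrow> h\<^sup>2 < t\<^sup>2" using power_mono_iff[of t h 2] h that by auto
      then show ?thesis using h by auto
    qed
    then have "(if 0 < t then ennreal (1 / t ^ 3) else 0) * indicator hexprism (z, t) = ennreal (1 / t ^ 3) * indicator {h<..} t" for t
      using True h by (auto simp: indicator_def hexprism_def)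
    then have "(\<integral>\<^sup>+t. (if 0 < t then ennreal (1 / t ^ 3) else 0) * indicator hexprism (z, t) \<partial>lborel) =
        (\<integral>\<^sup>+t. ennreal (1 / t ^ 3) * indicator {h<..} t \<partial>lborel)" by simp
    also have "\<dots> = (\<integral>\<^sup>+t. ennreal (1 / t ^ 3) * indicator {h..} t \<partial>lborel)"
      using AE_lborel_singleton[of h] by (intro nn_integral_cong_AE) (auto elim!: eventually_mono simp: indicator_def)
    also have "\<dots> = ennreal (0 - - 1 / (2 * h\<^sup>2))"
    proof (rule nn_integral_FTC_atLeast)
      fix t assume "h \<le> t"
      then have "t \<noteq> 0" using h by simp
      then show "((\<lambda>t. - 1 / (2 * t\<^sup>2)) has_real_derivative 1 / t ^ 3) (at t)"
        by (auto intro!: derivative_eq_intros simp: field_simps power2_eq_square power3_eq_cube)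
    next
      show "((\<lambda>t::real. - 1 / (2 * t\<^sup>2)) \<longlongrightarrow> 0) at_top" by real_asymp
    qed (use h in auto)
    finally show ?thesis using True h by simp
  qed
  show ?thesis unfolding hyp3_emeasure_gen[OF B] inner[symmetric]
    by (rule lborel_pair.Fubini') measurable
qed

definition hexdens :: "real \<Rightarrow> real \<Rightarrow> ennreal" where
  "hexdens x y = (if \<bar>x\<bar> < 1 / 2 \<and> \<bar>x\<bar> + sqrt 3 * \<bar>y\<bar> < 1 then ennreal (1 / (2 * (1 - (x\<^sup>2 + y\<^sup>2)))) else 0)"

text \<open>The abscissa at which the ray of slope s leaves the hexagon. The coordinates x and
  \<open>s = y / x\<close> take the place of polar ones; the angle enters afterwards through
  \<open>s = tan \<theta>\<close>.\<close>

definition hexcut :: "real \<Rightarrow> real" where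
  "hexcut s = min (1 / 2) (1 / (1 + sqrt 3 * s))"

lemma hexdens_measurable [measurable]:
  assumes [measurable]: "f \<in> borel_measurable M" "g \<in> borel_measurable M"
  shows "(\<lambda>x. hexdens (f x) (g x)) \<in> borel_measurable M"
  unfolding hexdens_def by measurable

lemma hexdens_even: "hexdens (- x) y = hexdens x y" "hexdens x (- y) = hexdens x y"
  unfolding hexdens_def power2_minus abs_minus_cancel by (rule refl)+

lemma emeasure_hexprism_quarter:
  "emeasure hyp3_measure hexprism = 4 * (\<integral>\<^sup>+x. (\<integral>\<^sup>+y. hexdens x y * indicator {0<..} y \<partial>lborel) * indicator {0<..} x \<partial>lborel)"
proof -
  have hm: "(\<lambda>z. if hex z then ennreal (1 / (2 * (1 - (cmod z)\<^sup>2))) else 0) \<in> borel_measurable borel"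
    unfolding hex_def by measurable
  have e: "(cmod (Complex x y))\<^sup>2 = x\<^sup>2 + y\<^sup>2" for x y by (simp add: complex_norm)
  have "emeasure hyp3_measure hexprism = (\<integral>\<^sup>+x. \<integral>\<^sup>+y. hexdens x y \<partial>lborel \<partial>lborel)"
    unfolding emeasure_hexprism nn_integral_complex[OF hm] unfolding hexdens_def hex_def e complex.sel ..
  also have "\<dots> = (\<integral>\<^sup>+x. 2 * (\<integral>\<^sup>+y. hexdens x y * indicator {0<..} y \<partial>lborel) \<partial>lborel)"
    by (intro nn_integral_cong nn_integral_even) (auto simp: hexdens_even)
  also have "\<dots> = 2 * (\<integral>\<^sup>+x. 2 * (\<integral>\<^sup>+y. hexdens x y * indicator {0<..} y \<partial>lborel) * indicator {0<..} x \<partial>lborel)"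
    by (rule nn_integral_even) (auto simp: hexdens_even)
  also have "\<dots> = 2 * (2 * (\<integral>\<^sup>+x. (\<integral>\<^sup>+y. hexdens x y * indicator {0<..} y \<partial>lborel) * indicator {0<..} x \<partial>lborel))"
    unfolding mult.assoc by (subst nn_integral_cmult) measurable
  finally show ?thesis by (simp flip: mult.assoc)
qed

lemma hexcut_bound:
  assumes "0 < s"
  shows "0 < hexcut s" "(hexcut s)\<^sup>2 * (1 + s\<^sup>2) \<le> 1 / 3"
proof -
  define X where "X = hexcut s"
  have s: "0 < 1 + sqrt 3 * s" using assms by (intro add_pos_pos) auto
  show X0: "0 < hexcut s" using s by (simp add: hexcut_def)
  have X1: "X \<le> 1 / 2" by (simp add: X_def hexcut_def)
  have "X \<le> 1 / (1 + sqrt 3 * s)" by (simp add: X_def hexcut_def)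
  then have "X * (1 + sqrt 3 * s) \<le> 1" using s by (simp add: pos_le_divide_eq)
  then have "sqrt 3 * s * X \<le> 1 - X" by (simp add: algebra_simps)
  then have "(sqrt 3 * s * X)\<^sup>2 \<le> (1 - X)\<^sup>2" using assms X0 by (intro power_mono) (auto simp: X_def)
  then have "3 * (s\<^sup>2 * X\<^sup>2) \<le> (1 - X)\<^sup>2" by (simp add: power_mult_distrib)
  moreover have "X * X \<le> X * (1 / 2)" using X1 X0 by (intro mult_left_mono) (auto simp: X_def)
  ultimately have "X\<^sup>2 * (1 + s\<^sup>2) \<le> 1 / 3" by (simp add: power2_eq_square algebra_simps)
  then show "(hexcut s)\<^sup>2 * (1 + s\<^sup>2) \<le> 1 / 3" by (simp add: X_def)
qed

definition slopedens :: "real \<Rightarrow> real" where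
  "slopedens s = - ln (1 - (hexcut s)\<^sup>2 * (1 + s\<^sup>2)) / (4 * (1 + s\<^sup>2))"

lemma slope_integral:
  assumes s: "0 < s"
  shows "(\<integral>\<^sup>+x. ennreal x * hexdens x (x * s) * indicator {0<..} x \<partial>lborel) = ennreal (slopedens s)"
proof -
  define X where "X = hexcut s"
  note X = hexcut_bound[OF s, folded X_def]
  define k where "k = 1 + s\<^sup>2"
  have k: "0 < k" by (simp add: k_def add_pos_nonneg)
  have s1: "0 < 1 + sqrt 3 * s" using s by (intro add_pos_pos) auto
  have b: "x\<^sup>2 * k < 1" if "0 \<le> x" "x \<le> X" for x
  proof -
    have "x\<^sup>2 * k \<le> X\<^sup>2 * k" using that k by (intro mult_right_mono power_mono) auto
    then show ?thesis using X k_def by simp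
  qed
  have "ennreal x * hexdens x (x * s) * indicator {0<..} x = ennreal (x / (2 * (1 - x\<^sup>2 * k))) * indicator {0<..<X} x" for x
  proof (cases "0 < x")
    case True
    have "x < X \<longleftrightarrow> x < 1 / 2 \<and> x * (1 + sqrt 3 * s) < 1"
      unfolding X_def hexcut_def using s1 by (simp add: pos_less_divide_eq)
    also have "\<dots> \<longleftrightarrow> \<bar>x\<bar> < 1 / 2 \<and> \<bar>x\<bar> + sqrt 3 * \<bar>x * s\<bar> < 1"
      using True s by (simp add: abs_mult algebra_simps)
    finally have "hexdens x (x * s) = (if x < X then ennreal (1 / (2 * (1 - x\<^sup>2 * k))) else 0)"
      unfolding hexdens_def by (simp add: k_def power_mult_distrib algebra_simps)
    then show ?thesis using True b[of x] by (simp add: indicator_def flip: ennreal_mult')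
  qed simp
  then have "(\<integral>\<^sup>+x. ennreal x * hexdens x (x * s) * indicator {0<..} x \<partial>lborel) =
      (\<integral>\<^sup>+x. ennreal (x / (2 * (1 - x\<^sup>2 * k))) * indicator {0<..<X} x \<partial>lborel)" by simp
  also have "\<dots> = (\<integral>\<^sup>+x. ennreal (x / (2 * (1 - x\<^sup>2 * k))) * indicator {0..X} x \<partial>lborel)"
    using AE_lborel_singleton[of 0] AE_lborel_singleton[of X]
    by (intro nn_integral_cong_AE) (auto elim!: eventually_elim2 simp: indicator_def)
  also have "\<dots> = ennreal (- ln (1 - X\<^sup>2 * k) / (4 * k) - - ln (1 - 0\<^sup>2 * k) / (4 * k))"
  proof (rule nn_integral_has_integral_lebesgue')
    show "((\<lambda>x. x / (2 * (1 - x\<^sup>2 * k))) has_integral - ln (1 - X\<^sup>2 * k) / (4 * k) - - ln (1 - 0\<^sup>2 * k) / (4 * k)) {0..X}"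
    proof (rule FTC_real[where f = "\<lambda>x. - ln (1 - x\<^sup>2 * k) / (4 * k)"])
      fix x assume "0 \<le> x" "x \<le> X"
      then show "((\<lambda>x. - ln (1 - x\<^sup>2 * k) / (4 * k)) has_real_derivative x / (2 * (1 - x\<^sup>2 * k))) (at x)"
        using b[of x] k by (auto intro!: derivative_eq_intros simp: field_simps)
    qed (use X in simp)
    show "0 \<le> x / (2 * (1 - x\<^sup>2 * k))" if "x \<in> {0..X}" for x using that b[of x] by simp
  qed
  finally show ?thesis by (simp add: slopedens_def X_def k_def)
qed

lemma quarter_slopes:
  "(\<integral>\<^sup>+x. (\<integral>\<^sup>+y. hexdens x y * indicator {0<..} y \<partial>lborel) * indicator {0<..} x \<partial>lborel) =
   (\<integral>\<^sup>+s. ennreal (slopedens s) * indicator {0<..} s \<partial>lborel)"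
proof -
  have "(\<integral>\<^sup>+y. hexdens x y * indicator {0<..} y \<partial>lborel) * indicator {0<..} x =
      (\<integral>\<^sup>+s. ennreal x * hexdens x (x * s) * indicator {0<..} x * indicator {0<..} s \<partial>lborel)" for x
  proof (cases "0 < x")
    case True
    have "(\<integral>\<^sup>+y. hexdens x y * indicator {0<..} y \<partial>lborel) =
        ennreal \<bar>x\<bar> * (\<integral>\<^sup>+s. hexdens x (0 + x * s) * indicator {0<..} (0 + x * s) \<partial>lborel)"
      using True by (intro nn_integral_real_affine) auto
    also have "\<dots> = ennreal x * (\<integral>\<^sup>+s. hexdens x (x * s) * indicator {0<..} s \<partial>lborel)"
      using True by (simp add: indicator_def zero_less_mult_iff)
    also have "\<dots> = (\<integral>\<^sup>+s. ennreal x * (hexdens x (x * s) * indicator {0<..} s) \<partial>lborel)"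
      by (rule nn_integral_cmult[symmetric]) measurable
    finally show ?thesis using True by (simp add: mult.assoc)
  qed simp
  then have "(\<integral>\<^sup>+x. (\<integral>\<^sup>+y. hexdens x y * indicator {0<..} y \<partial>lborel) * indicator {0<..} x \<partial>lborel) =
      (\<integral>\<^sup>+x. \<integral>\<^sup>+s. ennreal x * hexdens x (x * s) * indicator {0<..} x * indicator {0<..} s \<partial>lborel \<partial>lborel)"
    by simp
  also have "\<dots> = (\<integral>\<^sup>+s. \<integral>\<^sup>+x. ennreal x * hexdens x (x * s) * indicator {0<..} x * indicator {0<..} s \<partial>lborel \<partial>lborel)"
    by (rule lborel_pair.Fubini'[symmetric]) measurable
  also have "\<dots> = (\<integral>\<^sup>+s. (\<integral>\<^sup>+x. ennreal x * hexdens x (x * s) * indicator {0<..} x \<partial>lborel) * indicator {0<..} s \<partial>lborel)"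
    by (intro nn_integral_cong nn_integral_multc) measurable
  also have "\<dots> = (\<integral>\<^sup>+s. ennreal (slopedens s) * indicator {0<..} s \<partial>lborel)"
  proof (rule nn_integral_cong)
    fix s :: real
    show "(\<integral>\<^sup>+x. ennreal x * hexdens x (x * s) * indicator {0<..} x \<partial>lborel) * indicator {0<..} s =
        ennreal (slopedens s) * indicator {0<..} s"
      by (cases "0 < s") (simp_all add: slope_integral)
  qed
  finally show ?thesis .
qed

text \<open>The ray leaves through the vertical side for \<open>\<theta> \<le> \<pi> / 6\<close> and
  through the slanted side beyond; the derivative of the tangent cancels the factor
  \<open>1 + s^2\<close> in the denominator.\<close>

lemma slopedens_tan:
  assumes \<theta>: "0 < \<theta>" "\<theta> < pi / 2"
  shows "slopedens (tan \<theta>) * inverse ((cos \<theta>)\<^sup>2) = quarter \<theta>"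
proof -
  have c: "0 < cos \<theta>" using \<theta> by (intro cos_gt_zero_pi) auto
  have t: "0 < tan \<theta>" using \<theta> by (rule tan_gt_zero)
  have k: "1 + (tan \<theta>)\<^sup>2 = inverse ((cos \<theta>)\<^sup>2)" using tan_sec[of \<theta>] c by (simp add: power_inverse)
  have "slopedens (tan \<theta>) * inverse ((cos \<theta>)\<^sup>2) = - ln (1 - (hexcut (tan \<theta>))\<^sup>2 / (cos \<theta>)\<^sup>2) / 4"
  proof -
    have q: "x / (4 * inverse A) * inverse A = x / 4" if "0 < A" for x A :: real
      using that by (simp add: field_simps)
    have "0 < (cos \<theta>)\<^sup>2" using c by simp
    then show ?thesis unfolding slopedens_def k by (simp only: q) (simp only: divide_inverse)
  qed
  also have "\<dots> = quarter \<theta>"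
  proof (cases "\<theta> \<le> pi / 6")
    case True
    have "tan \<theta> \<le> tan (pi / 6)" using True \<theta> by (intro tan_mono_le) auto
    then have "sqrt 3 * tan \<theta> \<le> sqrt 3 * (1 / sqrt 3)" by (intro mult_left_mono) (auto simp: tan_30)
    then have "1 + sqrt 3 * tan \<theta> \<le> 2" by simp
    moreover have "0 < 1 + sqrt 3 * tan \<theta>" using t by (intro add_pos_pos) auto
    ultimately have "1 / 2 \<le> 1 / (1 + sqrt 3 * tan \<theta>)" by (intro divide_left_mono) auto
    then have "hexcut (tan \<theta>) = 1 / 2" by (simp add: hexcut_def)
    then have "(hexcut (tan \<theta>))\<^sup>2 / (cos \<theta>)\<^sup>2 = 1 / (4 * (cos \<theta>)\<^sup>2)"
      by (simp only:) (simp add: power2_eq_square)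
    then show ?thesis using True by (simp add: quarter_def sector_def)
  next
    case False
    have "tan (pi / 6) \<le> tan \<theta>" using False \<theta> by (intro tan_mono_le) auto
    then have "sqrt 3 * (1 / sqrt 3) \<le> sqrt 3 * tan \<theta>" by (intro mult_left_mono) (auto simp: tan_30)
    then have g: "2 \<le> 1 + sqrt 3 * tan \<theta>" by simp
    then have "1 / (1 + sqrt 3 * tan \<theta>) \<le> 1 / 2" by (intro divide_left_mono) auto
    then have "hexcut (tan \<theta>) = 1 / (1 + sqrt 3 * tan \<theta>)" by (simp add: hexcut_def)
    moreover have "(1 + sqrt 3 * tan \<theta>) * cos \<theta> = 2 * cos (\<theta> - pi / 3)"
    proof -
      have "cos (\<theta> - pi / 3) = cos \<theta> * (1 / 2) + sin \<theta> * (sqrt 3 / 2)" by (simp only: cos_diff cos_60 sin_60)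
      then show ?thesis using c by (simp only: tan_def) (simp add: field_simps)
    qed
    moreover have "(1 / u)\<^sup>2 / v\<^sup>2 = 1 / (u * v)\<^sup>2" for u v :: real
      by (simp add: power_divide power_mult_distrib)
    ultimately have "(hexcut (tan \<theta>))\<^sup>2 / (cos \<theta>)\<^sup>2 = 1 / (2 * cos (\<theta> - pi / 3))\<^sup>2"
      by (simp only:)
    then show ?thesis using False by (simp add: quarter_def sector_def power_mult_distrib)
  qed
  finally show ?thesis .
qed

lemma slopes_integral: "(\<integral>\<^sup>+s. ennreal (slopedens s) * indicator {0<..} s \<partial>lborel) = ennreal (pi * kap / 4)"
proof -
  define a where "a n = 1 / (real n + 2)" for n
  define b where "b n = pi / 2 - 1 / (real n + 2)" for n
  have half: "a n \<le> 1 / 2" "0 < a n" for n by (simp_all add: a_def divide_simps)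
  have ba: "b n = pi / 2 - a n" for n by (simp add: a_def b_def)
  have mono: "decseq a"
    unfolding a_def by (auto intro!: decseq_SucI simp: divide_simps)
  then have mono': "incseq b" by (auto intro!: incseq_SucI simp: ba dest: decseq_SucD)
  have in_n: "\<exists>n. x \<in> {a n..b n}" if "0 < x" "x < pi / 2" for x
  proof -
    have "(\<lambda>n. a n) \<longlonglongrightarrow> 0" unfolding a_def by real_asymp
    then have "\<forall>\<^sub>F n in sequentially. a n < min x (pi / 2 - x)" using that by (intro order_tendstoD(2)) auto
    then obtain n where "a n < min x (pi / 2 - x)" by (auto simp: eventually_sequentially)
    then show ?thesis by (intro exI[of _ n]) (auto simp: ba)
  qed
  have range: "0 < x" "x < pi / 2" if "x \<in> {a n..b n}" for x n
    using that half[of n] by (auto simp: ba)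
  have ab: "a n < b n" for n using half[of n] pi_gt3 by (simp add: ba)
  have I: "(\<Union>n. {a n..b n}) = {0<..<pi / 2}"
    using in_n range by (auto simp del: atLeastAtMost_iff) 
  have J: "(\<Union>n. {tan (a n)..tan (b n)}) = {0<..}"
  proof (intro equalityI subsetI)
    fix t :: real assume "t \<in> {0<..}"
    then obtain n where n: "arctan t \<in> {a n..b n}" using in_n[of "arctan t"] arctan_ubound[of t] by auto
    have "tan (a n) \<le> tan (arctan t)"
      using n half[of n] range[OF n] by (intro tan_mono_le) auto
    moreover have "tan (arctan t) \<le> tan (b n)"
      using n half[of n] range[OF n] by (intro tan_mono_le) (auto simp: ba)
    ultimately show "t \<in> (\<Union>n. {tan (a n)..tan (b n)})" by (auto simp: tan_arctan)
  next
    fix t :: real assume "t \<in> (\<Union>n. {tan (a n)..tan (b n)})"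
    then obtain n where "tan (a n) \<le> t" by auto
    moreover have "0 < tan (a n)" using range[of "a n" n] ab[of n] by (intro tan_gt_zero) auto
    ultimately show "t \<in> {0<..}" by simp
  qed
  have hc [measurable]: "hexcut \<in> borel_measurable borel" unfolding hexcut_def[abs_def] by measurable
  have sm: "(\<lambda>s. ennreal (slopedens s)) \<in> borel_measurable borel" unfolding slopedens_def by measurable
  have c: "cos x \<noteq> 0" if "x \<in> {a n..b n}" for x n
    using cos_gt_zero_pi[of x] range[OF that] by auto
  have [measurable]: "(\<lambda>x::real. sin x) \<in> borel_measurable borel" "(\<lambda>x::real. cos x) \<in> borel_measurable borel"
    by (intro borel_measurable_continuous_onI continuous_intros)+
  have tm: "(tan :: real \<Rightarrow> real) \<in> borel_measurable borel" unfolding tan_def[abs_def] by measurable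
  have "(\<integral>\<^sup>+s. ennreal (slopedens s) * indicator {0<..} s \<partial>lborel) =
      (\<integral>\<^sup>+\<theta>. ennreal (slopedens (tan \<theta>)) * ennreal (inverse ((cos \<theta>)\<^sup>2)) * indicator {0<..<pi / 2} \<theta> \<partial>lborel)"
    unfolding I[symmetric] J[symmetric]
  proof (rule nn_integral_substitution_UN)
    show "(tan has_real_derivative inverse ((cos x)\<^sup>2)) (at x)" if "x \<in> {a n..b n}" for x n
      using DERIV_tan[OF c[OF that]] .
    show "continuous_on {a n..b n} (\<lambda>x. inverse ((cos x)\<^sup>2))" for n
      using c by (intro continuous_intros) auto
  qed (use sm tm mono mono' ab in auto)
  also have "\<dots> = (\<integral>\<^sup>+\<theta>. ennreal (quarter \<theta>) * indicator {0<..<pi / 2} \<theta> \<partial>lborel)"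
  proof (rule nn_integral_cong)
    fix \<theta> :: real
    have "ennreal (slopedens (tan \<theta>)) * ennreal (inverse ((cos \<theta>)\<^sup>2)) = ennreal (quarter \<theta>)" if "0 < \<theta>" "\<theta> < pi / 2"
      using slopedens_tan[OF that] by (simp flip: ennreal_mult'')
    then show "ennreal (slopedens (tan \<theta>)) * ennreal (inverse ((cos \<theta>)\<^sup>2)) * indicator {0<..<pi / 2} \<theta> =
      ennreal (quarter \<theta>) * indicator {0<..<pi / 2} \<theta>" by (simp add: indicator_def)
  qed
  also have "\<dots> = (\<integral>\<^sup>+\<theta>. ennreal (quarter \<theta>) * indicator {0..pi / 2} \<theta> \<partial>lborel)"
    using AE_lborel_singleton[of 0] AE_lborel_singleton[of "pi / 2"]
    by (intro nn_integral_cong_AE) (auto elim!: eventually_elim2 simp: indicator_def)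
  also have "\<dots> = ennreal (pi * kap / 4)"
    using quarter_integral by (rule nn_integral_has_integral_lebesgue'[rotated]) (auto intro: quarter_nonneg)
  finally show ?thesis .
qed

text \<open>Four cells with four quadrants each, and every quadrant contributes
  \<open>\<pi> kap / 4\<close>.\<close>

theorem Vol41_kap: "Vol41 = 4 * pi * kap"
proof -
  have "emeasure hyp3_measure fig8_domain = 4 * (4 * ennreal (pi * kap / 4))"
    unfolding emeasure_fig8_domain emeasure_hexprism_quarter quarter_slopes slopes_integral ..
  also have "\<dots> = ennreal (4 * pi * kap)"
    using kap_pos by (simp flip: ennreal_numeral ennreal_mult')
  finally show ?thesis unfolding Vol41_eq measure_def using kap_pos by simp
qed

theorem theorem3:
  shows "(\<forall>\<epsilon>::real. \<epsilon> > 0 \<longrightarrow> (\<exists>A::real. \<forall>\<alpha>::real.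
            \<alpha> \<in> \<rat> \<and> 0 < \<alpha> \<and> \<alpha> < 1 \<and> real (cf_sum \<alpha>) > A * real (cf_len \<alpha>) \<longrightarrow>
            \<bar>ln (J41 (ee \<alpha>)) / (Vol41 / (2 * pi) * real (cf_sum \<alpha>)) - 1\<bar> < \<epsilon>))
       \<and> (\<forall>\<epsilon>::real. \<epsilon> > 0 \<longrightarrow>
            (\<lambda>N::nat.
               real (card {q \<in> unity_roots_upto N.
                  \<bar>ln (J41 q) - 12 / pi\<^sup>2 * (Vol41 / (2 * pi))
                       * ln (real (unity_order q)) * ln (ln (real (unity_order q)))\<bar>
                    > \<epsilon> * ln (real (unity_order q)) * ln (ln (real (unity_order q)))})
               / real (card (unity_roots_upto N)))
            \<longlonglongrightarrow> 0)"
proof -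
  have V: "Vol41 / (2 * pi) = 2 * kap" by (simp add: Vol41_kap)
  show ?thesis unfolding V
  proof (intro conjI allI impI)
    fix \<epsilon> :: real assume \<epsilon>: "\<epsilon> > 0"
    show "\<exists>A. \<forall>\<alpha>. \<alpha> \<in> \<rat> \<and> 0 < \<alpha> \<and> \<alpha> < 1 \<and> real (cf_sum \<alpha>) > A * real (cf_len \<alpha>) \<longrightarrow>
        \<bar>ln (J41 (ee \<alpha>)) / (2 * kap * real (cf_sum \<alpha>)) - 1\<bar> < \<epsilon>"
      using ln_J41_asymp_cf_sum[OF \<epsilon>] .
    show "(\<lambda>N. real (card {q \<in> unity_roots_upto N.
        \<bar>ln (J41 q) - 12 / pi\<^sup>2 * (2 * kap) * ln (real (unity_order q)) * ln (ln (real (unity_order q)))\<bar>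
          > \<epsilon> * ln (real (unity_order q)) * ln (ln (real (unity_order q)))})
        / real (card (unity_roots_upto N))) \<longlonglongrightarrow> 0"
      using ln_J41_almost_all[OF \<epsilon>] .
  qed
qed

end
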